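(* Under assumptions (A.1), (A.2), (A.3) (and with $\sigma$ as in (A.4)), the Cournot MFG system has at most one weak solution $(u,m,q^* )\in\mathbb X$.
   Context: Let $L,T>0$, $\mathbb L=(0,L)$, $Q=(0,T)\times\mathbb L$; fix constants $\lambda,\gamma,\kappa>0$, $r>3$. Standing assumptions: (A.1) $m_0\in C^3([0,L])$, $\int_0^Lm_0dx=1$, $m_0(0)=0$, $m_0(x)>0$ for $x\in(0,L]$. (A.2) $u_T\in C^3([0,L])$, $\partial_xu_T\ge0$ on $[0,L]$, $u_T(0)=0$, $\partial_xu_T(L)=0$. (A.3) $P:[0,T]\times[0,\infty)\to\mathbb R$ is $C^2$ in both variables with $\partial_aP(t,a)\le0$; there is $\Phi\in C^3([0,T]\times[0,\infty))$ with $P(t,a)=\partial_a\Phi(t,a)$; and there is $C_P>0$ with $\gamma<P(t,0)\le C_P+\gamma$ for all $t\in[0,T]$. (A.4) $\sigma\in C^2([0,L])$, $\sigma(x)\ge\sigma_0>0$. Cournot MFG system (unknowns $u,m:Q\to\mathbb R$, $q^*:Q\to[0,\infty)$): (i) $\partial_tu+\sigma^2(x)\partial^2_{xx}u-\lambda u+\sup_{q\ge0}\{-q\partial_xu+q\mathrm P(t)-\gamma q-\kappa q^2\}=0$ in $Q$, with $\mathrm P(t)=P(t,\int_0^Lq^*(t,x)m(t,x)dx)$, $u(t,0)=0$, $\partial_xu(t,L)=0$, $u(T,x)=u_T(x)$; (ii) $\partial_tm-\partial^2_{xx}(\sigma^2(x)m)-\partial_x(mq^* )=0$ in $Q$, $m(t,0)=0$,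 $\partial_x(\sigma^2(L)m(t,L))+q^*(t,L)m(t,L)=0$, $m(0,x)=m_0(x)$; (iii) $q^*(t,x)=\arg\max_{q\ge0}\{-q\partial_xu+q\mathrm P(t)-\gamma q-\kappa q^2\}=\big((\mathrm P(t)-\gamma-\partial_xu(t,x))/(2\kappa)\big)_+$. $H^1(\mathbb L)$: $H^1$ functions on $\mathbb L$ vanishing at $0$; $H^{-1}(\mathbb L)$ its dual; $W^{1,2}_r(Q)$: functions with $u,\partial_tu,\partial_xu,\partial^2_{xx}u\in L^r(Q)$. $\mathbb X$ is the set of triples $(u,m,q)$ with $u\in W^{1,2}_r(Q)$, $m\in L^2(0,T;H^1(\mathbb L))\cap L^\infty(Q)$, $\partial_tm\in L^2(0,T;H^{-1}(\mathbb L))$, and $q\in L^\infty(Q)$ with values in $[0,\infty)$. A weak solution is a triple in $\mathbb X$ satisfying (i) and (ii) in the sense of distributions and (iii) pointwise. *)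

theory Defs
  imports "HOL-Analysis.Analysis"
begin

definition pdt :: "(real \<times> real \<Rightarrow> real) \<Rightarrow> real \<times> real \<Rightarrow> real" where
  "pdt f z = deriv (\<lambda>s. f (s, snd z)) (fst z)"

definition pdx :: "(real \<times> real \<Rightarrow> real) \<Rightarrow> real \<times> real \<Rightarrow> real" where
  "pdx f z = deriv (\<lambda>y. f (fst z, y)) (snd z)"

text \<open>C^k on a (closed) set S of the plane: all iterated partial derivatives up to order k
  exist (one-sided / relative to S) and are continuous on S.  A list ds encodes the order
  of differentiation (True = d/dt, False = d/dx).\<close>

definition Ck2_on :: "nat \<Rightarrow> (real \<times> real) set \<Rightarrow> (real \<times> real \<Rightarrow> real) \<Rightarrow> bool" where
  "Ck2_on k S f \<longleftrightarrow> (\<exists>D :: bool list \<Rightarrow> real \<times> real \<Rightarrow> real.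
     (\<forall>z\<in>S. D [] z = f z) \<and>
     (\<forall>ds. length ds < k \<longrightarrow> (\<forall>t x. (t, x) \<in> S \<longrightarrow>
        ((\<lambda>s. D ds (s, x)) has_real_derivative D (True # ds) (t, x)) (at t within {s. (s, x) \<in> S}) \<and>
        ((\<lambda>y. D ds (t, y)) has_real_derivative D (False # ds) (t, x)) (at x within {y. (t, y) \<in> S}))) \<and>
     (\<forall>ds. length ds \<le> k \<longrightarrow> continuous_on S (D ds)))"

definition Ck_on :: "nat \<Rightarrow> real set \<Rightarrow> (real \<Rightarrow> real) \<Rightarrow> bool" where
  "Ck_on k S f \<longleftrightarrow> (\<exists>D :: nat \<Rightarrow> real \<Rightarrow> real.
     (\<forall>x\<in>S. D 0 x = f x) \<and>
     (\<forall>j<k. \<forall>x\<in>S. (D j has_real_derivative D (Suc j) x) (at x within S)) \<and>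
     (\<forall>j\<le>k. continuous_on S (D j)))"

definition smooth2 :: "(real \<times> real \<Rightarrow> real) \<Rightarrow> bool" where
  "smooth2 f \<longleftrightarrow> (\<forall>k. Ck2_on k UNIV f)"

definition supp2 :: "(real \<times> real \<Rightarrow> real) \<Rightarrow> (real \<times> real) set" where
  "supp2 f = closure {z. f z \<noteq> 0}"

definition test_fun :: "(real \<times> real) set \<Rightarrow> (real \<times> real \<Rightarrow> real) \<Rightarrow> bool" where
  "test_fun K \<phi> \<longleftrightarrow> smooth2 \<phi> \<and> compact (supp2 \<phi>) \<and> supp2 \<phi> \<subseteq> K"

definition Lp_on :: "real \<Rightarrow> (real \<times> real) set \<Rightarrow> (real \<times> real \<Rightarrow> real) \<Rightarrow> bool" where
  "Lp_on p Q f \<longleftrightarrow> set_borel_measurable lebesgue Q f \<and>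
     set_integrable lebesgue Q (\<lambda>z. \<bar>f z\<bar> powr p)"

definition Linf_on :: "(real \<times> real) set \<Rightarrow> (real \<times> real \<Rightarrow> real) \<Rightarrow> bool" where
  "Linf_on Q f \<longleftrightarrow> set_borel_measurable lebesgue Q f \<and>
     (\<exists>B. AE z in lebesgue. z \<in> Q \<longrightarrow> \<bar>f z\<bar> \<le> B)"

definition weak_dt :: "(real \<times> real) set \<Rightarrow> (real \<times> real \<Rightarrow> real) \<Rightarrow> (real \<times> real \<Rightarrow> real) \<Rightarrow> bool" where
  "weak_dt Q f g \<longleftrightarrow> (\<forall>\<phi>. test_fun Q \<phi> \<longrightarrow>
     (LINT z:Q|lebesgue. f z * pdt \<phi> z) = - (LINT z:Q|lebesgue. g z * \<phi> z))"

definition weak_dx :: "(real \<times> real) set \<Rightarrow> (real \<times> real \<Rightarrow> real) \<Rightarrow> (real \<times> real \<Rightarrow> real) \<Rightarrow> bool" where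
  "weak_dx Q f g \<longleftrightarrow> (\<forall>\<phi>. test_fun Q \<phi> \<longrightarrow>
     (LINT z:Q|lebesgue. f z * pdx \<phi> z) = - (LINT z:Q|lebesgue. g z * \<phi> z))"

definition weak_dxx :: "(real \<times> real) set \<Rightarrow> (real \<times> real \<Rightarrow> real) \<Rightarrow> (real \<times> real \<Rightarrow> real) \<Rightarrow> bool" where
  "weak_dxx Q f g \<longleftrightarrow> (\<forall>\<phi>. test_fun Q \<phi> \<longrightarrow>
     (LINT z:Q|lebesgue. f z * pdx (pdx \<phi>) z) = (LINT z:Q|lebesgue. g z * \<phi> z))"

definition cylQ :: "real \<Rightarrow> real \<Rightarrow> (real \<times> real) set" where
  "cylQ T L = {0<..<T} \<times> {0<..<L}"

definition price :: "real \<Rightarrow> (real \<Rightarrow> real \<Rightarrow> real) \<Rightarrow> (real \<times> real \<Rightarrow> real) \<Rightarrow> (real \<times> real \<Rightarrow> real) \<Rightarrow> real \<Rightarrow> real" where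
  "price L P q m t = P t (LINT x:{0<..<L}|lebesgue. q (t, x) * m (t, x))"

text \<open>Weak solution (u,m,q) in the space X of the Cournot MFG system (i)-(iii).
  The H^{-1}(L) = dual of H^1(L) is represented (Riesz, 1D) by functionals v \<mapsto> \<integral> g v_x.\<close>

definition cournot_weak_solution ::
  "real \<Rightarrow> real \<Rightarrow> real \<Rightarrow> real \<Rightarrow> real \<Rightarrow> real \<Rightarrow> (real \<Rightarrow> real) \<Rightarrow> (real \<Rightarrow> real \<Rightarrow> real)
   \<Rightarrow> (real \<Rightarrow> real) \<Rightarrow> (real \<Rightarrow> real)
   \<Rightarrow> (real \<times> real \<Rightarrow> real) \<Rightarrow> (real \<times> real \<Rightarrow> real) \<Rightarrow> (real \<times> real \<Rightarrow> real) \<Rightarrow> bool" where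
  "cournot_weak_solution L T lam gam kap r sig P m0 uT u m q \<longleftrightarrow>
   (\<comment> \<open>u \<in> W^{1,2}_r(Q), equation (i) in distributions, boundary/terminal data, and (iii)\<close>
    Lp_on r (cylQ T L) u \<and>
    (\<exists>ut ux uxx.
       Lp_on r (cylQ T L) ut \<and> Lp_on r (cylQ T L) ux \<and> Lp_on r (cylQ T L) uxx \<and>
       weak_dt (cylQ T L) u ut \<and> weak_dx (cylQ T L) u ux \<and> weak_dxx (cylQ T L) u uxx \<and>
       (\<forall>\<phi>. test_fun (cylQ T L) \<phi> \<longrightarrow>
          (LINT z:cylQ T L|lebesgue.
             (ut z + (sig (snd z))\<^sup>2 * uxx z - lam * u z
              + (SUP p\<in>{0..}. - p * ux z + p * price L P q m (fst z) - gam * p - kap * p\<^sup>2)) * \<phi> z) = 0) \<and>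
       (\<exists>U Ux. continuous_on ({0..T} \<times> {0..L}) U \<and> continuous_on ({0..T} \<times> {0..L}) Ux \<and>
          (AE z in lebesgue. z \<in> cylQ T L \<longrightarrow> u z = U z) \<and>
          (AE z in lebesgue. z \<in> cylQ T L \<longrightarrow> ux z = Ux z) \<and>
          (\<forall>t\<in>{0..T}. U (t, 0) = 0 \<and> Ux (t, L) = 0) \<and>
          (\<forall>x\<in>{0..L}. U (T, x) = uT x)) \<and>
       (AE z in lebesgue. z \<in> cylQ T L \<longrightarrow>
          q z = max 0 ((price L P q m (fst z) - gam - ux z) / (2 * kap)))) \<and>
    \<comment> \<open>m \<in> L^2(0,T;H^1(L)) \<inter> L^\<infinity>(Q), \<partial>_t m \<in> L^2(0,T;H^{-1}(L)), and equation (ii) weakly\<close>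
    Lp_on 2 (cylQ T L) m \<and> Linf_on (cylQ T L) m \<and>
    (\<exists>mx. Lp_on 2 (cylQ T L) mx \<and> weak_dx (cylQ T L) m mx \<and>
       (AE t in lebesgue. t \<in> {0<..<T} \<longrightarrow>
          (\<exists>g. continuous_on {0..L} g \<and> g 0 = 0 \<and>
               (AE x in lebesgue. x \<in> {0<..<L} \<longrightarrow> m (t, x) = g x))) \<and>
       (\<exists>g. Lp_on 2 (cylQ T L) g \<and>
          (\<forall>\<phi>. test_fun ({0<..<T} \<times> UNIV) \<phi> \<and> (\<forall>t. \<phi> (t, 0) = 0) \<longrightarrow>
             (LINT z:cylQ T L|lebesgue. m z * pdt \<phi> z) = (LINT z:cylQ T L|lebesgue. g z * pdx \<phi> z))) \<and>
       (\<forall>\<phi>. test_fun ({..<T} \<times> UNIV) \<phi> \<and> (\<forall>t. \<phi> (t, 0) = 0) \<longrightarrow>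
          (LINT z:cylQ T L|lebesgue. m z * pdt \<phi> z) + (LINT x:{0<..<L}|lebesgue. m0 x * \<phi> (0, x))
          = (LINT z:cylQ T L|lebesgue.
               ((sig (snd z))\<^sup>2 * mx z
                + vector_derivative (\<lambda>y. (sig y)\<^sup>2) (at (snd z) within {0..L}) * m z
                + m z * q z) * pdx \<phi> z))) \<and>
    \<comment> \<open>q \<in> L^\<infinity>(Q) with values in [0,\<infinity>)\<close>
    Linf_on (cylQ T L) q \<and> (\<forall>z\<in>cylQ T L. 0 \<le> q z))"

end

(* Testing the difference of the two Fokker-Planck equations with exp(-lam t) (u1 - u2) and the
   difference of the two HJB equations with m1 - m2 cancels the diffusion terms (Lasry-Lions) and leaves
     int exp(-lam t) [kap (m1 - m2) (q1^2 - q2^2) + dx(u1 - u2) (q1 m1 - q2 m2)] = 0.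
   Convexity of the Hamiltonian and monotonicity of P then force (m1 + m2) (q1 - q2)^2 = 0.  The price
   depends on t only, so this argument runs on time slices and never needs P to be measurable.  Hence
   m1 and m2 solve the same linear Fokker-Planck equation and coincide, and so do the prices; the
   x-derivative of u1 - u2, reflected in t and x, then solves a linear Fokker-Planck equation with zero
   data and vanishes.

   In one space dimension the tail integral of m turns the weak Fokker-Planck equation into an identity
   between primitives that holds almost everywhere, so all weak formulations can be handled without
   mollification.  Derivatives in time are replaced by difference quotients, whose limits exist by
   continuity of translations in L^2.  The maximum principle tests with the negative part. *)
theory Submission
  imports Defs
begin

section \<open>Primitives of integrable functions\<close>

text \<open>Two kinds of half-line integrals carry all boundary data. The no-flux condition at
  \<open>L\<close> makes the tail integral of \<open>m\<close> over \<open>(x, L)\<close> change in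
  time by the flux at \<open>x\<close> alone, and \<open>m(t,0) = 0\<close> says that
  \<open>m\<close> is the left primitive of its derivative. Likewise \<open>u\<close> is a left
  primitive because of its value at 0, and \<open>ux\<close> is minus a tail integral because of its
  value at \<open>L\<close>. Functions are therefore replaced by Borel representatives that vanish
  off the open rectangle. The Lasry-Lions argument gives \<open>q1 = q2\<close> only where
  \<open>m1 + m2 > 0\<close>, and strict positivity of the densities is not proved. What survives is
  \<open>m2 (q1 - q2) = 0\<close>, which lets both densities share the drift \<open>q1\<close>;
  equality of the controls elsewhere has to come from the value functions. One sign statement,
  \<open>fokker_planck_nonneg\<close>, serves three ends: the sign of \<open>m\<close>, the
  comparison of \<open>m1\<close> with \<open>m2\<close>, and the sign of
  \<open>dx(u1 - u2)\<close>. The last two become equalities when the solutions are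
  exchanged.\<close>

lemma integrable_lborel_prod_mult:
  fixes a b :: "real \<Rightarrow> real"
  assumes "integrable lborel a" "integrable lborel b"
  shows "integrable lborel (\<lambda>z. a (fst z) * b (snd z))"
proof -
  have [measurable]: "a \<in> borel_measurable borel" "b \<in> borel_measurable borel"
    using assms by (auto dest: borel_measurable_integrable)
  have "integrable (lborel \<Otimes>\<^sub>M lborel) (\<lambda>z. a (fst z) * b (snd z))"
  proof (rule lborel_pair.Fubini_integrable)
    show "integrable lborel (\<lambda>x. \<integral>y. norm (a (fst (x, y)) * b (snd (x, y))) \<partial>lborel)"
      using assms(1) by (simp add: abs_mult)
    show "AE x in lborel. integrable lborel (\<lambda>y. a (fst (x, y)) * b (snd (x, y)))"
      using assms(2) by simp
  qed simp
  then show ?thesis by (simp add: lborel_prod)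
qed

lemma
  fixes f :: "real \<times> real \<Rightarrow> real"
  assumes "integrable lborel f"
  shows lborel2_integral_fst: "(\<integral>z. f z \<partial>lborel) = (\<integral>t. \<integral>x. f (t, x) \<partial>lborel \<partial>lborel)"
    and lborel2_integral_snd: "(\<integral>z. f z \<partial>lborel) = (\<integral>x. \<integral>t. f (t, x) \<partial>lborel \<partial>lborel)"
    and lborel2_AE_fst: "AE t in lborel. integrable lborel (\<lambda>x. f (t, x))"
    and lborel2_AE_snd: "AE x in lborel. integrable lborel (\<lambda>t. f (t, x))"
    and lborel2_integrable_fst: "integrable lborel (\<lambda>t. \<integral>x. f (t, x) \<partial>lborel)"
    and lborel2_integrable_snd: "integrable lborel (\<lambda>x. \<integral>t. f (t, x) \<partial>lborel)"
proof -
  have f: "integrable (lborel \<Otimes>\<^sub>M lborel) f" using assms by (simp add: lborel_prod)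
  have f2: "integrable (lborel \<Otimes>\<^sub>M lborel) (case_prod (\<lambda>t x. f (t, x)))" using f by simp
  show "(\<integral>z. f z \<partial>lborel) = (\<integral>t. \<integral>x. f (t, x) \<partial>lborel \<partial>lborel)"
    using lborel_pair.integral_fst'[OF f] by (simp add: lborel_prod)
  show "(\<integral>z. f z \<partial>lborel) = (\<integral>x. \<integral>t. f (t, x) \<partial>lborel \<partial>lborel)"
    using lborel_pair.integral_snd[OF f2] by (simp add: lborel_prod)
  show "AE t in lborel. integrable lborel (\<lambda>x. f (t, x))"
    using lborel_pair.AE_integrable_fst'[OF f] .
  show "AE x in lborel. integrable lborel (\<lambda>t. f (t, x))"
    using lborel_pair.AE_integrable_snd[OF f2] .
  show "integrable lborel (\<lambda>t. \<integral>x. f (t, x) \<partial>lborel)"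
    using lborel_pair.integrable_fst'[OF f] .
  show "integrable lborel (\<lambda>x. \<integral>t. f (t, x) \<partial>lborel)"
    using lborel_pair.integrable_snd[OF f2] .
qed

text \<open>Fubini on the region \<open>x < y\<close>. This is the basic form of integration by
  parts used below: it moves a primitive from one factor to the other without boundary terms and
  without differentiability of either factor.\<close>

lemma integral_triangle:
  fixes a b :: "real \<Rightarrow> real"
  assumes "integrable lborel a" "integrable lborel b"
  shows "(\<integral>x. a x * (LBINT y:{x<..}. b y) \<partial>lborel) = (\<integral>y. b y * (LBINT x:{..<y}. a x) \<partial>lborel)"
proof -
  have [measurable]: "a \<in> borel_measurable borel" "b \<in> borel_measurable borel"
    using assms by (auto dest: borel_measurable_integrable)
  define f where "f = (\<lambda>z. (if fst z < snd z then a (fst z) * b (snd z) else 0))"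
  have fm[measurable]: "f \<in> borel_measurable (borel \<Otimes>\<^sub>M borel)" unfolding f_def by measurable
  have I: "integrable lborel f"
    by (rule Bochner_Integration.integrable_bound[OF integrable_lborel_prod_mult[OF assms]])
      (use fm in \<open>auto simp: f_def borel_prod\<close>)
  have 1: "(\<integral>x. f (t, x) \<partial>lborel) = a t * (LBINT y:{t<..}. b y)" for t
    unfolding f_def set_lebesgue_integral_def
    by (subst integral_mult_right_zero[symmetric], rule Bochner_Integration.integral_cong) (auto simp: indicator_def)
  have 2: "(\<integral>t. f (t, x) \<partial>lborel) = b x * (LBINT y:{..<x}. a y)" for x
    unfolding f_def set_lebesgue_integral_def
    by (subst integral_mult_right_zero[symmetric], rule Bochner_Integration.integral_cong) (auto simp: indicator_def)
  show ?thesis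
    using lborel2_integral_fst[OF I] lborel2_integral_snd[OF I] by (simp add: 1 2)
qed

text \<open>\<open>A\<close> is arbitrary. If the restriction to \<open>A\<close> is not integrable,
  as can happen for a non-measurable \<open>A\<close>, the integral has the default value 0 and the
  bound is trivial.\<close>

lemma primitive_bound:
  fixes a :: "real \<Rightarrow> real"
  assumes "integrable lborel a"
  shows "\<bar>LBINT y:A. a y\<bar> \<le> (\<integral>y. \<bar>a y\<bar> \<partial>lborel)"
proof (cases "integrable lborel (\<lambda>y. indicator A y * a y)")
  case True
  have "\<bar>LBINT y:A. a y\<bar> \<le> (\<integral>y. \<bar>indicator A y * a y\<bar> \<partial>lborel)"
    unfolding set_lebesgue_integral_def by (simp add: integral_abs_bound)
  also have "\<dots> \<le> (\<integral>y. \<bar>a y\<bar> \<partial>lborel)"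
    by (rule integral_mono) (use True assms in \<open>auto simp: indicator_def\<close>)
  finally show ?thesis .
next
  case False
  then show ?thesis unfolding set_lebesgue_integral_def
    by (simp add: not_integrable_integral_eq)
qed

lemma primitive_measurable [measurable (raw)]:
  fixes a :: "'a \<Rightarrow> real \<Rightarrow> real"
  assumes [measurable]: "case_prod a \<in> borel_measurable (M \<Otimes>\<^sub>M borel)"
    and [measurable]: "g \<in> borel_measurable M"
  shows "(\<lambda>x. LBINT y:{..<g x}. a x y) \<in> borel_measurable M"
    "(\<lambda>x. LBINT y:{g x<..}. a x y) \<in> borel_measurable M"
proof -
  have 1: "(\<lambda>x. LBINT y:{..<g x}. a x y) = (\<lambda>x. \<integral>y. (if y < g x then a x y else 0) \<partial>lborel)"
    "(\<lambda>x. LBINT y:{g x<..}. a x y) = (\<lambda>x. \<integral>y. (if g x < y then a x y else 0) \<partial>lborel)"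
    unfolding set_lebesgue_integral_def
    by (intro ext Bochner_Integration.integral_cong; auto simp: indicator_def)+
  show "(\<lambda>x. LBINT y:{..<g x}. a x y) \<in> borel_measurable M"
    "(\<lambda>x. LBINT y:{g x<..}. a x y) \<in> borel_measurable M"
    unfolding 1 by measurable
qed

lemma integrable_mult_bounded:
  fixes f g :: "'a \<Rightarrow> real"
  assumes "integrable M f" "g \<in> borel_measurable M" "\<And>x. \<bar>g x\<bar> \<le> B"
  shows "integrable M (\<lambda>x. g x * f x)"
proof (rule Bochner_Integration.integrable_bound)
  show "integrable M (\<lambda>x. B * f x)" using assms by simp
  show "AE x in M. norm (g x * f x) \<le> norm (B * f x)"
    using assms(3) by (auto simp: abs_mult intro!: mult_right_mono order_trans[OF assms(3)])
qed (use assms in measurable)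

text \<open>Product rule for absolutely continuous functions in integrated form. The square below
  \<open>x\<close> is cut along its diagonal, a null set, and \<open>integral_triangle\<close>
  exchanges the order of integration on the upper half.\<close>

lemma primitive_product:
  fixes a b :: "real \<Rightarrow> real"
  assumes a: "integrable lborel a" and b: "integrable lborel b"
  shows "(LBINT y:{..<x}. a y) * (LBINT y:{..<x}. b y)
    = (LBINT y:{..<x}. a y * (LBINT s:{..<y}. b s) + b y * (LBINT s:{..<y}. a s))"
proof -
  have [measurable]: "a \<in> borel_measurable borel" "b \<in> borel_measurable borel"
    using assms by (auto dest: borel_measurable_integrable)
  let ?a = "\<lambda>y. indicator {..<x} y * a y" and ?b = "\<lambda>y. indicator {..<x} y * b y"
  let ?A = "\<lambda>y. LBINT s:{..<y}. a s" and ?B = "\<lambda>y. LBINT s:{..<y}. b s"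
  have ia: "integrable lborel ?a" and ib: "integrable lborel ?b"
    by (auto intro!: integrable_mult_bounded[where B=1] a b simp: indicator_def)
  have iaB: "integrable lborel (\<lambda>y. ?B y * ?a y)"
    by (rule integrable_mult_bounded[OF ia, where B="(\<integral>y. \<bar>b y\<bar> \<partial>lborel)"])
      (auto intro: primitive_bound b)
  have ibA: "integrable lborel (\<lambda>y. ?A y * ?b y)"
    by (rule integrable_mult_bounded[OF ib, where B="(\<integral>y. \<bar>a y\<bar> \<partial>lborel)"])
      (auto intro: primitive_bound a)
  have b': "integrable lborel (\<lambda>y. indicator {..<t} y * b y)" for t
    by (auto intro!: integrable_mult_bounded[where B=1] b simp: indicator_def)
  have "(LBINT y:{..<x}. a y) * (LBINT y:{..<x}. b y) = (\<integral>y. ?a y * (\<integral>s. ?b s \<partial>lborel) \<partial>lborel)"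
    by (simp add: set_lebesgue_integral_def mult.commute)
  also have "\<dots> = (\<integral>y. ?a y * ?B y + ?a y * (LBINT s:{y<..}. ?b s) \<partial>lborel)"
  proof (rule Bochner_Integration.integral_cong[OF refl])
    fix y
    show "?a y * (\<integral>s. ?b s \<partial>lborel) = ?a y * ?B y + ?a y * (LBINT s:{y<..}. ?b s)"
    proof (cases "y < x")
      case True
      have "(\<integral>s. ?b s \<partial>lborel) = (\<integral>s. (indicator {..<y} s * b s) + indicator {y<..} s * ?b s \<partial>lborel)"
        by (rule integral_cong_AE) (use True in \<open>auto intro!: AE_I[where N="{y}"] simp: indicator_def\<close>)
      also have "\<dots> = (\<integral>s. (indicator {..<y} s * b s) \<partial>lborel) + (\<integral>s. indicator {y<..} s * ?b s \<partial>lborel)"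
        by (rule Bochner_Integration.integral_add[OF b' integrable_mult_bounded[OF ib, where B=1]])
          (auto simp: indicator_def)
      finally show ?thesis by (simp add: set_lebesgue_integral_def distrib_left)
    qed simp
  qed
  also have "\<dots> = (\<integral>y. ?a y * ?B y \<partial>lborel) + (\<integral>y. ?a y * (LBINT s:{y<..}. ?b s) \<partial>lborel)"
  proof (rule Bochner_Integration.integral_add)
    show "integrable lborel (\<lambda>y. ?a y * ?B y)" using iaB by (simp add: mult.commute)
    have "integrable lborel (\<lambda>y. (LBINT s:{y<..}. ?b s) * ?a y)"
      by (rule integrable_mult_bounded[OF ia, where B="(\<integral>y. \<bar>?b y\<bar> \<partial>lborel)"])
        (auto intro: primitive_bound ib)
    then show "integrable lborel (\<lambda>y. ?a y * (LBINT s:{y<..}. ?b s))" by (simp add: mult.commute)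
  qed
  also have "(\<integral>y. ?a y * (LBINT s:{y<..}. ?b s) \<partial>lborel) = (\<integral>y. ?b y * (LBINT s:{..<y}. ?a s) \<partial>lborel)"
    by (rule integral_triangle[OF ia ib])
  also have "\<dots> = (\<integral>y. ?A y * ?b y \<partial>lborel)"
    unfolding set_lebesgue_integral_def
    by (intro Bochner_Integration.integral_cong refl)
      (auto simp: indicator_def intro!: Bochner_Integration.integral_cong)
  also have "(\<integral>y. ?a y * ?B y \<partial>lborel) + \<dots> = (\<integral>y. ?a y * ?B y + ?A y * ?b y \<partial>lborel)"
    by (rule Bochner_Integration.integral_add[symmetric]) (use iaB ibA in \<open>auto simp: mult.commute\<close>)
  also have "\<dots> = (LBINT y:{..<x}. a y * (LBINT s:{..<y}. b s) + b y * (LBINT s:{..<y}. a s))"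
    unfolding set_lebesgue_integral_def
    by (intro Bochner_Integration.integral_cong refl) (auto simp: indicator_def)
  finally show ?thesis .
qed

text \<open>The chain rule for monomials, by induction with the product rule.\<close>

lemma primitive_power:
  fixes a :: "real \<Rightarrow> real"
  assumes a: "integrable lborel a"
  shows "(LBINT y:{..<x}. a y) ^ Suc n = (LBINT y:{..<x}. real (Suc n) * (LBINT s:{..<y}. a s) ^ n * a y)"
proof (induction n arbitrary: x)
  case 0
  then show ?case by simp
next
  case (Suc n)
  have [measurable]: "a \<in> borel_measurable borel"
    using assms by (auto dest: borel_measurable_integrable)
  let ?A = "\<lambda>y. LBINT s:{..<y}. a s"
  let ?b = "\<lambda>y. real (Suc n) * (LBINT s:{..<y}. a s) ^ n * a y"
  have ib: "integrable lborel ?b"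
  proof (rule integrable_mult_bounded[OF a, where B="real (Suc n) * (\<integral>y. \<bar>a y\<bar> \<partial>lborel) ^ n"])
    show "\<bar>real (Suc n) * ?A y ^ n\<bar> \<le> real (Suc n) * (\<integral>y. \<bar>a y\<bar> \<partial>lborel) ^ n" for y
      unfolding abs_mult power_abs by (intro mult_mono power_mono primitive_bound a) auto
  qed measurable
  have "?A x ^ Suc (Suc n) = ?A x * (LBINT y:{..<x}. ?b y)"
    using Suc.IH[of x] by simp
  also have "\<dots> = (LBINT y:{..<x}. a y * (LBINT s:{..<y}. ?b s) + ?b y * ?A y)"
    by (rule primitive_product[OF a ib])
  also have "\<dots> = (LBINT y:{..<x}. real (Suc (Suc n)) * ?A y ^ Suc n * a y)"
    by (simp only: Suc.IH[symmetric]) (simp add: algebra_simps)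
  finally show ?case .
qed

text \<open>Monomials give polynomials, and Weierstrass approximation of \<open>\<phi>'\<close> on
  the range of the primitive carries the rule over to continuously differentiable functions. Almost
  everywhere differentiability of the primitive is thereby avoided.\<close>

lemma primitive_chain_rule:
  fixes a \<phi> \<phi>' :: "real \<Rightarrow> real"
  assumes a: "integrable lborel a" and \<phi>: "\<And>s. (\<phi> has_real_derivative \<phi>' s) (at s)"
    and cont: "continuous_on UNIV \<phi>'" and zero: "\<phi> 0 = 0"
  shows "\<phi> (LBINT y:{..<x}. a y) = (LBINT y:{..<x}. \<phi>' (LBINT s:{..<y}. a s) * a y)"
proof -
  have [measurable]: "a \<in> borel_measurable borel" "\<phi>' \<in> borel_measurable borel"
    using a cont by (auto dest: borel_measurable_integrable intro: borel_measurable_continuous_onI)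
  let ?A = "\<lambda>y. LBINT s:{..<y}. a s"
  \<comment> \<open>The primitive takes its values in \<open>[-R, R]\<close>, so
    \<open>\<phi>'\<close> has to be approximated on this compact interval only.\<close>
  define R where "R = (\<integral>y. \<bar>a y\<bar> \<partial>lborel)"
  have R0: "R \<ge> 0" by (simp add: R_def)
  have AR: "\<bar>?A y\<bar> \<le> R" for y unfolding R_def by (rule primitive_bound[OF a])
  have AR': "?A y \<in> {-R..R}" for y using AR[of y] by (auto simp: abs_le_iff)
  have bd: "\<bar>LBINT y:{..<x}. f y * a y\<bar> \<le> e * R"
    if [measurable]: "f \<in> borel_measurable borel" and "\<And>y. \<bar>f y\<bar> \<le> e" for f :: "real \<Rightarrow> real" and e x
  proof -
    have "integrable lborel (\<lambda>y. f y * a y)" by (rule integrable_mult_bounded[OF a]) (use that in auto)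
    then have "\<bar>LBINT y:{..<x}. f y * a y\<bar> \<le> (\<integral>y. \<bar>f y * a y\<bar> \<partial>lborel)" by (rule primitive_bound)
    also have "\<dots> \<le> (\<integral>y. e * \<bar>a y\<bar> \<partial>lborel)"
      using a that(2) by (intro integral_mono integrable_abs \<open>integrable lborel (\<lambda>y. f y * a y)\<close>)
        (auto simp: abs_mult intro!: mult_right_mono)
    finally show ?thesis by (simp add: R_def)
  qed
  \<comment> \<open>One \<open>e * R\<close> comes from comparing \<open>\<phi>\<close> with the
    polynomial \<open>G\<close> by the mean value inequality, the other from replacing
    \<open>\<phi>'\<close> by \<open>g\<close> under the integral.\<close>
  have "\<bar>\<phi> (?A x) - (LBINT y:{..<x}. \<phi>' (?A y) * a y)\<bar> \<le> 2 * (e * R)" if e: "e > 0" for e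
  proof -
    obtain g where g: "real_polynomial_function g" "\<And>s. s \<in> {-R..R} \<Longrightarrow> \<bar>\<phi>' s - g s\<bar> < e"
      using Stone_Weierstrass_real_polynomial_function[of "{-R..R}" \<phi>' e] e cont
      by (auto intro: continuous_on_subset)
    from g(1) obtain c n where gc: "g = (\<lambda>s. \<Sum>i\<le>n. c i * s ^ i)"
      unfolding real_polynomial_function_iff_sum by auto
    \<comment> \<open>The antiderivative of \<open>g\<close> that vanishes at 0, as
      \<open>\<phi>\<close> does.\<close>
    define G where "G = (\<lambda>s. \<Sum>i\<le>n. c i / real (Suc i) * s ^ Suc i)"
    have dG: "(G has_real_derivative g s) (at s)" for s
    proof -
      have "((\<lambda>s. c i / real (Suc i) * s ^ Suc i) has_real_derivative c i * s ^ i) (at s)" for i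
        using DERIV_cmult[OF DERIV_pow[of "Suc i" s], of "c i / real (Suc i)"] by (simp del: of_nat_Suc power_Suc)
      then show ?thesis unfolding G_def gc by (intro DERIV_sum) auto
    qed
    have GG: "G (?A x) = (LBINT y:{..<x}. g (?A y) * a y)"
    proof -
      have i: "integrable lborel (\<lambda>y. real (Suc i) * ?A y ^ i * a y)" for i
      proof (rule integrable_mult_bounded[OF a, where B="real (Suc i) * R ^ i"])
        show "\<bar>real (Suc i) * ?A y ^ i\<bar> \<le> real (Suc i) * R ^ i" for y
          unfolding abs_mult power_abs by (intro mult_mono power_mono AR) auto
      qed measurable
      have i2: "integrable lborel (\<lambda>y. indicator {..<x} y * (c i * (?A y ^ i * a y)))" for i
      proof -
        have "integrable lborel (\<lambda>y. (indicator {..<x} y * c i / real (Suc i)) * (real (Suc i) * ?A y ^ i * a y))"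
          by (rule integrable_mult_bounded[OF i, where B="\<bar>c i / real (Suc i)\<bar>"]) (auto simp: indicator_def)
        then show ?thesis by (simp add: field_simps del: of_nat_Suc)
      qed
      have "G (?A x) = (\<Sum>i\<le>n. c i / real (Suc i) * (LBINT y:{..<x}. real (Suc i) * ?A y ^ i * a y))"
        unfolding G_def by (subst primitive_power[OF a]) simp
      also have "\<dots> = (\<Sum>i\<le>n. (\<integral>y. indicator {..<x} y * (c i * (?A y ^ i * a y)) \<partial>lborel))"
        unfolding set_lebesgue_integral_def
        by (intro sum.cong refl, subst integral_mult_right_zero[symmetric],
          rule Bochner_Integration.integral_cong) (auto simp del: of_nat_Suc)
      also have "\<dots> = (\<integral>y. (\<Sum>i\<le>n. indicator {..<x} y * (c i * (?A y ^ i * a y))) \<partial>lborel)"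
        by (rule Bochner_Integration.integral_sum[symmetric]) (rule i2)
      also have "\<dots> = (LBINT y:{..<x}. g (?A y) * a y)"
        unfolding set_lebesgue_integral_def gc
        by (intro Bochner_Integration.integral_cong refl) (simp add: sum_distrib_left sum_distrib_right mult.assoc)
      finally show ?thesis .
    qed
    have "\<bar>\<phi> (?A x) - G (?A x)\<bar> \<le> e * R"
    proof -
      have d: "((\<lambda>s. \<phi> s - G s) has_real_derivative (\<phi>' s - g s)) (at s within S)" for s S
        by (intro derivative_intros has_field_derivative_at_within[OF \<phi>] has_field_derivative_at_within[OF dG])
      have gn: "norm (\<phi>' s - g s) \<le> e" if "s \<in> {-R..R}" for s
        using g(2)[OF that] by simp
      have AS: "?A x \<in> {-R..R}" "0 \<in> {-R..R}" using AR[of x] R0 by auto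
      have "norm ((\<lambda>s. \<phi> s - G s) (?A x) - (\<lambda>s. \<phi> s - G s) 0) \<le> e * norm (?A x - 0)"
        by (rule field_differentiable_bound[OF convex_real_interval(5) d gn AS]) 
      then have "\<bar>\<phi> (?A x) - G (?A x)\<bar> \<le> e * \<bar>?A x\<bar>" by (simp add: zero G_def)
      also have "\<dots> \<le> e * R" using AR e by (intro mult_left_mono) auto
      finally show ?thesis .
    qed
    moreover have "\<bar>(LBINT y:{..<x}. (\<phi>' (?A y) - g (?A y)) * a y)\<bar> \<le> e * R"
    proof (rule bd)
      have "g \<in> borel_measurable borel" unfolding gc by measurable
      then show "(\<lambda>y. \<phi>' (?A y) - g (?A y)) \<in> borel_measurable borel" by measurable
      show "\<bar>\<phi>' (?A y) - g (?A y)\<bar> \<le> e" for y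
        using g(2)[OF AR'[of y]] by simp
    qed
    moreover have "(LBINT y:{..<x}. (\<phi>' (?A y) - g (?A y)) * a y)
       = (LBINT y:{..<x}. \<phi>' (?A y) * a y) - (LBINT y:{..<x}. g (?A y) * a y)"
    proof -
      have gm[measurable]: "g \<in> borel_measurable borel" unfolding gc by measurable
      obtain C where C: "\<And>s. s \<in> {-R..R} \<Longrightarrow> \<bar>\<phi>' s\<bar> \<le> C"
      proof -
        have "bounded (\<phi>' ` {-R..R})"
          using cont by (intro compact_imp_bounded compact_continuous_image) (auto intro: continuous_on_subset)
        then obtain C where "\<forall>s\<in>{-R..R}. \<bar>\<phi>' s\<bar> \<le> C" by (auto simp: bounded_iff)
        then show ?thesis using that by blast
      qed
      have i1: "integrable lborel (\<lambda>y. \<phi>' (?A y) * a y)"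
        by (rule integrable_mult_bounded[OF a _ C[OF AR']]) measurable
      have i2: "integrable lborel (\<lambda>y. g (?A y) * a y)"
      proof (rule integrable_mult_bounded[OF a, where B="C + e"])
        show "\<bar>g (?A y)\<bar> \<le> C + e" for y
          using C[OF AR'[of y]] g(2)[OF AR'[of y]] by linarith
      qed measurable
      have "set_integrable lborel {..<x} (\<lambda>y. \<phi>' (?A y) * a y)" "set_integrable lborel {..<x} (\<lambda>y. g (?A y) * a y)"
        using i1 i2 by (auto simp: set_integrable_def intro!: integrable_mult_bounded[where B=1] simp: indicator_def)
      then show ?thesis by (simp add: left_diff_distrib set_integral_diff)
    qed
    ultimately show ?thesis using GG by (auto simp: abs_le_iff)
  qed
  then have *: "\<bar>\<phi> (?A x) - (LBINT y:{..<x}. \<phi>' (?A y) * a y)\<bar> \<le> 2 * (e * R)" if "e > 0" for e using that by blast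
  have "\<bar>\<phi> (?A x) - (LBINT y:{..<x}. \<phi>' (?A y) * a y)\<bar> \<le> 0"
  proof (rule field_le_epsilon)
    fix e :: real assume "e > 0"
    \<comment> \<open>The summand 1 covers the case \<open>R = 0\<close>.\<close>
    have "2 * (e / (2 * R + 1) * R) \<le> e" using R0 \<open>e > 0\<close> by (simp add: field_simps)
    moreover have "e / (2 * R + 1) > 0" using R0 \<open>e > 0\<close> by simp
    ultimately show "\<bar>\<phi> (?A x) - (LBINT y:{..<x}. \<phi>' (?A y) * a y)\<bar> \<le> 0 + e"
      using *[of "e / (2 * R + 1)"] by linarith
  qed
  then show ?thesis by simp
qed

section \<open>Continuity of translations\<close>

lemma integrable_translate:
  fixes f :: "'a::euclidean_space \<Rightarrow> real"
  assumes "integrable lborel f"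
  shows "integrable lborel (\<lambda>z. f (s + z))"
proof -
  have "integrable (distr lborel borel ((+) s)) f" using assms by (simp add: lborel_distr_plus)
  then show ?thesis by (rule integrable_distr[rotated]) simp
qed

lemma integral_translate:
  fixes f :: "'a::euclidean_space \<Rightarrow> real"
  assumes [measurable]: "f \<in> borel_measurable borel"
  shows "(\<integral>z. f (s + z) \<partial>lborel) = (\<integral>z. f z \<partial>lborel)"
proof -
  have "(\<integral>z. f z \<partial>lborel) = (\<integral>z. f z \<partial>distr lborel borel ((+) s))" by (simp add: lborel_distr_plus)
  also have "\<dots> = (\<integral>z. f (s + z) \<partial>lborel)" by (rule integral_distr) auto
  finally show ?thesis by simp
qed

text \<open>The boundary of \<open>U\<close> may have positive measure, so the shifted indicators
  need not converge almost everywhere. On \<open>U\<close> itself openness gives convergence, hence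
  the positive part of \<open>indicator U z - indicator U (s + z)\<close> tends to 0 in the mean; by
  translation invariance the negative part has the same integral.\<close>

lemma translation_continuous_open:
  fixes U :: "'a::euclidean_space set"
  assumes U: "open U" "emeasure lborel U < \<infinity>"
  shows "((\<lambda>s. \<integral>z. \<bar>indicator U (s + z) - indicator U z\<bar> \<partial>lborel) \<longlongrightarrow> (0::real)) (at 0)"
proof -
  have [measurable]: "U \<in> sets borel" using U by auto
  let ?u = "indicator U :: 'a \<Rightarrow> real"
  have i: "integrable lborel ?u" using U by (simp add: integrable_indicator_iff)
  have ius: "integrable lborel (\<lambda>z. ?u (s + z))" for s by (rule integrable_translate[OF i])
  have im: "integrable lborel (\<lambda>z. max 0 (?u z - ?u (s + z)))" for s
    by (intro Bochner_Integration.integrable_max integrable_zero Bochner_Integration.integrable_diff i ius)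
  have eq: "(\<integral>z. \<bar>?u (s + z) - ?u z\<bar> \<partial>lborel) = 2 * (\<integral>z. max 0 (?u z - ?u (s + z)) \<partial>lborel)" for s
  proof -
    have "(\<integral>z. \<bar>?u (s + z) - ?u z\<bar> \<partial>lborel)
        = (\<integral>z. 2 * max 0 (?u z - ?u (s + z)) + (?u (s + z) - ?u z) \<partial>lborel)"
      by (rule Bochner_Integration.integral_cong) (auto simp: max_def)
    also have "\<dots> = 2 * (\<integral>z. max 0 (?u z - ?u (s + z)) \<partial>lborel) + ((\<integral>z. ?u (s + z) \<partial>lborel) - (\<integral>z. ?u z \<partial>lborel))"
      using i ius im by simp
    also have "(\<integral>z. ?u (s + z) \<partial>lborel) = (\<integral>z. ?u z \<partial>lborel)" by (rule integral_translate) simp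
    finally show ?thesis by simp
  qed
  have "((\<lambda>s. \<integral>z. max 0 (?u z - ?u (s + z)) \<partial>lborel) \<longlongrightarrow> 0) (at 0)"
    unfolding tendsto_at_iff_sequentially comp_def
  proof (intro allI impI)
    fix X :: "nat \<Rightarrow> 'a" assume "X \<longlonglongrightarrow> 0"
    have "(\<lambda>n. \<integral>z. max 0 (?u z - ?u (X n + z)) \<partial>lborel) \<longlonglongrightarrow> (\<integral>z. 0 \<partial>(lborel::'a measure))"
    proof (rule integral_dominated_convergence[where w="?u"])
      show "AE z in lborel. (\<lambda>n. max 0 (?u z - ?u (X n + z))) \<longlonglongrightarrow> 0"
      proof (rule AE_I2)
        fix z
        show "(\<lambda>n. max 0 (?u z - ?u (X n + z))) \<longlonglongrightarrow> 0"
        proof (cases "z \<in> U")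
          case True
          have "(\<lambda>n. X n + z) \<longlonglongrightarrow> 0 + z" by (intro tendsto_intros \<open>X \<longlonglongrightarrow> 0\<close>)
          then have "\<forall>\<^sub>F n in sequentially. X n + z \<in> U" using U True by (auto dest: topological_tendstoD)
          then have "\<forall>\<^sub>F n in sequentially. max 0 (?u z - ?u (X n + z)) = 0"
            by eventually_elim (auto simp: indicator_def)
          then show ?thesis by (rule tendsto_eventually)
        qed (simp add: indicator_def)
      qed
    qed (use i in \<open>auto simp: indicator_def\<close>)
    then show "(\<lambda>n. \<integral>z. max 0 (?u z - ?u (X n + z)) \<partial>lborel) \<longlonglongrightarrow> 0" by simp
  qed
  from tendsto_mult_left[OF this, of 2] show ?thesis unfolding eq by simp
qed

text \<open>Open sets approximate Borel sets from outside, which settles indicators; induction over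
  integrable functions does the rest, because the property survives approximation in the
  mean.\<close>

lemma translation_continuous_L1:
  fixes f :: "'a::euclidean_space \<Rightarrow> real"
  assumes "integrable lborel f"
  shows "((\<lambda>s. \<integral>z. \<bar>f (s + z) - f z\<bar> \<partial>lborel) \<longlongrightarrow> 0) (at 0)"
proof -
  define C where "C f \<longleftrightarrow> (\<forall>e>0. \<forall>\<^sub>F s in at 0. (\<integral>z. \<bar>f (s + z) - f z\<bar> \<partial>lborel) < e)" for f :: "'a \<Rightarrow> real"
  \<comment> \<open>Closure under approximation: a shift does not change the mean distance of
    \<open>f\<close> and \<open>g\<close>, so three thirds of \<open>e\<close> add up.\<close>
  have CI: "C f" if i: "integrable lborel f" and
    ap: "\<And>e. e > 0 \<Longrightarrow> \<exists>g. integrable lborel g \<and> C g \<and> (\<integral>z. \<bar>f z - g z\<bar> \<partial>lborel) < e" for f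
    unfolding C_def
  proof (intro allI impI)
    fix e :: real assume e: "e > 0"
    obtain g where g: "integrable lborel g" "C g" "(\<integral>z. \<bar>f z - g z\<bar> \<partial>lborel) < e / 3"
      using ap[of "e/3"] e by auto
    have "\<forall>\<^sub>F s in at 0. (\<integral>z. \<bar>g (s + z) - g z\<bar> \<partial>lborel) < e / 3" using g(2)[unfolded C_def, rule_format, of "e/3"] e by simp
    then show "\<forall>\<^sub>F s in at 0. (\<integral>z. \<bar>f (s + z) - f z\<bar> \<partial>lborel) < e"
    proof eventually_elim
      case (elim s)
      have fg: "integrable lborel (\<lambda>z. \<bar>f z - g z\<bar>)" using i g by simp
      have fgs: "integrable lborel (\<lambda>z. \<bar>f (s + z) - g (s + z)\<bar>)" using integrable_translate[OF fg] .
      have gg: "integrable lborel (\<lambda>z. \<bar>g (s + z) - g z\<bar>)" using g integrable_translate[OF g(1)] by simp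
      have ff: "integrable lborel (\<lambda>z. \<bar>f (s + z) - f z\<bar>)" using i integrable_translate[OF i] by simp
      have "(\<integral>z. \<bar>f (s + z) - f z\<bar> \<partial>lborel)
        \<le> (\<integral>z. \<bar>f (s + z) - g (s + z)\<bar> + (\<bar>g (s + z) - g z\<bar> + \<bar>f z - g z\<bar>) \<partial>lborel)"
        by (rule integral_mono) (use fg fgs gg ff in auto)
      also have "\<dots> = (\<integral>z. \<bar>f (s + z) - g (s + z)\<bar> \<partial>lborel)
        + ((\<integral>z. \<bar>g (s + z) - g z\<bar> \<partial>lborel) + (\<integral>z. \<bar>f z - g z\<bar> \<partial>lborel))"
        using fg fgs gg by simp
      also have "(\<integral>z. \<bar>f (s + z) - g (s + z)\<bar> \<partial>lborel) = (\<integral>z. \<bar>f z - g z\<bar> \<partial>lborel)"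
        using integral_translate[of "\<lambda>z. \<bar>f z - g z\<bar>" s] i g by (auto dest!: borel_measurable_integrable)
      finally show ?case using g(3) elim by simp
    qed
  qed
  have "C f" using assms
  proof (induction rule: integrable_induct)
    case (base A c)
    then have [measurable]: "A \<in> sets borel" by simp
    have iA: "integrable lborel (\<lambda>z. indicator A z *\<^sub>R c)"
      using base by (simp add: integrable_indicator_iff)
    show ?case
    proof (rule CI[OF iA])
      fix e :: real assume e: "e > 0"
      define d where "d = e / (\<bar>c\<bar> + 1)"
      have d: "d > 0" using e by (simp add: d_def)
      obtain U where U: "open U" "A \<subseteq> U" "emeasure lborel (U - A) < d"
        using outer_regular_lborel[OF \<open>A \<in> sets borel\<close> d] by auto
      have [measurable]: "U \<in> sets borel" using U by auto
      have "emeasure lborel U \<le> emeasure lborel A + emeasure lborel (U - A)"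
        using emeasure_subadditive[of A lborel "U - A"] U by (simp add: Un_absorb1)
      also have "\<dots> < \<infinity>" using base U(3) by (auto simp: less_top[symmetric] ennreal_add_eq_top)
      finally have Uf: "emeasure lborel U < \<infinity>" .
      have mUA: "measure lborel (U - A) < d"
        using U(3) d by (metis emeasure_eq_ennreal_measure ennreal_less_iff less_imp_neq measure_nonneg top.extremum_strict less_ennreal.rep_eq order_less_imp_not_less)
      let ?g = "\<lambda>z. c * indicator U z :: real"
      have ig: "integrable lborel ?g" using Uf by (simp add: integrable_indicator_iff)
      have "C ?g"
      proof -
        have "((\<lambda>s. \<bar>c\<bar> * (\<integral>z. \<bar>indicator U (s + z) - indicator U z\<bar> \<partial>lborel)) \<longlongrightarrow> \<bar>c\<bar> * (0::real)) (at 0)"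
          by (intro tendsto_mult_left translation_continuous_open U Uf)
        moreover have "\<bar>c\<bar> * (\<integral>z. \<bar>indicator U (s + z) - indicator U z\<bar> \<partial>lborel)
          = (\<integral>z. \<bar>?g (s + z) - ?g z\<bar> \<partial>lborel)" for s
          by (subst integral_mult_right_zero[symmetric], rule Bochner_Integration.integral_cong)
            (auto simp: abs_mult[symmetric] right_diff_distrib)
        ultimately show ?thesis unfolding C_def by (auto dest: order_tendstoD(2))
      qed
      moreover have "(\<integral>z. \<bar>indicator A z *\<^sub>R c - ?g z\<bar> \<partial>lborel) < e"
      proof -
        have "(\<integral>z. \<bar>indicator A z *\<^sub>R c - ?g z\<bar> \<partial>lborel) = (\<integral>z. \<bar>c\<bar> * indicator (U - A) z \<partial>lborel)"
          by (rule Bochner_Integration.integral_cong) (use U(2) in \<open>auto simp: indicator_def\<close>)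
        also have "\<dots> = \<bar>c\<bar> * measure lborel (U - A)" by simp
        also have "\<dots> \<le> \<bar>c\<bar> * d" using mUA by (intro mult_left_mono) auto
        also have "\<dots> < e" using e by (simp add: d_def field_simps)
        finally show ?thesis .
      qed
      ultimately show "\<exists>g. integrable lborel g \<and> C g \<and> (\<integral>z. \<bar>indicator A z *\<^sub>R c - g z\<bar> \<partial>lborel) < e"
        using ig by blast
    qed
  next
    case (add f g)
    show ?case unfolding C_def
    proof (intro allI impI)
      fix e :: real assume e: "e > 0"
      have "\<forall>\<^sub>F s in at 0. (\<integral>z. \<bar>f (s + z) - f z\<bar> \<partial>lborel) < e / 2"
        "\<forall>\<^sub>F s in at 0. (\<integral>z. \<bar>g (s + z) - g z\<bar> \<partial>lborel) < e / 2"
        using add.IH[unfolded C_def, rule_format, of "e/2"] e by simp_all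
      then show "\<forall>\<^sub>F s in at 0. (\<integral>z. \<bar>f (s + z) + g (s + z) - (f z + g z)\<bar> \<partial>lborel) < e"
      proof eventually_elim
        case (elim s)
        have ff: "integrable lborel (\<lambda>z. \<bar>f (s + z) - f z\<bar>)" and gg: "integrable lborel (\<lambda>z. \<bar>g (s + z) - g z\<bar>)"
          using add.hyps integrable_translate[of f s] integrable_translate[of g s] by auto
        have "(\<integral>z. \<bar>f (s + z) + g (s + z) - (f z + g z)\<bar> \<partial>lborel)
          \<le> (\<integral>z. \<bar>f (s + z) - f z\<bar> + \<bar>g (s + z) - g z\<bar> \<partial>lborel)"
          using add.hyps integrable_translate[of f s] integrable_translate[of g s]
          by (intro integral_mono) auto
        also have "\<dots> < e" using ff gg elim by simp
        finally show ?case .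
      qed
    qed
  next
    case (lim f s)
    show ?case
    proof (rule CI[OF lim.hyps(4)])
      fix e :: real assume e: "e > 0"
      have "(\<lambda>i. \<integral>z. \<bar>f z - s i z\<bar> \<partial>lborel) \<longlonglongrightarrow> (\<integral>z. 0 \<partial>(lborel::'a measure))"
      \<comment> \<open>The approximating functions satisfy
        \<open>\<bar>s i z\<bar> \<le> 2 * \<bar>f z\<bar>\<close>, hence the factor 3.\<close>
      proof (rule integral_dominated_convergence[where w="\<lambda>z. 3 * \<bar>f z\<bar>"])
        show "AE z in lborel. (\<lambda>i. \<bar>f z - s i z\<bar>) \<longlonglongrightarrow> 0"
        proof (rule AE_I2)
          fix z
          have "(\<lambda>i. \<bar>f z - s i z\<bar>) \<longlonglongrightarrow> \<bar>f z - f z\<bar>" by (intro tendsto_intros lim.hyps(2)) auto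
          then show "(\<lambda>i. \<bar>f z - s i z\<bar>) \<longlonglongrightarrow> 0" by simp
        qed
        show "AE z in lborel. norm \<bar>f z - s i z\<bar> \<le> 3 * \<bar>f z\<bar>" for i
        proof (rule AE_I2)
          fix z show "norm \<bar>f z - s i z\<bar> \<le> 3 * \<bar>f z\<bar>" using lim.hyps(3)[of z i] by simp
        qed
      qed (use lim.hyps in \<open>auto dest: borel_measurable_integrable\<close>)
      then have "\<forall>\<^sub>F i in sequentially. (\<integral>z. \<bar>f z - s i z\<bar> \<partial>lborel) < e"
        using e by (intro order_tendstoD(2)) auto
      then obtain i where "(\<integral>z. \<bar>f z - s i z\<bar> \<partial>lborel) < e" by (auto simp: eventually_sequentially)
      then show "\<exists>g. integrable lborel g \<and> C g \<and> (\<integral>z. \<bar>f z - g z\<bar> \<partial>lborel) < e"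
        using lim.hyps lim.IH by blast
    qed
  qed
  then show ?thesis unfolding C_def
    by (auto simp: tendsto_iff)
qed

lemma integrable_mult_L2:
  fixes f g :: "'a \<Rightarrow> real"
  assumes [measurable]: "f \<in> borel_measurable M" "g \<in> borel_measurable M"
    and "integrable M (\<lambda>z. (f z)\<^sup>2)" "integrable M (\<lambda>z. (g z)\<^sup>2)"
  shows "integrable M (\<lambda>z. f z * g z)"
proof (rule Bochner_Integration.integrable_bound)
  show "integrable M (\<lambda>z. (f z)\<^sup>2 + (g z)\<^sup>2)" using assms by simp
  have "\<bar>f z\<bar> * \<bar>g z\<bar> \<le> (f z)\<^sup>2 + (g z)\<^sup>2" for z
  proof -
    have "2 * (\<bar>f z\<bar> * \<bar>g z\<bar>) \<le> (f z)\<^sup>2 + (g z)\<^sup>2"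
      using sum_squares_bound[of "\<bar>f z\<bar>" "\<bar>g z\<bar>"] by (simp add: mult.assoc)
    moreover have "0 \<le> \<bar>f z\<bar> * \<bar>g z\<bar>" by simp
    ultimately show ?thesis by linarith
  qed
  then show "AE z in M. norm (f z * g z) \<le> norm ((f z)\<^sup>2 + (g z)\<^sup>2)"
    by (auto simp: abs_mult)
qed measurable

text \<open>Difference quotients in time are always paired with a fixed square integrable function,
  so this weak form of continuity is enough.\<close>

lemma translation_continuous_pairing:
  fixes f g :: "'a::euclidean_space \<Rightarrow> real"
  assumes [measurable]: "f \<in> borel_measurable borel" "g \<in> borel_measurable borel"
    and g: "integrable lborel (\<lambda>z. (g z)\<^sup>2)" and f: "integrable lborel (\<lambda>z. (f z)\<^sup>2)"
  shows "((\<lambda>s. \<integral>z. g z * f (s + z) \<partial>lborel) \<longlongrightarrow> (\<integral>z. g z * f z \<partial>lborel)) (at 0)"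
proof -
  define H where "H = (\<lambda>z. f z * \<bar>f z\<bar>)"
  have H: "integrable lborel H"
    by (rule Bochner_Integration.integrable_bound[OF f]) (auto simp: H_def abs_mult power2_eq_square)
  have ts: "((\<lambda>s. \<integral>z. \<bar>H (s + z) - H z\<bar> \<partial>lborel) \<longlongrightarrow> 0) (at 0)"
    by (rule translation_continuous_L1[OF H])
  have fs: "integrable lborel (\<lambda>z. (f (s + z))\<^sup>2)" for s by (rule integrable_translate[OF f])
  \<comment> \<open>reduces continuity of translations in L2 to the L1 case for \<open>f * \<bar>f\<bar>\<close>\<close>
  have dist_sq_le: "(a - b)\<^sup>2 \<le> 2 * \<bar>a * \<bar>a\<bar> - b * \<bar>b\<bar>\<bar>" for a b :: real
  proof -
    have *: "(a - b)\<^sup>2 \<le> 2 * \<bar>a * \<bar>a\<bar> - b * \<bar>b\<bar>\<bar>" if "a \<ge> 0" "a \<ge> b" for a b :: real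
    proof (cases "b \<ge> 0")
      case True
      have "(a - b) * (a - b) \<le> (a - b) * (a + b)" using that True by (intro mult_left_mono) auto
      moreover have "0 \<le> (a - b) * (a + b)" using that True by simp
      ultimately show ?thesis using that True by (simp add: power2_eq_square algebra_simps)
    next
      case False
      have "0 \<le> (a + b)\<^sup>2" by simp
      moreover have "0 \<le> a\<^sup>2 + b\<^sup>2" by simp
      ultimately show ?thesis using that False by (simp add: power2_eq_square algebra_simps)
    qed
    consider "a \<ge> 0" "a \<ge> b" | "b \<ge> 0" "b \<ge> a" | "- a \<ge> 0" "- a \<ge> - b" | "- b \<ge> 0" "- b \<ge> - a" by linarith
    then show ?thesis
    proof cases
      case 1 then show ?thesis by (rule *)
    next
      case 2 then show ?thesis using *[of b a] by (simp add: power2_commute abs_minus_commute)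
    next
      case 3 then show ?thesis using *[of "-a" "-b"] by (simp add: power2_commute abs_minus_commute add.commute)
    next
      case 4 then show ?thesis using *[of "-b" "-a"] by (simp add: power2_commute abs_minus_commute add.commute)
    qed
  qed
  have "\<forall>\<^sub>F s in at 0. \<bar>(\<integral>z. g z * f (s + z) \<partial>lborel) - (\<integral>z. g z * f z \<partial>lborel)\<bar> < e" if e: "e > 0" for e
  proof -
    define G where "G = (\<integral>z. (g z)\<^sup>2 \<partial>lborel)"
    have G0: "G \<ge> 0" by (simp add: G_def)
    \<comment> \<open>\<open>k\<close> is the weight in Young's inequality
      \<open>\<bar>g d\<bar> \<le> k/2 g^2 + d^2 / (2 k)\<close>. Because of
      \<open>k * G \<le> e\<close> the first term contributes at most \<open>e / 2\<close>.\<close>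
    define k where "k = e / (G + 1)"
    have k: "k > 0" using e G0 by (simp add: k_def)
    have kG: "k * G \<le> e" using e G0 by (simp add: k_def field_simps)
    have "\<forall>\<^sub>F s in at 0. (\<integral>z. \<bar>H (s + z) - H z\<bar> \<partial>lborel) < k * e / 2"
      using ts k e by (intro order_tendstoD(2)) auto
    then show ?thesis
    proof eventually_elim
      case (elim s)
      have i1: "integrable lborel (\<lambda>z. g z * f (s + z))" by (rule integrable_mult_L2) (use g fs in auto)
      have i2: "integrable lborel (\<lambda>z. g z * f z)" by (rule integrable_mult_L2) (use g f in auto)
      have i3: "integrable lborel (\<lambda>z. \<bar>H (s + z) - H z\<bar>)" using H integrable_translate[OF H] by simp
      have "\<bar>(\<integral>z. g z * f (s + z) \<partial>lborel) - (\<integral>z. g z * f z \<partial>lborel)\<bar>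
        = \<bar>\<integral>z. g z * f (s + z) - g z * f z \<partial>lborel\<bar>" using i1 i2 by simp
      also have "\<dots> \<le> (\<integral>z. \<bar>g z * f (s + z) - g z * f z\<bar> \<partial>lborel)" by (rule integral_abs_bound)
      also have "\<dots> \<le> (\<integral>z. (k / 2) * (g z)\<^sup>2 + (1 / k) * \<bar>H (s + z) - H z\<bar> \<partial>lborel)"
      proof (rule integral_mono)
        show "integrable lborel (\<lambda>z. \<bar>g z * f (s + z) - g z * f z\<bar>)" using i1 i2 by simp
        show "integrable lborel (\<lambda>z. (k / 2) * (g z)\<^sup>2 + (1 / k) * \<bar>H (s + z) - H z\<bar>)" using g i3 by simp
        fix z
        let ?d = "f (s + z) - f z"
        have "2 * ((k * \<bar>g z\<bar>) * \<bar>?d\<bar>) \<le> (k * \<bar>g z\<bar>)\<^sup>2 + (\<bar>?d\<bar>)\<^sup>2"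
          using sum_squares_bound[of "k * \<bar>g z\<bar>" "\<bar>?d\<bar>"] by (simp add: mult.assoc)
        also have "\<dots> \<le> k\<^sup>2 * (g z)\<^sup>2 + 2 * \<bar>H (s + z) - H z\<bar>"
          using dist_sq_le[of "f (s+z)" "f z"] by (simp add: H_def power_mult_distrib)
        finally have "2 * k * (\<bar>g z\<bar> * \<bar>?d\<bar>) \<le> 2 * k * ((k / 2) * (g z)\<^sup>2 + (1 / k) * \<bar>H (s + z) - H z\<bar>)"
          using k by (simp add: algebra_simps power2_eq_square)
        then have "\<bar>g z\<bar> * \<bar>?d\<bar> \<le> (k / 2) * (g z)\<^sup>2 + (1 / k) * \<bar>H (s + z) - H z\<bar>"
          using k by (subst (asm) mult_le_cancel_left_pos) auto
        then show "\<bar>g z * f (s + z) - g z * f z\<bar> \<le> (k / 2) * (g z)\<^sup>2 + (1 / k) * \<bar>H (s + z) - H z\<bar>"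
          by (simp add: abs_mult right_diff_distrib[symmetric])
      qed
      also have "\<dots> = (k / 2) * G + (1 / k) * (\<integral>z. \<bar>H (s + z) - H z\<bar> \<partial>lborel)"
        using g i3 by (simp add: G_def)
      also have "\<dots> < e"
      proof -
        have "(1 / k) * (\<integral>z. \<bar>H (s + z) - H z\<bar> \<partial>lborel) < (1 / k) * (k * e / 2)"
          using elim k by (intro mult_strict_left_mono) auto
        moreover have "(1 / k) * (k * e / 2) = e / 2" using k by simp
        ultimately show ?thesis using kG by linarith
      qed
      finally show ?case .
    qed
  qed
  then show ?thesis by (auto simp: tendsto_iff dist_real_def)
qed

lemma average_tendsto:
  fixes A :: "real \<Rightarrow> real"
  assumes [measurable]: "A \<in> borel_measurable borel" and B: "\<And>s. \<bar>A s\<bar> \<le> B"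
    and lim: "(A \<longlongrightarrow> c) (at 0)"
  shows "((\<lambda>h. (LBINT s:{0<..<h}. A s) / h) \<longlongrightarrow> c) (at_right 0)"
proof -
  have "\<forall>\<^sub>F h in at_right 0. \<bar>(LBINT s:{0<..<h}. A s) / h - c\<bar> < e" if e: "e > 0" for e
  proof -
    have "\<forall>\<^sub>F s in at 0. dist (A s) c < e / 2" using lim e by (auto dest: tendstoD[where e="e/2"])
    then obtain d where d: "d > 0" "\<And>s. s \<noteq> 0 \<Longrightarrow> \<bar>s\<bar> < d \<Longrightarrow> \<bar>A s - c\<bar> < e / 2"
      by (auto simp: eventually_at dist_real_def)
    have "\<bar>(LBINT s:{0<..<h}. A s) / h - c\<bar> < e" if h: "h > 0" "h < d" for h
    proof -
      have iA: "set_integrable lborel {0<..<h} A"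
        unfolding set_integrable_def
      proof (rule Bochner_Integration.integrable_bound)
        show "integrable lborel (\<lambda>s. indicator {0<..<h} s * B)"
          using h by (intro integrable_mult_left integrable_real_indicator) auto
        show "AE s in lborel. norm (indicator {0<..<h} s *\<^sub>R A s) \<le> norm (indicator {0<..<h} s * B)"
          by (rule AE_I2) (use B in \<open>auto simp: indicator_def intro: order_trans[OF B]\<close>)
      qed measurable
      have ic: "set_integrable lborel {0<..<h} (\<lambda>_. k)" for k :: real
        unfolding set_integrable_def using h by (simp add: integrable_indicator_iff)
      have lc: "(LBINT s:{0<..<h}. k) = k * h" for k :: real
        using h by (simp add: set_lebesgue_integral_def)
      have "\<bar>(LBINT s:{0<..<h}. A s) - c * h\<bar> = \<bar>LBINT s:{0<..<h}. A s - c\<bar>"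
        using set_integral_diff(2)[OF iA ic[of c]] by (simp add: lc)
      also have "\<dots> \<le> (LBINT s:{0<..<h}. \<bar>A s - c\<bar>)"
        using set_integral_norm_bound[OF set_integral_diff(1)[OF iA ic[of c]]] by simp
      also have "\<dots> \<le> (LBINT s:{0<..<h}. e / 2)"
        by (rule set_integral_mono) (use iA ic d h in \<open>auto intro!: set_integrable_abs set_integral_diff(1) less_imp_le\<close>)
      also have "\<dots> = e / 2 * h" by (rule lc)
      finally have "\<bar>((LBINT s:{0<..<h}. A s) - c * h) / h\<bar> \<le> e / 2"
        using h by (simp add: field_simps)
      moreover have "((LBINT s:{0<..<h}. A s) - c * h) / h = (LBINT s:{0<..<h}. A s) / h - c"
        using h by (simp add: field_simps)
      ultimately show ?thesis using e by auto
    qed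
    then show ?thesis using d(1) by (auto simp: eventually_at_right_field)
  qed
  then show ?thesis by (auto simp: tendsto_iff dist_real_def)
qed

text \<open>The sign \<open>k\<close> covers both directions in time: forward shifts occur with the
  time derivative of the value function, backward shifts with the flux. The uniform bound that
  \<open>average_tendsto\<close> asks for is translation invariance of the square norm.\<close>

lemma steklov_pairing_tendsto:
  fixes f g :: "real \<times> real \<Rightarrow> real"
  assumes [measurable]: "f \<in> borel_measurable borel" "g \<in> borel_measurable borel"
    and g: "integrable lborel (\<lambda>z. (g z)\<^sup>2)" and f: "integrable lborel (\<lambda>z. (f z)\<^sup>2)"
    and k: "\<bar>k\<bar> = 1"
  shows "((\<lambda>h. (LBINT s:{0<..<h}. \<integral>z. g z * f (fst z + k * s, snd z) \<partial>lborel) / h)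
    \<longlongrightarrow> (\<integral>z. g z * f z \<partial>lborel)) (at_right 0)"
proof (rule average_tendsto)
  have eq: "(fst z + k * s, snd z) = (k * s, 0) + z" for s :: real and z :: "real \<times> real" by (cases z) auto
  let ?A = "\<lambda>s. \<integral>z. g z * f (fst z + k * s, snd z) \<partial>lborel"
  have [measurable]: "(\<lambda>(s, z). g z * f (fst z + k * s, snd z)) \<in> borel_measurable (borel \<Otimes>\<^sub>M borel)"
  proof -
    have [measurable]: "g \<in> borel_measurable (borel \<Otimes>\<^sub>M borel)" "f \<in> borel_measurable (borel \<Otimes>\<^sub>M borel)"
      by (simp_all add: borel_prod)
    show ?thesis unfolding split_beta' borel_prod[symmetric] by measurable
  qed
  show "?A \<in> borel_measurable borel" by measurable
  have fs: "integrable lborel (\<lambda>z. (f (s + z))\<^sup>2)" for s by (rule integrable_translate[OF f])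
  show "\<bar>?A s\<bar> \<le> (\<integral>z. (g z)\<^sup>2 \<partial>lborel) + (\<integral>z. (f z)\<^sup>2 \<partial>lborel)" for s
  proof -
    let ?s = "(k * s, 0) :: real \<times> real"
    have i: "integrable lborel (\<lambda>z. g z * f (?s + z))" by (rule integrable_mult_L2) (use g fs in auto)
    have "\<bar>?A s\<bar> \<le> (\<integral>z. \<bar>g z * f (?s + z)\<bar> \<partial>lborel)" unfolding eq by (rule integral_abs_bound)
    also have "\<dots> \<le> (\<integral>z. (g z)\<^sup>2 + (f (?s + z))\<^sup>2 \<partial>lborel)"
    proof (rule integral_mono)
      show "integrable lborel (\<lambda>z. \<bar>g z * f (?s + z)\<bar>)" using i by simp
      show "integrable lborel (\<lambda>z. (g z)\<^sup>2 + (f (?s + z))\<^sup>2)" using g fs by simp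
      fix z
      have "2 * \<bar>g z\<bar> * \<bar>f (?s + z)\<bar> \<le> (g z)\<^sup>2 + (f (?s + z))\<^sup>2"
        using sum_squares_bound[of "\<bar>g z\<bar>" "\<bar>f (?s + z)\<bar>"] by simp
      moreover have "0 \<le> \<bar>g z\<bar> * \<bar>f (?s + z)\<bar>" by simp
      ultimately show "\<bar>g z * f (?s + z)\<bar> \<le> (g z)\<^sup>2 + (f (?s + z))\<^sup>2" unfolding abs_mult by linarith
    qed
    also have "\<dots> = (\<integral>z. (g z)\<^sup>2 \<partial>lborel) + (\<integral>z. (f (?s + z))\<^sup>2 \<partial>lborel)" using g fs by simp
    also have "(\<integral>z. (f (?s + z))\<^sup>2 \<partial>lborel) = (\<integral>z. (f z)\<^sup>2 \<partial>lborel)"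
      by (rule integral_translate[of "\<lambda>z. (f z)\<^sup>2"]) simp
    finally show ?thesis .
  qed
  have "((\<lambda>s. (k * s, 0 :: real)) \<longlongrightarrow> (k * 0, 0)) (at 0)" by (intro tendsto_intros)
  moreover have "\<forall>\<^sub>F s in at 0. (k * s, 0 :: real) \<noteq> 0"
    using k by (auto simp: eventually_at_filter zero_prod_def)
  ultimately have "filterlim (\<lambda>s. (k * s, 0 :: real)) (at 0) (at 0)"
    by (auto simp: filterlim_at zero_prod_def)
  then show "(?A \<longlongrightarrow> (\<integral>z. g z * f z \<partial>lborel)) (at 0)"
    unfolding eq by (rule filterlim_compose[OF translation_continuous_pairing[OF assms(1,2) g f]])
qed

section \<open>Smooth functions of compact support\<close>

text \<open>The factor \<open>(1 / x) ^ k\<close> makes the linear span of the family closed under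
  differentiation; \<open>k = 0\<close> is the classical flat function
  \<open>exp (- (1 / x))\<close>.\<close>

definition flat_exp :: "nat \<Rightarrow> real \<Rightarrow> real" where
  "flat_exp k x = (if x > 0 then (1 / x) ^ k * exp (- (1 / x)) else 0)"

lemma flat_exp_tendsto_0: "(flat_exp k \<longlongrightarrow> 0) (at_right 0)"
proof -
  have "((\<lambda>x::real. x ^ k / exp x) \<longlongrightarrow> 0) at_top" by (rule tendsto_power_div_exp_0)
  moreover have "filterlim (\<lambda>x::real. 1 / x) at_top (at_right 0)"
    using filterlim_inverse_at_top_right by (simp add: inverse_eq_divide)
  ultimately have "((\<lambda>x::real. (1 / x) ^ k / exp (1 / x)) \<longlongrightarrow> 0) (at_right 0)"
    by (rule filterlim_compose)
  then show ?thesis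
    by (rule tendsto_cong[THEN iffD1, rotated])
      (auto simp: eventually_at_filter flat_exp_def exp_minus divide_inverse)
qed

text \<open>At 0 the right difference quotient of \<open>flat_exp k\<close> is
  \<open>flat_exp (Suc k)\<close>, which tends to 0; away from 0 only one branch of the definition
  is active.\<close>

lemma flat_exp_deriv:
  "(flat_exp k has_real_derivative - real k * flat_exp (Suc k) x + flat_exp (Suc (Suc k)) x) (at x)"
proof -
  consider "x > 0" | "x < 0" | "x = 0" by linarith
  then show ?thesis
  proof cases
    case 1
    have "((\<lambda>x. (1 / x) ^ k * exp (- (1 / x))) has_real_derivative
      - real k * flat_exp (Suc k) x + flat_exp (Suc (Suc k)) x) (at x)"
    proof -
      have d: "((\<lambda>x. 1 / x) has_real_derivative - ((1 / x)\<^sup>2)) (at x)"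
        using 1 by (auto intro!: derivative_eq_intros simp: power2_eq_square)
      have "((\<lambda>x. (1 / x) ^ k * exp (- (1 / x))) has_real_derivative
        real k * (1 / x) ^ (k - 1) * - ((1 / x)\<^sup>2) * exp (- (1 / x)) + (1 / x) ^ k * (exp (- (1 / x)) * (1 / x)\<^sup>2)) (at x)"
        by (rule derivative_eq_intros d refl)+ (simp del: power_divide power_one_over)
      also have "real k * (1 / x) ^ (k - 1) * - ((1 / x)\<^sup>2) * exp (- (1 / x)) + (1 / x) ^ k * (exp (- (1 / x)) * (1 / x)\<^sup>2)
        = - real k * flat_exp (Suc k) x + flat_exp (Suc (Suc k)) x"
      proof -
        have "real k * y ^ (k - 1) * - (y\<^sup>2) * e + y ^ k * (e * y\<^sup>2) = - real k * (y ^ Suc k * e) + y ^ Suc (Suc k) * e" for y e :: real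
          by (cases k) (auto simp: power2_eq_square algebra_simps)
        then show ?thesis using 1 by (simp only: flat_exp_def if_True)
      qed
      finally show ?thesis .
    qed
    then show ?thesis
      by (rule DERIV_cong_ev[THEN iffD1, rotated 3])
        (use 1 in \<open>auto simp: flat_exp_def intro!: eventually_mono[OF eventually_gt_at_top]
          eventually_nhds_in_open[of "{0<..}" x, THEN eventually_mono]\<close>)
  next
    case 2
    have "((\<lambda>x. 0) has_real_derivative - real k * flat_exp (Suc k) x + flat_exp (Suc (Suc k)) x) (at x)"
      using 2 by (simp add: flat_exp_def)
    then show ?thesis
      by (rule DERIV_cong_ev[THEN iffD1, rotated 3])
        (use 2 in \<open>auto simp: flat_exp_def
          intro!: eventually_nhds_in_open[of "{..<0}" x, THEN eventually_mono]\<close>)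
  next
    case 3
    have "((\<lambda>h. (flat_exp k (0 + h) - flat_exp k 0) / h) \<longlongrightarrow> 0) (at_right 0)"
      by (rule tendsto_cong[THEN iffD1, OF _ flat_exp_tendsto_0[of "Suc k"]])
        (auto simp: eventually_at_filter flat_exp_def)
    moreover have "((\<lambda>h. (flat_exp k (0 + h) - flat_exp k 0) / h) \<longlongrightarrow> 0) (at_left 0)"
      by (rule tendsto_eventually) (auto simp: eventually_at_filter flat_exp_def)
    ultimately show ?thesis using 3
      by (simp add: DERIV_def filterlim_split_at flat_exp_def)
  qed
qed

text \<open>Products of two flat functions of affine arguments; with slopes of opposite sign these
  are the standard bumps. Sums are needed because the derivative of one product already has four
  terms of this kind.\<close>

inductive bump_class :: "(real \<Rightarrow> real) \<Rightarrow> bool" where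
  base: "bump_class (\<lambda>x. c * (flat_exp k (a * x + b) * flat_exp l (a' * x + b')))"
| add: "bump_class f \<Longrightarrow> bump_class g \<Longrightarrow> bump_class (\<lambda>x. f x + g x)"

definition smooth1 :: "(real \<Rightarrow> real) \<Rightarrow> bool" where
  "smooth1 f \<longleftrightarrow> (\<exists>D. D 0 = f \<and> (\<forall>n x. (D n has_real_derivative D (Suc n) x) (at x)))"

lemma bump_class_deriv: "bump_class f \<Longrightarrow> \<exists>f'. bump_class f' \<and> (\<forall>x. (f has_real_derivative f' x) (at x))"
proof (induction rule: bump_class.induct)
  case (base c k a b l a' b')
  let ?f' = "\<lambda>x. (- c * a * k * (flat_exp (Suc k) (a * x + b) * flat_exp l (a' * x + b'))
     + c * a * (flat_exp (Suc (Suc k)) (a * x + b) * flat_exp l (a' * x + b')))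
     + (- c * a' * l * (flat_exp k (a * x + b) * flat_exp (Suc l) (a' * x + b'))
     + c * a' * (flat_exp k (a * x + b) * flat_exp (Suc (Suc l)) (a' * x + b')))"
  have "bump_class ?f'" by (intro bump_class.intros)
  moreover have "((\<lambda>x. c * (flat_exp k (a * x + b) * flat_exp l (a' * x + b'))) has_real_derivative ?f' x) (at x)" for x
  proof -
    have 1: "((\<lambda>x. flat_exp k (a * x + b)) has_real_derivative
      (- real k * flat_exp (Suc k) (a * x + b) + flat_exp (Suc (Suc k)) (a * x + b)) * a) (at x)" for k a b
      by (rule DERIV_chain2[OF flat_exp_deriv]) (auto intro!: derivative_eq_intros)
    show ?thesis
      by (rule derivative_eq_intros 1 refl)+ (simp add: algebra_simps)
  qed
  ultimately show ?case by blast
next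
  case (add f g)
  then obtain f' g' where "bump_class f'" "\<And>x. (f has_real_derivative f' x) (at x)"
    "bump_class g'" "\<And>x. (g has_real_derivative g' x) (at x)" by blast
  then show ?case by (intro exI[of _ "\<lambda>x. f' x + g' x"]) (auto intro: bump_class.add DERIV_add)
qed

lemma bump_class_smooth1: assumes "bump_class f" shows "smooth1 f"
proof -
  define D where "D = rec_nat f (\<lambda>_ g. SOME g'. bump_class g' \<and> (\<forall>x. (g has_real_derivative g' x) (at x)))"
  have D: "D 0 = f" "D (Suc n) = (SOME g'. bump_class g' \<and> (\<forall>x. (D n has_real_derivative g' x) (at x)))" for n
    by (simp_all add: D_def)
  have b: "bump_class (D n)" for n
  proof (induction n)
    case (Suc n)
    show ?case unfolding D(2) using someI_ex[OF bump_class_deriv[OF Suc]] by blast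
  qed (simp add: D assms)
  have "(D n has_real_derivative D (Suc n) x) (at x)" for n x
    unfolding D(2) using someI_ex[OF bump_class_deriv[OF b[of n]]] by blast
  then show ?thesis unfolding smooth1_def using D(1) by blast
qed

lemma smooth1_integrate:
  assumes "smooth1 f" "\<And>x. (g has_real_derivative f x) (at x)"
  shows "smooth1 g"
proof -
  obtain D where D: "D 0 = f" "\<And>n x. (D n has_real_derivative D (Suc n) x) (at x)"
    using assms(1) by (auto simp: smooth1_def)
  have "((case_nat g D n) has_real_derivative (case_nat g D (Suc n)) x) (at x)" for n x
    using D assms(2) by (cases n) auto
  then show ?thesis unfolding smooth1_def by (intro exI[of _ "case_nat g D"]) auto
qed

lemma smooth1_linear:
  assumes "smooth1 f" "smooth1 g"
  shows "smooth1 (\<lambda>x. f x - c * g x)"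
proof -
  obtain D where D: "D 0 = f" "\<And>n x. (D n has_real_derivative D (Suc n) x) (at x)"
    using assms(1) by (auto simp: smooth1_def)
  obtain E where E: "E 0 = g" "\<And>n x. (E n has_real_derivative E (Suc n) x) (at x)"
    using assms(2) by (auto simp: smooth1_def)
  show ?thesis unfolding smooth1_def
    by (rule exI[of _ "\<lambda>n x. D n x - c * E n x"])
      (auto simp: D(1) E(1) intro!: derivative_eq_intros D(2) E(2))
qed

text \<open>The support is recorded by a closed interval inside \<open>I\<close>. It may be empty,
  with \<open>a > b\<close>, so the zero function qualifies for every \<open>I\<close>.\<close>

definition bump_on :: "real set \<Rightarrow> (real \<Rightarrow> real) \<Rightarrow> bool" where
  "bump_on I f \<longleftrightarrow> smooth1 f \<and> (\<exists>a b. {a..b} \<subseteq> I \<and> (\<forall>x. x \<notin> {a..b} \<longrightarrow> f x = 0))"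

lemma bump_on_mono: "bump_on I f \<Longrightarrow> I \<subseteq> J \<Longrightarrow> bump_on J f"
  unfolding bump_on_def by blast

lemma bump_on_deriv:
  assumes "bump_on I f"
  shows "(f has_real_derivative deriv f x) (at x)" "bump_on I (deriv f)"
proof -
  obtain D a b where D: "D 0 = f" "\<And>n x. (D n has_real_derivative D (Suc n) x) (at x)"
    and ab: "{a..b} \<subseteq> I" "\<And>x. x \<notin> {a..b} \<Longrightarrow> f x = 0"
    using assms by (auto simp: bump_on_def smooth1_def)
  have df: "deriv f = D (Suc 0)" using D(1) D(2)[of 0] by (auto intro!: ext DERIV_imp_deriv)
  show 1: "(f has_real_derivative deriv f x) (at x)" for x using D(2)[of 0 x] by (simp add: df D(1))
  have "smooth1 (deriv f)" unfolding smooth1_def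
    by (rule exI[of _ "\<lambda>n. D (Suc n)"]) (use D(2) in \<open>auto simp: df\<close>)
  moreover have "deriv f x = 0" if "x \<notin> {a..b}" for x
  proof -
    have "((\<lambda>_. 0) has_real_derivative 0) (at x)" by simp
    moreover have "\<forall>\<^sub>F y in nhds x. y \<in> - {a..b}"
      using that by (intro eventually_nhds_in_open) (auto intro: open_Compl)
    then have "\<forall>\<^sub>F y in nhds x. f y = 0" by eventually_elim (simp add: ab(2))
    ultimately have "(f has_real_derivative 0) (at x)"
      by (subst DERIV_cong_ev[OF refl _ refl])
    then show ?thesis by (rule DERIV_imp_deriv)
  qed
  ultimately show "bump_on I (deriv f)" unfolding bump_on_def using ab(1) by blast
qed

lemma bump_on_continuous: "bump_on I f \<Longrightarrow> continuous_on A f"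
  by (intro continuous_at_imp_continuous_on ballI DERIV_isCont[OF bump_on_deriv(1)])

lemma bump_on_measurable [measurable_dest]: "bump_on I f \<Longrightarrow> f \<in> borel_measurable borel"
  by (intro borel_measurable_continuous_onI bump_on_continuous)

lemma bump_on_bounded:
  assumes "bump_on I f"
  obtains B where "B \<ge> 0" "\<And>x. \<bar>f x\<bar> \<le> B"
proof -
  obtain a b where ab: "\<And>x. x \<notin> {a..b} \<Longrightarrow> f x = 0" using assms by (auto simp: bump_on_def)
  have "bounded (f ` {a..b})"
    by (intro compact_imp_bounded compact_continuous_image bump_on_continuous[OF assms]) auto
  then obtain B where B: "\<forall>x\<in>{a..b}. \<bar>f x\<bar> \<le> B" by (auto simp: bounded_iff)
  show ?thesis
  proof (rule that[of "max B 0"])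
    show "\<bar>f x\<bar> \<le> max B 0" for x using B ab[of x] by (cases "x \<in> {a..b}") fastforce+
  qed simp
qed

lemma bump_on_integrable: assumes "bump_on I f" shows "integrable lborel f"
proof -
  obtain a b where ab: "\<And>x. x \<notin> {a..b} \<Longrightarrow> f x = 0" using assms by (auto simp: bump_on_def)
  have "integrable lborel (\<lambda>x. indicator {a..b} x *\<^sub>R f x)"
    using borel_integrable_compact[of "{a..b}" f] bump_on_continuous[OF assms]
    by (simp add: if_distrib indicator_def cong: if_cong)
  moreover have "(\<lambda>x. indicator {a..b} x *\<^sub>R f x) = f"
  proof
    show "indicator {a..b} x *\<^sub>R f x = f x" for x using ab[of x] by (cases "x \<in> {a..b}") auto
  qed
  ultimately show ?thesis by simp
qed

lemma bump_on_FTC: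
  assumes "bump_on I f"
  shows "(LBINT y:{..<x}. deriv f y) = f x" "(LBINT y:{x<..}. deriv f y) = - f x"
proof -
  obtain a b where ab: "\<And>x. x \<notin> {a..b} \<Longrightarrow> f x = 0" and ab': "\<And>x. x \<notin> {a..b} \<Longrightarrow> deriv f x = 0"
  proof -
    obtain a b where 1: "\<And>x. x \<notin> {a..b} \<Longrightarrow> f x = 0" using assms unfolding bump_on_def by blast
    obtain a' b' where 2: "\<And>x. x \<notin> {a'..b'} \<Longrightarrow> deriv f x = 0"
      using bump_on_deriv(2)[OF assms] unfolding bump_on_def by blast
    show ?thesis by (rule that[of "min a a'" "max b b'"]; rule 1 2; auto)
  qed
  have FTC: "(\<integral>x. deriv f x * indicator {l..u} x \<partial>lborel) = f u - f l" if "l \<le> u" for l u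
    using that bump_on_deriv(1)[OF assms] bump_on_continuous[OF bump_on_deriv(2)[OF assms], of UNIV]
    by (intro integral_FTC_Icc_real) (auto simp: continuous_on_eq_continuous_at)
  have "(LBINT y:{..<x}. deriv f y) = (\<integral>y. deriv f y * indicator {min x a - 1..x} y \<partial>lborel)"
    unfolding set_lebesgue_integral_def
  proof (rule integral_cong_AE)
    have "indicator {..<x} y *\<^sub>R deriv f y = deriv f y * indicator {min x a - 1..x} y" if "y \<noteq> x" for y
      using that ab'[of y] by (cases "y \<in> {a..b}") (auto simp: indicator_def)
    then show "AE y in lborel. indicator {..<x} y *\<^sub>R deriv f y = deriv f y * indicator {min x a - 1..x} y"
      by (intro AE_I[where N="{x}"]) auto
  qed (use bump_on_deriv(2)[OF assms] in measurable)
  also have "\<dots> = f x" 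
  proof -
    have "f (min x a - 1) = 0" by (rule ab) auto
    then show ?thesis using FTC[of "min x a - 1" x] by simp
  qed
  finally show "(LBINT y:{..<x}. deriv f y) = f x" .
  have "(LBINT y:{x<..}. deriv f y) = (\<integral>y. deriv f y * indicator {x..max x b + 1} y \<partial>lborel)"
    unfolding set_lebesgue_integral_def
  proof (rule integral_cong_AE)
    have "indicator {x<..} y *\<^sub>R deriv f y = deriv f y * indicator {x..max x b + 1} y" if "y \<noteq> x" for y
      using that ab'[of y] by (cases "y \<in> {a..b}") (auto simp: indicator_def)
    then show "AE y in lborel. indicator {x<..} y *\<^sub>R deriv f y = deriv f y * indicator {x..max x b + 1} y"
      by (intro AE_I[where N="{x}"]) auto
  qed (use bump_on_deriv(2)[OF assms] in measurable)
  also have "\<dots> = - f x" 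
  proof -
    have "f (max x b + 1) = 0" by (rule ab) auto
    then show ?thesis using FTC[of x "max x b + 1"] by simp
  qed
  finally show "(LBINT y:{x<..}. deriv f y) = - f x" .
qed

text \<open>The vanishing mean lets the antiderivative return to 0 beyond the support. This is what
  the du Bois-Reymond arguments below rest on.\<close>

lemma bump_on_primitive:
  assumes "bump_on I f" "(\<integral>x. f x \<partial>lborel) = 0" "is_interval I"
  obtains F where "bump_on I F" "deriv F = f"
proof -
  obtain a b where ab0: "{a..b} \<subseteq> I" "\<And>x. x \<notin> {a..b} \<Longrightarrow> f x = 0" using assms(1) by (auto simp: bump_on_def)
  show ?thesis
  proof (cases "a \<le> b")
    case False
    then have "f = (\<lambda>_. 0)" using ab0(2) by auto
    then show ?thesis using that[of f] assms(1) by simp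
  next
    case True
    \<comment> \<open>One of the two intervals is empty or a single point, so this is the oriented
      integral from \<open>a\<close> to \<open>x\<close>.\<close>
    define F where "F x = integral {a..x} f - integral {x..a} f" for x
    have io: "f integrable_on {l..u}" for l u
      by (intro integrable_continuous_interval bump_on_continuous[OF assms(1)])
    \<comment> \<open>A base point \<open>c\<close> to the left of both \<open>a\<close> and
      \<open>x\<close> turns the oriented integral into an ordinary one, to which the fundamental
      theorem applies near \<open>x\<close>.\<close>
    have FF: "F x = integral {c..x} f - integral {c..a} f" if "c \<le> a" "c \<le> x" for c x
    proof (cases "a \<le> x")
      case True
      then show ?thesis using Henstock_Kurzweil_Integration.integral_combine[of c a x f] that io
        by (cases "x = a") (auto simp: F_def)
    next
      case False
      then show ?thesis using Henstock_Kurzweil_Integration.integral_combine[of c x a f] that io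
        by (auto simp: F_def)
    qed
    have dF: "(F has_real_derivative f x) (at x)" for x
    proof -
      define c where "c = min a (x - 1)"
      have "((\<lambda>u. integral {c..u} f) has_real_derivative f x) (at x within {c..x+1})"
        by (rule integral_has_real_derivative) (auto simp: c_def intro: bump_on_continuous[OF assms(1)])
      then have "((\<lambda>u. integral {c..u} f) has_real_derivative f x) (at x)"
        by (subst (asm) at_within_Icc_at) (auto simp: c_def)
      then have "((\<lambda>u. integral {c..u} f - integral {c..a} f) has_real_derivative f x) (at x)"
        by (auto intro!: derivative_eq_intros)
      moreover have "\<forall>\<^sub>F u in nhds x. u \<in> {c<..}"
        by (rule eventually_nhds_in_open) (auto simp: c_def)
      then have "\<forall>\<^sub>F u in nhds x. integral {c..u} f - integral {c..a} f = F u"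
        by eventually_elim (rule FF[symmetric], auto simp: c_def)
      ultimately show ?thesis by (subst DERIV_cong_ev[OF refl _ refl, symmetric])
    qed
    have "smooth1 F" by (rule smooth1_integrate[OF _ dF]) (use assms(1) in \<open>simp add: bump_on_def\<close>)
    moreover have "F x = 0" if "x \<notin> {a..b}" for x
    proof (cases "x < a")
      case True
      have "integral {x..a} f = integral {x..a} (\<lambda>_. 0)"
        by (rule integral_spike[of "{a}"]) (use ab0(2) in auto)
      then show ?thesis using True by (simp add: F_def)
    next
      case False
      then have x: "x > b" using that by auto
      have "(\<integral>x. f x \<partial>lborel) = (LINT y:{a..x}|lborel. f y)"
        unfolding set_lebesgue_integral_def
      proof (rule Bochner_Integration.integral_cong[OF refl])
        show "f y = indicator {a..x} y *\<^sub>R f y" for y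
          using ab0(2)[of y] x by (cases "y \<in> {a..b}") (auto simp: indicator_def)
      qed
      also have "\<dots> = integral {a..x} f"
        by (rule set_borel_integral_eq_integral(2), unfold set_integrable_def)
          (auto intro!: integrable_mult_bounded[where B=1] bump_on_integrable[OF assms(1)] simp: indicator_def)
      finally show ?thesis using assms(2) x True by (simp add: F_def)
    qed
    ultimately have "bump_on I F" unfolding bump_on_def using ab0(1) by blast
    moreover have "deriv F = f" using dF by (auto intro!: ext DERIV_imp_deriv)
    ultimately show ?thesis by (rule that)
  qed
qed

lemma bump_approx_indicator:
  fixes c d :: real
  obtains \<theta> where "\<And>n. bump_on {c<..<d} (\<theta> n)" "\<And>n x. 0 \<le> \<theta> n x \<and> \<theta> n x \<le> 1"
    "\<And>x. (\<lambda>n. \<theta> n x) \<longlonglongrightarrow> indicator {c<..<d} x"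
proof -
  \<comment> \<open>The shift by \<open>-1\<close> places the support in
    \<open>[c + 1/n, d - 1/n]\<close>, a closed part of the open interval; inside, both arguments
    tend to infinity and both factors to 1.\<close>
  define \<theta> where "\<theta> n x = 1 * (flat_exp 0 (real n * x + (- real n * c - 1)) * flat_exp 0 (- real n * x + (real n * d - 1)))" for n x
  have z: "\<theta> n x = 0" if "x \<notin> {c + 1 / real n..d - 1 / real n}" for n x
  proof (cases "n = 0")
    case False
    then show ?thesis using that unfolding \<theta>_def flat_exp_def
      by (auto simp: field_simps)
  qed (simp add: \<theta>_def flat_exp_def)
  have b: "bump_on {c<..<d} (\<theta> n)" for n
  proof -
    have "smooth1 (\<theta> n)" unfolding \<theta>_def by (intro bump_class_smooth1 bump_class.base)
    moreover have "\<exists>a b. {a..b} \<subseteq> {c<..<d} \<and> (\<forall>x. x \<notin> {a..b} \<longrightarrow> \<theta> n x = 0)"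
    proof (cases "n = 0")
      case True
      have "\<theta> n x = 0" for x using True by (simp add: \<theta>_def flat_exp_def)
      then show ?thesis by (intro exI[of _ 1] exI[of _ 0]) auto
    next
      case False
      then have p: "0 < 1 / real n" by simp
      have "{c + 1 / real n..d - 1 / real n} \<subseteq> {c<..<d}"
      proof
        fix x assume "x \<in> {c + 1 / real n..d - 1 / real n}"
        then have "c + 1 / real n \<le> x" "x \<le> d - 1 / real n" by auto
        with p have "c < x" "x < d" by linarith+
        then show "x \<in> {c<..<d}" by simp
      qed
      then show ?thesis using z by blast
    qed
    ultimately show ?thesis by (simp add: bump_on_def)
  qed
  have f01: "0 \<le> flat_exp 0 y \<and> flat_exp 0 y \<le> 1" for y by (simp add: flat_exp_def)
  have f1: "((\<lambda>y. flat_exp 0 y) \<longlongrightarrow> 1) at_top"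
  proof -
    have "((\<lambda>y::real. exp (- (1 / y))) \<longlongrightarrow> exp (- 0)) at_top"
      by (intro tendsto_intros tendsto_divide_0[OF tendsto_const filterlim_at_top_imp_at_infinity] filterlim_ident)
    moreover have "\<forall>\<^sub>F y in at_top. exp (- (1 / y)) = flat_exp 0 y"
      using eventually_gt_at_top[of 0] by eventually_elim (simp add: flat_exp_def)
    ultimately show ?thesis using tendsto_cong by fastforce
  qed
  have "(\<lambda>n. \<theta> n x) \<longlonglongrightarrow> indicator {c<..<d} x" for x
  proof (cases "x \<in> {c<..<d}")
    case True
    have lim: "filterlim (\<lambda>n. real n * e + (- 1)) at_top sequentially" if "e > 0" for e
    proof -
      have "filterlim (\<lambda>n. e * real n) at_top sequentially"
        by (rule filterlim_tendsto_pos_mult_at_top[OF tendsto_const that filterlim_real_sequentially])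
      then have "filterlim (\<lambda>n. (- 1) + e * real n) at_top sequentially"
        by (rule filterlim_tendsto_add_at_top[OF tendsto_const])
      then show ?thesis by (simp add: ac_simps)
    qed
    have eq: "real n * x + (- real n * c - 1) = real n * (x - c) + (- 1)"
      "- real n * x + (real n * d - 1) = real n * (d - x) + (- 1)" for n by (simp_all add: algebra_simps)
    have "(\<lambda>n. \<theta> n x) \<longlonglongrightarrow> 1 * (1 * 1)" unfolding \<theta>_def eq
      by (intro tendsto_intros filterlim_compose[OF f1] lim) (use True in auto)
    then show ?thesis using True by simp
  next
    case False
    then have "\<theta> n x = 0" for n using b[of n] unfolding bump_on_def by blast
    then show ?thesis using False by simp
  qed
  moreover have "0 \<le> \<theta> n x \<and> \<theta> n x \<le> 1" for n x
    unfolding \<theta>_def using f01 by (auto intro!: mult_nonneg_nonneg mult_le_one)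
  ultimately show ?thesis using that b by blast
qed

lemma bump_unit_integral:
  fixes c d :: real
  assumes "c < d"
  obtains \<eta> where "bump_on {c<..<d} \<eta>" "(\<integral>x. \<eta> x \<partial>lborel) = 1"
proof -
  obtain \<theta> where \<theta>: "\<And>n. bump_on {c<..<d} (\<theta> n)" "\<And>n x. 0 \<le> \<theta> n x \<and> \<theta> n x \<le> 1"
    "\<And>x. (\<lambda>n. \<theta> n x) \<longlonglongrightarrow> indicator {c<..<d} x" using bump_approx_indicator[of c d] by blast
  have z: "\<theta> n x = 0" if "x \<notin> {c<..<d}" for n x
    using \<theta>(1)[of n] that unfolding bump_on_def by blast
  have "(\<lambda>n. \<integral>x. \<theta> n x \<partial>lborel) \<longlonglongrightarrow> (\<integral>x. indicator {c<..<d} x \<partial>lborel)"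
  proof (rule integral_dominated_convergence[where w="indicator {c<..<d}"])
    show "AE x in lborel. norm (\<theta> i x) \<le> indicator {c<..<d} x" for i
      using \<theta>(2)[of i] z[of _ i] by (intro AE_I2) (auto simp: indicator_def)
    show "integrable lborel (indicator {c<..<d} :: real \<Rightarrow> real)"
      using assms by (intro integrable_real_indicator) auto
  qed (use \<theta> in \<open>auto intro: bump_on_measurable\<close>)
  then have "(\<lambda>n. \<integral>x. \<theta> n x \<partial>lborel) \<longlonglongrightarrow> d - c" using assms by simp
  then have "\<forall>\<^sub>F n in sequentially. (\<integral>x. \<theta> n x \<partial>lborel) > 0"
    using assms by (intro order_tendstoD(1)) auto
  then obtain n where n: "(\<integral>x. \<theta> n x \<partial>lborel) > 0" by (auto simp: eventually_sequentially)
  let ?k = "(\<integral>x. \<theta> n x \<partial>lborel)"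
  \<comment> \<open>This is \<open>\<theta> n / ?k\<close>, written as a difference so that
    \<open>smooth1_linear\<close> applies.\<close>
  define \<eta> where "\<eta> = (\<lambda>x. \<theta> n x - (1 - 1 / ?k) * \<theta> n x)"
  have "smooth1 \<eta>" unfolding \<eta>_def by (rule smooth1_linear) (use \<theta>(1)[of n] in \<open>auto simp: bump_on_def\<close>)
  then have "bump_on {c<..<d} \<eta>" using \<theta>(1)[of n] by (auto simp: bump_on_def \<eta>_def)
  moreover have "(\<integral>x. \<eta> x \<partial>lborel) = 1"
  proof -
    have "\<eta> = (\<lambda>x. \<theta> n x / ?k)" using n by (auto simp: \<eta>_def field_simps)
    then show ?thesis using n by simp
  qed
  ultimately show ?thesis by (rule that)
qed

lemma bump_on_linear:
  assumes "bump_on I f" "bump_on I g" "is_interval I"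
  shows "bump_on I (\<lambda>x. f x - c * g x)"
proof -
  obtain a b where ab1: "{a..b} \<subseteq> I" "\<And>x. x \<notin> {a..b} \<Longrightarrow> f x = 0"
    using assms(1) unfolding bump_on_def by blast
  obtain a' b' where ab2: "{a'..b'} \<subseteq> I" "\<And>x. x \<notin> {a'..b'} \<Longrightarrow> g x = 0"
    using assms(2) unfolding bump_on_def by blast
  note ab = ab1 ab2
  have "smooth1 (\<lambda>x. f x - c * g x)" using assms by (auto simp: bump_on_def intro: smooth1_linear)
  moreover have "\<exists>l u. {l..u} \<subseteq> I \<and> (\<forall>x. x \<notin> {l..u} \<longrightarrow> f x - c * g x = 0)"
  \<comment> \<open>Two nonempty supports have their hull inside the interval \<open>I\<close>. An
    empty one belongs to the zero function, and its end points, which may lie outside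
    \<open>I\<close>, must not enter the hull.\<close>
  proof (cases "a \<le> b \<and> a' \<le> b'")
    case True
    have "{min a a'..max b b'} \<subseteq> I"
    proof
      fix x assume x: "x \<in> {min a a'..max b b'}"
      have "a \<in> I" "a' \<in> I" "b \<in> I" "b' \<in> I" using True ab(1,3) by auto
      then have "min a a' \<in> I" "max b b' \<in> I" by (auto simp: min_def max_def)
      moreover have "min a a' \<le> x" "x \<le> max b b'" using x by simp_all
      ultimately show "x \<in> I" using assms(3) unfolding is_interval_1 by blast
    qed
    moreover have "f x - c * g x = 0" if "x \<notin> {min a a'..max b b'}" for x
    proof -
      have "x \<notin> {a..b}" "x \<notin> {a'..b'}" using that by auto
      then show ?thesis by (simp add: ab)
    qed
    ultimately show ?thesis by blast
  next
    case False
    then consider "\<not> a \<le> b" | "\<not> a' \<le> b'" by blast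
    then show ?thesis
    proof cases
      case 1
      then have "f x = 0" for x using ab(2)[of x] by simp
      then show ?thesis using ab(3,4) by (intro exI[of _ a'] exI[of _ b'] conjI allI impI) simp_all
    next
      case 2
      then have "g x = 0" for x using ab(4)[of x] by simp
      then show ?thesis using ab(1,2) by (intro exI[of _ a] exI[of _ b] conjI allI impI) simp_all
    qed
  qed
  ultimately show ?thesis by (simp add: bump_on_def)
qed

lemma test_fun_product:
  assumes "bump_on I \<theta>" "bump_on J \<xi>" "I \<times> J \<subseteq> K"
  shows "test_fun K (\<lambda>z. \<theta> (fst z) * \<xi> (snd z))"
proof -
  let ?f = "\<lambda>z. \<theta> (fst z) * \<xi> (snd z)"
  obtain D a b where D: "D 0 = \<theta>" "\<And>n x. (D n has_real_derivative D (Suc n) x) (at x)"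
    and ab: "{a..b} \<subseteq> I" "\<And>x. x \<notin> {a..b} \<Longrightarrow> \<theta> x = 0"
    using assms(1) by (auto simp: bump_on_def smooth1_def)
  obtain E c d where E: "E 0 = \<xi>" "\<And>n x. (E n has_real_derivative E (Suc n) x) (at x)"
    and cd: "{c..d} \<subseteq> J" "\<And>x. x \<notin> {c..d} \<Longrightarrow> \<xi> x = 0"
    using assms(2) by (auto simp: bump_on_def smooth1_def)
  have cD: "continuous_on A (D n)" "continuous_on A (E n)" for n A
    using DERIV_isCont[OF D(2)] DERIV_isCont[OF E(2)] by (auto intro: continuous_at_imp_continuous_on)
  have sub: "supp2 ?f \<subseteq> {a..b} \<times> {c..d}" unfolding supp2_def
  proof (rule closure_minimal)
    show "{z. ?f z \<noteq> 0} \<subseteq> {a..b} \<times> {c..d}"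
    proof
      fix z assume "z \<in> {z. ?f z \<noteq> 0}"
      then have "fst z \<in> {a..b}" "snd z \<in> {c..d}" using ab(2)[of "fst z"] cd(2)[of "snd z"] by force+
      then show "z \<in> {a..b} \<times> {c..d}" by (simp add: mem_Times_iff)
    qed
  qed (auto intro: closed_Times)
  have "compact (supp2 ?f)"
    using closed_Int_compact[of "supp2 ?f" "{a..b} \<times> {c..d}"] sub
    by (simp add: compact_Times Int_absorb2 supp2_def)
  moreover have "smooth2 ?f" unfolding smooth2_def Ck2_on_def
  \<comment> \<open>A mixed derivative of a product depends only on how often each variable occurs,
    so the list \<open>ds\<close> enters through its numbers of \<open>True\<close> and
    \<open>False\<close>.\<close>
  proof (intro allI exI[of _ "\<lambda>ds z. D (length (filter id ds)) (fst z) * E (length (filter Not ds)) (snd z)"] conjI ballI impI)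
    fix ds :: "bool list" and t x :: real
    let ?n = "length (filter id ds)" and ?m = "length (filter Not ds)"
    show "((\<lambda>s. D ?n (fst (s, x)) * E ?m (snd (s, x))) has_real_derivative
        D (length (filter id (True # ds))) (fst (t, x)) * E (length (filter Not (True # ds))) (snd (t, x)))
        (at t within {s. (s, x) \<in> UNIV})"
      using D(2)[of ?n t] by (auto intro!: derivative_eq_intros)
    show "((\<lambda>y. D ?n (fst (t, y)) * E ?m (snd (t, y))) has_real_derivative
        D (length (filter id (False # ds))) (fst (t, x)) * E (length (filter Not (False # ds))) (snd (t, x)))
        (at x within {y. (t, y) \<in> UNIV})"
      using E(2)[of ?m x] by (auto intro!: derivative_eq_intros)
    show "continuous_on UNIV (\<lambda>z. D ?n (fst z) * E ?m (snd z))"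
      by (intro continuous_intros continuous_on_compose2[OF cD(1)] continuous_on_compose2[OF cD(2)]) auto
  qed (auto simp: D(1) E(1))
  ultimately show ?thesis using sub ab(1) cd(1) assms(3) unfolding test_fun_def by blast
qed

lemma pdt_product:
  assumes "bump_on I \<theta>"
  shows "pdt (\<lambda>z. \<theta> (fst z) * \<xi> (snd z)) z = deriv \<theta> (fst z) * \<xi> (snd z)"
  unfolding pdt_def
  by (rule DERIV_imp_deriv) (simp add: DERIV_cmult_right[OF bump_on_deriv(1)[OF assms]])

lemma pdx_product:
  assumes "bump_on I \<xi>"
  shows "pdx (\<lambda>z. \<theta> (fst z) * \<xi> (snd z)) z = \<theta> (fst z) * deriv \<xi> (snd z)"
  unfolding pdx_def
  by (rule DERIV_imp_deriv) (simp add: DERIV_cmult[OF bump_on_deriv(1)[OF assms]])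

section \<open>Weak derivatives in a rectangle\<close>

lemma sets_borel_pair [measurable_cong]:
  "sets (borel :: (real \<times> real) measure) = sets (borel \<Otimes>\<^sub>M borel)"
  by (rule arg_cong[OF borel_prod[symmetric]])

text \<open>\<open>ennreal\<close> sends negative values to 0, so the two densities are the positive
  and the negative part of \<open>f\<close>. The measures agree on boxes, a generating class stable
  under intersection, hence everywhere, and so do their densities.\<close>

lemma AE_zero_if_box_integrals_zero:
  fixes f :: "'a::euclidean_space \<Rightarrow> real"
  assumes f: "integrable lborel f" and z: "\<And>a b. (\<integral>z. indicator (box a b) z * f z \<partial>lborel) = 0"
  shows "AE z in lborel. f z = 0"
proof -
  have [measurable]: "f \<in> borel_measurable borel" using f by (auto dest: borel_measurable_integrable)
  let ?M = "density lborel (\<lambda>z. ennreal (f z))" and ?N = "density lborel (\<lambda>z. ennreal (- f z))"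
  have *: "emeasure ?M (box a b) = emeasure ?N (box a b)" "emeasure ?M (box a b) \<noteq> \<infinity>" for a b
  proof -
    let ?g = "\<lambda>z. indicator (box a b) z * f z"
    have g: "integrable lborel ?g" by (rule integrable_mult_bounded[OF f, where B=1]) (auto simp: indicator_def)
    have e: "emeasure ?M (box a b) = (\<integral>\<^sup>+z. ennreal (?g z) \<partial>lborel)"
      "emeasure ?N (box a b) = (\<integral>\<^sup>+z. ennreal (- ?g z) \<partial>lborel)"
    proof -
      have "emeasure ?M (box a b) = (\<integral>\<^sup>+z. ennreal (f z) * indicator (box a b) z \<partial>lborel)"
        "emeasure ?N (box a b) = (\<integral>\<^sup>+z. ennreal (- f z) * indicator (box a b) z \<partial>lborel)"
        by (rule emeasure_density; measurable)+
      moreover have "ennreal (f z) * indicator (box a b) z = ennreal (?g z)"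
        "ennreal (- f z) * indicator (box a b) z = ennreal (- ?g z)" for z
        by (cases "z \<in> box a b"; simp)+
      ultimately show "emeasure ?M (box a b) = (\<integral>\<^sup>+z. ennreal (?g z) \<partial>lborel)"
        "emeasure ?N (box a b) = (\<integral>\<^sup>+z. ennreal (- ?g z) \<partial>lborel)" by (simp_all only:)
    qed
    have fin: "(\<integral>\<^sup>+z. ennreal (?g z) \<partial>lborel) \<noteq> \<infinity>" "(\<integral>\<^sup>+z. ennreal (- ?g z) \<partial>lborel) \<noteq> \<infinity>"
      using g unfolding real_integrable_def by auto
    have "enn2real (\<integral>\<^sup>+z. ennreal (?g z) \<partial>lborel) = enn2real (\<integral>\<^sup>+z. ennreal (- ?g z) \<partial>lborel)"
      using real_lebesgue_integral_def[OF g] z[of a b] by linarith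
    moreover have "x = y" if "enn2real x = enn2real y" "x \<noteq> \<infinity>" "y \<noteq> \<infinity>" for x y
      using that by (cases x; cases y) auto
    ultimately have "(\<integral>\<^sup>+z. ennreal (?g z) \<partial>lborel) = (\<integral>\<^sup>+z. ennreal (- ?g z) \<partial>lborel)"
      using fin by blast
    then show "emeasure ?M (box a b) = emeasure ?N (box a b)" "emeasure ?M (box a b) \<noteq> \<infinity>"
      using fin by (simp_all add: e)
  qed
  have "?M = ?N"
  proof (rule measure_eqI_generator_eq)
    let ?E = "range (\<lambda>(a, b). box a b :: 'a set)"
    show "Int_stable ?E" by (auto simp: Int_stable_def box_Int_box)
    show "emeasure ?M X = emeasure ?N X" if "X \<in> ?E" for X using that *(1) by auto
    have "sets (borel :: 'a measure) = sigma_sets UNIV ?E"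
      by (subst borel_eq_box) (rule sets_measure_of, simp)
    then show "sets ?M = sigma_sets UNIV ?E" "sets ?N = sigma_sets UNIV ?E"
      by simp_all
    show "range (\<lambda>n::nat. box (- (real n *\<^sub>R One)) (real n *\<^sub>R One) :: 'a set) \<subseteq> ?E" by auto
    show "(\<Union>n::nat. box (- (real n *\<^sub>R One)) (real n *\<^sub>R One) :: 'a set) = UNIV" by (rule UN_box_eq_UNIV)
    show "emeasure ?M (box (- (real n *\<^sub>R One)) (real n *\<^sub>R One)) \<noteq> \<infinity>" for n by (rule *(2))
  qed auto
  then have "AE z in lborel. ennreal (f z) = ennreal (- f z)"
    by (intro sigma_finite_measure.density_unique[OF sigma_finite_lborel]) auto
  then show ?thesis
  proof eventually_elim
    case (elim z)
    then show ?case by (cases "f z \<ge> 0") (auto simp: ennreal_neg ennreal_eq_0_iff)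
  qed
qed

text \<open>The fundamental lemma of the calculus of variations. Boxes are products of intervals, so
  products of one-dimensional bumps suffice as test functions.\<close>

lemma AE_zero_if_bump_integrals_zero:
  fixes f :: "real \<times> real \<Rightarrow> real"
  assumes f: "integrable lborel f"
    and z: "\<And>\<theta> \<xi>. bump_on {a<..<b} \<theta> \<Longrightarrow> bump_on {c<..<d} \<xi> \<Longrightarrow>
      (\<integral>z. f z * (\<theta> (fst z) * \<xi> (snd z)) \<partial>lborel) = 0"
  shows "AE z in lborel. z \<in> {a<..<b} \<times> {c<..<d} \<longrightarrow> f z = 0"
proof -
  have [measurable]: "f \<in> borel_measurable borel" using f by (auto dest: borel_measurable_integrable)
  let ?Q = "{a<..<b} \<times> {c<..<d}"
  have "AE z in lborel. indicator ?Q z * f z = 0"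
  proof (rule AE_zero_if_box_integrals_zero)
    show "integrable lborel (\<lambda>z. indicator ?Q z * f z)"
      by (rule integrable_mult_bounded[OF f, where B=1]) (auto simp: indicator_def borel_prod[symmetric])
    fix p q :: "real \<times> real"
    let ?I = "{max a (fst p)<..<min b (fst q)}" and ?J = "{max c (snd p)<..<min d (snd q)}"
    obtain \<theta> where \<theta>: "\<And>n. bump_on ?I (\<theta> n)" "\<And>n x. 0 \<le> \<theta> n x \<and> \<theta> n x \<le> 1"
      "\<And>x. (\<lambda>n. \<theta> n x) \<longlonglongrightarrow> indicator ?I x" using bump_approx_indicator[of "max a (fst p)" "min b (fst q)"] by blast
    obtain \<xi> where \<xi>: "\<And>n. bump_on ?J (\<xi> n)" "\<And>n x. 0 \<le> \<xi> n x \<and> \<xi> n x \<le> 1"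
      "\<And>x. (\<lambda>n. \<xi> n x) \<longlonglongrightarrow> indicator ?J x" using bump_approx_indicator[of "max c (snd p)" "min d (snd q)"] by blast
    have [measurable]: "\<theta> n \<in> borel_measurable borel" "\<xi> n \<in> borel_measurable borel" for n
      using \<theta>(1) \<xi>(1) by (auto intro: bump_on_measurable)
    have "(\<lambda>n. \<integral>z. f z * (\<theta> n (fst z) * \<xi> n (snd z)) \<partial>lborel)
      \<longlonglongrightarrow> (\<integral>z. f z * (indicator ?I (fst z) * indicator ?J (snd z)) \<partial>lborel)"
    proof (rule integral_dominated_convergence[where w="\<lambda>z. \<bar>f z\<bar>"])
      show "AE z in lborel. norm (f z * (\<theta> n (fst z) * \<xi> n (snd z))) \<le> \<bar>f z\<bar>" for n
      proof (rule AE_I2)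
        fix z :: "real \<times> real"
        have "0 \<le> \<theta> n (fst z) * \<xi> n (snd z)" "\<theta> n (fst z) * \<xi> n (snd z) \<le> 1"
          using \<theta>(2) \<xi>(2) by (auto intro!: mult_nonneg_nonneg mult_le_one)
        then show "norm (f z * (\<theta> n (fst z) * \<xi> n (snd z))) \<le> \<bar>f z\<bar>"
          by (simp add: abs_mult mult_left_le)
      qed
      show "AE z in lborel. (\<lambda>n. f z * (\<theta> n (fst z) * \<xi> n (snd z)))
        \<longlonglongrightarrow> f z * (indicator ?I (fst z) * indicator ?J (snd z))"
        by (intro AE_I2 tendsto_intros \<theta> \<xi>)
    qed (use f in auto)
    moreover have "(\<integral>z. f z * (\<theta> n (fst z) * \<xi> n (snd z)) \<partial>lborel) = 0" for n
      by (rule z) (use \<theta>(1)[of n] \<xi>(1)[of n] in \<open>auto elim!: bump_on_mono\<close>)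
    ultimately have "(\<integral>z. f z * (indicator ?I (fst z) * indicator ?J (snd z)) \<partial>lborel) = 0"
      by (simp add: LIMSEQ_const_iff)
    moreover have eq: "indicator (box p q) z * (indicator ?Q z * f z) = f z * (indicator ?I (fst z) * indicator ?J (snd z))" for z
      by (auto simp: indicator_def box_prod mem_Times_iff)
    ultimately show "(\<integral>z. indicator (box p q) z * (indicator ?Q z * f z) \<partial>lborel) = 0"
      by (subst Bochner_Integration.integral_cong[OF refl eq]) assumption
  qed
  then show ?thesis by eventually_elim (auto simp: indicator_def)
qed

section \<open>Exchange of the variables, and primitives in one of two variables\<close>

lemma lborel_swap: "distr lborel borel (\<lambda>z. (snd z, fst z)) = (lborel :: (real \<times> real) measure)"
proof -
  have eq: "(\<lambda>z. (snd z, fst z)) = (\<lambda>(x, y). (y, x :: real) :: real \<times> real)" by auto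
  have "(lborel \<Otimes>\<^sub>M lborel :: (real \<times> real) measure) = distr (lborel \<Otimes>\<^sub>M lborel) (lborel \<Otimes>\<^sub>M lborel) (\<lambda>(x, y). (y, x))"
    by (rule lborel_pair.distr_pair_swap)
  then have "lborel = distr lborel (lborel :: (real \<times> real) measure) (\<lambda>z. (snd z, fst z))"
    unfolding eq by (simp add: lborel_prod)
  also have "\<dots> = distr lborel borel (\<lambda>z. (snd z, fst z))" by (rule distr_cong) auto
  finally show ?thesis by simp
qed

lemma swap_measurable [measurable]: "(\<lambda>z. (snd z, fst z)) \<in> borel \<rightarrow>\<^sub>M (borel :: (real \<times> real) measure)"
  by (intro borel_measurable_continuous_onI continuous_intros)

lemma AE_swap:
  assumes "AE z in lborel. P (z :: real \<times> real)"
  shows "AE z in lborel. P (snd z, fst z)"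
proof -
  have "AE z in distr lborel borel (\<lambda>z. (snd z, fst z)). P (z :: real \<times> real)" unfolding lborel_swap by (rule assms)
  then show ?thesis by (rule AE_distrD[rotated]) simp
qed

lemma integral_swap:
  fixes f :: "real \<times> real \<Rightarrow> real"
  assumes [measurable]: "f \<in> borel_measurable borel"
  shows "(\<integral>z. f (snd z, fst z) \<partial>lborel) = (\<integral>z. f z \<partial>lborel)"
proof -
  have "(\<integral>z. f z \<partial>lborel) = (\<integral>z. f z \<partial>distr lborel borel (\<lambda>z. (snd z, fst z)))" by (simp add: lborel_swap)
  also have "\<dots> = (\<integral>z. f (snd z, fst z) \<partial>lborel)" by (rule integral_distr) auto
  finally show ?thesis by simp
qed

lemma integrable_swap:
  fixes f :: "real \<times> real \<Rightarrow> real"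
  assumes "integrable lborel f"
  shows "integrable lborel (\<lambda>z. f (snd z, fst z))"
proof -
  have "integrable (distr lborel borel (\<lambda>z. (snd z, fst z))) f" using assms by (simp add: lborel_swap)
  then show ?thesis by (rule integrable_distr[rotated]) simp
qed

lemma borel_measurable_pairI:
  fixes f :: "real \<times> real \<Rightarrow> real"
  shows "f \<in> borel_measurable borel \<Longrightarrow> f \<in> borel_measurable (borel \<Otimes>\<^sub>M borel)"
  by (simp add: borel_prod)

lemma primitive_x_measurable:
  fixes g :: "real \<times> real \<Rightarrow> real"
  assumes "g \<in> borel_measurable borel"
  shows "(\<lambda>z. LBINT y:{..<snd z}. g (fst z, y)) \<in> borel_measurable borel"
    "(\<lambda>z. LBINT y:{snd z<..}. g (fst z, y)) \<in> borel_measurable borel"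
proof -
  have [measurable]: "g \<in> borel_measurable (borel \<Otimes>\<^sub>M borel)" using assms by (rule borel_measurable_pairI)
  have "(\<lambda>z. LBINT y:{..<snd z}. g (fst z, y)) \<in> borel_measurable (borel \<Otimes>\<^sub>M borel)"
    "(\<lambda>z. LBINT y:{snd z<..}. g (fst z, y)) \<in> borel_measurable (borel \<Otimes>\<^sub>M borel)" by measurable
  then show "(\<lambda>z. LBINT y:{..<snd z}. g (fst z, y)) \<in> borel_measurable borel"
    "(\<lambda>z. LBINT y:{snd z<..}. g (fst z, y)) \<in> borel_measurable borel" by (simp_all add: borel_prod)
qed

lemma primitive_t_measurable:
  fixes g :: "real \<times> real \<Rightarrow> real"
  assumes "g \<in> borel_measurable borel"
  shows "(\<lambda>z. LBINT s:{..<fst z}. g (s, snd z)) \<in> borel_measurable borel"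
    "(\<lambda>z. LBINT s:{fst z<..}. g (s, snd z)) \<in> borel_measurable borel"
proof -
  have [measurable]: "g \<in> borel_measurable (borel \<Otimes>\<^sub>M borel)" using assms by (rule borel_measurable_pairI)
  have "(\<lambda>z. LBINT s:{..<fst z}. g (s, snd z)) \<in> borel_measurable (borel \<Otimes>\<^sub>M borel)"
    "(\<lambda>z. LBINT s:{fst z<..}. g (s, snd z)) \<in> borel_measurable (borel \<Otimes>\<^sub>M borel)" by measurable
  then show "(\<lambda>z. LBINT s:{..<fst z}. g (s, snd z)) \<in> borel_measurable borel"
    "(\<lambda>z. LBINT s:{fst z<..}. g (s, snd z)) \<in> borel_measurable borel" by (simp_all add: borel_prod)
qed

text \<open>\<open>integral_triangle\<close> on each time slice. As \<open>g\<close> is integrable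
  on the plane, almost every slice is integrable, and the primitive is dominated by the slice norm
  \<open>n\<close>, which is integrable in time.\<close>

lemma primitive_x_pairing:
  fixes g :: "real \<times> real \<Rightarrow> real"
  assumes g: "integrable lborel g" and p[measurable]: "p \<in> borel_measurable borel"
    and pB: "\<And>t. \<bar>p t\<bar> \<le> B" and q: "integrable lborel q"
  shows "integrable lborel (\<lambda>z. (LBINT y:{..<snd z}. g (fst z, y)) * (p (fst z) * q (snd z)))"
    "(\<integral>z. (LBINT y:{..<snd z}. g (fst z, y)) * (p (fst z) * q (snd z)) \<partial>lborel)
      = (\<integral>z. g z * (p (fst z) * (LBINT x:{snd z<..}. q x)) \<partial>lborel)"
proof -
  have gm: "g \<in> borel_measurable borel" using g by (auto dest: borel_measurable_integrable)
  have [measurable]: "q \<in> borel_measurable borel" using q by (auto dest: borel_measurable_integrable)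
  note [measurable] = primitive_x_measurable[OF gm] gm
  let ?G = "\<lambda>z. LBINT y:{..<snd z}. g (fst z, y)"
  define n where "n t = (\<integral>y. \<bar>g (t, y)\<bar> \<partial>lborel)" for t
  have n: "integrable lborel n" unfolding n_def by (rule lborel2_integrable_fst) (use g in simp)
  have "integrable lborel (\<lambda>z. (B * n (fst z)) * \<bar>q (snd z)\<bar>)"
    by (rule integrable_lborel_prod_mult) (use n q in auto)
  then show i: "integrable lborel (\<lambda>z. ?G z * (p (fst z) * q (snd z)))"
  proof (rule Bochner_Integration.integrable_bound)
    have "AE z :: real \<times> real in lborel. integrable lborel (\<lambda>y. g (fst z, y))"
    proof -
      let ?P = "\<lambda>z :: real \<times> real. integrable lborel (\<lambda>y. g (fst z, y))"
      have m: "{z \<in> space (lborel \<Otimes>\<^sub>M lborel). ?P z} \<in> sets (lborel \<Otimes>\<^sub>M lborel)" by measurable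
      have a: "AE x in lborel. AE y in lborel. ?P (x, y)"
        using lborel2_AE_fst[OF g] by eventually_elim simp
      have "AE z in lborel \<Otimes>\<^sub>M lborel. ?P z" by (rule lborel_pair.AE_pair_measure[OF m a])
      then show ?thesis unfolding lborel_prod .
    qed
    then show "AE z in lborel. norm (?G z * (p (fst z) * q (snd z))) \<le> norm ((B * n (fst z)) * \<bar>q (snd z)\<bar>)"
    proof eventually_elim
      case (elim z)
      have "\<bar>?G z\<bar> \<le> n (fst z)" unfolding n_def by (rule primitive_bound[OF elim])
      moreover have "0 \<le> n (fst z)" by (simp add: n_def)
      moreover have "B \<ge> 0" using pB[of 0] by simp
      ultimately have "\<bar>?G z\<bar> * (\<bar>p (fst z)\<bar> * \<bar>q (snd z)\<bar>) \<le> n (fst z) * (B * \<bar>q (snd z)\<bar>)"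
        using pB by (intro mult_mono) auto
      also have "\<dots> = \<bar>(B * n (fst z)) * \<bar>q (snd z)\<bar>\<bar>"
        using \<open>0 \<le> n (fst z)\<close> \<open>B \<ge> 0\<close> by (simp add: abs_mult ac_simps)
      finally show ?case by (simp add: abs_mult)
    qed
  qed measurable
  have i2: "integrable lborel (\<lambda>z. g z * (p (fst z) * (LBINT x:{snd z<..}. q x)))"
  proof -
    have "integrable lborel (\<lambda>z. (p (fst z) * (LBINT x:{snd z<..}. q x)) * g z)"
    proof (rule integrable_mult_bounded[OF g, where B="B * (\<integral>x. \<bar>q x\<bar> \<partial>lborel)"])
      show "\<bar>p (fst z) * (LBINT x:{snd z<..}. q x)\<bar> \<le> B * (\<integral>x. \<bar>q x\<bar> \<partial>lborel)" for z :: "real \<times> real"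
        unfolding abs_mult using pB[of 0] by (intro mult_mono pB primitive_bound q) auto
    qed measurable
    then show ?thesis by (simp add: mult.commute)
  qed
  have "(\<integral>z. ?G z * (p (fst z) * q (snd z)) \<partial>lborel)
    = (\<integral>t. \<integral>x. (LBINT y:{..<x}. g (t, y)) * (p t * q x) \<partial>lborel \<partial>lborel)"
    using lborel2_integral_fst[OF i] by simp
  also have "\<dots> = (\<integral>t. \<integral>x. g (t, x) * (p t * (LBINT y:{x<..}. q y)) \<partial>lborel \<partial>lborel)"
  proof (rule integral_cong_AE)
    show "AE t in lborel. (\<integral>x. (LBINT y:{..<x}. g (t, y)) * (p t * q x) \<partial>lborel)
      = (\<integral>x. g (t, x) * (p t * (LBINT y:{x<..}. q y)) \<partial>lborel)"
      using lborel2_AE_fst[OF g]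
    proof eventually_elim
      case (elim t)
      have "p t * (\<integral>x. q x * (LBINT y:{..<x}. g (t, y)) \<partial>lborel) = p t * (\<integral>x. g (t, x) * (LBINT y:{x<..}. q y) \<partial>lborel)"
        using integral_triangle[OF elim q] by simp
      then show ?case
        by (subst (asm) (1 2) integral_mult_right_zero[symmetric]) (simp add: ac_simps)
    qed
  qed (use lborel2_integrable_fst[OF i] lborel2_integrable_fst[OF i2] in \<open>auto dest: borel_measurable_integrable\<close>)
  also have "\<dots> = (\<integral>z. g z * (p (fst z) * (LBINT x:{snd z<..}. q x)) \<partial>lborel)"
    using lborel2_integral_fst[OF i2] by simp
  finally show "(\<integral>z. ?G z * (p (fst z) * q (snd z)) \<partial>lborel)
      = (\<integral>z. g z * (p (fst z) * (LBINT x:{snd z<..}. q x)) \<partial>lborel)" .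
qed

text \<open>The statement in \<open>x\<close> after an exchange of the variables, which spares a
  second Fubini argument.\<close>

lemma primitive_t_pairing:
  fixes g :: "real \<times> real \<Rightarrow> real"
  assumes g: "integrable lborel g" and p: "p \<in> borel_measurable borel"
    and pB: "\<And>x. \<bar>p x\<bar> \<le> B" and q: "integrable lborel q"
  shows "integrable lborel (\<lambda>z. (LBINT s:{..<fst z}. g (s, snd z)) * (q (fst z) * p (snd z)))"
    "(\<integral>z. (LBINT s:{..<fst z}. g (s, snd z)) * (q (fst z) * p (snd z)) \<partial>lborel)
      = (\<integral>z. g z * ((LBINT t:{fst z<..}. q t) * p (snd z)) \<partial>lborel)"
proof -
  have [measurable]: "g \<in> borel_measurable borel" "q \<in> borel_measurable borel" "p \<in> borel_measurable borel"
    using g q p by (auto dest: borel_measurable_integrable)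
  note [measurable] = primitive_t_measurable[of g]
  note x = primitive_x_pairing[OF integrable_swap[OF g] p pB q]
  show 1: "integrable lborel (\<lambda>z. (LBINT s:{..<fst z}. g (s, snd z)) * (q (fst z) * p (snd z)))"
    using integrable_swap[OF x(1)] by (simp add: mult.commute)
  have "(\<integral>z. (LBINT s:{..<fst z}. g (s, snd z)) * (q (fst z) * p (snd z)) \<partial>lborel)
    = (\<integral>z. (LBINT y:{..<snd z}. g (snd (fst z, y), fst (fst z, y))) * (p (fst z) * q (snd z)) \<partial>lborel)"
    by (subst integral_swap[symmetric]) (simp_all add: mult.commute)
  also have "\<dots> = (\<integral>z. g (snd z, fst z) * (p (fst z) * (LBINT x:{snd z<..}. q x)) \<partial>lborel)" by (rule x(2))
  also have "\<dots> = (\<integral>z. g z * ((LBINT t:{fst z<..}. q t) * p (snd z)) \<partial>lborel)"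
    by (subst integral_swap[symmetric]) (simp_all add: mult.commute)
  finally show "(\<integral>z. (LBINT s:{..<fst z}. g (s, snd z)) * (q (fst z) * p (snd z)) \<partial>lborel)
      = (\<integral>z. g z * ((LBINT t:{fst z<..}. q t) * p (snd z)) \<partial>lborel)" .
qed

lemma bump_pair_integrable:
  fixes f :: "real \<times> real \<Rightarrow> real"
  assumes f: "integrable lborel f" and "bump_on I \<theta>" "bump_on J \<xi>"
  shows "integrable lborel (\<lambda>z. f z * (\<theta> (fst z) * \<xi> (snd z)))"
proof -
  obtain B where B: "B \<ge> 0" "\<And>x. \<bar>\<theta> x\<bar> \<le> B" using bump_on_bounded[OF assms(2)] by blast
  obtain C where C: "C \<ge> 0" "\<And>x. \<bar>\<xi> x\<bar> \<le> C" using bump_on_bounded[OF assms(3)] by blast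
  note [measurable] = bump_on_measurable[OF assms(2)] bump_on_measurable[OF assms(3)]
  have "integrable lborel (\<lambda>z. (\<theta> (fst z) * \<xi> (snd z)) * f z)"
  proof (rule integrable_mult_bounded[OF f, where B="B * C"])
    show "\<bar>\<theta> (fst z) * \<xi> (snd z)\<bar> \<le> B * C" for z :: "real \<times> real"
      unfolding abs_mult by (intro mult_mono B C) auto
  qed measurable
  then show ?thesis by (simp add: mult.commute)
qed

lemma bump_on_zero: "bump_on I f \<Longrightarrow> x \<notin> I \<Longrightarrow> f x = 0"
  unfolding bump_on_def by blast

text \<open>Du Bois-Reymond: after subtraction of the primitive of \<open>g\<close> the remainder
  \<open>h\<close> is orthogonal to every \<open>x\<close>-derivative of a test function, and such a
  function depends on \<open>t\<close> alone. Its value \<open>k\<close> is the average against a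
  bump of integral 1.\<close>

lemma weak_x_derivative_primitive:
  fixes f g :: "real \<times> real \<Rightarrow> real"
  assumes f: "integrable lborel f" and g: "integrable lborel g" and cd: "c < d"
    and weak: "\<And>\<theta> \<xi>. bump_on {a<..<b} \<theta> \<Longrightarrow> bump_on {c<..<d} \<xi> \<Longrightarrow>
      (\<integral>z. f z * (\<theta> (fst z) * deriv \<xi> (snd z)) \<partial>lborel) = - (\<integral>z. g z * (\<theta> (fst z) * \<xi> (snd z)) \<partial>lborel)"
  obtains k where "AE z in lborel. z \<in> {a<..<b} \<times> {c<..<d} \<longrightarrow> f z = k (fst z) + (LBINT y:{..<snd z}. g (fst z, y))"
proof -
  have fm[measurable]: "f \<in> borel_measurable borel" and gm[measurable]: "g \<in> borel_measurable borel"
    using f g by (auto dest: borel_measurable_integrable)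
  note [measurable] = primitive_x_measurable[OF gm]
  let ?Q = "{a<..<b} \<times> {c<..<d}"
  let ?G = "\<lambda>z. LBINT y:{..<snd z}. g (fst z, y)"
  have Qm[measurable]: "?Q \<in> sets borel" by (intro borel_open open_Times) auto
  define h where "h z = f z - indicator ?Q z * ?G z" for z
  have "integrable lborel (\<lambda>z. ?G z * (indicator {a<..<b} (fst z) * indicator {c<..<d} (snd z)))"
    by (rule primitive_x_pairing(1)[OF g, where B=1]) (use cd in \<open>auto simp: indicator_def[of "{a<..<b}"] intro: integrable_real_indicator\<close>)
  moreover have "?G z * (indicator {a<..<b} (fst z) * indicator {c<..<d} (snd z)) = indicator ?Q z * ?G z" for z
    by (auto simp: indicator_def mem_Times_iff)
  ultimately have iG: "integrable lborel (\<lambda>z. indicator ?Q z * ?G z)" by simp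
  have h: "integrable lborel h" unfolding h_def using f iG by simp
  have hz: "(\<integral>z. h z * (\<theta> (fst z) * deriv \<xi> (snd z)) \<partial>lborel) = 0"
    if \<theta>: "bump_on {a<..<b} \<theta>" and \<xi>: "bump_on {c<..<d} \<xi>" for \<theta> \<xi>
  proof -
    obtain B where B: "B \<ge> 0" "\<And>x. \<bar>\<theta> x\<bar> \<le> B" using bump_on_bounded[OF \<theta>] by blast
    have \<xi>': "bump_on {c<..<d} (deriv \<xi>)" by (rule bump_on_deriv[OF \<xi>])
    have eq: "h z * (\<theta> (fst z) * deriv \<xi> (snd z)) = f z * (\<theta> (fst z) * deriv \<xi> (snd z)) - ?G z * (\<theta> (fst z) * deriv \<xi> (snd z))" for z
      using bump_on_zero[OF \<theta>, of "fst z"] bump_on_zero[OF \<xi>', of "snd z"]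
      by (cases "z \<in> ?Q") (auto simp: h_def algebra_simps mem_Times_iff)
    note P = primitive_x_pairing[OF g bump_on_measurable[OF \<theta>] B(2) bump_on_integrable[OF \<xi>']]
    have "(\<integral>z. h z * (\<theta> (fst z) * deriv \<xi> (snd z)) \<partial>lborel)
      = (\<integral>z. f z * (\<theta> (fst z) * deriv \<xi> (snd z)) \<partial>lborel) - (\<integral>z. ?G z * (\<theta> (fst z) * deriv \<xi> (snd z)) \<partial>lborel)"
      unfolding eq by (rule Bochner_Integration.integral_diff[OF bump_pair_integrable[OF f \<theta> \<xi>'] P(1)])
    also have "\<dots> = 0" unfolding P(2) weak[OF \<theta> \<xi>] bump_on_FTC(2)[OF \<xi>] by simp
    finally show ?thesis .
  qed
  obtain \<eta> where \<eta>: "bump_on {c<..<d} \<eta>" "(\<integral>x. \<eta> x \<partial>lborel) = 1" using bump_unit_integral[OF cd] by blast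
  note [measurable] = bump_on_measurable[OF \<eta>(1)]
  define k where "k t = (\<integral>y. h (t, y) * \<eta> y \<partial>lborel)" for t
  obtain C where C: "C \<ge> 0" "\<And>x. \<bar>\<eta> x\<bar> \<le> C" using bump_on_bounded[OF \<eta>(1)] by blast
  have hm[measurable]: "h \<in> borel_measurable borel" using h by (auto dest: borel_measurable_integrable)
  have h\<eta>: "integrable lborel (\<lambda>z. h z * \<eta> (snd z))"
    using integrable_mult_bounded[OF h, of "\<lambda>z. \<eta> (snd z)" C] C by (simp add: mult.commute)
  have k: "integrable lborel k" unfolding k_def using lborel2_integrable_fst[OF h\<eta>] by simp
  have km[measurable]: "k \<in> borel_measurable borel" using k by (auto dest: borel_measurable_integrable)
  have ik: "integrable lborel (\<lambda>z. k (fst z) * indicator {c<..<d} (snd z))"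
    by (rule integrable_lborel_prod_mult[OF k]) (use cd in \<open>auto intro: integrable_real_indicator\<close>)
  have "AE z in lborel. z \<in> ?Q \<longrightarrow> h z - k (fst z) * indicator {c<..<d} (snd z) = 0"
  proof (rule AE_zero_if_bump_integrals_zero)
    show "integrable lborel (\<lambda>z. h z - k (fst z) * indicator {c<..<d} (snd z))" using h ik by simp
    fix \<theta> \<zeta> assume \<theta>: "bump_on {a<..<b} \<theta>" and \<zeta>: "bump_on {c<..<d} \<zeta>"
    obtain B where B: "B \<ge> 0" "\<And>x. \<bar>\<theta> x\<bar> \<le> B" using bump_on_bounded[OF \<theta>] by blast
    note [measurable] = bump_on_measurable[OF \<theta>] bump_on_measurable[OF \<zeta>]
    define m where "m = (\<integral>x. \<zeta> x \<partial>lborel)"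
    \<comment> \<open>Any test function is a multiple of the unit bump plus one of mean zero; the
      latter is a derivative, so \<open>h\<close> annihilates it.\<close>
    have "bump_on {c<..<d} (\<lambda>x. \<zeta> x - m * \<eta> x)" by (rule bump_on_linear[OF \<zeta> \<eta>(1)]) (rule is_interval_oo)
    moreover have "(\<integral>x. \<zeta> x - m * \<eta> x \<partial>lborel) = 0"
      using bump_on_integrable[OF \<zeta>] bump_on_integrable[OF \<eta>(1)] \<eta>(2) by (simp add: m_def)
    ultimately obtain F where F: "bump_on {c<..<d} F" "deriv F = (\<lambda>x. \<zeta> x - m * \<eta> x)"
      using bump_on_primitive is_interval_oo by blast
    have i1: "integrable lborel (\<lambda>z. h z * (\<theta> (fst z) * \<zeta> (snd z)))" by (rule bump_pair_integrable[OF h \<theta> \<zeta>])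
    have i2: "integrable lborel (\<lambda>z. h z * (\<theta> (fst z) * \<eta> (snd z)))" by (rule bump_pair_integrable[OF h \<theta> \<eta>(1)])
    have \<theta>k: "integrable lborel (\<lambda>t. \<theta> t * k t)" by (rule integrable_mult_bounded[OF k _ B(2)]) measurable
    have i3: "integrable lborel (\<lambda>z. \<theta> (fst z) * k (fst z) * \<zeta> (snd z))"
      by (rule integrable_lborel_prod_mult[OF \<theta>k bump_on_integrable[OF \<zeta>]])
    have "0 = (\<integral>z. h z * (\<theta> (fst z) * \<zeta> (snd z)) - m * (h z * (\<theta> (fst z) * \<eta> (snd z))) \<partial>lborel)"
      using hz[OF \<theta> F(1)] unfolding F(2) by (simp add: algebra_simps)
    also have "\<dots> = (\<integral>z. h z * (\<theta> (fst z) * \<zeta> (snd z)) \<partial>lborel) - m * (\<integral>z. h z * (\<theta> (fst z) * \<eta> (snd z)) \<partial>lborel)"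
      using i1 i2 by simp
    also have "(\<integral>z. h z * (\<theta> (fst z) * \<eta> (snd z)) \<partial>lborel) = (\<integral>t. \<theta> t * k t \<partial>lborel)"
      using lborel2_integral_fst[OF i2] unfolding k_def
      by (subst integral_mult_right_zero[symmetric]) (simp add: ac_simps)
    also have "m * (\<integral>t. \<theta> t * k t \<partial>lborel) = (\<integral>z. \<theta> (fst z) * k (fst z) * \<zeta> (snd z) \<partial>lborel)"
      using lborel2_integral_fst[OF i3] by (simp add: m_def mult.commute)
    finally have "(\<integral>z. h z * (\<theta> (fst z) * \<zeta> (snd z)) \<partial>lborel) - (\<integral>z. \<theta> (fst z) * k (fst z) * \<zeta> (snd z) \<partial>lborel) = 0" by simp
    then have "(\<integral>z. h z * (\<theta> (fst z) * \<zeta> (snd z)) - \<theta> (fst z) * k (fst z) * \<zeta> (snd z) \<partial>lborel) = 0"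
      using i1 i3 by simp
    moreover have "(h z - k (fst z) * indicator {c<..<d} (snd z)) * (\<theta> (fst z) * \<zeta> (snd z))
      = h z * (\<theta> (fst z) * \<zeta> (snd z)) - \<theta> (fst z) * k (fst z) * \<zeta> (snd z)" for z
      using bump_on_zero[OF \<zeta>, of "snd z"] by (cases "snd z \<in> {c<..<d}") (auto simp: algebra_simps)
    ultimately show "(\<integral>z. (h z - k (fst z) * indicator {c<..<d} (snd z)) * (\<theta> (fst z) * \<zeta> (snd z)) \<partial>lborel) = 0"
      by simp
  qed
  then have "AE z in lborel. z \<in> ?Q \<longrightarrow> f z = k (fst z) + ?G z"
    by eventually_elim (auto simp: h_def)
  then show ?thesis by (rule that)
qed

text \<open>Test functions that need not vanish at time 0 fix the constant of integration as
  \<open>M0\<close>. Hence their range \<open>{-1<..<T}\<close>, in which any negative left end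
  would do.\<close>

lemma weak_t_derivative_initial:
  fixes M F :: "real \<times> real \<Rightarrow> real" and M0 :: "real \<Rightarrow> real"
  assumes M: "integrable lborel M" and F: "integrable lborel F" and M0: "integrable lborel M0" and T: "0 < T"
    and F0: "\<And>z. fst z \<notin> {0<..<T} \<Longrightarrow> F z = 0"
    and weak: "\<And>\<theta> \<zeta>. bump_on {-1<..<T} \<theta> \<Longrightarrow> bump_on {c<..<d} \<zeta> \<Longrightarrow>
      (\<integral>z. M z * (deriv \<theta> (fst z) * \<zeta> (snd z)) \<partial>lborel) + \<theta> 0 * (\<integral>x. M0 x * \<zeta> x \<partial>lborel)
      = (\<integral>z. F z * (\<theta> (fst z) * \<zeta> (snd z)) \<partial>lborel)"
    and Mz: "\<And>z. fst z \<notin> {0<..<T} \<Longrightarrow> M z = 0"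
  shows "AE z in lborel. z \<in> {0<..<T} \<times> {c<..<d} \<longrightarrow> M z = M0 (snd z) - (LBINT s:{..<fst z}. F (s, snd z))"
proof -
  have Mm[measurable]: "M \<in> borel_measurable borel" and Fm[measurable]: "F \<in> borel_measurable borel"
    and M0m[measurable]: "M0 \<in> borel_measurable borel"
    using M F M0 by (auto dest: borel_measurable_integrable)
  note [measurable] = primitive_t_measurable[OF Fm]
  let ?H = "\<lambda>z. LBINT s:{..<fst z}. F (s, snd z)"
  let ?I = "\<lambda>z. indicator {0<..<T} (fst z) :: real"
  have iI: "integrable lborel (indicator {0<..<T} :: real \<Rightarrow> real)" using T by (intro integrable_real_indicator) auto
  have iH: "integrable lborel (\<lambda>z. ?I z * ?H z)"
    using primitive_t_pairing(1)[OF F, of "\<lambda>_. 1" 1 "indicator {0<..<T}"] iI by (simp add: mult.commute)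
  have iM0: "integrable lborel (\<lambda>z. ?I z * M0 (snd z))" by (rule integrable_lborel_prod_mult[OF iI M0])
  have "AE z in lborel. z \<in> {0<..<T} \<times> {c<..<d} \<longrightarrow> M z + ?I z * ?H z - ?I z * M0 (snd z) = 0"
  proof (rule AE_zero_if_bump_integrals_zero)
    show "integrable lborel (\<lambda>z. M z + ?I z * ?H z - ?I z * M0 (snd z))" using M iH iM0 by simp
    fix \<eta> \<zeta> assume \<eta>: "bump_on {0<..<T} \<eta>" and \<zeta>: "bump_on {c<..<d} \<zeta>"
    obtain \<eta>1 where \<eta>1: "bump_on {-1<..<0} \<eta>1" "(\<integral>x. \<eta>1 x \<partial>lborel) = 1"
      using bump_unit_integral[of "-1" 0] by auto
    \<comment> \<open>the bump at negative times gives the primitive \<open>\<theta>\<close> of \<open>\<eta>\<close> compact support and picks up the initial value\<close>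
    define m where "m = (\<integral>x. \<eta> x \<partial>lborel)"
    have \<eta>': "bump_on {-1<..<T} \<eta>" "bump_on {-1<..<T} \<eta>1"
      using \<eta> \<eta>1(1) T by (auto elim!: bump_on_mono)
    have "bump_on {-1<..<T} (\<lambda>x. \<eta> x - m * \<eta>1 x)" by (rule bump_on_linear[OF \<eta>']) (rule is_interval_oo)
    moreover have "(\<integral>x. \<eta> x - m * \<eta>1 x \<partial>lborel) = 0"
      using bump_on_integrable[OF \<eta>] bump_on_integrable[OF \<eta>1(1)] \<eta>1(2) by (simp add: m_def)
    ultimately obtain \<theta> where \<theta>: "bump_on {-1<..<T} \<theta>" "deriv \<theta> = (\<lambda>x. \<eta> x - m * \<eta>1 x)"
      using bump_on_primitive is_interval_oo by blast
    obtain C where C: "C \<ge> 0" "\<And>x. \<bar>\<zeta> x\<bar> \<le> C" using bump_on_bounded[OF \<zeta>] by blast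
    have d\<theta>: "deriv \<theta> x = \<eta> x" if "x > 0" for x
      using \<theta>(2) bump_on_zero[OF \<eta>1(1), of x] that by simp
    have tail: "(LBINT t:{s<..}. \<eta> t) = - \<theta> s" if "s \<ge> 0" for s
    proof -
      have "(LBINT t:{s<..}. \<eta> t) = (LBINT t:{s<..}. deriv \<theta> t)"
        unfolding set_lebesgue_integral_def
        by (rule Bochner_Integration.integral_cong) (use d\<theta> that in \<open>auto simp: indicator_def\<close>)
      then show ?thesis using bump_on_FTC(2)[OF \<theta>(1)] by simp
    qed
    have \<theta>0: "\<theta> 0 = - m"
    proof -
      have "(LBINT t:{0<..}. \<eta> t) = m" unfolding set_lebesgue_integral_def m_def
      proof (rule Bochner_Integration.integral_cong[OF refl])
        show "indicator {0<..} t *\<^sub>R \<eta> t = \<eta> t" for t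
          using bump_on_zero[OF \<eta>, of t] by (cases "t \<in> {0<..<T}") (auto simp: indicator_def)
      qed
      then show ?thesis using tail[of 0] by simp
    qed
    note P = primitive_t_pairing[OF F bump_on_measurable[OF \<zeta>] C(2) bump_on_integrable[OF \<eta>]]
    have 1: "(\<integral>z. M z * (\<eta> (fst z) * \<zeta> (snd z)) \<partial>lborel) = (\<integral>z. M z * (deriv \<theta> (fst z) * \<zeta> (snd z)) \<partial>lborel)"
    proof (rule Bochner_Integration.integral_cong[OF refl])
      show "M z * (\<eta> (fst z) * \<zeta> (snd z)) = M z * (deriv \<theta> (fst z) * \<zeta> (snd z))" for z
        using d\<theta>[of "fst z"] Mz[of z] by (cases "fst z \<in> {0<..<T}") auto
    qed
    have 2: "(\<integral>z. ?H z * (\<eta> (fst z) * \<zeta> (snd z)) \<partial>lborel) = - (\<integral>z. F z * (\<theta> (fst z) * \<zeta> (snd z)) \<partial>lborel)"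
      unfolding P(2) Bochner_Integration.integral_minus[symmetric]
    proof (rule Bochner_Integration.integral_cong[OF refl])
      show "F z * ((LBINT t:{fst z<..}. \<eta> t) * \<zeta> (snd z)) = - (F z * (\<theta> (fst z) * \<zeta> (snd z)))" for z
        using tail[of "fst z"] F0[of z] by (cases "fst z \<in> {0<..<T}") auto
    qed
    have iM0\<zeta>: "integrable lborel (\<lambda>x. M0 x * \<zeta> x)"
      using integrable_mult_bounded[OF M0, of \<zeta> C] C(2) bump_on_measurable[OF \<zeta>] by (simp add: mult.commute)
    have i3: "integrable lborel (\<lambda>z. \<eta> (fst z) * (M0 (snd z) * \<zeta> (snd z)))"
      by (rule integrable_lborel_prod_mult[OF bump_on_integrable[OF \<eta>] iM0\<zeta>])
    have 3: "(\<integral>z. \<eta> (fst z) * (M0 (snd z) * \<zeta> (snd z)) \<partial>lborel) = m * (\<integral>x. M0 x * \<zeta> x \<partial>lborel)"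
      using lborel2_integral_fst[OF i3] by (simp add: m_def)
    have i1: "integrable lborel (\<lambda>z. M z * (\<eta> (fst z) * \<zeta> (snd z)))" by (rule bump_pair_integrable[OF M \<eta> \<zeta>])
    have eq: "(M z + ?I z * ?H z - ?I z * M0 (snd z)) * (\<eta> (fst z) * \<zeta> (snd z))
      = M z * (\<eta> (fst z) * \<zeta> (snd z)) + ?H z * (\<eta> (fst z) * \<zeta> (snd z)) - \<eta> (fst z) * (M0 (snd z) * \<zeta> (snd z))" for z
      using bump_on_zero[OF \<eta>, of "fst z"] by (cases "fst z \<in> {0<..<T}") (auto simp: algebra_simps)
    have "(\<integral>z. (M z + ?I z * ?H z - ?I z * M0 (snd z)) * (\<eta> (fst z) * \<zeta> (snd z)) \<partial>lborel)
      = (\<integral>z. M z * (\<eta> (fst z) * \<zeta> (snd z)) \<partial>lborel) + (\<integral>z. ?H z * (\<eta> (fst z) * \<zeta> (snd z)) \<partial>lborel)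
        - (\<integral>z. \<eta> (fst z) * (M0 (snd z) * \<zeta> (snd z)) \<partial>lborel)"
      unfolding eq using i1 P(1) i3 by simp
    also have "\<dots> = 0" using weak[OF \<theta>(1) \<zeta>] unfolding 1 2 3 \<theta>0 by simp
    finally show "(\<integral>z. (M z + ?I z * ?H z - ?I z * M0 (snd z)) * (\<eta> (fst z) * \<zeta> (snd z)) \<partial>lborel) = 0" .
  qed
  then show ?thesis by eventually_elim auto
qed

section \<open>Null sets on slices, increments of primitives and bounds on a rectangle\<close>

lemma AE_lborel2_iterated:
  "AE z in lborel. P (z :: real \<times> real) \<Longrightarrow> AE t in lborel. AE x in lborel. P (t, x)"
  by (rule lborel_pair.AE_pair) (simp only: lborel_prod)

lemma AE_lborel2_swapped:
  "AE z in lborel. P (z :: real \<times> real) \<Longrightarrow> AE x in lborel. AE t in lborel. P (t, x)"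
  using AE_lborel2_iterated[OF AE_swap[of P]] by simp

lemma AE_lborel2_fst:
  assumes "AE t in lborel. P t"
  shows "AE z :: real \<times> real in lborel. P (fst z)"
proof -
  obtain N where N: "N \<in> sets lborel" "emeasure lborel N = 0" "{t. \<not> P t} \<subseteq> N"
    using assms unfolding eventually_ae_filter null_sets_def by auto
  have m: "{z \<in> space (lborel \<Otimes>\<^sub>M lborel). fst z \<notin> N} \<in> sets (lborel \<Otimes>\<^sub>M (lborel :: real measure))"
    using N(1) by measurable
  have "AE t in lborel. t \<notin> N" using N(1,2) by (intro AE_not_in) (auto simp: null_sets_def)
  then have "AE t in lborel. AE x in (lborel :: real measure). fst (t, x) \<notin> N" by eventually_elim simp
  from lborel_pair.AE_pair_measure[OF m this] have "AE z :: real \<times> real in lborel. fst z \<notin> N"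
    unfolding lborel_prod .
  then show ?thesis by eventually_elim (use N(3) in auto)
qed

lemma AE_lborel2_snd:
  assumes "AE x in lborel. P x"
  shows "AE z :: real \<times> real in lborel. P (snd z)"
  using AE_swap[OF AE_lborel2_fst[OF assms]] by simp

lemma AE_translate:
  fixes P :: "'a::euclidean_space \<Rightarrow> bool"
  assumes "AE z in lborel. P z"
  shows "AE z in lborel. P (s + z)"
proof -
  have "AE z in distr lborel borel ((+) s). P z" unfolding lborel_distr_plus by (rule assms)
  then show ?thesis by (rule AE_distrD[rotated]) simp
qed

text \<open>An increment over a step \<open>h\<close> becomes an integral of shifted values, the
  form to which the Steklov lemmas apply.\<close>

lemma primitive_diff_left:
  fixes f :: "real \<Rightarrow> real"
  assumes f: "integrable lborel f" and h: "h > 0"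
  shows "(LBINT s:{..<t}. f s) - (LBINT s:{..<t - h}. f s) = (LBINT s:{0<..<h}. f (t - s))"
proof -
  have [measurable]: "f \<in> borel_measurable borel" using f by (auto dest: borel_measurable_integrable)
  have i: "integrable lborel (\<lambda>s. indicator A s *\<^sub>R f s)" if "A \<in> sets borel" for A
    using that by (intro integrable_mult_indicator f) auto
  have "(LBINT s:{..<t}. f s) - (LBINT s:{..<t - h}. f s) = (\<integral>s. indicator {..<t} s *\<^sub>R f s - indicator {..<t - h} s *\<^sub>R f s \<partial>lborel)"
    unfolding set_lebesgue_integral_def
    by (rule Bochner_Integration.integral_diff[symmetric]; rule i) auto
  also have "\<dots> = (\<integral>s. indicator {t - h<..<t} s * f s \<partial>lborel)"
  proof (rule integral_cong_AE)
    have "indicator {..<t} s *\<^sub>R f s - indicator {..<t - h} s *\<^sub>R f s = indicator {t - h<..<t} s * f s" if "s \<noteq> t - h" for s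
      using that h by (auto simp: indicator_def)
    then show "AE s in lborel. indicator {..<t} s *\<^sub>R f s - indicator {..<t - h} s *\<^sub>R f s = indicator {t - h<..<t} s * f s"
      by (intro AE_I[where N="{t - h}"]) auto
  qed measurable
  also have "\<dots> = \<bar>- 1\<bar> *\<^sub>R (\<integral>s. indicator {t - h<..<t} (t + (- 1) * s) * f (t + (- 1) * s) \<partial>lborel)"
    by (rule lborel_integral_real_affine) simp
  also have "\<dots> = (LBINT s:{0<..<h}. f (t - s))"
    unfolding set_lebesgue_integral_def
    by (simp, rule Bochner_Integration.integral_cong) (auto simp: indicator_def)
  finally show ?thesis .
qed

lemma primitive_diff_right:
  fixes f :: "real \<Rightarrow> real"
  assumes f: "integrable lborel f" and h: "h > 0"
  shows "(LBINT s:{t<..}. f s) - (LBINT s:{t + h<..}. f s) = (LBINT s:{0<..<h}. f (t + s))"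
proof -
  have [measurable]: "f \<in> borel_measurable borel" using f by (auto dest: borel_measurable_integrable)
  have i: "integrable lborel (\<lambda>s. indicator A s *\<^sub>R f s)" if "A \<in> sets borel" for A
    using that by (intro integrable_mult_indicator f) auto
  have "(LBINT s:{t<..}. f s) - (LBINT s:{t + h<..}. f s) = (\<integral>s. indicator {t<..} s *\<^sub>R f s - indicator {t + h<..} s *\<^sub>R f s \<partial>lborel)"
    unfolding set_lebesgue_integral_def
    by (rule Bochner_Integration.integral_diff[symmetric]; rule i) auto
  also have "\<dots> = (\<integral>s. indicator {t<..<t + h} s * f s \<partial>lborel)"
  proof (rule integral_cong_AE)
    have "indicator {t<..} s *\<^sub>R f s - indicator {t + h<..} s *\<^sub>R f s = indicator {t<..<t + h} s * f s" if "s \<noteq> t + h" for s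
      using that h by (auto simp: indicator_def)
    then show "AE s in lborel. indicator {t<..} s *\<^sub>R f s - indicator {t + h<..} s *\<^sub>R f s = indicator {t<..<t + h} s * f s"
      by (intro AE_I[where N="{t + h}"]) auto
  qed measurable
  also have "\<dots> = \<bar>1\<bar> *\<^sub>R (\<integral>s. indicator {t<..<t + h} (t + 1 * s) * f (t + 1 * s) \<partial>lborel)"
    by (rule lborel_integral_real_affine) simp
  also have "\<dots> = (LBINT s:{0<..<h}. f (t + s))"
    unfolding set_lebesgue_integral_def
    by (simp, rule Bochner_Integration.integral_cong) (auto simp: indicator_def)
  finally show ?thesis .
qed

lemma square_bound_mult: "\<bar>a * b\<bar> \<le> a\<^sup>2 + (b::real)\<^sup>2"
proof -
  have "2 * \<bar>a\<bar> * \<bar>b\<bar> \<le> a\<^sup>2 + b\<^sup>2" using sum_squares_bound[of "\<bar>a\<bar>" "\<bar>b\<bar>"] by simp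
  moreover have "0 \<le> \<bar>a\<bar> * \<bar>b\<bar>" by simp
  ultimately show ?thesis unfolding abs_mult by linarith
qed

lemma set_integral_measurable [measurable (raw)]:
  fixes a :: "'a \<Rightarrow> real \<Rightarrow> real"
  assumes [measurable]: "case_prod a \<in> borel_measurable (M \<Otimes>\<^sub>M borel)" and [measurable]: "A \<in> sets borel"
  shows "(\<lambda>x. LBINT s:A. a x s) \<in> borel_measurable M"
  unfolding set_lebesgue_integral_def by measurable

lemma integrable_indicator_Ioo: "integrable lborel (indicator {a<..<b :: real} :: real \<Rightarrow> real)"
  by (cases "a \<le> b") (auto intro!: integrable_real_indicator)

lemma abs_square_le: "\<bar>x\<bar> \<le> y \<Longrightarrow> \<bar>x\<^sup>2\<bar> \<le> (y :: real)\<^sup>2"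
  by (metis abs_ge_zero abs_power2 power2_abs power_mono)

text \<open>Fubini in the shift parameter against the plane. The inner norm is bounded uniformly in
  \<open>s\<close>, because a shift preserves the square norm.\<close>

lemma steklov_pairing_swap:
  fixes f g :: "real \<times> real \<Rightarrow> real"
  assumes [measurable]: "f \<in> borel_measurable borel" "g \<in> borel_measurable borel"
    and g: "integrable lborel (\<lambda>z. (g z)\<^sup>2)" and f: "integrable lborel (\<lambda>z. (f z)\<^sup>2)"
  shows "(\<integral>z. g z * (LBINT s:{0<..<h}. f (fst z + k * s, snd z)) \<partial>lborel)
    = (LBINT s:{0<..<h}. \<integral>z. g z * f (fst z + k * s, snd z) \<partial>lborel)" (is ?eq)
    and "integrable lborel (\<lambda>z. g z * (LBINT s:{0<..<h}. f (fst z + k * s, snd z)))" (is ?int)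
proof -
  let ?f = "\<lambda>s z. indicator {0<..<h} s * (g z * f (fst z + k * s, snd z))"
  have eq: "(fst z + k * s, snd z) = (k * s, 0) + z" for s :: real and z :: "real \<times> real" by (cases z) auto
  have fs: "integrable lborel (\<lambda>z. (f (fst z + k * s, snd z))\<^sup>2)" for s
    unfolding eq by (rule integrable_translate[OF f])
  have i: "integrable lborel (\<lambda>z. g z * f (fst z + k * s, snd z))" for s
    by (rule integrable_mult_L2) (use g fs in auto)
  define C where "C = (\<integral>z. (g z)\<^sup>2 \<partial>lborel) + (\<integral>z. (f z)\<^sup>2 \<partial>lborel)"
  have "(\<integral>z. \<bar>g z * f (fst z + k * s, snd z)\<bar> \<partial>lborel) \<le> C" for s
  proof -
    have "(\<integral>z. \<bar>g z * f (fst z + k * s, snd z)\<bar> \<partial>lborel) \<le> (\<integral>z. (g z)\<^sup>2 + (f (fst z + k * s, snd z))\<^sup>2 \<partial>lborel)"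
    proof (rule integral_mono)
      show "integrable lborel (\<lambda>z. \<bar>g z * f (fst z + k * s, snd z)\<bar>)" by (rule integrable_abs[OF i])
      show "integrable lborel (\<lambda>z. (g z)\<^sup>2 + (f (fst z + k * s, snd z))\<^sup>2)" using g fs by simp
    qed (rule square_bound_mult)
    also have "\<dots> = (\<integral>z. (g z)\<^sup>2 \<partial>lborel) + (\<integral>z. (f ((k * s, 0) + z))\<^sup>2 \<partial>lborel)" using g fs[of s] by (simp add: eq)
    also have "(\<integral>z. (f ((k * s, 0) + z))\<^sup>2 \<partial>lborel) = (\<integral>z. (f z)\<^sup>2 \<partial>lborel)"
      by (rule integral_translate[of "\<lambda>z. (f z)\<^sup>2"]) simp
    finally show ?thesis by (simp add: C_def)
  qed
  then have bd: "norm (\<integral>z. norm (?f s z) \<partial>lborel) \<le> norm (indicator {0<..<h} s * C)" for s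
    by (auto simp: indicator_def intro: order_trans[OF _ abs_ge_self])
  have I: "integrable (lborel \<Otimes>\<^sub>M lborel) (\<lambda>(s, z). ?f s z)"
  proof (rule lborel_pair.Fubini_integrable)
    show "integrable lborel (\<lambda>s. \<integral>z. norm (case (s, z) of (s, z) \<Rightarrow> ?f s z) \<partial>lborel)"
    proof (rule Bochner_Integration.integrable_bound)
      show "integrable lborel (\<lambda>s. indicator {0<..<h} s * C)"
        by (intro integrable_mult_left integrable_indicator_Ioo)
    qed (use bd in auto)
    show "AE s in lborel. integrable lborel (\<lambda>z. case (s, z) of (s, z) \<Rightarrow> ?f s z)"
      using i by simp
  qed measurable
  from lborel_pair.Fubini_integral[OF I]
  have "(\<integral>z. \<integral>s. ?f s z \<partial>lborel \<partial>lborel) = (\<integral>s. \<integral>z. ?f s z \<partial>lborel \<partial>lborel)" .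
  moreover have *: "(\<integral>s. ?f s z \<partial>lborel) = g z * (LBINT s:{0<..<h}. f (fst z + k * s, snd z))" for z
    unfolding set_lebesgue_integral_def
    by (subst integral_mult_right_zero[symmetric]) (simp add: ac_simps)
  ultimately show ?eq by (simp add: set_lebesgue_integral_def)
  show ?int using lborel_pair.integrable_snd[OF I] unfolding * .
qed

lemma integrable_bounded_on_rectangle:
  fixes f :: "real \<times> real \<Rightarrow> real"
  assumes [measurable]: "f \<in> borel_measurable borel" and "\<And>z. \<bar>f z\<bar> \<le> B"
    and "\<And>z. z \<notin> {a<..<b} \<times> {c<..<d} \<Longrightarrow> f z = 0"
  shows "integrable lborel f"
proof (rule Bochner_Integration.integrable_bound)
  show "integrable lborel (\<lambda>z :: real \<times> real. (B * indicator {a<..<b} (fst z)) * indicator {c<..<d} (snd z))"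
    by (intro integrable_lborel_prod_mult integrable_mult_right integrable_indicator_Ioo)
  show "AE z in lborel. norm (f z) \<le> norm ((B * indicator {a<..<b} (fst z)) * indicator {c<..<d} (snd z))"
  proof (rule AE_I2)
    fix z :: "real \<times> real"
    show "norm (f z) \<le> norm ((B * indicator {a<..<b} (fst z)) * indicator {c<..<d} (snd z))"
    proof (cases "z \<in> {a<..<b} \<times> {c<..<d}")
      case True
      then show ?thesis using assms(2)[of z] by (simp add: mem_Times_iff)
    next
      case False
      then show ?thesis using assms(3)[of z] by simp
    qed
  qed
qed measurable

lemma integrable_bounded_on_interval:
  fixes f :: "real \<Rightarrow> real"
  assumes [measurable]: "f \<in> borel_measurable borel" and "\<And>x. \<bar>f x\<bar> \<le> B"
    and "\<And>x. x \<notin> {c<..<d} \<Longrightarrow> f x = 0"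
  shows "integrable lborel f" "(\<integral>x. \<bar>f x\<bar> \<partial>lborel) \<le> B * \<bar>d - c\<bar>"
proof -
  have b: "integrable lborel (\<lambda>x. B * indicator {c<..<d} x :: real)"
    by (intro integrable_mult_right integrable_indicator_Ioo)
  have le: "\<bar>f x\<bar> \<le> B * indicator {c<..<d} x" for x
    using assms(2)[of x] assms(3)[of x] by (cases "x \<in> {c<..<d}") auto
  show f: "integrable lborel f"
  proof (rule Bochner_Integration.integrable_bound[OF b])
    show "AE x in lborel. norm (f x) \<le> norm (B * indicator {c<..<d} x :: real)"
      by (rule AE_I2) (use le in \<open>auto intro: order_trans[OF _ abs_ge_self]\<close>)
  qed measurable
  have "B \<ge> 0" using assms(2)[of 0] by simp
  have "(\<integral>x. \<bar>f x\<bar> \<partial>lborel) \<le> (\<integral>x. B * indicator {c<..<d} x \<partial>lborel)"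
    by (rule integral_mono[OF integrable_abs[OF f] b le])
  also have "\<dots> \<le> B * \<bar>d - c\<bar>" using \<open>B \<ge> 0\<close> by (cases "c \<le> d") auto
  finally show "(\<integral>x. \<bar>f x\<bar> \<partial>lborel) \<le> B * \<bar>d - c\<bar>" .
qed

lemma L2_on_rectangle_integrable:
  fixes f :: "real \<times> real \<Rightarrow> real"
  assumes [measurable]: "f \<in> borel_measurable borel" and f: "integrable lborel (\<lambda>z. (f z)\<^sup>2)"
    and "\<And>z. z \<notin> {a<..<b} \<times> {c<..<d} \<Longrightarrow> f z = 0"
  shows "integrable lborel f"
proof -
  let ?I = "\<lambda>z. indicator {a<..<b} (fst z) * indicator {c<..<d} (snd z) :: real"
  have "integrable lborel (\<lambda>z. ?I z * f z)"
  proof (rule integrable_mult_L2)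
    show "integrable lborel (\<lambda>z :: real \<times> real. (?I z)\<^sup>2)"
      by (rule integrable_bounded_on_rectangle[where B=1 and a=a and b=b and c=c and d=d])
        (auto simp: indicator_def mem_Times_iff)
  qed (use f in auto)
  moreover have "?I z * f z = f z" for z
    using assms(3)[of z] by (cases "z \<in> {a<..<b} \<times> {c<..<d}") (auto simp: mem_Times_iff)
  ultimately show ?thesis by simp
qed

lemma primitive_zero:
  fixes f :: "real \<Rightarrow> real"
  assumes "\<And>s. s \<in> A \<Longrightarrow> f s = 0"
  shows "(LBINT s:A. f s) = 0"
proof -
  have "(LBINT s:A. f s) = (\<integral>s. 0 \<partial>(lborel :: real measure))"
    unfolding set_lebesgue_integral_def
    by (rule Bochner_Integration.integral_cong) (use assms in \<open>auto simp: indicator_def\<close>)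
  then show ?thesis by simp
qed

text \<open>Let \<open>N\<close> be the tail integral of \<open>\<mu>\<close> and \<open>V\<close>
  the primitive of \<open>vx\<close>. Formally \<open>N_x = - \<mu>\<close>,
  \<open>N_t = - G\<close> and \<open>V_t = vt\<close>, and the two sides differ by one integration
  by parts in \<open>x\<close> and one in \<open>t\<close>. Boundary terms vanish because
  \<open>N\<close> is 0 at the initial time and at \<open>L\<close>, and \<open>V\<close> at the
  final time and at 0. As \<open>\<mu>\<close> has no time derivative among functions, difference
  quotients take its place.\<close>

lemma cross_pairing:
  fixes \<mu> G vt vx :: "real \<times> real \<Rightarrow> real" and T L B :: real
  defines "Q \<equiv> {0<..<T} \<times> {0<..<L}"
  assumes meas[measurable]: "\<mu> \<in> borel_measurable borel" "G \<in> borel_measurable borel"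
      "vt \<in> borel_measurable borel" "vx \<in> borel_measurable borel"
    and L2: "integrable lborel (\<lambda>z. (G z)\<^sup>2)" "integrable lborel (\<lambda>z. (vt z)\<^sup>2)" "integrable lborel (\<lambda>z. (vx z)\<^sup>2)"
    and supp: "\<And>z. z \<notin> Q \<Longrightarrow> \<mu> z = 0" "\<And>z. z \<notin> Q \<Longrightarrow> G z = 0"
      "\<And>z. z \<notin> Q \<Longrightarrow> vt z = 0" "\<And>z. z \<notin> Q \<Longrightarrow> vx z = 0"
    and \<mu>B: "\<And>z. \<bar>\<mu> z\<bar> \<le> B"
    and N: "AE z in lborel. z \<in> Q \<longrightarrow> (LBINT y:{snd z<..}. \<mu> (fst z, y)) = - (LBINT s:{..<fst z}. G (s, snd z))"
    and v: "AE z in lborel. z \<in> Q \<longrightarrow> (LBINT y:{..<snd z}. vx (fst z, y)) = - (LBINT s:{fst z<..}. vt (s, snd z))"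
  shows "(\<integral>z. \<mu> z * vt z \<partial>lborel) = (\<integral>z. vx z * G z \<partial>lborel)"
proof -
  note supp' = supp[unfolded Q_def]
  have \<mu>2: "integrable lborel (\<lambda>z. (\<mu> z)\<^sup>2)"
  proof (rule integrable_bounded_on_rectangle[where B="B\<^sup>2" and a=0 and b=T and c=0 and d=L])
    show "\<bar>(\<mu> z)\<^sup>2\<bar> \<le> B\<^sup>2" for z using \<mu>B[of z] by (metis abs_ge_zero abs_power2 power2_abs power_mono)
  qed (use supp' in auto)
  have \<mu>1: "integrable lborel \<mu>" by (rule integrable_bounded_on_rectangle[OF meas(1) \<mu>B supp'(1)])
  have G1: "integrable lborel G" by (rule L2_on_rectangle_integrable[OF meas(2) L2(1) supp'(2)])
  have vt1: "integrable lborel vt" by (rule L2_on_rectangle_integrable[OF meas(3) L2(2) supp'(3)])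
  have vx1: "integrable lborel vx" by (rule L2_on_rectangle_integrable[OF meas(4) L2(3) supp'(4)])
  define V where "V z = (LBINT y:{..<snd z}. vx (fst z, y))" for z
  define N where "N z = (LBINT y:{snd z<..}. \<mu> (fst z, y))" for z
  have [measurable]: "V \<in> borel_measurable borel" "N \<in> borel_measurable borel"
    unfolding V_def[abs_def] N_def[abs_def] by (intro primitive_x_measurable meas)+
  have NB: "\<bar>N z\<bar> \<le> B * \<bar>L - 0\<bar>" for z
  proof -
    have *: "integrable lborel (\<lambda>y. \<mu> (fst z, y))" "(\<integral>y. \<bar>\<mu> (fst z, y)\<bar> \<partial>lborel) \<le> B * \<bar>L - 0\<bar>"
    proof -
      have m: "(\<lambda>y. \<mu> (fst z, y)) \<in> borel_measurable borel" by measurable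
      have z: "\<mu> (fst z, y) = 0" if "y \<notin> {0<..<L}" for y using that by (intro supp') auto
      show "integrable lborel (\<lambda>y. \<mu> (fst z, y))" "(\<integral>y. \<bar>\<mu> (fst z, y)\<bar> \<partial>lborel) \<le> B * \<bar>L - 0\<bar>"
        using integrable_bounded_on_interval[OF m \<mu>B z, of 0 L] by simp_all
    qed
    show ?thesis unfolding N_def by (rule order_trans[OF primitive_bound[OF *(1)] *(2)])
  qed
  \<comment> \<open>A forward step for \<open>V\<close> on the left becomes a backward step for
    \<open>N\<close> on the right; a shift of the time variable exchanges them.\<close>
  have key: "(LBINT s:{0<..<h}. \<integral>z. \<mu> z * vt (fst z + 1 * s, snd z) \<partial>lborel)
    = (LBINT s:{0<..<h}. \<integral>z. vx z * G (fst z + (- 1) * s, snd z) \<partial>lborel)" if h: "h > 0" for h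
  proof -
    have shift: "(fst z + h, snd z) = (h, 0) + z" "(fst z - h, snd z) = (- h, 0) + z" for z :: "real \<times> real"
      by (cases z, simp)+
    have vt': "AE z :: real \<times> real in lborel. integrable lborel (\<lambda>s. vt (s, snd z))" by (rule AE_lborel2_snd[OF lborel2_AE_snd[OF vt1]])
    have G': "AE z :: real \<times> real in lborel. integrable lborel (\<lambda>s. G (s, snd z))" by (rule AE_lborel2_snd[OF lborel2_AE_snd[OF G1]])
    have 1: "(\<integral>z. \<mu> z * (LBINT s:{0<..<h}. vt (fst z + 1 * s, snd z)) \<partial>lborel) = (\<integral>z. \<mu> z * (V (fst z + h, snd z) - V z) \<partial>lborel)"
    proof (rule integral_cong_AE)
      show "AE z in lborel. \<mu> z * (LBINT s:{0<..<h}. vt (fst z + 1 * s, snd z)) = \<mu> z * (V (fst z + h, snd z) - V z)"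
        using vt' v AE_translate[OF v, of "(h, 0)"]
      proof eventually_elim
        case (elim z)
        show ?case
        proof (cases "z \<in> Q")
          case True
          have a: "V z = - (LBINT s:{fst z<..}. vt (s, snd z))" using elim True by (simp add: V_def)
          \<comment> \<open>The hypothesis \<open>v\<close> is available only inside the rectangle.
            Past the final time both sides vanish, because \<open>vx\<close> and \<open>vt\<close>
            do.\<close>
          have b: "V (fst z + h, snd z) = - (LBINT s:{fst z + h<..}. vt (s, snd z))"
          proof (cases "fst z + h < T")
            case True
            then have "(h, 0) + z \<in> Q" using \<open>z \<in> Q\<close> h by (auto simp: Q_def mem_Times_iff)
            then show ?thesis using elim by (simp add: V_def add.commute)
          next
            case False
            have "V (fst z + h, snd z) = 0" unfolding V_def
              by (rule primitive_zero) (use False in \<open>auto intro!: supp simp: Q_def\<close>)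
            moreover have "(LBINT s:{fst z + h<..}. vt (s, snd z)) = 0"
              by (rule primitive_zero) (use False in \<open>auto intro!: supp simp: Q_def\<close>)
            ultimately show ?thesis by simp
          qed
          show ?thesis unfolding a b using primitive_diff_right[OF elim(1) h, of "fst z"] by simp
        qed (simp add: supp)
      qed
    qed measurable
    have i\<mu>V: "integrable lborel (\<lambda>z. \<mu> z * W z)" "(\<integral>z. \<mu> z * W z \<partial>lborel) = (\<integral>z. w z * N z \<partial>lborel)"
      "integrable lborel (\<lambda>z. w z * N z)"
      if w: "integrable lborel w" and W: "W = (\<lambda>z. LBINT y:{..<snd z}. w (fst z, y))" for w W
    proof -
      have [measurable]: "w \<in> borel_measurable borel" using w by (auto dest: borel_measurable_integrable)
      have Wm[measurable]: "W \<in> borel_measurable borel" unfolding W by (intro primitive_x_measurable) measurable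
      \<comment> \<open>\<open>W\<close> need not be integrable, as a primitive may stay at a
        nonzero constant beyond the support. The indicator can be inserted since
        \<open>\<mu>\<close> vanishes outside the rectangle.\<close>
      have "integrable lborel (\<lambda>z. (LBINT y:{..<snd z}. w (fst z, y)) * (1 * indicator {0<..<L} (snd z)))"
        by (rule primitive_x_pairing(1)[OF w, where p="\<lambda>_. 1" and B=1])
          (auto intro: integrable_indicator_Ioo)
      then have "integrable lborel (\<lambda>z. \<mu> z * ((LBINT y:{..<snd z}. w (fst z, y)) * (1 * indicator {0<..<L} (snd z))))"
        by (rule integrable_mult_bounded[OF _ _ \<mu>B]) measurable
      then have "integrable lborel (\<lambda>z. \<mu> z * (W z * (1 * indicator {0<..<L} (snd z))))" by (simp add: W)
      moreover have W1: "\<mu> z * (W z * (1 * indicator {0<..<L} (snd z))) = \<mu> z * W z" for z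
        using supp(1)[of z] by (cases "z \<in> Q") (auto simp: Q_def mem_Times_iff)
      ultimately show i1: "integrable lborel (\<lambda>z. \<mu> z * W z)" unfolding W1 by blast
      have "integrable lborel (\<lambda>z. N z * w z)" by (rule integrable_mult_bounded[OF w _ NB]) measurable
      then show i2: "integrable lborel (\<lambda>z. w z * N z)" by (simp add: mult.commute)
      have "(\<integral>z. \<mu> z * W z \<partial>lborel) = (\<integral>t. \<integral>x. \<mu> (t, x) * W (t, x) \<partial>lborel \<partial>lborel)"
        by (rule lborel2_integral_fst[OF i1])
      also have "\<dots> = (\<integral>t. \<integral>x. w (t, x) * N (t, x) \<partial>lborel \<partial>lborel)"
      proof (rule integral_cong_AE)
        show "AE t in lborel. (\<integral>x. \<mu> (t, x) * W (t, x) \<partial>lborel) = (\<integral>x. w (t, x) * N (t, x) \<partial>lborel)"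
          using lborel2_AE_fst[OF w] lborel2_AE_fst[OF \<mu>1]
          by eventually_elim (simp add: W N_def integral_triangle)
      qed measurable
      also have "\<dots> = (\<integral>z. w z * N z \<partial>lborel)" by (rule lborel2_integral_fst[OF i2, symmetric])
      finally show "(\<integral>z. \<mu> z * W z \<partial>lborel) = (\<integral>z. w z * N z \<partial>lborel)" .
    qed
    have vxh: "integrable lborel (\<lambda>z. vx (fst z + h, snd z))" unfolding shift by (rule integrable_translate[OF vx1])
    note A = i\<mu>V[OF vxh, of "\<lambda>z. V (fst z + h, snd z)"] and A' = i\<mu>V[OF vx1, of V]
    have Vh: "(\<lambda>z. V (fst z + h, snd z)) = (\<lambda>z. LBINT y:{..<snd z}. vx (fst (fst z, y) + h, snd (fst z, y)))"
      by (simp add: V_def)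
    have V: "V = (\<lambda>z. LBINT y:{..<snd z}. vx (fst z, y))" by (simp add: V_def[abs_def])
    have "(\<integral>z. \<mu> z * (V (fst z + h, snd z) - V z) \<partial>lborel)
      = (\<integral>z. \<mu> z * V (fst z + h, snd z) \<partial>lborel) - (\<integral>z. \<mu> z * V z \<partial>lborel)"
      unfolding right_diff_distrib by (rule Bochner_Integration.integral_diff[OF A(1)[OF Vh] A'(1)[OF V]])
    also have "\<dots> = (\<integral>z. vx (fst z + h, snd z) * N z \<partial>lborel) - (\<integral>z. vx z * N z \<partial>lborel)"
      unfolding A(2)[OF Vh] A'(2)[OF V] ..
    \<comment> \<open>Translation invariance moves the shift from \<open>vx\<close> to
      \<open>N\<close>, with the opposite sign.\<close>
    also have "(\<integral>z. vx (fst z + h, snd z) * N z \<partial>lborel) = (\<integral>z. vx z * N (fst z - h, snd z) \<partial>lborel)"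
      using integral_translate[of "\<lambda>z. vx z * N (fst z - h, snd z)" "(h, 0)"] by (simp add: shift(1)[symmetric])
    also have "\<dots> - (\<integral>z. vx z * N z \<partial>lborel) = (\<integral>z. vx z * (N (fst z - h, snd z) - N z) \<partial>lborel)"
    proof -
      have "integrable lborel (\<lambda>z. N (fst z - h, snd z) * vx z)" by (rule integrable_mult_bounded[OF vx1 _ NB]) measurable
      then show ?thesis unfolding right_diff_distrib
        by (intro Bochner_Integration.integral_diff[symmetric] A'(3)[OF V]) (simp add: mult.commute)
    qed
    also have "\<dots> = (\<integral>z. vx z * (LBINT s:{0<..<h}. G (fst z + (- 1) * s, snd z)) \<partial>lborel)"
    proof (rule integral_cong_AE)
      show "AE z in lborel. vx z * (N (fst z - h, snd z) - N z) = vx z * (LBINT s:{0<..<h}. G (fst z + (- 1) * s, snd z))"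
        \<comment> \<open>\<open>assms(14)\<close> is the hypothesis on the tail integrals of
          \<open>\<mu>\<close>.\<close>
        using G' assms(14) AE_translate[OF assms(14), of "(- h, 0)"]
      proof eventually_elim
        case (elim z)
        show ?case
        proof (cases "z \<in> Q")
          case True
          have a: "N z = - (LBINT s:{..<fst z}. G (s, snd z))" using elim True by (simp add: N_def)
          have b: "N (fst z - h, snd z) = - (LBINT s:{..<fst z - h}. G (s, snd z))"
          proof (cases "fst z - h > 0")
            case True
            then have "(- h, 0) + z \<in> Q" using \<open>z \<in> Q\<close> h by (auto simp: Q_def mem_Times_iff)
            then show ?thesis using elim by (simp add: N_def)
          next
            case False
            have "N (fst z - h, snd z) = 0" unfolding N_def
              by (rule primitive_zero) (use False in \<open>auto intro!: supp simp: Q_def\<close>)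
            moreover have "(LBINT s:{..<fst z - h}. G (s, snd z)) = 0"
              by (rule primitive_zero) (use False in \<open>auto intro!: supp simp: Q_def\<close>)
            ultimately show ?thesis by simp
          qed
          show ?thesis unfolding a b using primitive_diff_left[OF elim(1) h, of "fst z"] by simp
        qed (simp add: supp)
      qed
    qed measurable
    finally show ?thesis
      using 1 steklov_pairing_swap(1)[OF meas(3,1) \<mu>2 L2(2), of h 1] steklov_pairing_swap(1)[OF meas(2,4) L2(3,1), of h "-1"]
      by (simp only:)
  qed
  have l1: "((\<lambda>h. (LBINT s:{0<..<h}. \<integral>z. \<mu> z * vt (fst z + 1 * s, snd z) \<partial>lborel) / h) \<longlongrightarrow> (\<integral>z. \<mu> z * vt z \<partial>lborel)) (at_right 0)"
    by (rule steklov_pairing_tendsto[OF meas(3,1) \<mu>2 L2(2)]) simp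
  have l2: "((\<lambda>h. (LBINT s:{0<..<h}. \<integral>z. vx z * G (fst z + (- 1) * s, snd z) \<partial>lborel) / h) \<longlongrightarrow> (\<integral>z. vx z * G z \<partial>lborel)) (at_right 0)"
    by (rule steklov_pairing_tendsto[OF meas(2,4) L2(3,1)]) simp
  have "\<forall>\<^sub>F h in at_right 0. (LBINT s:{0<..<h}. \<integral>z. \<mu> z * vt (fst z + 1 * s, snd z) \<partial>lborel) / h
    = (LBINT s:{0<..<h}. \<integral>z. vx z * G (fst z + (- 1) * s, snd z) \<partial>lborel) / h"
    using key by (auto simp: eventually_at_filter)
  from tendsto_cong[OF this] l1 l2 show ?thesis
    by (metis (no_types, lifting) tendsto_unique trivial_limit_at_right_real)
qed


section \<open>The maximum principle for the one-dimensional Fokker-Planck equation\<close>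

text \<open>The negative part is cubed, not squared, because the derivative of the resulting entropy is then
  itself continuously differentiable, as the chain rule for primitives requires.\<close>

definition neg_cube :: "real \<Rightarrow> real" where "neg_cube s = (max 0 (- s)) ^ 3 / 3"

lemma neg_square_deriv:
  "((\<lambda>s. - ((max 0 (- s))\<^sup>2)) has_real_derivative 2 * max 0 (- s)) (at s)"
proof -
  consider "s < 0" | "s > 0" | "s = 0" by linarith
  then show ?thesis
  proof cases
    case 1
    have "((\<lambda>s. - (s\<^sup>2)) has_real_derivative 2 * max 0 (- s)) (at s)"
      using 1 by (auto intro!: derivative_eq_intros)
    moreover have "\<forall>\<^sub>F y in nhds s. y \<in> {..<0}" using 1 by (intro eventually_nhds_in_open) auto
    then have "\<forall>\<^sub>F y in nhds s. - (y\<^sup>2) = - ((max 0 (- y))\<^sup>2)" by eventually_elim (simp add: max_def)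
    ultimately show ?thesis by (subst DERIV_cong_ev[OF refl _ refl, symmetric])
  next
    case 2
    have "((\<lambda>s. 0) has_real_derivative 2 * max 0 (- s)) (at s)" using 2 by simp
    moreover have "\<forall>\<^sub>F y in nhds s. y \<in> {0<..}" using 2 by (intro eventually_nhds_in_open) auto
    then have "\<forall>\<^sub>F y in nhds s. 0 = - ((max 0 (- y))\<^sup>2)" by eventually_elim (simp add: max_def)
    ultimately show ?thesis by (subst DERIV_cong_ev[OF refl _ refl, symmetric])
  next
    case 3
    have "((\<lambda>h::real. - (max 0 (- h))\<^sup>2 / h) \<longlongrightarrow> 0) (at 0)"
    proof (rule Lim_null_comparison)
      show "\<forall>\<^sub>F h :: real in at 0. norm (- (max 0 (- h))\<^sup>2 / h) \<le> \<bar>h\<bar>"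
        by (auto simp: eventually_at_filter max_def power2_eq_square)
      show "((\<lambda>h::real. \<bar>h\<bar>) \<longlongrightarrow> 0) (at 0)" using tendsto_rabs[OF tendsto_ident_at[of 0 UNIV]] by simp
    qed
    then show ?thesis using 3 by (simp add: DERIV_def)
  qed
qed

text \<open>The tangent inequality of a convex function stands in for the chain rule in time, since
  \<open>m\<close> has time increments but no time derivative. Its core is
  \<open>2 a^3 - 3 a^2 b + b^3 = (a - b)^2 (2 a + b)\<close>.\<close>

lemma neg_cube_convex: "neg_cube s - neg_cube t \<le> - ((max 0 (- s))\<^sup>2) * (s - t)"
proof -
  define a b where "a = max 0 (- s)" and "b = max 0 (- t)"
  have ab: "a \<ge> 0" "b \<ge> 0" by (auto simp: a_def b_def)
  have "0 \<le> (a - b)\<^sup>2 * (2 * a + b)" using ab by simp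
  then have "3 * a\<^sup>2 * b \<le> 2 * a ^ 3 + b ^ 3" by (simp add: power2_eq_square power3_eq_cube algebra_simps)
  then have 1: "a ^ 3 / 3 - b ^ 3 / 3 \<le> a\<^sup>2 * (a - b)" by (simp add: power2_eq_square power3_eq_cube algebra_simps)
  have "a\<^sup>2 * (a - b) \<le> - (a\<^sup>2) * (s - t)"
  proof (cases "s < 0")
    case True
    then have "a = - s" "- t \<le> b" by (auto simp: a_def b_def)
    then have "a - b \<le> t - s" by linarith
    from mult_left_mono[OF this, of "a\<^sup>2"] show ?thesis by (simp add: algebra_simps)
  next
    case False
    then have "a = 0" by (simp add: a_def)
    then show ?thesis by simp
  qed
  with 1 show ?thesis unfolding neg_cube_def a_def[symmetric] b_def[symmetric] by linarith
qed

lemma neg_cube_nonneg: "0 \<le> neg_cube s" by (simp add: neg_cube_def)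

lemma neg_cube_zero: "0 \<le> s \<Longrightarrow> neg_cube s = 0" by (simp add: neg_cube_def max_def)

lemma neg_cube_measurable [measurable]: "neg_cube \<in> borel_measurable borel"
  unfolding neg_cube_def[abs_def] by measurable

lemma neg_cube_bound: "\<bar>s\<bar> \<le> B \<Longrightarrow> neg_cube s \<le> B ^ 3 / 3"
  unfolding neg_cube_def by (intro divide_right_mono power_mono) auto

text \<open>With \<open>n = - m > 0\<close> the mixed term is absorbed into the diffusion by
  completing the square in \<open>p\<close>. What remains is \<open>C^2 n^3 / (2 a0)\<close>; the
  factor 3 in the constant compensates the division by 3 in \<open>neg_cube\<close>.\<close>

lemma drift_diffusion_absorb:
  fixes a c m p :: real
  assumes "a \<ge> a0" "a0 > 0" "\<bar>c\<bar> \<le> C"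
  shows "- (2 * max 0 (- m) * p) * (a * p + c * m) \<le> (3 * C\<^sup>2 / (2 * a0)) * neg_cube m"
proof (cases "m < 0")
  case True
  define n where "n = - m"
  have n: "n > 0" "max 0 (- m) = n" "m = - n" using True by (auto simp: n_def)
  have 1: "2 * (c * n * p) \<le> 2 * a0 * p\<^sup>2 + C\<^sup>2 * n\<^sup>2 / (2 * a0)"
  proof -
    have "0 \<le> (2 * a0 * p - c * n)\<^sup>2" by simp
    then have "4 * a0 * (c * n * p) \<le> 4 * a0\<^sup>2 * p\<^sup>2 + c\<^sup>2 * n\<^sup>2" by (simp add: power2_eq_square algebra_simps)
    also have "c\<^sup>2 * n\<^sup>2 \<le> C\<^sup>2 * n\<^sup>2" using assms(3) by (intro mult_right_mono) (auto simp: abs_le_square_iff[symmetric])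
    finally have "2 * a0 * (2 * (c * n * p)) \<le> 2 * a0 * (2 * a0 * p\<^sup>2 + C\<^sup>2 * n\<^sup>2 / (2 * a0))"
      using assms(2) by (simp add: power2_eq_square algebra_simps)
    then show ?thesis using assms(2) by (subst (asm) mult_le_cancel_left_pos) auto
  qed
  have 2: "a0 * p\<^sup>2 \<le> a * p\<^sup>2" using assms(1) by (intro mult_right_mono) auto
  have "- (2 * n * p) * (a * p + c * m) = n * (2 * (c * n * p) - 2 * (a * p\<^sup>2))"
    by (simp add: n(3) power2_eq_square algebra_simps)
  also have "\<dots> \<le> n * (C\<^sup>2 * n\<^sup>2 / (2 * a0))" using 1 2 n(1) by (intro mult_left_mono) auto
  also have "\<dots> = (3 * C\<^sup>2 / (2 * a0)) * neg_cube m"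
    using assms(2) by (simp add: neg_cube_def n(2) power2_eq_square power3_eq_cube field_simps)
  finally show ?thesis by (simp add: n(2))
next
  case False
  then show ?thesis by (simp add: neg_cube_def max_def)
qed

text \<open>A Gronwall argument for \<open>Y\<close>, the integral of \<open>neg_cube m\<close> with
  an exponential weight. In time, convexity bounds the increment of \<open>neg_cube\<close> by its
  derivative at \<open>m\<close> times the increment of \<open>m\<close>. In \<open>x\<close>, the
  chain rule writes that derivative as a primitive, and \<open>integral_triangle\<close> moves the
  primitive onto the increment, producing the tail integral that the equation controls. In the limit
  \<open>K * Y \<le> k * Y\<close> with \<open>K > k\<close>, so \<open>Y\<close> vanishes.\<close>

lemma fokker_planck_nonneg:
  fixes m mx a c :: "real \<times> real \<Rightarrow> real" and m0 :: "real \<Rightarrow> real" and T L B A C a0 :: real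
  defines "Q \<equiv> {0<..<T} \<times> {0<..<L}"
  assumes meas[measurable]: "m \<in> borel_measurable borel" "mx \<in> borel_measurable borel"
      "a \<in> borel_measurable borel" "c \<in> borel_measurable borel" "m0 \<in> borel_measurable borel"
    and mx2: "integrable lborel (\<lambda>z. (mx z)\<^sup>2)"
    and supp: "\<And>z. z \<notin> Q \<Longrightarrow> m z = 0" "\<And>z. z \<notin> Q \<Longrightarrow> mx z = 0" "\<And>x. x \<notin> {0<..<L} \<Longrightarrow> m0 x = 0"
    and mB: "\<And>z. \<bar>m z\<bar> \<le> B" "\<And>x. \<bar>m0 x\<bar> \<le> B" and m0: "\<And>x. m0 x \<ge> 0"
    and a: "a0 > 0" "\<And>z. z \<in> Q \<Longrightarrow> a0 \<le> a z" "\<And>z. \<bar>a z\<bar> \<le> A" and c: "\<And>z. \<bar>c z\<bar> \<le> C"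
    and mprim: "AE z in lborel. z \<in> Q \<longrightarrow> m z = (LBINT y:{..<snd z}. mx (fst z, y))"
    and F: "\<And>z. F z = a z * mx z + c z * m z"
    and eq: "AE z in lborel. z \<in> Q \<longrightarrow> (LBINT y:{snd z<..}. m (fst z, y))
      = (LBINT y:{snd z<..}. m0 y) - (LBINT s:{..<fst z}. F (s, snd z))"
  shows "AE z in lborel. m z \<ge> 0"
proof -
  have F': "F = (\<lambda>z. a z * mx z + c z * m z)" using F by auto
  have Fm[measurable]: "F \<in> borel_measurable borel" unfolding F' by measurable
  have suppF: "F z = 0" if "z \<notin> Q" for z using that supp by (simp add: F)
  note supp' = supp[unfolded Q_def] and suppF' = suppF[unfolded Q_def]
  have Qm[measurable]: "Q \<in> sets borel" unfolding Q_def by (intro borel_open open_Times) auto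
  have B0: "B \<ge> 0" using mB(1)[of 0] by simp
  have A0: "A \<ge> 0" using a(3)[of 0] by simp
  have mx1: "integrable lborel mx" by (rule L2_on_rectangle_integrable[OF meas(2) mx2 supp'(2)])
  have m2: "integrable lborel (\<lambda>z. (c z * m z)\<^sup>2)"
  proof (rule integrable_bounded_on_rectangle[where B="(C * B)\<^sup>2" and a=0 and b=T and c=0 and d=L])
    show "\<bar>(c z * m z)\<^sup>2\<bar> \<le> (C * B)\<^sup>2" for z
    proof -
      have "\<bar>c z * m z\<bar> \<le> C * B" unfolding abs_mult using c[of z] mB(1)[of z] by (intro mult_mono) auto
      then show ?thesis by (metis abs_ge_zero abs_power2 power2_abs power_mono)
    qed
  qed (use supp' in auto)
  have a2: "integrable lborel (\<lambda>z. (a z * mx z)\<^sup>2)"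
    unfolding power_mult_distrib
    by (rule integrable_mult_bounded[OF mx2, where B="A\<^sup>2"])
      (use a(3) A0 in \<open>auto simp: abs_le_square_iff[symmetric]\<close>)
  have F2: "integrable lborel (\<lambda>z. (F z)\<^sup>2)"
  proof (rule Bochner_Integration.integrable_bound)
    show "integrable lborel (\<lambda>z. 2 * (a z * mx z)\<^sup>2 + 2 * (c z * m z)\<^sup>2)" using a2 m2 by simp
    have "(x + y)\<^sup>2 \<le> 2 * x\<^sup>2 + 2 * y\<^sup>2" for x y :: real using sum_squares_bound[of x y] by (simp add: power2_sum)
    then show "AE z in lborel. norm ((F z)\<^sup>2) \<le> norm (2 * (a z * mx z)\<^sup>2 + 2 * (c z * m z)\<^sup>2)"
      by (intro AE_I2) (simp add: F)
  qed measurable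
  have F1: "integrable lborel F" by (rule L2_on_rectangle_integrable[OF Fm F2 suppF'])
  \<comment> \<open>\<open>k\<close> is the constant of \<open>drift_diffusion_absorb\<close>; the
    excess of \<open>K\<close> over \<open>k\<close> is what forces \<open>Y\<close> to be
    0.\<close>
  define k where "k = 3 * C\<^sup>2 / (2 * a0)"
  define K where "K = k + 1"
  have k0: "k \<ge> 0" using a(1) by (simp add: k_def)
  have K0: "K > 0" using k0 by (simp add: K_def)
  define w where "w t = indicator {0<..<T} t * exp (- K * t)" for t
  have wm[measurable]: "w \<in> borel_measurable borel" unfolding w_def[abs_def] by measurable
  have w01: "0 \<le> w t" "w t \<le> 1" for t
    using K0 by (auto simp: w_def indicator_def)
  have wpos: "w t > 0" if "t \<in> {0<..<T}" for t using that by (simp add: w_def)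
  \<comment> \<open>Only an inequality, since the shifted time may lie beyond \<open>T\<close>,
    where the weight is 0.\<close>
  have wshift: "w (t + h) \<le> exp (- K * h) * w t" if "h > 0" "t > 0" for t h
    using that by (auto simp: w_def indicator_def exp_add[symmetric] algebra_simps)
  \<comment> \<open>The weighted \<open>x\<close>-derivative of the test function
    \<open>- ((max 0 (- m z))\<^sup>2)\<close>, which is itself the derivative of
    \<open>neg_cube\<close> at \<open>m z\<close>.\<close>
  define g where "g z = w (fst z) * (2 * max 0 (- m z)) * mx z" for z
  have gm[measurable]: "g \<in> borel_measurable borel" unfolding g_def[abs_def] by measurable
  have g2: "integrable lborel (\<lambda>z. (g z)\<^sup>2)"
  proof -
    have "\<bar>(w (fst z) * (2 * max 0 (- m z)))\<^sup>2\<bar> \<le> (1 * (2 * B))\<^sup>2" for z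
    proof (rule abs_square_le)
      have "\<bar>2 * max 0 (- m z)\<bar> \<le> 2 * B" using mB(1)[of z] by auto
      then show "\<bar>w (fst z) * (2 * max 0 (- m z))\<bar> \<le> 1 * (2 * B)"
        unfolding abs_mult[of "w _"] using w01[of "fst z"] by (intro mult_mono) auto
    qed
    then show ?thesis unfolding g_def power_mult_distrib[of _ "mx _"]
      by (intro integrable_mult_bounded[OF mx2]) auto
  qed
  define Y where "Y = (\<integral>z. w (fst z) * neg_cube (m z) \<partial>lborel)"
  have jB: "\<bar>neg_cube (m z)\<bar> \<le> B ^ 3 / 3" for z using neg_cube_bound[OF mB(1)] neg_cube_nonneg by simp
  have iY: "integrable lborel (\<lambda>z. w (fst z) * neg_cube (m z))"
  proof (rule integrable_bounded_on_rectangle[where B="1 * (B ^ 3 / 3)" and a=0 and b=T and c=0 and d=L])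
    show "\<bar>w (fst z) * neg_cube (m z)\<bar> \<le> 1 * (B ^ 3 / 3)" for z
      unfolding abs_mult using w01[of "fst z"] jB B0 by (intro mult_mono) auto
  qed (use supp' in \<open>auto simp: neg_cube_zero\<close>)
  have key: "(1 - exp (- K * h)) * Y \<le> - (LBINT s:{0<..<h}. \<integral>z. g z * F (fst z + (- 1) * s, snd z) \<partial>lborel)" if h: "h > 0" for h
  proof -
    \<comment> \<open>The density one step earlier, continued before time 0 by the initial value, so
      that increments over the first step fit the integrated equation too.\<close>
    define mh where "mh z = (if fst z \<le> h then m0 (snd z) else m (fst z - h, snd z))" for z
    have [measurable]: "mh \<in> borel_measurable borel" unfolding mh_def[abs_def] by measurable
    have mhB: "\<bar>mh z\<bar> \<le> B" for z using mB by (simp add: mh_def)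
    \<comment> \<open>For times up to \<open>h\<close> both sides are 0: the left one because
      \<open>m0 \<ge> 0\<close>, the right one because \<open>m\<close> vanishes outside the
      rectangle. This is where the sign of the initial density enters.\<close>
    have jmh: "neg_cube (mh z) = neg_cube (m (fst z - h, snd z))" for z
      using m0 h by (auto simp: mh_def neg_cube_zero supp'(1))
    define r where "r z = w (fst z) * (- ((max 0 (- m z))\<^sup>2) * (m z - mh z))" for z
    have [measurable]: "r \<in> borel_measurable borel" unfolding r_def[abs_def] by measurable
    have ir: "integrable lborel r"
    proof (rule integrable_bounded_on_rectangle[where B="1 * (B\<^sup>2 * (B + B))" and a=0 and b=T and c=0 and d=L])
      show "\<bar>r z\<bar> \<le> 1 * (B\<^sup>2 * (B + B))" for z
      proof -
        have "\<bar>m z - mh z\<bar> \<le> B + B" using mB(1)[of z] mhB[of z] by linarith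
        moreover have "\<bar>(max 0 (- m z))\<^sup>2\<bar> \<le> B\<^sup>2" using mB(1)[of z] by (intro abs_square_le) auto
        ultimately show ?thesis unfolding r_def abs_mult abs_minus_cancel
          using w01[of "fst z"] by (intro mult_mono) auto
      qed
    qed (use supp' in \<open>auto simp: r_def\<close>)
    have iYh: "integrable lborel (\<lambda>z. w (fst z) * neg_cube (m (fst z - h, snd z)))"
    proof (rule integrable_bounded_on_rectangle[where B="1 * (B ^ 3 / 3)" and a=0 and b=T and c=0 and d=L])
      show "\<bar>w (fst z) * neg_cube (m (fst z - h, snd z))\<bar> \<le> 1 * (B ^ 3 / 3)" for z
        unfolding abs_mult using w01[of "fst z"] jB B0 by (intro mult_mono) auto
      show "w (fst z) * neg_cube (m (fst z - h, snd z)) = 0" if "z \<notin> {0<..<T} \<times> {0<..<L}" for z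
        using that supp'(1)[of "(fst z - h, snd z)"]
        by (cases "fst z \<in> {0<..<T}") (auto simp: w_def neg_cube_zero mem_Times_iff)
    qed measurable
    have Yh: "(\<integral>z. w (fst z) * neg_cube (m (fst z - h, snd z)) \<partial>lborel) \<le> exp (- K * h) * Y"
    proof -
      have "(\<integral>z. w (fst z) * neg_cube (m (fst z - h, snd z)) \<partial>lborel) = (\<integral>z. w (fst z + h) * neg_cube (m z) \<partial>lborel)"
        using integral_translate[of "\<lambda>z. w (fst z) * neg_cube (m (fst z - h, snd z))" "(h, 0)"] by (simp add: add.commute)
      also have "\<dots> \<le> (\<integral>z. exp (- K * h) * (w (fst z) * neg_cube (m z)) \<partial>lborel)"
      proof (rule integral_mono)
        show "integrable lborel (\<lambda>z. w (fst z + h) * neg_cube (m z))"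
          using integrable_translate[OF iYh, of "(h, 0)"] by (simp add: add.commute)
        show "integrable lborel (\<lambda>z. exp (- K * h) * (w (fst z) * neg_cube (m z)))" using iY by simp
        show "w (fst z + h) * neg_cube (m z) \<le> exp (- K * h) * (w (fst z) * neg_cube (m z))" for z
        proof (cases "z \<in> Q")
          case True
          then show ?thesis using mult_right_mono[OF wshift[OF h, of "fst z"] neg_cube_nonneg[of "m z"]]
            by (auto simp: Q_def mem_Times_iff mult.assoc)
        qed (simp add: supp neg_cube_zero)
      qed
      finally show ?thesis by (simp add: Y_def)
    qed
    have 1: "Y - (\<integral>z. w (fst z) * neg_cube (m (fst z - h, snd z)) \<partial>lborel) \<le> (\<integral>z. r z \<partial>lborel)"
    proof -
      have "Y - (\<integral>z. w (fst z) * neg_cube (m (fst z - h, snd z)) \<partial>lborel)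
        = (\<integral>z. w (fst z) * neg_cube (m z) - w (fst z) * neg_cube (m (fst z - h, snd z)) \<partial>lborel)"
        unfolding Y_def by (rule Bochner_Integration.integral_diff[OF iY iYh, symmetric])
      also have "\<dots> \<le> (\<integral>z. r z \<partial>lborel)"
      proof (rule integral_mono[OF Bochner_Integration.integrable_diff[OF iY iYh] ir])
        show "w (fst z) * neg_cube (m z) - w (fst z) * neg_cube (m (fst z - h, snd z)) \<le> r z" for z
          unfolding r_def jmh[symmetric] right_diff_distrib[symmetric]
          by (rule mult_left_mono[OF neg_cube_convex w01(1)])
      qed
      finally show ?thesis .
    qed
    let ?S = "\<lambda>z. LBINT s:{0<..<h}. F (fst z + (- 1) * s, snd z)"
    have gS: "integrable lborel (\<lambda>z. g z * ?S z)" by (rule steklov_pairing_swap(2)[OF Fm gm g2 F2])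
    have 2: "(\<integral>z. r z \<partial>lborel) = - (\<integral>z. g z * ?S z \<partial>lborel)"
    proof -
      have shifted: "AE z in lborel. (fst z - h, snd z) \<in> Q \<longrightarrow> (LBINT y:{snd z<..}. m (fst z - h, y))
          = (LBINT y:{snd z<..}. m0 y) - (LBINT s:{..<fst z - h}. F (s, snd z))"
        using AE_translate[OF eq, of "(- h, 0)"]
      proof eventually_elim
        case (elim z)
        moreover have "(- h, 0) + z = (fst z - h, snd z)" by (cases z) simp
        ultimately show ?case by simp
      qed
      have Fint: "AE z :: real \<times> real in lborel. integrable lborel (\<lambda>s. F (s, snd z))"
        by (rule AE_lborel2_snd[OF lborel2_AE_snd[OF F1]])
      have "AE t in lborel. (\<integral>x. r (t, x) \<partial>lborel) = - (\<integral>x. g (t, x) * ?S (t, x) \<partial>lborel)"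
        using AE_lborel2_iterated[OF eq] AE_lborel2_iterated[OF mprim] AE_lborel2_iterated[OF shifted]
          AE_lborel2_iterated[OF Fint] lborel2_AE_fst[OF mx1]
      proof eventually_elim
        case (elim t)
        show ?case
        proof (cases "t \<in> {0<..<T}")
          case False
          then have "w t = 0" by (simp add: w_def)
          then show ?thesis by (simp add: r_def g_def)
        next
          case True
          have Qt: "(t, x) \<in> Q \<longleftrightarrow> x \<in> {0<..<L}" for x using True by (auto simp: Q_def)
          let ?n = "\<lambda>x. max 0 (- m (t, x))"
          define \<alpha> where "\<alpha> y = (2 * ?n y) * mx (t, y)" for y
          define \<beta> where "\<beta> x = m (t, x) - mh (t, x)" for x
          let ?I = "\<lambda>y. LBINT s:{..<y}. mx (t, s)"
          have [measurable]: "\<alpha> \<in> borel_measurable borel" "\<beta> \<in> borel_measurable borel"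
            unfolding \<alpha>_def[abs_def] \<beta>_def[abs_def] by measurable
          have [measurable]: "(\<lambda>x. ?S (t, x)) \<in> borel_measurable borel" unfolding fst_conv snd_conv by measurable
          have i\<alpha>: "integrable lborel \<alpha>" unfolding \<alpha>_def[abs_def]
          proof (rule integrable_mult_bounded[OF elim(5), where B="2 * B"])
            show "\<bar>2 * ?n y\<bar> \<le> 2 * B" for y using mB(1)[of "(t, y)"] by auto
          qed measurable
          have im: "integrable lborel (\<lambda>x. m (t, x))"
          proof (rule integrable_bounded_on_interval(1)[where c=0 and d=L])
            show "m (t, x) = 0" if "x \<notin> {0<..<L}" for x using that Qt by (intro supp) auto
          qed (use mB in auto)
          have imh: "integrable lborel (\<lambda>x. mh (t, x))"
          proof (rule integrable_bounded_on_interval(1)[where c=0 and d=L])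
            show "mh (t, x) = 0" if "x \<notin> {0<..<L}" for x
              using that supp(1)[of "(t - h, x)"] supp(3)[of x] by (auto simp: mh_def Q_def)
          qed (use mhB in auto)
          have i\<beta>: "integrable lborel \<beta>" unfolding \<beta>_def[abs_def] using im imh by simp
          \<comment> \<open>The chain rule concerns the primitive \<open>?I\<close>. Under the
            integral it may be replaced by \<open>m\<close>, which agrees with it almost everywhere
            on the slice, while \<open>mx\<close> vanishes elsewhere.\<close>
          have chain: "- ((max 0 (- ?I x))\<^sup>2) = (LBINT y:{..<x}. \<alpha> y)" for x
          proof -
            have "- ((max 0 (- ?I x))\<^sup>2) = (LBINT y:{..<x}. (2 * max 0 (- ?I y)) * mx (t, y))"
              by (rule primitive_chain_rule[OF elim(5) neg_square_deriv]) (auto intro!: continuous_intros)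
            also have "\<dots> = (LBINT y:{..<x}. \<alpha> y)"
            proof (rule set_lebesgue_integral_cong_AE)
              show "AE y in lborel. y \<in> {..<x} \<longrightarrow> (2 * max 0 (- ?I y)) * mx (t, y) = \<alpha> y"
                using elim(2)
              proof eventually_elim
                case (elim y)
                then show ?case using Qt[of y] supp(2)[of "(t, y)"] by (cases "(t, y) \<in> Q") (auto simp: \<alpha>_def)
              qed
            qed measurable
            finally show ?thesis .
          qed
          have "(\<integral>x. r (t, x) \<partial>lborel) = (\<integral>x. w t * (\<beta> x * (LBINT y:{..<x}. \<alpha> y)) \<partial>lborel)"
          proof (rule integral_cong_AE)
            show "AE x in lborel. r (t, x) = w t * (\<beta> x * (LBINT y:{..<x}. \<alpha> y))"
              using elim(2)
            proof eventually_elim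
              case (elim x)
              show ?case
              proof (cases "(t, x) \<in> Q")
                case True
                then have "m (t, x) = ?I x" using elim by simp
                then show ?thesis using chain[of x] by (simp add: r_def \<beta>_def mult.commute)
              next
                case False
                then have "m (t, x) = 0" "mh (t, x) = 0"
                  using supp Qt[of x] by (auto simp: mh_def Q_def)
                then show ?thesis by (simp add: r_def \<beta>_def)
              qed
            qed
          qed measurable
          \<comment> \<open>After this exchange the equation enters: the tail of
            \<open>\<beta>\<close> is the increment over \<open>h\<close> of the tail of
            \<open>m\<close>.\<close>
          also have "\<dots> = w t * (\<integral>x. \<alpha> x * (LBINT y:{x<..}. \<beta> y) \<partial>lborel)"
            using integral_triangle[OF i\<alpha> i\<beta>] by simp
          also have "(\<integral>x. \<alpha> x * (LBINT y:{x<..}. \<beta> y) \<partial>lborel) = (\<integral>x. - (\<alpha> x * ?S (t, x)) \<partial>lborel)"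
          proof (rule integral_cong_AE)
            show "AE x in lborel. \<alpha> x * (LBINT y:{x<..}. \<beta> y) = - (\<alpha> x * ?S (t, x))"
              using elim(1,3,4)
            proof eventually_elim
              case (elim x)
              show ?case
              proof (cases "(t, x) \<in> Q")
                case True
                have "set_integrable lborel {x<..} (\<lambda>y. m (t, y))" "set_integrable lborel {x<..} (\<lambda>y. mh (t, y))"
                  unfolding set_integrable_def by (intro integrable_mult_indicator im imh; simp)+
                then have "(LBINT y:{x<..}. \<beta> y) = (LBINT y:{x<..}. m (t, y)) - (LBINT y:{x<..}. mh (t, y))"
                  unfolding \<beta>_def by (rule set_integral_diff(2))
                also have "(LBINT y:{x<..}. m (t, y)) = (LBINT y:{x<..}. m0 y) - (LBINT s:{..<t}. F (s, x))"
                  using elim(1) True by simp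
                also have "(LBINT y:{x<..}. mh (t, y)) = (LBINT y:{x<..}. m0 y) - (LBINT s:{..<t - h}. F (s, x))"
                proof (cases "t \<le> h")
                  case True
                  have "(LBINT s:{..<t - h}. F (s, x)) = 0"
                    by (rule primitive_zero) (use True in \<open>auto intro!: suppF simp: Q_def\<close>)
                  then show ?thesis using True by (simp add: mh_def)
                next
                  case False
                  then have "(t - h, x) \<in> Q" using True h by (auto simp: Q_def)
                  then show ?thesis using elim(2) False by (simp add: mh_def)
                qed
                finally have "(LBINT y:{x<..}. \<beta> y) = - ((LBINT s:{..<t}. F (s, x)) - (LBINT s:{..<t - h}. F (s, x)))" by simp
                also have "\<dots> = - ?S (t, x)" using elim(3) by (subst primitive_diff_left[OF _ h]) auto
                finally show ?thesis by simp
              next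
                case False
                then show ?thesis by (simp add: \<alpha>_def supp)
              qed
            qed
          qed measurable
          also have "w t * \<dots> = - (\<integral>x. g (t, x) * ?S (t, x) \<partial>lborel)"
            by (simp add: \<alpha>_def g_def mult.assoc)
          finally show ?thesis .
        qed
      qed
      then have "(\<integral>t. \<integral>x. r (t, x) \<partial>lborel \<partial>lborel) = (\<integral>t. - (\<integral>x. g (t, x) * ?S (t, x) \<partial>lborel) \<partial>lborel)"
        by (intro integral_cong_AE) measurable
      then show ?thesis unfolding lborel2_integral_fst[OF ir] lborel2_integral_fst[OF gS] by simp
    qed
    show ?thesis
      using 1 Yh steklov_pairing_swap(1)[OF Fm gm g2 F2, of h "-1"] unfolding 2
      by (simp add: algebra_simps)
  qed
  have lim1: "((\<lambda>h. - ((LBINT s:{0<..<h}. \<integral>z. g z * F (fst z + (- 1) * s, snd z) \<partial>lborel) / h)) \<longlongrightarrow> - (\<integral>z. g z * F z \<partial>lborel)) (at_right 0)"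
    by (intro tendsto_minus steklov_pairing_tendsto[OF Fm gm g2 F2]) simp
  have lim2: "((\<lambda>h. (1 - exp (- K * h)) / h * Y) \<longlongrightarrow> K * Y) (at_right 0)"
  proof -
    have "((\<lambda>h. 1 - exp (- K * h)) has_real_derivative K) (at 0)"
      by (auto intro!: derivative_eq_intros)
    then have "((\<lambda>h. (1 - exp (- K * h)) / h) \<longlongrightarrow> K) (at 0)"
      by (simp add: DERIV_def)
    then have "((\<lambda>h. (1 - exp (- K * h)) / h) \<longlongrightarrow> K) (at_right 0)"
      by (rule tendsto_mono[rotated]) (simp add: at_le)
    then show ?thesis by (intro tendsto_mult tendsto_const)
  qed
  have "K * Y \<le> - (\<integral>z. g z * F z \<partial>lborel)"
  proof (rule tendsto_le[OF _ lim1 lim2])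
    show "\<forall>\<^sub>F h in at_right 0. (1 - exp (- K * h)) / h * Y
      \<le> - ((LBINT s:{0<..<h}. \<integral>z. g z * F (fst z + (- 1) * s, snd z) \<partial>lborel) / h)"
      using eventually_at_right_less[of 0]
    proof eventually_elim
      case (elim h)
      from divide_right_mono[OF key[OF elim], of h] elim show ?case by simp
    qed
  qed simp
  also have "\<dots> = (\<integral>z. - (g z * F z) \<partial>lborel)" by simp
  also have "\<dots> \<le> (\<integral>z. k * (w (fst z) * neg_cube (m z)) \<partial>lborel)"
  proof (rule integral_mono)
    show "integrable lborel (\<lambda>z. - (g z * F z))"
      by (intro Bochner_Integration.integrable_minus integrable_mult_L2) (use g2 F2 in auto)
    show "integrable lborel (\<lambda>z. k * (w (fst z) * neg_cube (m z)))" using iY by simp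
    show "- (g z * F z) \<le> k * (w (fst z) * neg_cube (m z))" for z
    proof (cases "z \<in> Q")
      case True
      have "w (fst z) * (- (2 * max 0 (- m z) * mx z) * (a z * mx z + c z * m z)) \<le> w (fst z) * (k * neg_cube (m z))"
        unfolding k_def by (rule mult_left_mono[OF drift_diffusion_absorb[OF a(2)[OF True] a(1) c] w01(1)])
      then show ?thesis by (simp add: g_def F algebra_simps)
    qed (simp add: suppF supp neg_cube_zero)
  qed
  also have "\<dots> = k * Y" by (simp add: Y_def)
  finally have "Y \<le> 0" unfolding K_def by (simp add: algebra_simps)
  moreover have "0 \<le> w (fst z) * neg_cube (m z)" for z by (intro mult_nonneg_nonneg w01 neg_cube_nonneg)
  ultimately have "Y = 0" unfolding Y_def by (intro antisym integral_nonneg) auto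
  then have "AE z in lborel. w (fst z) * neg_cube (m z) = 0"
    unfolding Y_def using integral_nonneg_eq_0_iff_AE[OF iY] \<open>\<And>z. 0 \<le> w (fst z) * neg_cube (m z)\<close> by simp
  then show ?thesis
  proof eventually_elim
    case (elim z)
    show ?case
    proof (cases "z \<in> Q")
      case True
      then have "w (fst z) > 0" by (intro wpos) (auto simp: Q_def)
      then show ?thesis using elim by (auto simp: neg_cube_def max_def split: if_splits)
    qed (simp add: supp)
  qed
qed

section \<open>Regularity of weak solutions\<close>

lemma integral_lebesgue_eq_lborel:
  fixes F G :: "'a::euclidean_space \<Rightarrow> real"
  assumes [measurable]: "G \<in> borel_measurable borel" and AE: "AE z in lborel. F z = G z"
  shows "integral\<^sup>L lebesgue F = integral\<^sup>L lborel G"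
proof -
  have AE': "AE z in lebesgue. F z = G z" using AE by (simp add: AE_completion_iff)
  have G: "G \<in> borel_measurable lebesgue" by (simp add: measurable_completion)
  have F: "F \<in> borel_measurable lebesgue"
    by (rule borel_measurable_AE[OF G]) (use AE' in \<open>auto elim: AE_mp\<close>)
  have "integral\<^sup>L lebesgue F = integral\<^sup>L lebesgue G" by (rule integral_cong_AE[OF F G AE'])
  also have "\<dots> = integral\<^sup>L lborel G" by (rule integral_completion) simp
  finally show ?thesis .
qed

lemma set_integral_lebesgue_eq_lborel:
  fixes F G :: "'a::euclidean_space \<Rightarrow> real"
  assumes "G \<in> borel_measurable borel" "AE z in lborel. z \<in> A \<longrightarrow> F z = G z" "\<And>z. z \<notin> A \<Longrightarrow> G z = 0"
  shows "(LINT z:A|lebesgue. F z) = integral\<^sup>L lborel G"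
  unfolding set_lebesgue_integral_def
  by (rule integral_lebesgue_eq_lborel[OF assms(1)])
    (use assms(2) in \<open>eventually_elim, auto simp: indicator_def assms(3)\<close>)

lemma borel_representative:
  fixes f :: "'a::euclidean_space \<Rightarrow> real"
  assumes "set_borel_measurable lebesgue A f" and [measurable]: "A \<in> sets borel"
  obtains g where "g \<in> borel_measurable borel" "\<And>z. z \<notin> A \<Longrightarrow> g z = 0" "AE z in lborel. z \<in> A \<longrightarrow> f z = g z"
proof -
  obtain g where [measurable]: "g \<in> borel_measurable borel" and g: "AE z in lborel. indicator A z *\<^sub>R f z = g z"
    using completion_ex_borel_measurable_real[of "\<lambda>z. indicator A z *\<^sub>R f z" lborel] assms(1)
    unfolding set_borel_measurable_def by auto
  have "AE z in lborel. z \<in> A \<longrightarrow> f z = indicator A z * g z" using g by eventually_elim auto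
  then show ?thesis by (intro that[of "\<lambda>z. indicator A z * g z"]) auto
qed

text \<open>Borel measurability, unlike Lebesgue measurability, passes to every slice. Vanishing at
  every point off \<open>Q\<close> lets integrals over half-lines be written without a
  cut-off.\<close>

definition L2_on :: "(real \<times> real) set \<Rightarrow> (real \<times> real \<Rightarrow> real) \<Rightarrow> bool" where
  "L2_on Q g \<longleftrightarrow> g \<in> borel_measurable borel \<and> integrable lborel (\<lambda>z. (g z)\<^sup>2) \<and> (\<forall>z. z \<notin> Q \<longrightarrow> g z = 0)"

lemma cylQ_borel [measurable]: "cylQ T L \<in> sets borel"
  unfolding cylQ_def by (intro borel_open open_Times) auto

text \<open>The rectangle has finite measure and
  \<open>x\<^sup>2 \<le> 1 + \<bar>x\<bar> powr p\<close>, so every exponent from 2 on reduces to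
  the square case.\<close>

lemma Lp_representative:
  assumes "Lp_on p (cylQ T L) f" "p \<ge> 2"
  obtains g where "L2_on (cylQ T L) g" "AE z in lborel. z \<in> cylQ T L \<longrightarrow> f z = g z"
proof -
  obtain g where g[measurable]: "g \<in> borel_measurable borel" and z: "\<And>z. z \<notin> cylQ T L \<Longrightarrow> g z = 0"
    and ae: "AE z in lborel. z \<in> cylQ T L \<longrightarrow> f z = g z"
    using borel_representative[of "cylQ T L" f] assms(1) cylQ_borel unfolding Lp_on_def by blast
  let ?I = "\<lambda>z. indicator (cylQ T L) z :: real"
  have i: "integrable lebesgue (\<lambda>z. ?I z *\<^sub>R \<bar>f z\<bar> powr p)"
    using assms(1) unfolding Lp_on_def set_integrable_def by auto
  have "integrable lebesgue (\<lambda>z. ?I z * \<bar>g z\<bar> powr p)"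
  proof (rule integrable_cong_AE_imp[OF i])
    show "(\<lambda>z. ?I z * \<bar>g z\<bar> powr p) \<in> borel_measurable lebesgue" by (rule measurable_completion) measurable
    have "AE z in lborel. ?I z *\<^sub>R \<bar>f z\<bar> powr p = ?I z * \<bar>g z\<bar> powr p"
      using ae by eventually_elim (auto simp: indicator_def)
    then show "AE z in lebesgue. ?I z *\<^sub>R \<bar>f z\<bar> powr p = ?I z * \<bar>g z\<bar> powr p" by (rule AE_completion)
  qed
  then have ig: "integrable lborel (\<lambda>z. ?I z * \<bar>g z\<bar> powr p)" by (subst (asm) integrable_completion) measurable
  have iI: "integrable lborel ?I"
    by (rule integrable_bounded_on_rectangle[where B=1 and a=0 and b=T and c=0 and d=L])
      (auto simp: indicator_def cylQ_def)
  have le: "x\<^sup>2 \<le> 1 + \<bar>x\<bar> powr p" for x :: real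
  proof (cases "\<bar>x\<bar> \<le> 1")
    case True
    then have "x\<^sup>2 \<le> 1" by (simp add: abs_square_le_1)
    then show ?thesis by (simp add: add_increasing2)
  next
    case False
    then have "\<bar>x\<bar> powr 2 \<le> \<bar>x\<bar> powr p" using assms(2) by (intro powr_mono) auto
    then show ?thesis using False by (simp add: powr_realpow[symmetric])
  qed
  have "integrable lborel (\<lambda>z. (g z)\<^sup>2)"
  proof (rule Bochner_Integration.integrable_bound)
    show "integrable lborel (\<lambda>z. ?I z + ?I z * \<bar>g z\<bar> powr p)" using iI ig by simp
    show "AE z in lborel. norm ((g z)\<^sup>2) \<le> norm (?I z + ?I z * \<bar>g z\<bar> powr p)"
    proof (rule AE_I2)
      fix z show "norm ((g z)\<^sup>2) \<le> norm (?I z + ?I z * \<bar>g z\<bar> powr p)"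
        using le[of "g z"] z[of z] by (cases "z \<in> cylQ T L") auto
    qed
  qed measurable
  then show ?thesis using that[of g] g z ae by (auto simp: L2_on_def)
qed

lemma L2_on_bounded:
  assumes "g \<in> borel_measurable borel" "\<And>z. \<bar>g z\<bar> \<le> B" "\<And>z. z \<notin> cylQ T L \<Longrightarrow> g z = 0"
  shows "L2_on (cylQ T L) g"
proof -
  have "integrable lborel (\<lambda>z. (g z)\<^sup>2)"
    by (rule integrable_bounded_on_rectangle[where B="B\<^sup>2" and a=0 and b=T and c=0 and d=L])
      (use assms in \<open>auto simp: cylQ_def intro: abs_square_le[simplified]\<close>)
  then show ?thesis using assms by (simp add: L2_on_def)
qed

text \<open>Truncation at the essential bound makes the bound hold at every point, and therefore on
  every slice.\<close>

lemma Linf_representative: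
  assumes "Linf_on (cylQ T L) f"
  obtains g B where "g \<in> borel_measurable borel" "\<And>z. \<bar>g z\<bar> \<le> B" "\<And>z. z \<notin> cylQ T L \<Longrightarrow> g z = 0"
    "AE z in lborel. z \<in> cylQ T L \<longrightarrow> f z = g z"
proof -
  obtain g where g[measurable]: "g \<in> borel_measurable borel" and z: "\<And>z. z \<notin> cylQ T L \<Longrightarrow> g z = 0"
    and ae: "AE z in lborel. z \<in> cylQ T L \<longrightarrow> f z = g z"
    using borel_representative[of "cylQ T L" f] assms(1) cylQ_borel unfolding Linf_on_def by blast
  obtain B where "AE z in lebesgue. z \<in> cylQ T L \<longrightarrow> \<bar>f z\<bar> \<le> B" using assms unfolding Linf_on_def by auto
  then have B: "AE z in lborel. z \<in> cylQ T L \<longrightarrow> \<bar>f z\<bar> \<le> B" by (simp add: AE_completion_iff)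
  define h where "h z = (if \<bar>g z\<bar> \<le> \<bar>B\<bar> then g z else 0)" for z
  have "h \<in> borel_measurable borel" unfolding h_def[abs_def] by measurable
  moreover have "\<bar>h z\<bar> \<le> \<bar>B\<bar>" for z by (simp add: h_def)
  moreover have "AE z in lborel. z \<in> cylQ T L \<longrightarrow> f z = h z"
    using ae B by eventually_elim (auto simp: h_def)
  ultimately show ?thesis using that[of h "\<bar>B\<bar>"] z by (auto simp: h_def)
qed

text \<open>Inside the open interval the set of disagreement is open and null, hence empty; closure
  adds the end points, where boundary values are read off.\<close>

lemma continuous_on_AE_eq:
  fixes f g :: "real \<Rightarrow> real"
  assumes cd: "c < d" and cont: "continuous_on {c..d} f" "continuous_on {c..d} g"
    and ae: "AE x in lborel. x \<in> {c<..<d} \<longrightarrow> f x = g x" and x: "x \<in> {c..d}"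
  shows "f x = g x"
proof -
  let ?h = "\<lambda>x. f x - g x"
  have ch: "continuous_on {c..d} ?h" by (intro continuous_intros cont)
  define S where "S = {c<..<d} \<inter> ?h -` (- {0})"
  have oS: "open S" unfolding S_def
    by (rule continuous_open_preimage) (auto intro: continuous_on_subset[OF ch] open_Compl)
  have "AE x in lborel. x \<notin> S" using ae by eventually_elim (auto simp: S_def)
  then have "S \<in> null_sets lborel" using oS by (subst AE_iff_null_sets) auto
  then have "negligible S" by (simp add: negligible_iff_null_sets null_sets_completionI)
  then have "S = {}" using open_not_negligible[OF oS] by blast
  then have z: "?h y = 0" if "y \<in> {c<..<d}" for y using that by (auto simp: S_def)
  have "continuous_on (closure {c<..<d}) ?h" "x \<in> closure {c<..<d}" using ch x cd by auto
  with z have "?h x = 0" by (intro continuous_constant_on_closure[of "{c<..<d}" ?h 0 x])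
  then show ?thesis by simp
qed

lemma primitive_continuous:
  fixes a :: "real \<Rightarrow> real"
  assumes a: "integrable lborel a"
  shows "continuous_on S (\<lambda>x. LBINT y:{..<x}. a y)"
proof -
  have [measurable]: "a \<in> borel_measurable borel" using a by (auto dest: borel_measurable_integrable)
  have "isCont (\<lambda>x. LBINT y:{..<x}. a y) x" for x
    unfolding continuous_at_sequentially comp_def
  proof (intro allI impI)
    fix X assume X: "X \<longlonglongrightarrow> x"
    show "(\<lambda>n. LBINT y:{..<X n}. a y) \<longlonglongrightarrow> (LBINT y:{..<x}. a y)"
      unfolding set_lebesgue_integral_def
    proof (rule integral_dominated_convergence[where w="\<lambda>y. \<bar>a y\<bar>"])
      have "(\<lambda>n. indicator {..<X n} y *\<^sub>R a y) \<longlonglongrightarrow> indicator {..<x} y *\<^sub>R a y" if "y \<noteq> x" for y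
      proof (rule tendsto_eventually)
        show "\<forall>\<^sub>F n in sequentially. indicator {..<X n} y *\<^sub>R a y = indicator {..<x} y *\<^sub>R a y"
        proof (cases "y < x")
          case True
          from order_tendstoD(1)[OF X this] show ?thesis by eventually_elim (use True in simp)
        next
          case False
          then have "x < y" using that by simp
          from order_tendstoD(2)[OF X this] show ?thesis by eventually_elim (use \<open>x < y\<close> in simp)
        qed
      qed
      then show "AE y in lborel. (\<lambda>n. indicator {..<X n} y *\<^sub>R a y) \<longlonglongrightarrow> indicator {..<x} y *\<^sub>R a y"
        by (intro AE_I[where N="{x}"]) auto
    qed (use a in \<open>auto simp: indicator_def\<close>)
  qed
  then show ?thesis by (intro continuous_at_imp_continuous_on) auto
qed

lemma primitive_split:
  fixes a :: "real \<Rightarrow> real"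
  assumes a: "integrable lborel a"
  shows "(\<integral>y. a y \<partial>lborel) = (LBINT y:{..<x}. a y) + (LBINT y:{x<..}. a y)"
proof -
  have [measurable]: "a \<in> borel_measurable borel" using a by (auto dest: borel_measurable_integrable)
  have i: "integrable lborel (\<lambda>s. indicator A s *\<^sub>R a s)" if "A \<in> sets borel" for A
    using that by (intro integrable_mult_indicator a) auto
  have "(\<integral>y. a y \<partial>lborel) = (\<integral>y. indicator {..<x} y *\<^sub>R a y + indicator {x<..} y *\<^sub>R a y \<partial>lborel)"
    by (rule integral_cong_AE) (auto simp: indicator_def intro!: AE_I[where N="{x}"])
  also have "\<dots> = (LBINT y:{..<x}. a y) + (LBINT y:{x<..}. a y)"
    unfolding set_lebesgue_integral_def by (rule Bochner_Integration.integral_add; rule i) auto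
  finally show ?thesis .
qed

lemma primitive_whole:
  fixes a :: "real \<Rightarrow> real"
  assumes "\<And>y. y \<notin> A \<Longrightarrow> a y = 0"
  shows "(LBINT y:A. a y) = (\<integral>y. a y \<partial>lborel)"
  unfolding set_lebesgue_integral_def
  by (rule Bochner_Integration.integral_cong) (use assms in \<open>auto simp: indicator_def\<close>)

text \<open>On almost every slice two continuous functions are compared at the end point
  \<open>c\<close>, where the primitive is 0; this identifies the free function
  \<open>k\<close>.\<close>

lemma primitive_boundary_left:
  fixes f g :: "real \<times> real \<Rightarrow> real"
  assumes g: "integrable lborel g" "\<And>z. z \<notin> {a<..<b} \<times> {c<..<d} \<Longrightarrow> g z = 0" and cd: "c < d"
    and f: "AE z in lborel. z \<in> {a<..<b} \<times> {c<..<d} \<longrightarrow> f z = k (fst z) + (LBINT y:{..<snd z}. g (fst z, y))"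
    and h: "AE t in lborel. t \<in> {a<..<b} \<longrightarrow> (\<exists>h. continuous_on {c..d} h \<and> h c = \<beta> t \<and> (AE x in lborel. x \<in> {c<..<d} \<longrightarrow> f (t, x) = h x))"
  shows "AE z in lborel. z \<in> {a<..<b} \<times> {c<..<d} \<longrightarrow> f z = \<beta> (fst z) + (LBINT y:{..<snd z}. g (fst z, y))"
proof -
  have "AE t in lborel. t \<in> {a<..<b} \<longrightarrow> k t = \<beta> t"
    using AE_lborel2_iterated[OF f] h lborel2_AE_fst[OF g(1)]
  proof eventually_elim
    case (elim t)
    show ?case
    proof
      assume t: "t \<in> {a<..<b}"
      then obtain h where h: "continuous_on {c..d} h" "h c = \<beta> t" "AE x in lborel. x \<in> {c<..<d} \<longrightarrow> f (t, x) = h x"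
        using elim by blast
      have "h c = k t + (LBINT y:{..<c}. g (t, y))"
      proof (rule continuous_on_AE_eq[OF cd h(1)])
        show "continuous_on {c..d} (\<lambda>x. k t + (LBINT y:{..<x}. g (t, y)))"
          by (intro continuous_intros primitive_continuous elim)
        show "AE x in lborel. x \<in> {c<..<d} \<longrightarrow> h x = k t + (LBINT y:{..<x}. g (t, y))"
          using elim(1) h(3) by eventually_elim (use t in auto)
      qed (use cd in auto)
      moreover have "(LBINT y:{..<c}. g (t, y)) = 0" by (rule primitive_zero) (auto intro: g(2))
      ultimately show "k t = \<beta> t" using h(2) by simp
    qed
  qed
  from AE_lborel2_fst[OF this] f show ?thesis by eventually_elim auto
qed

text \<open>At the right end the primitive is the full integral. Thus \<open>k\<close> is the
  boundary value less the full integral, and minus the tail remains.\<close>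

lemma primitive_boundary_right:
  fixes f g :: "real \<times> real \<Rightarrow> real"
  assumes g: "integrable lborel g" "\<And>z. z \<notin> {a<..<b} \<times> {c<..<d} \<Longrightarrow> g z = 0" and cd: "c < d"
    and f: "AE z in lborel. z \<in> {a<..<b} \<times> {c<..<d} \<longrightarrow> f z = k (fst z) + (LBINT y:{..<snd z}. g (fst z, y))"
    and h: "AE t in lborel. t \<in> {a<..<b} \<longrightarrow> (\<exists>h. continuous_on {c..d} h \<and> h d = \<beta> t \<and> (AE x in lborel. x \<in> {c<..<d} \<longrightarrow> f (t, x) = h x))"
  shows "AE z in lborel. z \<in> {a<..<b} \<times> {c<..<d} \<longrightarrow> f z = \<beta> (fst z) - (LBINT y:{snd z<..}. g (fst z, y))"
proof -
  have "AE t in lborel. t \<in> {a<..<b} \<longrightarrow> k t = \<beta> t - (\<integral>y. g (t, y) \<partial>lborel) \<and> integrable lborel (\<lambda>y. g (t, y))"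
    using AE_lborel2_iterated[OF f] h lborel2_AE_fst[OF g(1)]
  proof eventually_elim
    case (elim t)
    show ?case
    proof
      assume t: "t \<in> {a<..<b}"
      then obtain h where h: "continuous_on {c..d} h" "h d = \<beta> t" "AE x in lborel. x \<in> {c<..<d} \<longrightarrow> f (t, x) = h x"
        using elim by blast
      have "h d = k t + (LBINT y:{..<d}. g (t, y))"
      proof (rule continuous_on_AE_eq[OF cd h(1)])
        show "continuous_on {c..d} (\<lambda>x. k t + (LBINT y:{..<x}. g (t, y)))"
          by (intro continuous_intros primitive_continuous elim)
        show "AE x in lborel. x \<in> {c<..<d} \<longrightarrow> h x = k t + (LBINT y:{..<x}. g (t, y))"
          using elim(1) h(3) by eventually_elim (use t in auto)
      qed (use cd in auto)
      moreover have "(LBINT y:{..<d}. g (t, y)) = (\<integral>y. g (t, y) \<partial>lborel)" by (rule primitive_whole) (auto intro: g(2))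
      ultimately show "k t = \<beta> t - (\<integral>y. g (t, y) \<partial>lborel) \<and> integrable lborel (\<lambda>y. g (t, y))" using h(2) elim by simp
    qed
  qed
  from AE_lborel2_fst[OF this] f show ?thesis
  proof eventually_elim
    case (elim z)
    then show ?case using primitive_split[of "\<lambda>y. g (fst z, y)" "snd z"] by auto
  qed
qed

text \<open>The maximiser of the concave parabola on the half-line is the control of (iii). Along a
  solution the Hamiltonian is therefore \<open>kap * q^2\<close>, an expression in the control
  alone.\<close>

lemma quadratic_sup:
  fixes a b gam kap :: real
  assumes "kap > 0"
  shows "(SUP p\<in>{0..}. - p * a + p * b - gam * p - kap * p\<^sup>2) = kap * (max 0 ((b - gam - a) / (2 * kap)))\<^sup>2"
proof -
  define c where "c = b - gam - a"
  define p0 where "p0 = max 0 (c / (2 * kap))"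
  have p0: "p0 \<ge> 0" by (simp add: p0_def)
  have c: "c \<le> 2 * kap * p0"
  proof -
    have "c = 2 * kap * (c / (2 * kap))" using assms by simp
    also have "\<dots> \<le> 2 * kap * p0" using assms by (intro mult_left_mono) (auto simp: p0_def)
    finally show ?thesis .
  qed
  \<comment> \<open>Either \<open>p0 = 0\<close>, or the maximum is interior and
    \<open>c = 2 * kap * p0\<close>.\<close>
  have c0: "p0 * c = 2 * kap * p0\<^sup>2" using assms by (auto simp: p0_def max_def power2_eq_square)
  have eq: "- p * a + p * b - gam * p - kap * p\<^sup>2 = p * c - kap * p\<^sup>2" for p by (simp add: c_def algebra_simps)
  have "Sup ((\<lambda>p. - p * a + p * b - gam * p - kap * p\<^sup>2) ` {0..}) = kap * p0\<^sup>2"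
  proof (rule cSup_eq_maximum)
    have "kap * p0\<^sup>2 = p0 * c - kap * p0\<^sup>2" using c0 by simp
    then show "kap * p0\<^sup>2 \<in> (\<lambda>p. - p * a + p * b - gam * p - kap * p\<^sup>2) ` {0..}" unfolding eq using p0 by (intro image_eqI[of _ _ p0]) auto
    fix y assume "y \<in> (\<lambda>p. - p * a + p * b - gam * p - kap * p\<^sup>2) ` {0..}"
    then obtain p where p: "p \<ge> 0" "y = p * c - kap * p\<^sup>2" unfolding eq by auto
    have "p * c \<le> p * (2 * kap * p0)" using p c by (intro mult_left_mono)
    moreover have "0 \<le> kap * (p - p0)\<^sup>2" using assms by simp
    ultimately show "y \<le> kap * p0\<^sup>2" by (simp add: p(2) power2_eq_square algebra_simps)
  qed
  then show ?thesis by (simp add: p0_def c_def)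
qed

text \<open>Only the values of \<open>sig\<close> on \<open>[0, L]\<close> are controlled, so
  \<open>s2\<close> and \<open>ds2\<close> are cut off to bounded Borel functions on the line. The
  primitive formula for \<open>s2\<close> is what the product rule for \<open>s2\<close> times a
  density needs later.\<close>

lemma square_coefficient:
  fixes sig :: "real \<Rightarrow> real"
  assumes L: "L > 0" and sig: "Ck_on 2 {0..L} sig" "sig0 > 0" "\<forall>x\<in>{0..L}. sig x \<ge> sig0"
  obtains s2 ds2 A where "s2 \<in> borel_measurable borel" "ds2 \<in> borel_measurable borel"
    "\<And>x. \<bar>s2 x\<bar> \<le> A" "\<And>x. \<bar>ds2 x\<bar> \<le> A" "\<And>x. x \<in> {0<..<L} \<Longrightarrow> s2 x = (sig x)\<^sup>2"
    "\<And>x. x \<in> {0<..<L} \<Longrightarrow> s2 x \<ge> sig0\<^sup>2"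
    "\<And>x. x \<in> {0<..<L} \<Longrightarrow> ds2 x = vector_derivative (\<lambda>y. (sig y)\<^sup>2) (at x within {0..L})"
    "\<And>x. x \<in> {0<..<L} \<Longrightarrow> s2 x = (sig 0)\<^sup>2 + (LBINT y:{..<x}. ds2 y)"
    "\<And>x. x \<notin> {0<..<L} \<Longrightarrow> ds2 x = 0"
proof -
  obtain D where D: "\<And>x. x \<in> {0..L} \<Longrightarrow> D 0 x = sig x"
    "\<And>j x. j < 2 \<Longrightarrow> x \<in> {0..L} \<Longrightarrow> (D j has_real_derivative D (Suc j) x) (at x within {0..L})"
    "\<And>j. j \<le> 2 \<Longrightarrow> continuous_on {0..L} (D (j :: nat))" using sig(1) unfolding Ck_on_def by blast
  define e where "e x = 2 * D 0 x * D 1 x" for x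
  have ce: "continuous_on {0..L} e" unfolding e_def by (intro continuous_intros D(3)) auto
  have cs: "continuous_on {0..L} (\<lambda>x. (sig x)\<^sup>2)"
  proof -
    have "continuous_on {0..L} sig" by (rule continuous_on_eq[OF D(3)[of 0]]) (auto simp: D(1))
    then show ?thesis by (intro continuous_intros)
  qed
  have ds: "((\<lambda>y. (sig y)\<^sup>2) has_real_derivative e x) (at x within {0..L})" if x: "x \<in> {0..L}" for x
  proof -
    have "((\<lambda>y. (D 0 y)\<^sup>2) has_real_derivative e x) (at x within {0..L})"
      using D(2)[of 0 x] x by (auto intro!: derivative_eq_intros simp: e_def)
    then show ?thesis by (rule has_field_derivative_transform_within[OF _ zero_less_one x]) (simp add: D(1))
  qed
  define s2 where "s2 x = indicator {0..L} x *\<^sub>R (sig x)\<^sup>2" for x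
  define ds2 where "ds2 x = indicator {0<..<L} x *\<^sub>R e x" for x
  have m1: "s2 \<in> borel_measurable borel" unfolding s2_def[abs_def]
    by (rule borel_measurable_continuous_on_indicator[OF _ cs]) simp
  have m2: "ds2 \<in> borel_measurable borel" unfolding ds2_def[abs_def]
    by (rule borel_measurable_continuous_on_indicator[OF _ continuous_on_subset[OF ce]]) auto
  have "bounded ((\<lambda>x. (sig x)\<^sup>2) ` {0..L})" "bounded (e ` {0..L})"
    by (intro compact_imp_bounded compact_continuous_image cs ce compact_Icc)+
  then obtain A1 A2 where A: "\<And>x. x \<in> {0..L} \<Longrightarrow> \<bar>(sig x)\<^sup>2\<bar> \<le> A1" "\<And>x. x \<in> {0..L} \<Longrightarrow> \<bar>e x\<bar> \<le> A2"
    unfolding bounded_iff real_norm_def by (metis image_eqI)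
  define A where "A = \<bar>A1\<bar> + \<bar>A2\<bar>"
  have b1: "\<bar>s2 x\<bar> \<le> A" for x using A(1)[of x] by (cases "x \<in> {0..L}") (auto simp: s2_def A_def)
  have b2: "\<bar>ds2 x\<bar> \<le> A" for x using A(2)[of x] by (cases "x \<in> {0<..<L}") (auto simp: ds2_def A_def)
  have vd: "vector_derivative (\<lambda>y. (sig y)\<^sup>2) (at x within {0..L}) = e x" if "x \<in> {0..L}" for x
    using vector_derivative_within_cbox[of 0 L x "\<lambda>y. (sig y)\<^sup>2" "e x"] ds[OF that] that L
    by (simp add: has_real_derivative_iff_has_vector_derivative)
  have prim: "s2 x = (sig 0)\<^sup>2 + (LBINT y:{..<x}. ds2 y)" if x: "x \<in> {0<..<L}" for x
  proof -
    have int: "(e has_integral ((sig x)\<^sup>2 - (sig 0)\<^sup>2)) {0..x}"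
    proof (rule fundamental_theorem_of_calculus)
      show "((\<lambda>y. (sig y)\<^sup>2) has_vector_derivative e y) (at y within {0..x})" if "y \<in> {0..x}" for y
        using DERIV_subset[OF ds[of y], of "{0..x}"] that x
        by (auto simp: has_real_derivative_iff_has_vector_derivative)
    qed (use x in auto)
    have cx: "continuous_on {0..x} e" by (rule continuous_on_subset[OF ce]) (use x in auto)
    have "set_integrable lborel {0..x} e" unfolding set_integrable_def
      by (rule borel_integrable_compact[OF compact_Icc cx])
    then have "(LBINT y:{0..x}. e y) = integral {0..x} e" by (rule set_borel_integral_eq_integral(2))
    moreover have "(LBINT y:{0..x}. e y) = (LBINT y:{..<x}. ds2 y)"
    proof -
      have me: "(\<lambda>y. indicator {0..L} y *\<^sub>R e y) \<in> borel_measurable borel"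
        by (rule borel_measurable_continuous_on_indicator[OF _ ce]) simp
      have eq: "indicator {0..x} y *\<^sub>R e y = indicator {0..x} y * (indicator {0..L} y *\<^sub>R e y)" for y
        using x by (auto simp: indicator_def)
      show ?thesis unfolding set_lebesgue_integral_def
      proof (rule integral_cong_AE)
        show "(\<lambda>y. indicator {0..x} y *\<^sub>R e y) \<in> borel_measurable lborel" unfolding eq using me by measurable
        show "(\<lambda>y. indicator {..<x} y *\<^sub>R ds2 y) \<in> borel_measurable lborel" using m2 by measurable
        have "indicator {0..x} y *\<^sub>R e y = indicator {..<x} y *\<^sub>R ds2 y" if "y \<noteq> 0" "y \<noteq> x" for y
          using that x by (auto simp: ds2_def indicator_def)
        then show "AE y in lborel. indicator {0..x} y *\<^sub>R e y = indicator {..<x} y *\<^sub>R ds2 y"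
          by (intro AE_I[where N="{0, x}"]) (auto simp: emeasure_lborel_countable)
      qed
    qed
    ultimately show ?thesis using integral_unique[OF int] x by (simp add: s2_def)
  qed
  show ?thesis
  proof (rule that[OF m1 m2 b1 b2 _ _ _ prim])
    show "s2 x = (sig x)\<^sup>2" if "x \<in> {0<..<L}" for x using that by (simp add: s2_def)
    show "s2 x \<ge> sig0\<^sup>2" if "x \<in> {0<..<L}" for x
      using that sig(2,3) by (auto simp: s2_def intro!: power_mono)
    show "ds2 x = vector_derivative (\<lambda>y. (sig y)\<^sup>2) (at x within {0..L})" if "x \<in> {0<..<L}" for x
      using that vd[of x] by (simp add: ds2_def)
  qed (auto simp: ds2_def)
qed

lemma L2_on_zero: "L2_on Q g \<Longrightarrow> z \<notin> Q \<Longrightarrow> g z = 0"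
  unfolding L2_on_def by blast

lemma L2_on_cylQ_zero: "L2_on (cylQ T L) g \<Longrightarrow> z \<notin> {0<..<T} \<times> {0<..<L} \<Longrightarrow> g z = 0"
  by (rule L2_on_zero) (simp_all only: cylQ_def not_False_eq_True)

lemma weak_integral_transfer:
  fixes f g \<phi> :: "real \<times> real \<Rightarrow> real"
  assumes g: "L2_on (cylQ T L) g" "AE z in lborel. z \<in> cylQ T L \<longrightarrow> f z = g z"
    and \<phi>: "\<phi> \<in> borel_measurable borel"
  shows "(LINT z:cylQ T L|lebesgue. f z * \<phi> z) = (\<integral>z. g z * \<phi> z \<partial>lborel)"
proof (rule set_integral_lebesgue_eq_lborel)
  have [measurable]: "g \<in> borel_measurable borel" using g(1) by (simp add: L2_on_def)
  show "(\<lambda>z. g z * \<phi> z) \<in> borel_measurable borel" using \<phi> by measurable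
  show "AE z in lborel. z \<in> cylQ T L \<longrightarrow> f z * \<phi> z = g z * \<phi> z" using g(2) by eventually_elim auto
  show "g z * \<phi> z = 0" if "z \<notin> cylQ T L" for z using L2_on_zero[OF g(1) that] by simp
qed

lemma bump_product_measurable:
  assumes "bump_on I \<theta>" "bump_on J \<xi>"
  shows "(\<lambda>z :: real \<times> real. \<theta> (fst z) * \<xi> (snd z)) \<in> borel_measurable borel"
proof -
  note [measurable] = bump_on_measurable[OF assms(1)] bump_on_measurable[OF assms(2)]
  show ?thesis by measurable
qed

lemma
  assumes \<theta>: "bump_on {0<..<T} \<theta>" and \<xi>: "bump_on {0<..<L} \<xi>"
    and g: "L2_on (cylQ T L) g" "AE z in lborel. z \<in> cylQ T L \<longrightarrow> f z = g z"
    and g': "L2_on (cylQ T L) g'" "AE z in lborel. z \<in> cylQ T L \<longrightarrow> f' z = g' z"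
  shows weak_dx_pairing: "weak_dx (cylQ T L) f f' \<Longrightarrow>
      (\<integral>z. g z * (\<theta> (fst z) * deriv \<xi> (snd z)) \<partial>lborel) = - (\<integral>z. g' z * (\<theta> (fst z) * \<xi> (snd z)) \<partial>lborel)"
    and weak_dt_pairing: "weak_dt (cylQ T L) f f' \<Longrightarrow>
      (\<integral>z. g z * (deriv \<theta> (fst z) * \<xi> (snd z)) \<partial>lborel) = - (\<integral>z. g' z * (\<theta> (fst z) * \<xi> (snd z)) \<partial>lborel)"
    and weak_dxx_pairing: "weak_dxx (cylQ T L) f f' \<Longrightarrow>
      (\<integral>z. g z * (\<theta> (fst z) * deriv (deriv \<xi>) (snd z)) \<partial>lborel) = (\<integral>z. g' z * (\<theta> (fst z) * \<xi> (snd z)) \<partial>lborel)"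
proof -
  let ?\<phi> = "\<lambda>z. \<theta> (fst z) * \<xi> (snd z)"
  have t: "test_fun (cylQ T L) ?\<phi>" by (rule test_fun_product[OF \<theta> \<xi>]) (simp add: cylQ_def)
  note d\<theta> = bump_on_deriv(2)[OF \<theta>] and d\<xi> = bump_on_deriv(2)[OF \<xi>]
  have dx: "pdx ?\<phi> = (\<lambda>z. \<theta> (fst z) * deriv \<xi> (snd z))" by (rule ext) (rule pdx_product[OF \<xi>])
  have dxx: "pdx (pdx ?\<phi>) = (\<lambda>z. \<theta> (fst z) * deriv (deriv \<xi>) (snd z))"
    unfolding dx by (rule ext) (rule pdx_product[OF d\<xi>])
  have dt: "pdt ?\<phi> = (\<lambda>z. deriv \<theta> (fst z) * \<xi> (snd z))" by (rule ext) (rule pdt_product[OF \<theta>])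
  show "(\<integral>z. g z * (\<theta> (fst z) * deriv \<xi> (snd z)) \<partial>lborel) = - (\<integral>z. g' z * ?\<phi> z \<partial>lborel)"
    if "weak_dx (cylQ T L) f f'"
    using that[unfolded weak_dx_def, rule_format, OF t] unfolding dx
      weak_integral_transfer[OF g bump_product_measurable[OF \<theta> d\<xi>]]
      weak_integral_transfer[OF g' bump_product_measurable[OF \<theta> \<xi>]] .
  show "(\<integral>z. g z * (deriv \<theta> (fst z) * \<xi> (snd z)) \<partial>lborel) = - (\<integral>z. g' z * ?\<phi> z \<partial>lborel)"
    if "weak_dt (cylQ T L) f f'"
    using that[unfolded weak_dt_def, rule_format, OF t] unfolding dt
      weak_integral_transfer[OF g bump_product_measurable[OF d\<theta> \<xi>]]
      weak_integral_transfer[OF g' bump_product_measurable[OF \<theta> \<xi>]] .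
  show "(\<integral>z. g z * (\<theta> (fst z) * deriv (deriv \<xi>) (snd z)) \<partial>lborel) = (\<integral>z. g' z * ?\<phi> z \<partial>lborel)"
    if "weak_dxx (cylQ T L) f f'"
    using that[unfolded weak_dxx_def, rule_format, OF t] unfolding dxx
      weak_integral_transfer[OF g bump_product_measurable[OF \<theta> bump_on_deriv(2)[OF d\<xi>]]]
      weak_integral_transfer[OF g' bump_product_measurable[OF \<theta> \<xi>]] .
qed

lemma L2_on_integrable: assumes "L2_on (cylQ T L) g" shows "integrable lborel g"
proof (rule L2_on_rectangle_integrable)
  show "g \<in> borel_measurable borel" "integrable lborel (\<lambda>z. (g z)\<^sup>2)" using assms unfolding L2_on_def by blast+
  show "g z = 0" if "z \<notin> {0<..<T} \<times> {0<..<L}" for z by (rule L2_on_cylQ_zero[OF assms that])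
qed

lemma slice_continuous:
  assumes "continuous_on ({0..T} \<times> {0..L}) f"
  shows "t \<in> {0..T} \<Longrightarrow> continuous_on {0..L} (\<lambda>x. f (t, x))"
    "x \<in> {0..L} \<Longrightarrow> continuous_on {0..T} (\<lambda>t. f (t, x))"
  by (rule continuous_on_compose2[OF assms]; auto intro!: continuous_intros)+

text \<open>The three primitive identities encode \<open>U = 0\<close> at \<open>x = 0\<close>,
  \<open>Ux = 0\<close> at \<open>x = L\<close> and the terminal condition, so that traces are not
  mentioned afterwards.\<close>

definition value_regular :: "real \<Rightarrow> real \<Rightarrow> (real \<Rightarrow> real) \<Rightarrow> (real \<times> real \<Rightarrow> real) \<Rightarrow> (real \<times> real \<Rightarrow> real) \<Rightarrow>
  (real \<times> real \<Rightarrow> real) \<Rightarrow> (real \<times> real \<Rightarrow> real) \<Rightarrow> bool" where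
  "value_regular T L uT U Ut Ux Uxx \<longleftrightarrow>
     L2_on (cylQ T L) U \<and> L2_on (cylQ T L) Ut \<and> L2_on (cylQ T L) Ux \<and> L2_on (cylQ T L) Uxx \<and>
     (\<exists>B. \<forall>z. \<bar>Ux z\<bar> \<le> B) \<and>
     (AE z in lborel. z \<in> cylQ T L \<longrightarrow> U z = (LBINT y:{..<snd z}. Ux (fst z, y))) \<and>
     (AE z in lborel. z \<in> cylQ T L \<longrightarrow> Ux z = - (LBINT y:{snd z<..}. Uxx (fst z, y))) \<and>
     (AE z in lborel. z \<in> cylQ T L \<longrightarrow> U z = uT (snd z) - (LBINT s:{fst z<..}. Ut (s, snd z)))"

lemma value_regularity:
  assumes TL: "T > 0" "L > 0" and r: "r \<ge> 2"
    and Lp: "Lp_on r (cylQ T L) u" "Lp_on r (cylQ T L) ut" "Lp_on r (cylQ T L) ux" "Lp_on r (cylQ T L) uxx"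
    and weak: "weak_dt (cylQ T L) u ut" "weak_dx (cylQ T L) u ux" "weak_dxx (cylQ T L) u uxx"
    and cont: "continuous_on ({0..T} \<times> {0..L}) U0" "continuous_on ({0..T} \<times> {0..L}) Ux0"
    and ae: "AE z in lebesgue. z \<in> cylQ T L \<longrightarrow> u z = U0 z" "AE z in lebesgue. z \<in> cylQ T L \<longrightarrow> ux z = Ux0 z"
    and bc: "\<forall>t\<in>{0..T}. U0 (t, 0) = 0 \<and> Ux0 (t, L) = 0" and tc: "\<forall>x\<in>{0..L}. U0 (T, x) = uT x"
  obtains U Ut Ux Uxx where "value_regular T L uT U Ut Ux Uxx"
    "AE z in lborel. z \<in> cylQ T L \<longrightarrow> u z = U z \<and> ut z = Ut z \<and> ux z = Ux z \<and> uxx z = Uxx z"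
proof -
  let ?Q = "cylQ T L"
  obtain U where U: "L2_on ?Q U" "AE z in lborel. z \<in> ?Q \<longrightarrow> u z = U z" by (rule Lp_representative[OF Lp(1) r])
  obtain Ut where Ut: "L2_on ?Q Ut" "AE z in lborel. z \<in> ?Q \<longrightarrow> ut z = Ut z" by (rule Lp_representative[OF Lp(2) r])
  obtain Ux1 where Ux1: "L2_on ?Q Ux1" "AE z in lborel. z \<in> ?Q \<longrightarrow> ux z = Ux1 z" by (rule Lp_representative[OF Lp(3) r])
  obtain Uxx where Uxx: "L2_on ?Q Uxx" "AE z in lborel. z \<in> ?Q \<longrightarrow> uxx z = Uxx z" by (rule Lp_representative[OF Lp(4) r])
  have ae': "AE z in lborel. z \<in> ?Q \<longrightarrow> u z = U0 z" "AE z in lborel. z \<in> ?Q \<longrightarrow> ux z = Ux0 z"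
    using ae by (simp_all add: AE_completion_iff)
  have "bounded (Ux0 ` ({0..T} \<times> {0..L}))"
    by (intro compact_imp_bounded compact_continuous_image cont compact_Times compact_Icc)
  then obtain B where B: "\<And>z. z \<in> {0..T} \<times> {0..L} \<Longrightarrow> \<bar>Ux0 z\<bar> \<le> B"
    unfolding bounded_iff real_norm_def by (metis image_eqI)
  \<comment> \<open>The continuous representative bounds \<open>ux\<close> almost everywhere;
    truncation of the Borel representative makes the bound pointwise.\<close>
  define Ux where "Ux z = (if \<bar>Ux1 z\<bar> \<le> \<bar>B\<bar> then Ux1 z else 0)" for z
  have [measurable]: "Ux1 \<in> borel_measurable borel" using Ux1(1) by (simp add: L2_on_def)
  have Uxm: "Ux \<in> borel_measurable borel" unfolding Ux_def[abs_def] by measurable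
  have UxB: "\<bar>Ux z\<bar> \<le> \<bar>B\<bar>" for z by (simp add: Ux_def)
  have Ux: "L2_on ?Q Ux" by (rule L2_on_bounded[OF Uxm UxB]) (simp add: Ux_def L2_on_zero[OF Ux1(1)])
  have Ux2: "AE z in lborel. z \<in> ?Q \<longrightarrow> ux z = Ux z" using Ux1(2) ae'(2)
  proof eventually_elim
    case (elim z)
    show ?case
    proof
      assume z: "z \<in> ?Q"
      then have "z \<in> {0..T} \<times> {0..L}" by (auto simp: cylQ_def)
      from B[OF this] have "\<bar>Ux1 z\<bar> \<le> \<bar>B\<bar>" using elim z by auto
      then show "ux z = Ux z" using elim z by (simp add: Ux_def)
    qed
  qed
  have z0: "\<And>z. z \<notin> {0<..<T} \<times> {0<..<L} \<Longrightarrow> Ux z = 0" "\<And>z. z \<notin> {0<..<T} \<times> {0<..<L} \<Longrightarrow> Uxx z = 0"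
    "\<And>z. z \<notin> {0<..<T} \<times> {0<..<L} \<Longrightarrow> Ut z = 0"
    by (rule L2_on_cylQ_zero[OF Ux] L2_on_cylQ_zero[OF Uxx(1)] L2_on_cylQ_zero[OF Ut(1)]; assumption)+
  have UU0: "AE z in lborel. z \<in> ?Q \<longrightarrow> U z = U0 z" using U(2) ae'(1) by eventually_elim auto
  have UxU0: "AE z in lborel. z \<in> ?Q \<longrightarrow> Ux z = Ux0 z" using Ux2 ae'(2) by eventually_elim auto
  obtain k1 where k1: "AE z in lborel. z \<in> {0<..<T} \<times> {0<..<L} \<longrightarrow> U z = k1 (fst z) + (LBINT y:{..<snd z}. Ux (fst z, y))"
    by (rule weak_x_derivative_primitive[OF L2_on_integrable[OF U(1)] L2_on_integrable[OF Ux] TL(2)])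
      (rule weak_dx_pairing[OF _ _ U Ux Ux2 weak(2)])
  have "AE z in lborel. z \<in> {0<..<T} \<times> {0<..<L} \<longrightarrow> U z = 0 + (LBINT y:{..<snd z}. Ux (fst z, y))"
  proof (rule primitive_boundary_left[where \<beta>="\<lambda>_. 0", OF L2_on_integrable[OF Ux] _ TL(2) k1])
    show "Ux z = 0" if "z \<notin> {0<..<T} \<times> {0<..<L}" for z using that by (rule z0)
    show "AE t in lborel. t \<in> {0<..<T} \<longrightarrow> (\<exists>h. continuous_on {0..L} h \<and> h 0 = 0 \<and> (AE x in lborel. x \<in> {0<..<L} \<longrightarrow> U (t, x) = h x))"
      using AE_lborel2_iterated[OF UU0]
    proof eventually_elim
      case (elim t)
      show ?case
      proof
        assume t: "t \<in> {0<..<T}"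
        have "AE x in lborel. x \<in> {0<..<L} \<longrightarrow> U (t, x) = U0 (t, x)"
          using elim by eventually_elim (use t in \<open>auto simp: cylQ_def\<close>)
        then show "\<exists>h. continuous_on {0..L} h \<and> h 0 = 0 \<and> (AE x in lborel. x \<in> {0<..<L} \<longrightarrow> U (t, x) = h x)"
          using slice_continuous(1)[OF cont(1), of t] bc t by (intro exI[of _ "\<lambda>x. U0 (t, x)"]) auto
      qed
    qed
  qed
  then have 1: "AE z in lborel. z \<in> ?Q \<longrightarrow> U z = (LBINT y:{..<snd z}. Ux (fst z, y))" by (simp add: cylQ_def)
  obtain k2 where k2: "AE z in lborel. z \<in> {0<..<T} \<times> {0<..<L} \<longrightarrow> Ux z = k2 (fst z) + (LBINT y:{..<snd z}. Uxx (fst z, y))"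
  proof (rule weak_x_derivative_primitive[OF L2_on_integrable[OF Ux] L2_on_integrable[OF Uxx(1)] TL(2)])
    \<comment> \<open>Testing the first weak derivative with \<open>deriv \<xi>\<close> and the
      second with \<open>\<xi>\<close> shows that \<open>uxx\<close> is the weak derivative of
      \<open>ux\<close>.\<close>
    fix \<theta> \<xi> assume b: "bump_on {0<..<T} \<theta>" "bump_on {0<..<L} \<xi>"
    show "(\<integral>z. Ux z * (\<theta> (fst z) * deriv \<xi> (snd z)) \<partial>lborel) = - (\<integral>z. Uxx z * (\<theta> (fst z) * \<xi> (snd z)) \<partial>lborel)"
      using weak_dx_pairing[OF b(1) bump_on_deriv(2)[OF b(2)] U Ux Ux2 weak(2)] weak_dxx_pairing[OF b U Uxx weak(3)] by simp
  qed
  have "AE z in lborel. z \<in> {0<..<T} \<times> {0<..<L} \<longrightarrow> Ux z = 0 - (LBINT y:{snd z<..}. Uxx (fst z, y))"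
  proof (rule primitive_boundary_right[where \<beta>="\<lambda>_. 0", OF L2_on_integrable[OF Uxx(1)] _ TL(2) k2])
    show "Uxx z = 0" if "z \<notin> {0<..<T} \<times> {0<..<L}" for z using that by (rule z0)
    show "AE t in lborel. t \<in> {0<..<T} \<longrightarrow> (\<exists>h. continuous_on {0..L} h \<and> h L = 0 \<and> (AE x in lborel. x \<in> {0<..<L} \<longrightarrow> Ux (t, x) = h x))"
      using AE_lborel2_iterated[OF UxU0]
    proof eventually_elim
      case (elim t)
      show ?case
      proof
        assume t: "t \<in> {0<..<T}"
        have "AE x in lborel. x \<in> {0<..<L} \<longrightarrow> Ux (t, x) = Ux0 (t, x)"
          using elim by eventually_elim (use t in \<open>auto simp: cylQ_def\<close>)
        then show "\<exists>h. continuous_on {0..L} h \<and> h L = 0 \<and> (AE x in lborel. x \<in> {0<..<L} \<longrightarrow> Ux (t, x) = h x)"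
          using slice_continuous(1)[OF cont(2), of t] bc t by (intro exI[of _ "\<lambda>x. Ux0 (t, x)"]) auto
      qed
    qed
  qed
  then have 2: "AE z in lborel. z \<in> ?Q \<longrightarrow> Ux z = - (LBINT y:{snd z<..}. Uxx (fst z, y))" by (simp add: cylQ_def)
  \<comment> \<open>Exchanging the variables turns the time derivative into a derivative in the
    second variable, and the terminal condition into a right boundary value.\<close>
  let ?Us = "\<lambda>z. U (snd z, fst z)" and ?Uts = "\<lambda>z. Ut (snd z, fst z)"
  have [measurable]: "U \<in> borel_measurable borel" "Ut \<in> borel_measurable borel" using U(1) Ut(1) by (auto simp: L2_on_def)
  note ius = integrable_swap[OF L2_on_integrable[OF U(1)]] integrable_swap[OF L2_on_integrable[OF Ut(1)]]
  obtain k3 where k3: "AE z in lborel. z \<in> {0<..<L} \<times> {0<..<T} \<longrightarrow> ?Us z = k3 (fst z) + (LBINT y:{..<snd z}. ?Uts (fst z, y))"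
  proof (rule weak_x_derivative_primitive[OF ius TL(1)])
    fix \<theta> \<xi> assume b: "bump_on {0<..<L} \<theta>" "bump_on {0<..<T} \<xi>"
    note [measurable] = bump_on_measurable[OF b(1)] bump_on_measurable[OF b(2)] bump_on_measurable[OF bump_on_deriv(2)[OF b(2)]]
    have "(\<integral>z. ?Us z * (\<theta> (fst z) * deriv \<xi> (snd z)) \<partial>lborel) = (\<integral>z. U z * (deriv \<xi> (fst z) * \<theta> (snd z)) \<partial>lborel)"
      by (subst integral_swap[of "\<lambda>z. U z * (deriv \<xi> (fst z) * \<theta> (snd z))", symmetric]) (simp_all add: mult.commute)
    moreover have "(\<integral>z. ?Uts z * (\<theta> (fst z) * \<xi> (snd z)) \<partial>lborel) = (\<integral>z. Ut z * (\<xi> (fst z) * \<theta> (snd z)) \<partial>lborel)"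
      by (subst integral_swap[of "\<lambda>z. Ut z * (\<xi> (fst z) * \<theta> (snd z))", symmetric]) (simp_all add: mult.commute)
    ultimately show "(\<integral>z. ?Us z * (\<theta> (fst z) * deriv \<xi> (snd z)) \<partial>lborel) = - (\<integral>z. ?Uts z * (\<theta> (fst z) * \<xi> (snd z)) \<partial>lborel)"
      using weak_dt_pairing[OF b(2,1) U Ut weak(1)] by simp
  qed
  have "AE z in lborel. z \<in> {0<..<L} \<times> {0<..<T} \<longrightarrow> ?Us z = uT (fst z) - (LBINT y:{snd z<..}. ?Uts (fst z, y))"
  proof (rule primitive_boundary_right[OF ius(2) _ TL(1) k3])
    show "?Uts z = 0" if "z \<notin> {0<..<L} \<times> {0<..<T}" for z using that by (intro z0) (auto simp: mem_Times_iff)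
    show "AE x in lborel. x \<in> {0<..<L} \<longrightarrow> (\<exists>h. continuous_on {0..T} h \<and> h T = uT x \<and> (AE t in lborel. t \<in> {0<..<T} \<longrightarrow> ?Us (x, t) = h t))"
      using AE_lborel2_swapped[OF UU0]
    proof eventually_elim
      case (elim x)
      show ?case
      proof
        assume x: "x \<in> {0<..<L}"
        have "AE t in lborel. t \<in> {0<..<T} \<longrightarrow> U (t, x) = U0 (t, x)"
          using elim by eventually_elim (use x in \<open>auto simp: cylQ_def\<close>)
        then show "\<exists>h. continuous_on {0..T} h \<and> h T = uT x \<and> (AE t in lborel. t \<in> {0<..<T} \<longrightarrow> ?Us (x, t) = h t)"
          using slice_continuous(2)[OF cont(1), of x] tc x by (intro exI[of _ "\<lambda>t. U0 (t, x)"]) auto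
      qed
    qed
  qed
  from AE_swap[OF this] have 3: "AE z in lborel. z \<in> ?Q \<longrightarrow> U z = uT (snd z) - (LBINT s:{fst z<..}. Ut (s, snd z))"
    by eventually_elim (auto simp: cylQ_def mem_Times_iff)
  have "value_regular T L uT U Ut Ux Uxx" unfolding value_regular_def using U(1) Ut(1) Ux Uxx(1) UxB 1 2 3 by blast
  moreover have "AE z in lborel. z \<in> ?Q \<longrightarrow> u z = U z \<and> ut z = Ut z \<and> ux z = Ux z \<and> uxx z = Uxx z"
    using U(2) Ut(2) Ux2 Uxx(2) by eventually_elim auto
  ultimately show ?thesis by (rule that)
qed

lemma tail_primitive_bounded:
  fixes M :: "real \<Rightarrow> real"
  assumes "M \<in> borel_measurable borel" "\<And>x. \<bar>M x\<bar> \<le> B" "\<And>x. x \<notin> {0<..<L} \<Longrightarrow> M x = 0"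
  shows "\<bar>LBINT y:A. M y\<bar> \<le> B * \<bar>L\<bar>"
proof -
  have "integrable lborel M" using assms by (rule integrable_bounded_on_interval(1))
  moreover have "(\<integral>x. \<bar>M x\<bar> \<partial>lborel) \<le> B * \<bar>L - 0\<bar>"
    using assms by (rule integrable_bounded_on_interval(2))
  ultimately have "integrable lborel M" "(\<integral>x. \<bar>M x\<bar> \<partial>lborel) \<le> B * \<bar>L - 0\<bar>" by this
  then show ?thesis using primitive_bound[of M A] by simp
qed

text \<open>Admissible test functions vanish at \<open>x = 0\<close> and are free at
  \<open>L\<close>. Taking the spatial factor as a primitive of an arbitrary bump
  \<open>\<zeta>\<close> and moving that primitive onto the density produces the tail integral. In
  this way the no-flux condition enters although the flux has no trace.\<close>

lemma density_regularity:
  fixes m mx q m0 :: "_ \<Rightarrow> real"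
  assumes TL: "T > 0" "L > 0"
    and M: "L2_on (cylQ T L) M" "\<And>z. \<bar>M z\<bar> \<le> B" "AE z in lborel. z \<in> cylQ T L \<longrightarrow> m z = M z"
    and Mx: "L2_on (cylQ T L) Mx" "AE z in lborel. z \<in> cylQ T L \<longrightarrow> mx z = Mx z"
    and F: "L2_on (cylQ T L) F" "AE z in lborel. z \<in> cylQ T L \<longrightarrow> f z = F z"
    and n0: "n0 \<in> borel_measurable borel" "\<And>x. \<bar>n0 x\<bar> \<le> B" "\<And>x. x \<notin> {0<..<L} \<Longrightarrow> n0 x = 0" "\<And>x. x \<in> {0<..<L} \<Longrightarrow> m0 x = n0 x"
    and weak: "weak_dx (cylQ T L) m mx"
    and trace: "AE t in lebesgue. t \<in> {0<..<T} \<longrightarrow> (\<exists>g. continuous_on {0..L} g \<and> g 0 = 0 \<and>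
       (AE x in lebesgue. x \<in> {0<..<L} \<longrightarrow> m (t, x) = g x))"
    and fp: "\<forall>\<phi>. test_fun ({..<T} \<times> UNIV) \<phi> \<and> (\<forall>t. \<phi> (t, 0) = 0) \<longrightarrow>
       (LINT z:cylQ T L|lebesgue. m z * pdt \<phi> z) + (LINT x:{0<..<L}|lebesgue. m0 x * \<phi> (0, x))
       = (LINT z:cylQ T L|lebesgue. f z * pdx \<phi> z)"
  shows "AE z in lborel. z \<in> cylQ T L \<longrightarrow> M z = (LBINT y:{..<snd z}. Mx (fst z, y))"
    and "AE z in lborel. z \<in> cylQ T L \<longrightarrow> (LBINT y:{snd z<..}. M (fst z, y))
      = (LBINT y:{snd z<..}. n0 y) - (LBINT s:{..<fst z}. F (s, snd z))"
proof -
  let ?Q = "cylQ T L"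
  have [measurable]: "M \<in> borel_measurable borel" "Mx \<in> borel_measurable borel" "F \<in> borel_measurable borel" "n0 \<in> borel_measurable borel"
    using M(1) Mx(1) F(1) n0 by (auto simp: L2_on_def)
  have z0: "\<And>z. z \<notin> {0<..<T} \<times> {0<..<L} \<Longrightarrow> M z = 0" "\<And>z. z \<notin> {0<..<T} \<times> {0<..<L} \<Longrightarrow> Mx z = 0"
    "\<And>z. z \<notin> {0<..<T} \<times> {0<..<L} \<Longrightarrow> F z = 0"
    by (rule L2_on_cylQ_zero[OF M(1)] L2_on_cylQ_zero[OF Mx(1)] L2_on_cylQ_zero[OF F(1)]; assumption)+
  obtain k where k: "AE z in lborel. z \<in> {0<..<T} \<times> {0<..<L} \<longrightarrow> M z = k (fst z) + (LBINT y:{..<snd z}. Mx (fst z, y))"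
    by (rule weak_x_derivative_primitive[OF L2_on_integrable[OF M(1)] L2_on_integrable[OF Mx(1)] TL(2)])
      (rule weak_dx_pairing[OF _ _ M(1,3) Mx weak])
  have "AE z in lborel. z \<in> {0<..<T} \<times> {0<..<L} \<longrightarrow> M z = 0 + (LBINT y:{..<snd z}. Mx (fst z, y))"
  proof (rule primitive_boundary_left[where \<beta>="\<lambda>_. 0", OF L2_on_integrable[OF Mx(1)] _ TL(2) k])
    show "Mx z = 0" if "z \<notin> {0<..<T} \<times> {0<..<L}" for z using that by (rule z0)
    have trace': "AE t in lborel. t \<in> {0<..<T} \<longrightarrow> (\<exists>g. continuous_on {0..L} g \<and> g 0 = 0 \<and>
       (AE x in lborel. x \<in> {0<..<L} \<longrightarrow> m (t, x) = g x))"
      using trace by (simp add: AE_completion_iff)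
    show "AE t in lborel. t \<in> {0<..<T} \<longrightarrow> (\<exists>h. continuous_on {0..L} h \<and> h 0 = 0 \<and> (AE x in lborel. x \<in> {0<..<L} \<longrightarrow> M (t, x) = h x))"
      using AE_lborel2_iterated[OF M(3)] trace'
    proof eventually_elim
      case (elim t)
      show ?case
      proof
        assume t: "t \<in> {0<..<T}"
        then obtain g where g: "continuous_on {0..L} g" "g 0 = 0" "AE x in lborel. x \<in> {0<..<L} \<longrightarrow> m (t, x) = g x"
          using elim by blast
        have "AE x in lborel. x \<in> {0<..<L} \<longrightarrow> M (t, x) = g x"
          using g(3) elim(1) by eventually_elim (use t in \<open>auto simp: cylQ_def\<close>)
        then show "\<exists>h. continuous_on {0..L} h \<and> h 0 = 0 \<and> (AE x in lborel. x \<in> {0<..<L} \<longrightarrow> M (t, x) = h x)"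
          using g by blast
      qed
    qed
  qed
  then show "AE z in lborel. z \<in> ?Q \<longrightarrow> M z = (LBINT y:{..<snd z}. Mx (fst z, y))" by (simp add: cylQ_def)
  \<comment> \<open>Without the cut the tail of \<open>M\<close> would stay constant for
    \<open>x < 0\<close>, and \<open>N\<close> need not be integrable.\<close>
  define N where "N z = indicator ?Q z * (LBINT y:{snd z<..}. M (fst z, y))" for z
  define N0 where "N0 x = indicator {0<..<L} x * (LBINT y:{x<..}. n0 y)" for x
  have Nm[measurable]: "N \<in> borel_measurable borel" "N0 \<in> borel_measurable borel"
    unfolding N_def[abs_def] N0_def[abs_def] using cylQ_borel by measurable
  have MB: "\<bar>LBINT y:A. M (t, y)\<bar> \<le> B * \<bar>L\<bar>" for A t
    by (rule tail_primitive_bounded) (use M(2) z0(1) in auto)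
  have n0B: "\<bar>LBINT y:A. n0 y\<bar> \<le> B * \<bar>L\<bar>" for A by (rule tail_primitive_bounded) (use n0 in auto)
  have BL: "0 \<le> B * \<bar>L\<bar>" using n0(2)[of 0] by simp
  have NB: "\<bar>N z\<bar> \<le> B * \<bar>L\<bar>" "\<bar>N0 x\<bar> \<le> B * \<bar>L\<bar>" for z x
    using MB n0B BL by (auto simp: N_def N0_def indicator_def)
  have iN: "integrable lborel N"
    by (rule integrable_bounded_on_rectangle[OF Nm(1) NB(1), of 0 T 0 L]) (simp add: N_def cylQ_def)
  have iN0: "integrable lborel N0"
    by (rule integrable_bounded_on_interval(1)[OF Nm(2) NB(2), of 0 L]) (simp add: N0_def)
  have in0: "integrable lborel n0" by (rule integrable_bounded_on_interval(1)[OF n0(1,2,3)])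
  have "AE z in lborel. z \<in> {0<..<T} \<times> {0<..<L} \<longrightarrow> N z = N0 (snd z) - (LBINT s:{..<fst z}. F (s, snd z))"
  proof (rule weak_t_derivative_initial[OF iN L2_on_integrable[OF F(1)] iN0 TL(1)])
    show "F z = 0" if "fst z \<notin> {0<..<T}" for z using that by (intro z0) auto
    show "N z = 0" if "fst z \<notin> {0<..<T}" for z
    proof -
      have "z \<notin> ?Q" using that by (auto simp: cylQ_def)
      then show ?thesis by (simp add: N_def)
    qed
    fix \<theta> \<zeta> assume \<theta>: "bump_on {-1<..<T} \<theta>" and \<zeta>: "bump_on {0<..<L} \<zeta>"
    obtain \<eta> where \<eta>: "bump_on {L<..<L + 1} \<eta>" "(\<integral>x. \<eta> x \<partial>lborel) = 1" using bump_unit_integral[of L "L + 1"] by auto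
    \<comment> \<open>a primitive of \<open>\<zeta>\<close> is constant near \<open>L\<close>; subtracting a bump beyond \<open>L\<close> gives it compact
      support without changing it on the domain\<close>
    define c where "c = (\<integral>x. \<zeta> x \<partial>lborel)"
    have b: "bump_on {0<..<L + 1} \<zeta>" "bump_on {0<..<L + 1} \<eta>"
      using \<zeta> \<eta>(1) TL(2) by (auto elim!: bump_on_mono)
    have "bump_on {0<..<L + 1} (\<lambda>x. \<zeta> x - c * \<eta> x)" by (rule bump_on_linear[OF b]) (rule is_interval_oo)
    moreover have "(\<integral>x. \<zeta> x - c * \<eta> x \<partial>lborel) = 0"
      using bump_on_integrable[OF \<zeta>] bump_on_integrable[OF \<eta>(1)] \<eta>(2) by (simp add: c_def)
    ultimately obtain X where X: "bump_on {0<..<L + 1} X" "deriv X = (\<lambda>x. \<zeta> x - c * \<eta> x)"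
      using bump_on_primitive is_interval_oo by blast
    let ?\<phi> = "\<lambda>z. \<theta> (fst z) * X (snd z)"
    have "test_fun ({..<T} \<times> UNIV) ?\<phi>" by (rule test_fun_product[OF \<theta> X(1)]) auto
    moreover have "X 0 = 0" by (rule bump_on_zero[OF X(1)]) simp
    ultimately have eq: "(LINT z:?Q|lebesgue. m z * pdt ?\<phi> z) + (LINT x:{0<..<L}|lebesgue. m0 x * ?\<phi> (0, x))
       = (LINT z:?Q|lebesgue. f z * pdx ?\<phi> z)" by (intro fp[rule_format] conjI allI) simp_all
    note d\<theta> = bump_on_deriv(2)[OF \<theta>] and dX = bump_on_deriv(2)[OF X(1)]
    note [measurable] = bump_on_measurable[OF \<theta>] bump_on_measurable[OF X(1)] bump_on_measurable[OF d\<theta>] bump_on_measurable[OF \<zeta>]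
    have dx: "pdx ?\<phi> = (\<lambda>z. \<theta> (fst z) * deriv X (snd z))" by (rule ext) (rule pdx_product[OF X(1)])
    have dt: "pdt ?\<phi> = (\<lambda>z. deriv \<theta> (fst z) * X (snd z))" by (rule ext) (rule pdt_product[OF \<theta>])
    have X\<zeta>: "deriv X x = \<zeta> x" if "x < L" for x using X(2) bump_on_zero[OF \<eta>(1), of x] that by simp
    have Xp: "X x = (LBINT y:{..<x}. \<zeta> y)" if "x < L" for x
    proof -
      have "(LBINT y:{..<x}. \<zeta> y) = (LBINT y:{..<x}. deriv X y)" unfolding set_lebesgue_integral_def
        by (rule Bochner_Integration.integral_cong) (use X\<zeta> that in \<open>auto simp: indicator_def\<close>)
      then show ?thesis using bump_on_FTC(1)[OF X(1)] by simp
    qed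
    obtain B1 where B1: "B1 \<ge> 0" "\<And>x. \<bar>deriv \<theta> x\<bar> \<le> B1" using bump_on_bounded[OF d\<theta>] by blast
    \<comment> \<open>\<open>\<mu>\<close> lives on \<open>(0, L)\<close>, and there the compactly
      supported \<open>X\<close> coincides with the primitive of \<open>\<zeta>\<close>.\<close>
    have swap: "(\<integral>x. \<mu> x * X x \<partial>lborel) = (\<integral>x. \<zeta> x * (LBINT y:{x<..}. \<mu> y) \<partial>lborel)"
      if \<mu>: "integrable lborel \<mu>" "\<And>x. x \<notin> {0<..<L} \<Longrightarrow> \<mu> x = 0" for \<mu>
    proof -
      have e: "\<mu> x * X x = \<mu> x * (LBINT y:{..<x}. \<zeta> y)" for x using \<mu>(2)[of x] Xp[of x] by (cases "x \<in> {0<..<L}") auto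
      show ?thesis unfolding e by (rule integral_triangle[OF bump_on_integrable[OF \<zeta>] \<mu>(1), symmetric])
    qed
    have 1: "(LINT z:?Q|lebesgue. m z * pdt ?\<phi> z) = (\<integral>z. N z * (deriv \<theta> (fst z) * \<zeta> (snd z)) \<partial>lborel)"
    proof -
      have i1: "integrable lborel (\<lambda>z. M z * (deriv \<theta> (fst z) * X (snd z)))"
        by (rule bump_pair_integrable[OF L2_on_integrable[OF M(1)] d\<theta> X(1)])
      have i2: "integrable lborel (\<lambda>z. N z * (deriv \<theta> (fst z) * \<zeta> (snd z)))"
        by (rule bump_pair_integrable[OF iN d\<theta> \<zeta>])
      have "(LINT z:?Q|lebesgue. m z * pdt ?\<phi> z) = (\<integral>z. M z * (deriv \<theta> (fst z) * X (snd z)) \<partial>lborel)"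
        unfolding dt by (rule weak_integral_transfer[OF M(1,3) bump_product_measurable[OF d\<theta> X(1)]])
      also have "\<dots> = (\<integral>t. \<integral>x. M (t, x) * (deriv \<theta> t * X x) \<partial>lborel \<partial>lborel)" using lborel2_integral_fst[OF i1] by simp
      also have "\<dots> = (\<integral>t. \<integral>x. N (t, x) * (deriv \<theta> t * \<zeta> x) \<partial>lborel \<partial>lborel)"
      proof (rule Bochner_Integration.integral_cong[OF refl])
        fix t
        show "(\<integral>x. M (t, x) * (deriv \<theta> t * X x) \<partial>lborel) = (\<integral>x. N (t, x) * (deriv \<theta> t * \<zeta> x) \<partial>lborel)"
        proof -
          have Mt: "M (t, x) = 0" if "x \<notin> {0<..<L}" for x using that by (intro z0) auto
          have iM: "integrable lborel (\<lambda>x. M (t, x))"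
            by (rule integrable_bounded_on_interval(1)[where B=B and c=0 and d=L]) (use M(2) Mt in auto)
          have "(\<integral>x. M (t, x) * (deriv \<theta> t * X x) \<partial>lborel) = deriv \<theta> t * (\<integral>x. M (t, x) * X x \<partial>lborel)"
            by (subst integral_mult_right_zero[symmetric]) (simp add: ac_simps)
          also have "\<dots> = deriv \<theta> t * (\<integral>x. \<zeta> x * (LBINT y:{x<..}. M (t, y)) \<partial>lborel)" using swap[OF iM Mt] by simp
          also have "\<dots> = (\<integral>x. deriv \<theta> t * (\<zeta> x * (LBINT y:{x<..}. M (t, y))) \<partial>lborel)"
            by (subst integral_mult_right_zero[symmetric]) simp
          also have "\<dots> = (\<integral>x. N (t, x) * (deriv \<theta> t * \<zeta> x) \<partial>lborel)"
          proof (rule Bochner_Integration.integral_cong[OF refl])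
            fix x
            show "deriv \<theta> t * (\<zeta> x * (LBINT y:{x<..}. M (t, y))) = N (t, x) * (deriv \<theta> t * \<zeta> x)"
            proof (cases "(t, x) \<in> ?Q")
              case True
              then show ?thesis by (simp add: N_def)
            next
              case False
              then have "\<zeta> x = 0 \<or> (LBINT y:{x<..}. M (t, y)) = 0"
              proof (cases "x \<in> {0<..<L}")
                case True
                then have "t \<notin> {0<..<T}" using False by (auto simp: cylQ_def)
                then have "(LBINT y:{x<..}. M (t, y)) = 0" by (intro primitive_zero z0) auto
                then show ?thesis by simp
              qed (use bump_on_zero[OF \<zeta>] in auto)
              then show ?thesis using False by (auto simp: N_def)
            qed
          qed
          finally show ?thesis .
        qed
      qed
      also have "\<dots> = (\<integral>z. N z * (deriv \<theta> (fst z) * \<zeta> (snd z)) \<partial>lborel)" using lborel2_integral_fst[OF i2] by simp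
      finally show ?thesis .
    qed
    have 2: "(LINT x:{0<..<L}|lebesgue. m0 x * ?\<phi> (0, x)) = \<theta> 0 * (\<integral>x. N0 x * \<zeta> x \<partial>lborel)"
    proof -
      have "(LINT x:{0<..<L}|lebesgue. m0 x * ?\<phi> (0, x)) = (\<integral>x. n0 x * (\<theta> 0 * X x) \<partial>lborel)"
        by (rule set_integral_lebesgue_eq_lborel) (use n0 in auto)
      also have "\<dots> = \<theta> 0 * (\<integral>x. n0 x * X x \<partial>lborel)"
        by (subst integral_mult_right_zero[symmetric]) (simp add: ac_simps)
      also have "(\<integral>x. n0 x * X x \<partial>lborel) = (\<integral>x. \<zeta> x * (LBINT y:{x<..}. n0 y) \<partial>lborel)" by (rule swap[OF in0 n0(3)])
      also have "\<dots> = (\<integral>x. N0 x * \<zeta> x \<partial>lborel)"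
      proof (rule Bochner_Integration.integral_cong[OF refl])
        show "\<zeta> x * (LBINT y:{x<..}. n0 y) = N0 x * \<zeta> x" for x
          using bump_on_zero[OF \<zeta>, of x] by (cases "x \<in> {0<..<L}") (auto simp: N0_def)
      qed
      finally show ?thesis .
    qed
    have 3: "(LINT z:?Q|lebesgue. f z * pdx ?\<phi> z) = (\<integral>z. F z * (\<theta> (fst z) * \<zeta> (snd z)) \<partial>lborel)"
    proof -
      have "(LINT z:?Q|lebesgue. f z * pdx ?\<phi> z) = (\<integral>z. F z * (\<theta> (fst z) * deriv X (snd z)) \<partial>lborel)"
        unfolding dx by (rule weak_integral_transfer[OF F bump_product_measurable[OF \<theta> dX]])
      also have "\<dots> = (\<integral>z. F z * (\<theta> (fst z) * \<zeta> (snd z)) \<partial>lborel)"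
      proof (rule Bochner_Integration.integral_cong[OF refl])
        show "F z * (\<theta> (fst z) * deriv X (snd z)) = F z * (\<theta> (fst z) * \<zeta> (snd z))" for z
          using z0(3)[of z] X\<zeta>[of "snd z"] by (cases "z \<in> {0<..<T} \<times> {0<..<L}") (auto simp: mem_Times_iff)
      qed
      finally show ?thesis .
    qed
    show "(\<integral>z. N z * (deriv \<theta> (fst z) * \<zeta> (snd z)) \<partial>lborel) + \<theta> 0 * (\<integral>x. N0 x * \<zeta> x \<partial>lborel)
      = (\<integral>z. F z * (\<theta> (fst z) * \<zeta> (snd z)) \<partial>lborel)" using eq unfolding 1 2 3 .
  qed
  then show "AE z in lborel. z \<in> ?Q \<longrightarrow> (LBINT y:{snd z<..}. M (fst z, y))
      = (LBINT y:{snd z<..}. n0 y) - (LBINT s:{..<fst z}. F (s, snd z))"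
    by eventually_elim (auto simp: N_def N0_def cylQ_def)
qed

section \<open>Uniqueness\<close>

lemma L2_onI:
  "f \<in> borel_measurable borel \<Longrightarrow> integrable lborel (\<lambda>z. (f z)\<^sup>2) \<Longrightarrow> (\<And>z. z \<notin> Q \<Longrightarrow> f z = 0) \<Longrightarrow> L2_on Q f"
  unfolding L2_on_def by blast

lemma L2_onD:
  assumes "L2_on Q f"
  shows "f \<in> borel_measurable borel" "integrable lborel (\<lambda>z. (f z)\<^sup>2)"
  using assms unfolding L2_on_def by blast+

lemma L2_on_mult_bounded:
  assumes f: "L2_on Q f" and g[measurable]: "g \<in> borel_measurable borel" and B: "\<And>z. \<bar>g z\<bar> \<le> B"
  shows "L2_on Q (\<lambda>z. g z * f z)"
proof (rule L2_onI)
  note [measurable] = L2_onD(1)[OF f]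
  show "(\<lambda>z. g z * f z) \<in> borel_measurable borel" by measurable
  show "integrable lborel (\<lambda>z. (g z * f z)\<^sup>2)"
    unfolding power_mult_distrib
  proof (rule integrable_mult_bounded[OF L2_onD(2)[OF f]])
    show "\<bar>(g z)\<^sup>2\<bar> \<le> B\<^sup>2" for z by (rule abs_square_le[OF B])
  qed measurable
  show "g z * f z = 0" if "z \<notin> Q" for z using L2_on_zero[OF f that] by simp
qed

lemma L2_on_add:
  assumes f: "L2_on Q f" and g: "L2_on Q g"
  shows "L2_on Q (\<lambda>z. f z + g z)"
proof (rule L2_onI)
  note [measurable] = L2_onD(1)[OF f] L2_onD(1)[OF g]
  show "(\<lambda>z. f z + g z) \<in> borel_measurable borel" by measurable
  show "integrable lborel (\<lambda>z. (f z + g z)\<^sup>2)"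
  proof (rule Bochner_Integration.integrable_bound)
    show "integrable lborel (\<lambda>z. 2 * (f z)\<^sup>2 + 2 * (g z)\<^sup>2)" using L2_onD(2)[OF f] L2_onD(2)[OF g] by simp
    have "(x + y)\<^sup>2 \<le> 2 * x\<^sup>2 + 2 * y\<^sup>2" for x y :: real using sum_squares_bound[of x y] by (simp add: power2_sum)
    then show "AE z in lborel. norm ((f z + g z)\<^sup>2) \<le> norm (2 * (f z)\<^sup>2 + 2 * (g z)\<^sup>2)" by (intro AE_I2) simp
  qed measurable
  show "f z + g z = 0" if "z \<notin> Q" for z using L2_on_zero[OF f that] L2_on_zero[OF g that] by simp
qed

lemma L2_on_cmult: "L2_on Q f \<Longrightarrow> L2_on Q (\<lambda>z. c * f z)"
  by (rule L2_on_mult_bounded[where B="\<bar>c\<bar>"]) auto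

lemma L2_on_diff:
  assumes "L2_on Q f" "L2_on Q g"
  shows "L2_on Q (\<lambda>z. f z - g z)"
  using L2_on_add[OF assms(1) L2_on_cmult[OF assms(2), of "-1"]] by simp

lemma L2_on_pairing:
  assumes "L2_on Q f" "L2_on Q' g"
  shows "integrable lborel (\<lambda>z. f z * g z)"
  using L2_onD[OF assms(1)] L2_onD[OF assms(2)] by (intro integrable_mult_L2) simp_all

lemma set_integral_AE_diff:
  fixes f g h :: "real \<Rightarrow> real"
  assumes f: "integrable lborel f" and g: "integrable lborel g" and h: "h \<in> borel_measurable borel"
    and ae: "AE s in lborel. h s = f s - g s" and A: "A \<in> sets borel"
  shows "(LBINT s:A. h s) = (LBINT s:A. f s) - (LBINT s:A. g s)"
proof -
  have [measurable]: "f \<in> borel_measurable borel" "g \<in> borel_measurable borel"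
    using f g by (auto dest: borel_measurable_integrable)
  note [measurable] = h A
  have "set_integrable lborel A f" "set_integrable lborel A g"
    unfolding set_integrable_def by (intro integrable_mult_indicator f g; simp add: A)+
  from set_integral_diff(2)[OF this] have "(LBINT s:A. f s) - (LBINT s:A. g s) = (LBINT s:A. f s - g s)" by simp
  also have "\<dots> = (LBINT s:A. h s)" unfolding set_lebesgue_integral_def
    by (rule integral_cong_AE) (use ae in \<open>measurable, eventually_elim, auto\<close>)
  finally show ?thesis by simp
qed

text \<open>The quantifier over \<open>A\<close> stands inside \<open>AE\<close>: the exceptional
  null set must not depend on the half-line, whose end point varies with \<open>z\<close>.\<close>

lemma AE_primitive_t_diff:
  fixes f g h :: "real \<times> real \<Rightarrow> real"
  assumes f: "integrable lborel f" and g: "integrable lborel g" and h[measurable]: "h \<in> borel_measurable borel"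
    and ae: "AE z in lborel. h z = f z - g z"
  shows "AE z :: real \<times> real in lborel. \<forall>A\<in>sets borel. (LBINT s:A. h (s, snd z)) = (LBINT s:A. f (s, snd z)) - (LBINT s:A. g (s, snd z))"
proof (rule AE_lborel2_snd)
  show "AE x in lborel. \<forall>A\<in>sets borel. (LBINT s:A. h (s, x)) = (LBINT s:A. f (s, x)) - (LBINT s:A. g (s, x))"
    using lborel2_AE_snd[OF f] lborel2_AE_snd[OF g] AE_lborel2_swapped[OF ae]
    by eventually_elim (auto intro!: set_integral_AE_diff)
qed

lemma AE_primitive_x_diff:
  fixes f g h :: "real \<times> real \<Rightarrow> real"
  assumes f: "integrable lborel f" and g: "integrable lborel g" and h[measurable]: "h \<in> borel_measurable borel"
    and ae: "AE z in lborel. h z = f z - g z"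
  shows "AE z :: real \<times> real in lborel. \<forall>A\<in>sets borel. (LBINT y:A. h (fst z, y)) = (LBINT y:A. f (fst z, y)) - (LBINT y:A. g (fst z, y))"
proof (rule AE_lborel2_fst)
  show "AE t in lborel. \<forall>A\<in>sets borel. (LBINT y:A. h (t, y)) = (LBINT y:A. f (t, y)) - (LBINT y:A. g (t, y))"
    using lborel2_AE_fst[OF f] lborel2_AE_fst[OF g] AE_lborel2_iterated[OF ae]
    by eventually_elim (auto intro!: set_integral_AE_diff)
qed

lemma primitive_reflect:
  fixes f :: "real \<Rightarrow> real"
  shows "(LBINT y:{..<c - x}. f (c - y)) = (LBINT y:{x<..}. f y)"
    and "(LBINT y:{c - x<..}. f (c - y)) = (LBINT y:{..<x}. f y)"
proof -
  have "(LBINT y:{x<..}. f y) = \<bar>- 1\<bar> *\<^sub>R (\<integral>y. indicator {x<..} (c + (- 1) * y) *\<^sub>R f (c + (- 1) * y) \<partial>lborel)"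
    unfolding set_lebesgue_integral_def by (rule lborel_integral_real_affine) simp
  also have "\<dots> = (LBINT y:{..<c - x}. f (c - y))"
    unfolding set_lebesgue_integral_def by (simp, rule Bochner_Integration.integral_cong) (auto simp: indicator_def)
  finally show "(LBINT y:{..<c - x}. f (c - y)) = (LBINT y:{x<..}. f y)" ..
  have "(LBINT y:{..<x}. f y) = \<bar>- 1\<bar> *\<^sub>R (\<integral>y. indicator {..<x} (c + (- 1) * y) *\<^sub>R f (c + (- 1) * y) \<partial>lborel)"
    unfolding set_lebesgue_integral_def by (rule lborel_integral_real_affine) simp
  also have "\<dots> = (LBINT y:{c - x<..}. f (c - y))"
    unfolding set_lebesgue_integral_def by (simp, rule Bochner_Integration.integral_cong) (auto simp: indicator_def)
  finally show "(LBINT y:{c - x<..}. f (c - y)) = (LBINT y:{..<x}. f y)" ..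
qed

lemma integrable_reflect:
  fixes f :: "real \<Rightarrow> real"
  assumes "integrable lborel f"
  shows "integrable lborel (\<lambda>y. f (c - y))"
  using lborel_integrable_real_affine[OF assms, of "-1" c] by simp

lemma tail_product:
  fixes a b :: "real \<Rightarrow> real"
  assumes "integrable lborel a" "integrable lborel b"
  shows "(LBINT y:{x<..}. a y) * (LBINT y:{x<..}. b y)
    = (LBINT y:{x<..}. a y * (LBINT s:{y<..}. b s) + b y * (LBINT s:{y<..}. a s))"
proof -
  have r: "(LBINT s:{..<y}. f (- s)) = (LBINT s:{- y<..}. f s)" for f :: "real \<Rightarrow> real" and y
    using primitive_reflect(1)[of 0 "- y" f] by simp
  have i: "integrable lborel (\<lambda>y. a (- y))" "integrable lborel (\<lambda>y. b (- y))"
    using integrable_reflect[OF assms(1), of 0] integrable_reflect[OF assms(2), of 0] by simp_all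
  have "(LBINT y:{x<..}. a y) * (LBINT y:{x<..}. b y) = (LBINT y:{..<- x}. a (- y)) * (LBINT y:{..<- x}. b (- y))"
    by (simp add: r)
  also have "\<dots> = (LBINT y:{..<- x}. a (- y) * (LBINT s:{..<y}. b (- s)) + b (- y) * (LBINT s:{..<y}. a (- s)))"
    by (rule primitive_product[OF i])
  also have "\<dots> = (LBINT y:{..<- x}. (\<lambda>y. a y * (LBINT s:{y<..}. b s) + b y * (LBINT s:{y<..}. a s)) (- y))"
    by (simp add: r)
  also have "\<dots> = (LBINT y:{x<..}. a y * (LBINT s:{y<..}. b s) + b y * (LBINT s:{y<..}. a s))"
    by (subst r) simp
  finally show ?thesis .
qed

text \<open>The product rule for \<open>exp (- lam * t)\<close> times the tail of \<open>f\<close>.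
  The exponential is not itself a tail, so on the interval it is split into the tail of
  \<open>b\<close> and the constant \<open>exp (- lam * T)\<close>; \<open>tail_product\<close>
  treats the first summand and linearity the second.\<close>

lemma exp_weighted_tail:
  fixes f g :: "real \<Rightarrow> real"
  assumes f: "integrable lborel f" and t: "t \<in> {0<..<T}" and fT: "\<And>s. s \<notin> {0<..<T} \<Longrightarrow> f s = 0"
    and g[measurable]: "g \<in> borel_measurable borel"
    and ae: "AE s in lborel. s \<in> {0<..<T} \<longrightarrow> g s = exp (- lam * s) * (f s + lam * (LBINT r:{s<..}. f r))"
    and gT: "\<And>s. s \<notin> {0<..<T} \<Longrightarrow> g s = 0"
  shows "exp (- lam * t) * (LBINT r:{t<..}. f r) = (LBINT s:{t<..}. g s)"
proof -
  have [measurable]: "f \<in> borel_measurable borel" using f by (auto dest: borel_measurable_integrable)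
  define b where "b s = indicator {0<..<T} s * (lam * exp (- lam * s))" for s
  have bm[measurable]: "b \<in> borel_measurable borel" unfolding b_def[abs_def] by measurable
  have b: "integrable lborel b"
  proof -
    have "integrable lborel (\<lambda>s. indicator {0..T} s *\<^sub>R (lam * exp (- lam * s)))"
      by (rule borel_integrable_compact) (auto intro!: continuous_intros)
    then have "integrable lborel (\<lambda>s. indicator {0<..<T} s *\<^sub>R (indicator {0..T} s *\<^sub>R (lam * exp (- lam * s))))"
      by (rule integrable_mult_indicator[rotated]) simp
    moreover have eq: "indicator {0<..<T} s *\<^sub>R (indicator {0..T} s *\<^sub>R (lam * exp (- lam * s))) = b s" for s
      by (auto simp: b_def indicator_def)
    ultimately show ?thesis by (simp only: eq)
  qed
  let ?I = "\<lambda>s. LBINT r:{s<..}. f r"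
  have tb: "(LBINT r:{s<..}. b r) = exp (- lam * s) - exp (- lam * T)" if s: "s \<in> {0<..<T}" for s
  proof -
    have "(\<integral>x. (lam * exp (- lam * x)) * indicator {s..T} x \<partial>lborel) = (- exp (- lam * T)) - (- exp (- lam * s))"
      by (rule integral_FTC_Icc_real[where F="\<lambda>x. - exp (- lam * x)"])
        (use s in \<open>auto intro!: derivative_eq_intros continuous_intros\<close>)
    moreover have "(LBINT r:{s<..}. b r) = (\<integral>x. (lam * exp (- lam * x)) * indicator {s..T} x \<partial>lborel)"
      unfolding set_lebesgue_integral_def
    proof (rule integral_cong_AE)
      have "indicator {s<..} r *\<^sub>R b r = (lam * exp (- lam * r)) * indicator {s..T} r" if "r \<noteq> s" "r \<noteq> T" for r
        using that s by (auto simp: b_def indicator_def)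
      then show "AE r in lborel. indicator {s<..} r *\<^sub>R b r = (lam * exp (- lam * r)) * indicator {s..T} r"
        by (intro AE_I[where N="{s, T}"]) (auto simp: emeasure_lborel_countable)
    qed measurable
    ultimately show ?thesis by simp
  qed
  have "exp (- lam * t) * ?I t = (LBINT r:{t<..}. b r) * ?I t + exp (- lam * T) * ?I t"
    by (simp add: tb[OF t] algebra_simps)
  also have "(LBINT r:{t<..}. b r) * ?I t = (LBINT y:{t<..}. b y * ?I y + f y * (LBINT s:{y<..}. b s))"
    by (rule tail_product[OF b f])
  also have "exp (- lam * T) * ?I t = (LBINT y:{t<..}. exp (- lam * T) * f y)" by simp
  also have "(LBINT y:{t<..}. b y * ?I y + f y * (LBINT s:{y<..}. b s)) + (LBINT y:{t<..}. exp (- lam * T) * f y)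
    = (LBINT y:{t<..}. (b y * ?I y + f y * (LBINT s:{y<..}. b s)) + exp (- lam * T) * f y)"
  proof (rule set_integral_add(2)[symmetric])
    have "integrable lborel (\<lambda>y. ?I y * b y)"
      by (rule integrable_mult_bounded[OF b _ primitive_bound[OF f]]) measurable
    moreover have "integrable lborel (\<lambda>y. (LBINT s:{y<..}. b s) * f y)"
      by (rule integrable_mult_bounded[OF f _ primitive_bound[OF b]]) measurable
    ultimately have "integrable lborel (\<lambda>y. b y * ?I y + f y * (LBINT s:{y<..}. b s))" by (simp add: mult.commute)
    then show "set_integrable lborel {t<..} (\<lambda>y. b y * ?I y + f y * (LBINT s:{y<..}. b s))"
      unfolding set_integrable_def by (intro integrable_mult_indicator) auto
    show "set_integrable lborel {t<..} (\<lambda>y. exp (- lam * T) * f y)"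
      unfolding set_integrable_def using f by (intro integrable_mult_indicator) auto
  qed
  also have "\<dots> = (LBINT s:{t<..}. g s)"
  proof (rule set_lebesgue_integral_cong_AE)
    show "AE y in lborel. y \<in> {t<..} \<longrightarrow> b y * ?I y + f y * (LBINT s:{y<..}. b s) + exp (- lam * T) * f y = g y"
      using ae
    proof eventually_elim
      case (elim y)
      show ?case
      proof (cases "y \<in> {0<..<T}")
        case True
        then have "b y = lam * exp (- lam * y)" by (simp add: b_def)
        then show ?thesis using elim True unfolding tb[OF True] by (simp add: algebra_simps)
      next
        case False
        then have "b y = 0" "f y = 0" "g y = 0" using fT gT by (simp_all add: b_def)
        then show ?thesis by simp
      qed
    qed
  qed measurable
  finally show ?thesis .
qed

text \<open>The product rule for \<open>s2\<close> times a density that starts from 0 at the left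
  end. The coefficient starts from \<open>s20\<close> instead, which accounts for the separate term
  with \<open>s20\<close>.\<close>

lemma divergence_primitive:
  fixes \<mu>x \<mu> s2 ds2 :: "real \<Rightarrow> real"
  assumes \<mu>x: "integrable lborel \<mu>x" "\<And>y. y \<notin> {0<..<L} \<Longrightarrow> \<mu>x y = 0" and ds2: "integrable lborel ds2" "\<And>y. y \<notin> {0<..<L} \<Longrightarrow> ds2 y = 0"
    and m[measurable]: "\<mu> \<in> borel_measurable borel" "s2 \<in> borel_measurable borel"
    and s2: "\<And>y. y \<in> {0<..<L} \<Longrightarrow> s2 y = s20 + (LBINT s:{..<y}. ds2 s)"
    and \<mu>: "AE y in lborel. y \<in> {0<..<L} \<longrightarrow> \<mu> y = (LBINT s:{..<y}. \<mu>x s)"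
    and x: "x \<in> {0<..<L}" "\<mu> x = (LBINT s:{..<x}. \<mu>x s)"
  shows "s2 x * \<mu> x = (LBINT y:{..<x}. s2 y * \<mu>x y + ds2 y * \<mu> y)"
proof -
  have [measurable]: "\<mu>x \<in> borel_measurable borel" "ds2 \<in> borel_measurable borel"
    using \<mu>x ds2 by (auto dest: borel_measurable_integrable)
  let ?D = "\<lambda>y. LBINT s:{..<y}. ds2 s" and ?I = "\<lambda>y. LBINT s:{..<y}. \<mu>x s"
  have "s2 x * \<mu> x = ?D x * ?I x + s20 * ?I x" using s2[OF x(1)] x(2) by (simp add: algebra_simps)
  also have "?D x * ?I x = (LBINT y:{..<x}. ds2 y * ?I y + \<mu>x y * ?D y)" by (rule primitive_product[OF ds2(1) \<mu>x(1)])
  also have "s20 * ?I x = (LBINT y:{..<x}. s20 * \<mu>x y)" by simp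
  also have "(LBINT y:{..<x}. ds2 y * ?I y + \<mu>x y * ?D y) + \<dots> = (LBINT y:{..<x}. (ds2 y * ?I y + \<mu>x y * ?D y) + s20 * \<mu>x y)"
  proof (rule set_integral_add(2)[symmetric])
    have "integrable lborel (\<lambda>y. ?I y * ds2 y)" by (rule integrable_mult_bounded[OF ds2(1) _ primitive_bound[OF \<mu>x(1)]]) measurable
    moreover have "integrable lborel (\<lambda>y. ?D y * \<mu>x y)" by (rule integrable_mult_bounded[OF \<mu>x(1) _ primitive_bound[OF ds2(1)]]) measurable
    ultimately have "integrable lborel (\<lambda>y. ds2 y * ?I y + \<mu>x y * ?D y)" by (simp add: mult.commute)
    then show "set_integrable lborel {..<x} (\<lambda>y. ds2 y * ?I y + \<mu>x y * ?D y)"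
      unfolding set_integrable_def by (intro integrable_mult_indicator) auto
    show "set_integrable lborel {..<x} (\<lambda>y. s20 * \<mu>x y)"
      unfolding set_integrable_def using \<mu>x(1) by (intro integrable_mult_indicator) auto
  qed
  also have "\<dots> = (LBINT y:{..<x}. s2 y * \<mu>x y + ds2 y * \<mu> y)"
  proof (rule set_lebesgue_integral_cong_AE)
    show "AE y in lborel. y \<in> {..<x} \<longrightarrow> ds2 y * ?I y + \<mu>x y * ?D y + s20 * \<mu>x y = s2 y * \<mu>x y + ds2 y * \<mu> y"
      using \<mu>
    proof eventually_elim
      case (elim y)
      show ?case
      proof (cases "y \<in> {0<..<L}")
        case True
        then show ?thesis using elim s2[OF True] by (simp add: algebra_simps)
      next
        case False
        then show ?thesis using \<mu>x(2)[OF False] ds2(2)[OF False] by simp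
      qed
    qed
  qed measurable
  finally show ?thesis .
qed

text \<open>For \<open>H(A) = (max 0 A)^2 / (4 kap)\<close> one has \<open>H = kap q^2\<close> and
  \<open>H' = q\<close>, so this is convexity of the Hamiltonian, used once with each density as
  weight. Its defect is at least \<open>kap (q1 - q2)^2\<close>: for the unclipped parabola with
  equality, and in general because \<open>A \<le> 2 kap q\<close> and
  \<open>q \<ge> 0\<close>.\<close>

lemma lasry_lions_pointwise:
  fixes A1 A2 q1 q2 m1 m2 kap :: real
  assumes k: "kap > 0" and m: "m1 \<ge> 0" "m2 \<ge> 0"
    and q: "q1 = max 0 (A1 / (2 * kap))" "q2 = max 0 (A2 / (2 * kap))"
  shows "kap * (m1 - m2) * (q1\<^sup>2 - q2\<^sup>2) - (A1 - A2) * (q1 * m1 - q2 * m2) \<le> - (kap * (m1 + m2) * (q1 - q2)\<^sup>2)"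
proof -
  have *: "kap * (p\<^sup>2 - r\<^sup>2) - (a - b) * p \<le> - (kap * (p - r)\<^sup>2)"
    if "p = max 0 (a / (2 * kap))" "r = max 0 (b / (2 * kap))" for p r a b
  proof -
    have 1: "a * p = 2 * kap * p\<^sup>2" using k that(1) by (auto simp: max_def power2_eq_square)
    have "b = 2 * kap * (b / (2 * kap))" using k by simp
    also have "\<dots> \<le> 2 * kap * r" using k that(2) by (intro mult_left_mono) auto
    finally have "b * p \<le> 2 * kap * r * p" using that(1) by (intro mult_right_mono) auto
    moreover have "kap * (p\<^sup>2 - r\<^sup>2) - (a - b) * p = kap * p\<^sup>2 - kap * r\<^sup>2 - a * p + b * p" by (simp add: algebra_simps)
    moreover have "- (kap * (p - r)\<^sup>2) = 2 * kap * r * p - kap * p\<^sup>2 - kap * r\<^sup>2"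
      by (simp add: power2_eq_square algebra_simps)
    ultimately show ?thesis using 1 by linarith
  qed
  have "m1 * (kap * (q1\<^sup>2 - q2\<^sup>2) - (A1 - A2) * q1) \<le> m1 * - (kap * (q1 - q2)\<^sup>2)"
    by (rule mult_left_mono[OF *[OF q] m(1)])
  moreover have "m2 * (kap * (q2\<^sup>2 - q1\<^sup>2) - (A2 - A1) * q2) \<le> m2 * - (kap * (q2 - q1)\<^sup>2)"
    by (rule mult_left_mono[OF *[OF q(2,1)] m(2)])
  ultimately show ?thesis by (simp add: power2_eq_square algebra_simps)
qed

lemma lborel_reflect2: "distr lborel borel (\<lambda>z. v - z) = (lborel :: (real \<times> real) measure)"
  using lborel_affine[of "-1" v] by (simp add: density_1)

lemma AE_reflect:
  assumes "AE z in lborel. P (z :: real \<times> real)"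
  shows "AE z in lborel. P (T - fst z, L - snd z)"
proof -
  have "AE z in distr lborel borel (\<lambda>z. (T, L) - z). P z" unfolding lborel_reflect2 by (rule assms)
  then have "AE z in lborel. P ((T, L) - z)" by (rule AE_distrD[rotated]) measurable
  then show ?thesis
  proof eventually_elim
    case (elim z)
    moreover have "(T, L) - z = (T - fst z, L - snd z)" by (cases z) simp
    ultimately show ?case by simp
  qed
qed

lemma L2_on_reflect:
  assumes f: "L2_on (cylQ T L) f"
  shows "L2_on (cylQ T L) (\<lambda>z. f (T - fst z, L - snd z))"
proof (rule L2_onI)
  note [measurable] = L2_onD(1)[OF f]
  show "(\<lambda>z. f (T - fst z, L - snd z)) \<in> borel_measurable borel" by measurable
  have "integrable (distr lborel borel (\<lambda>z. (T, L) - z)) (\<lambda>z. (f z)\<^sup>2)"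
    unfolding lborel_reflect2 by (rule L2_onD(2)[OF f])
  then have i: "integrable lborel (\<lambda>z. (f ((T, L) - z))\<^sup>2)" by (rule integrable_distr[rotated]) measurable
  have eq: "(T, L) - z = (T - fst z, L - snd z)" for z :: "real \<times> real" by (cases z) simp
  show "integrable lborel (\<lambda>z. (f (T - fst z, L - snd z))\<^sup>2)" using i unfolding eq .
  show "f (T - fst z, L - snd z) = 0" if "z \<notin> cylQ T L" for z
    using that by (intro L2_on_zero[OF f]) (auto simp: cylQ_def mem_Times_iff)
qed

text \<open>A weak solution in primitive form: each weak equation is replaced by an identity that
  holds almost everywhere. \<open>s2\<close> and \<open>ds2\<close> stand for the squared volatility
  and its derivative, \<open>s20\<close> for the left boundary value of \<open>s2\<close>, and
  \<open>n0\<close> for the initial density cut to the open interval. A single \<open>B\<close>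
  bounds \<open>n0\<close>, \<open>Ux\<close>, \<open>M\<close> and \<open>q\<close>.\<close>

locale regular_solution =
  fixes T L lam gam kap :: real and P :: "real \<Rightarrow> real \<Rightarrow> real" and s2 ds2 n0 uT :: "real \<Rightarrow> real"
    and a0 A s20 :: real and U Ut Ux Uxx M Mx q :: "real \<times> real \<Rightarrow> real" and B :: real
  assumes T_pos: "T > 0" and L_pos: "L > 0" and kap_pos: "kap > 0" and a0_pos: "a0 > 0"
    and s2_meas: "s2 \<in> borel_measurable borel" and ds2_meas: "ds2 \<in> borel_measurable borel"
    and s2_bound: "\<And>x. \<bar>s2 x\<bar> \<le> A" and ds2_bound: "\<And>x. \<bar>ds2 x\<bar> \<le> A"
    and s2_ge: "\<And>x. x \<in> {0<..<L} \<Longrightarrow> s2 x \<ge> a0"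
    and s2_prim: "\<And>x. x \<in> {0<..<L} \<Longrightarrow> s2 x = s20 + (LBINT y:{..<x}. ds2 y)"
    and ds2_zero: "\<And>x. x \<notin> {0<..<L} \<Longrightarrow> ds2 x = 0"
    and n0_meas: "n0 \<in> borel_measurable borel" and n0_bound: "\<And>x. \<bar>n0 x\<bar> \<le> B"
    and n0_zero: "\<And>x. x \<notin> {0<..<L} \<Longrightarrow> n0 x = 0" and n0_nonneg: "\<And>x. n0 x \<ge> 0"
    and value_reg: "value_regular T L uT U Ut Ux Uxx"
    and M: "L2_on (cylQ T L) M" and Mx: "L2_on (cylQ T L) Mx" and q: "L2_on (cylQ T L) q"
    and Ux_bound: "\<And>z. \<bar>Ux z\<bar> \<le> B" and M_bound: "\<And>z. \<bar>M z\<bar> \<le> B" and q_bound: "\<And>z. \<bar>q z\<bar> \<le> B"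
    and q_nonneg: "\<And>z. q z \<ge> 0"
    and hjb: "AE z in lborel. z \<in> cylQ T L \<longrightarrow> Ut z + s2 (snd z) * Uxx z - lam * U z + kap * (q z)\<^sup>2 = 0"
    and control: "AE z in lborel. z \<in> cylQ T L \<longrightarrow>
      q z = max 0 ((P (fst z) (\<integral>x. q (fst z, x) * M (fst z, x) \<partial>lborel) - gam - Ux z) / (2 * kap))"
    and M_prim: "AE z in lborel. z \<in> cylQ T L \<longrightarrow> M z = (LBINT y:{..<snd z}. Mx (fst z, y))"
    and fp: "AE z in lborel. z \<in> cylQ T L \<longrightarrow> (LBINT y:{snd z<..}. M (fst z, y)) = (LBINT y:{snd z<..}. n0 y)
      - (LBINT s:{..<fst z}. s2 (snd z) * Mx (s, snd z) + ds2 (snd z) * M (s, snd z) + M (s, snd z) * q (s, snd z))"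
begin

lemma U_L2: "L2_on (cylQ T L) U" "L2_on (cylQ T L) Ut" "L2_on (cylQ T L) Ux" "L2_on (cylQ T L) Uxx"
  and U_prim: "AE z in lborel. z \<in> cylQ T L \<longrightarrow> U z = (LBINT y:{..<snd z}. Ux (fst z, y))"
  and Ux_prim: "AE z in lborel. z \<in> cylQ T L \<longrightarrow> Ux z = - (LBINT y:{snd z<..}. Uxx (fst z, y))"
  and U_time: "AE z in lborel. z \<in> cylQ T L \<longrightarrow> U z = uT (snd z) - (LBINT s:{fst z<..}. Ut (s, snd z))"
  using value_reg unfolding value_regular_def by blast+

text \<open>The equation reads \<open>m_t = flux_x\<close>. The derivative of \<open>s2 * M\<close>
  is expanded so that only the coefficient functions and \<open>Mx\<close> appear.\<close>

definition flux :: "real \<times> real \<Rightarrow> real" where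
  "flux z = s2 (snd z) * Mx z + ds2 (snd z) * M z + M z * q z"

lemma s2_snd_meas:
  "(\<lambda>z :: real \<times> real. s2 (snd z)) \<in> borel_measurable borel"
  "(\<lambda>z :: real \<times> real. ds2 (snd z)) \<in> borel_measurable borel"
proof -
  note [measurable] = s2_meas ds2_meas
  show "(\<lambda>z :: real \<times> real. s2 (snd z)) \<in> borel_measurable borel" "(\<lambda>z :: real \<times> real. ds2 (snd z)) \<in> borel_measurable borel"
    by measurable
qed

lemma flux_L2: "L2_on (cylQ T L) flux"
  unfolding flux_def[abs_def]
proof (intro L2_on_add)
  show "L2_on (cylQ T L) (\<lambda>z. s2 (snd z) * Mx z)" by (rule L2_on_mult_bounded[OF Mx s2_snd_meas(1) s2_bound])
  show "L2_on (cylQ T L) (\<lambda>z. ds2 (snd z) * M z)" by (rule L2_on_mult_bounded[OF M s2_snd_meas(2) ds2_bound])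
  show "L2_on (cylQ T L) (\<lambda>z. M z * q z)" by (rule L2_on_mult_bounded[OF q L2_onD(1)[OF M] M_bound])
qed

text \<open>The derivative of the coefficient and the control are both bounded, so together they
  form the lower order coefficient of the maximum principle.\<close>

lemma density_nonneg: "AE z in lborel. M z \<ge> 0"
proof (rule fokker_planck_nonneg[where T=T and L=L and m=M and mx=Mx and a="\<lambda>z. s2 (snd z)" and c="\<lambda>z. ds2 (snd z) + q z"
      and ?m0.0=n0 and F=flux and B=B and A=A and C="A + B" and ?a0.0=a0])
  show "(\<lambda>z :: real \<times> real. s2 (snd z)) \<in> borel_measurable borel" by (rule s2_snd_meas(1))
  note [measurable] = s2_snd_meas(2) L2_onD(1)[OF q]
  show "(\<lambda>z. ds2 (snd z) + q z) \<in> borel_measurable borel" by measurable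
  show "a0 \<le> s2 (snd z)" if "z \<in> {0<..<T} \<times> {0<..<L}" for z using that by (intro s2_ge) auto
  show "\<bar>ds2 (snd z) + q z\<bar> \<le> A + B" for z using ds2_bound[of "snd z"] q_bound[of z] by linarith
  show "AE z in lborel. z \<in> {0<..<T} \<times> {0<..<L} \<longrightarrow> M z = (LBINT y:{..<snd z}. Mx (fst z, y))"
    using M_prim by (simp only: cylQ_def)
  show "AE z in lborel. z \<in> {0<..<T} \<times> {0<..<L} \<longrightarrow> (LBINT y:{snd z<..}. M (fst z, y))
      = (LBINT y:{snd z<..}. n0 y) - (LBINT s:{..<fst z}. flux (s, snd z))"
    using fp by (simp only: cylQ_def flux_def fst_conv snd_conv)
  show "flux z = s2 (snd z) * Mx z + (ds2 (snd z) + q z) * M z" for z by (simp add: flux_def algebra_simps)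
qed (use T_pos L_pos L2_onD[OF M] L2_onD[OF Mx] n0_meas L2_on_cylQ_zero[OF M] L2_on_cylQ_zero[OF Mx] n0_zero M_bound n0_bound
      n0_nonneg a0_pos s2_bound in blast)+

end

text \<open>Both solutions have the same initial density and the same terminal value, which drop out
  of the differences; the bounds \<open>B1\<close> and \<open>B2\<close> are kept apart.\<close>

locale regular_pair =
  S1: regular_solution T L lam gam kap P s2 ds2 n0 uT a0 A s20 U1 Ut1 Ux1 Uxx1 M1 Mx1 q1 B1 +
  S2: regular_solution T L lam gam kap P s2 ds2 n0 uT a0 A s20 U2 Ut2 Ux2 Uxx2 M2 Mx2 q2 B2
  for T L lam gam kap P s2 ds2 n0 uT a0 A s20 U1 Ut1 Ux1 Uxx1 M1 Mx1 q1 B1 U2 Ut2 Ux2 Uxx2 M2 Mx2 q2 B2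
begin

lemma density_difference:
  "AE z in lborel. z \<in> cylQ T L \<longrightarrow> (LBINT y:{snd z<..}. M1 (fst z, y) - M2 (fst z, y))
    = - (LBINT s:{..<fst z}. S1.flux (s, snd z) - S2.flux (s, snd z))"
  and density_difference_prim:
  "AE z in lborel. z \<in> cylQ T L \<longrightarrow> M1 z - M2 z = (LBINT y:{..<snd z}. Mx1 (fst z, y) - Mx2 (fst z, y))"
proof -
  have fd: "(\<lambda>z. S1.flux z - S2.flux z) \<in> borel_measurable borel" by (rule L2_onD(1)[OF L2_on_diff[OF S1.flux_L2 S2.flux_L2]])
  have md: "(\<lambda>z. M1 z - M2 z) \<in> borel_measurable borel" by (rule L2_onD(1)[OF L2_on_diff[OF S1.M S2.M]])
  have mxd: "(\<lambda>z. Mx1 z - Mx2 z) \<in> borel_measurable borel" by (rule L2_onD(1)[OF L2_on_diff[OF S1.Mx S2.Mx]])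
  have f: "AE z :: real \<times> real in lborel. \<forall>A\<in>sets borel. (LBINT s:A. S1.flux (s, snd z) - S2.flux (s, snd z))
      = (LBINT s:A. S1.flux (s, snd z)) - (LBINT s:A. S2.flux (s, snd z))"
    by (rule AE_primitive_t_diff[OF L2_on_integrable[OF S1.flux_L2] L2_on_integrable[OF S2.flux_L2] fd]) simp
  have m: "AE z :: real \<times> real in lborel. \<forall>A\<in>sets borel. (LBINT y:A. M1 (fst z, y) - M2 (fst z, y))
      = (LBINT y:A. M1 (fst z, y)) - (LBINT y:A. M2 (fst z, y))"
    by (rule AE_primitive_x_diff[OF L2_on_integrable[OF S1.M] L2_on_integrable[OF S2.M] md]) simp
  have mx: "AE z :: real \<times> real in lborel. \<forall>A\<in>sets borel. (LBINT y:A. Mx1 (fst z, y) - Mx2 (fst z, y))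
      = (LBINT y:A. Mx1 (fst z, y)) - (LBINT y:A. Mx2 (fst z, y))"
    by (rule AE_primitive_x_diff[OF L2_on_integrable[OF S1.Mx] L2_on_integrable[OF S2.Mx] mxd]) simp
  show "AE z in lborel. z \<in> cylQ T L \<longrightarrow> (LBINT y:{snd z<..}. M1 (fst z, y) - M2 (fst z, y))
    = - (LBINT s:{..<fst z}. S1.flux (s, snd z) - S2.flux (s, snd z))"
    using f m S1.fp S2.fp by eventually_elim (simp add: S1.flux_def S2.flux_def)
  show "AE z in lborel. z \<in> cylQ T L \<longrightarrow> M1 z - M2 z = (LBINT y:{..<snd z}. Mx1 (fst z, y) - Mx2 (fst z, y))"
    using mx S1.M_prim S2.M_prim by eventually_elim simp
qed

text \<open>The flux difference is the flux of \<open>M1 - M2\<close> with drift \<open>q1\<close>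
  plus the error \<open>M2 (q1 - q2)\<close>, which vanishes by hypothesis. So the difference solves
  a linear Fokker-Planck equation with zero initial value, and the maximum principle applies to
  it.\<close>

lemma density_le:
  assumes same: "AE z in lborel. M2 z * (q1 z - q2 z) = 0"
  shows "AE z in lborel. M2 z \<le> M1 z"
proof -
  define F where "F z = s2 (snd z) * (Mx1 z - Mx2 z) + (ds2 (snd z) + q1 z) * (M1 z - M2 z)" for z
  note [measurable] = S1.s2_snd_meas L2_onD(1)[OF S1.M] L2_onD(1)[OF S2.M] L2_onD(1)[OF S1.Mx] L2_onD(1)[OF S2.Mx]
    L2_onD(1)[OF S1.q]
  have Fm[measurable]: "F \<in> borel_measurable borel" unfolding F_def[abs_def] by measurable
  have Fd: "AE z in lborel. F z = S1.flux z - S2.flux z"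
    using same
  proof eventually_elim
    case (elim z)
    have "F z = S1.flux z - S2.flux z - M2 z * (q1 z - q2 z)"
      by (simp add: F_def S1.flux_def S2.flux_def algebra_simps)
    then show ?case by (simp only: elim diff_zero)
  qed
  have f: "AE z :: real \<times> real in lborel. \<forall>A\<in>sets borel. (LBINT s:A. F (s, snd z))
      = (LBINT s:A. S1.flux (s, snd z)) - (LBINT s:A. S2.flux (s, snd z))"
    by (rule AE_primitive_t_diff[OF L2_on_integrable[OF S1.flux_L2] L2_on_integrable[OF S2.flux_L2] Fm Fd])
  have g: "AE z :: real \<times> real in lborel. \<forall>A\<in>sets borel. (LBINT s:A. S1.flux (s, snd z) - S2.flux (s, snd z))
      = (LBINT s:A. S1.flux (s, snd z)) - (LBINT s:A. S2.flux (s, snd z))"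
    by (rule AE_primitive_t_diff[OF L2_on_integrable[OF S1.flux_L2] L2_on_integrable[OF S2.flux_L2]
      L2_onD(1)[OF L2_on_diff[OF S1.flux_L2 S2.flux_L2]]]) simp
  have "AE z in lborel. M1 z - M2 z \<ge> 0"
  proof (rule fokker_planck_nonneg[where T=T and L=L and m="\<lambda>z. M1 z - M2 z" and mx="\<lambda>z. Mx1 z - Mx2 z"
      and a="\<lambda>z. s2 (snd z)" and c="\<lambda>z. ds2 (snd z) + q1 z"
      and ?m0.0="\<lambda>_. 0" and F=F and B="B1 + B2" and A=A and C="A + B1" and ?a0.0=a0])
    show "integrable lborel (\<lambda>z. (Mx1 z - Mx2 z)\<^sup>2)" by (rule L2_onD(2)[OF L2_on_diff[OF S1.Mx S2.Mx]])
    show "M1 z - M2 z = 0" if "z \<notin> {0<..<T} \<times> {0<..<L}" for z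
      by (rule L2_on_cylQ_zero[OF L2_on_diff[OF S1.M S2.M] that])
    show "Mx1 z - Mx2 z = 0" if "z \<notin> {0<..<T} \<times> {0<..<L}" for z
      by (rule L2_on_cylQ_zero[OF L2_on_diff[OF S1.Mx S2.Mx] that])
    show "\<bar>M1 z - M2 z\<bar> \<le> B1 + B2" for z using S1.M_bound[of z] S2.M_bound[of z] by linarith
    show "\<bar>0\<bar> \<le> B1 + B2" using S1.M_bound[of 0] S2.M_bound[of 0] by linarith
    show "a0 \<le> s2 (snd z)" if "z \<in> {0<..<T} \<times> {0<..<L}" for z using that by (intro S1.s2_ge) auto
    show "\<bar>ds2 (snd z) + q1 z\<bar> \<le> A + B1" for z using S1.ds2_bound[of "snd z"] S1.q_bound[of z] by linarith
    show "AE z in lborel. z \<in> {0<..<T} \<times> {0<..<L} \<longrightarrow> M1 z - M2 z = (LBINT y:{..<snd z}. Mx1 (fst z, y) - Mx2 (fst z, y))"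
      using density_difference_prim by (simp only: cylQ_def)
    show "AE z in lborel. z \<in> {0<..<T} \<times> {0<..<L} \<longrightarrow> (LBINT y:{snd z<..}. M1 (fst z, y) - M2 (fst z, y))
        = (LBINT y:{snd z<..}. 0) - (LBINT s:{..<fst z}. F (s, snd z))"
      using density_difference f g by eventually_elim (simp add: cylQ_def)
    show "F z = s2 (snd z) * (Mx1 z - Mx2 z) + (ds2 (snd z) + q1 z) * (M1 z - M2 z)" for z by (rule F_def)
  qed (use S1.T_pos S1.L_pos S1.a0_pos S1.s2_bound in \<open>auto\<close>)
  then show ?thesis by eventually_elim simp
qed

section \<open>The difference of the value functions and its weight in time\<close>

abbreviation w where "w z \<equiv> U1 z - U2 z"
abbreviation wt where "wt z \<equiv> Ut1 z - Ut2 z"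
abbreviation wx where "wx z \<equiv> Ux1 z - Ux2 z"
abbreviation wxx where "wxx z \<equiv> Uxx1 z - Uxx2 z"

text \<open>The exponential turns \<open>w_t - lam w\<close> into a pure time derivative. With the
  indicator the weight vanishes off the time interval and is bounded on the whole line.\<close>

definition weight :: "real \<Rightarrow> real" where "weight t = indicator {0<..<T} t * exp (- lam * t)"

lemma weight_measurable [measurable]: "weight \<in> borel_measurable borel"
  unfolding weight_def[abs_def] by measurable

lemma weight_bound: "\<bar>weight t\<bar> \<le> exp (\<bar>lam\<bar> * T)"
proof (cases "t \<in> {0<..<T}")
  case True
  have "- lam * t \<le> \<bar>lam\<bar> * t" using True by (intro mult_right_mono) auto
  also have "\<dots> \<le> \<bar>lam\<bar> * T" using True by (intro mult_left_mono) auto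
  finally show ?thesis using True by (simp add: weight_def)
qed (simp add: weight_def)

lemma weight_pos: "t \<in> {0<..<T} \<Longrightarrow> weight t > 0" by (simp add: weight_def)

lemma weight_nonneg: "weight t \<ge> 0" by (simp add: weight_def)

lemma w_L2: "L2_on (cylQ T L) w" "L2_on (cylQ T L) wt" "L2_on (cylQ T L) wx" "L2_on (cylQ T L) wxx"
  by (intro L2_on_diff S1.U_L2 S2.U_L2)+

lemma w_prim: "AE z in lborel. z \<in> cylQ T L \<longrightarrow> w z = (LBINT y:{..<snd z}. wx (fst z, y))"
  and wx_prim: "AE z in lborel. z \<in> cylQ T L \<longrightarrow> wx z = - (LBINT y:{snd z<..}. wxx (fst z, y))"
  and w_time: "AE z in lborel. z \<in> cylQ T L \<longrightarrow> w z = - (LBINT s:{fst z<..}. wt (s, snd z))"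
  and w_equation: "AE z in lborel. z \<in> cylQ T L \<longrightarrow> wt z + s2 (snd z) * wxx z - lam * w z = - (kap * ((q1 z)\<^sup>2 - (q2 z)\<^sup>2))"
proof -
  have 1: "AE z :: real \<times> real in lborel. \<forall>A\<in>sets borel. (LBINT y:A. wx (fst z, y)) = (LBINT y:A. Ux1 (fst z, y)) - (LBINT y:A. Ux2 (fst z, y))"
    by (rule AE_primitive_x_diff[OF L2_on_integrable[OF S1.U_L2(3)] L2_on_integrable[OF S2.U_L2(3)] L2_onD(1)[OF w_L2(3)]]) simp
  have 2: "AE z :: real \<times> real in lborel. \<forall>A\<in>sets borel. (LBINT y:A. wxx (fst z, y)) = (LBINT y:A. Uxx1 (fst z, y)) - (LBINT y:A. Uxx2 (fst z, y))"
    by (rule AE_primitive_x_diff[OF L2_on_integrable[OF S1.U_L2(4)] L2_on_integrable[OF S2.U_L2(4)] L2_onD(1)[OF w_L2(4)]]) simp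
  have 3: "AE z :: real \<times> real in lborel. \<forall>A\<in>sets borel. (LBINT s:A. wt (s, snd z)) = (LBINT s:A. Ut1 (s, snd z)) - (LBINT s:A. Ut2 (s, snd z))"
    by (rule AE_primitive_t_diff[OF L2_on_integrable[OF S1.U_L2(2)] L2_on_integrable[OF S2.U_L2(2)] L2_onD(1)[OF w_L2(2)]]) simp
  show "AE z in lborel. z \<in> cylQ T L \<longrightarrow> w z = (LBINT y:{..<snd z}. wx (fst z, y))"
    using 1 S1.U_prim S2.U_prim by eventually_elim simp
  show "AE z in lborel. z \<in> cylQ T L \<longrightarrow> wx z = - (LBINT y:{snd z<..}. wxx (fst z, y))"
    using 2 S1.Ux_prim S2.Ux_prim by eventually_elim simp
  show "AE z in lborel. z \<in> cylQ T L \<longrightarrow> w z = - (LBINT s:{fst z<..}. wt (s, snd z))"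
    using 3 S1.U_time S2.U_time by eventually_elim simp
  show "AE z in lborel. z \<in> cylQ T L \<longrightarrow> wt z + s2 (snd z) * wxx z - lam * w z = - (kap * ((q1 z)\<^sup>2 - (q2 z)\<^sup>2))"
    using S1.hjb S2.hjb by eventually_elim (auto simp: algebra_simps)
qed

text \<open>\<open>g\<close> has to agree with the weighted time derivative only almost everywhere,
  so the HJB equation may be used to supply a \<open>g\<close> in which no time derivative
  occurs.\<close>

lemma w_weighted_time:
  assumes g: "L2_on (cylQ T L) g" and ae: "AE z in lborel. z \<in> cylQ T L \<longrightarrow> g z = weight (fst z) * (wt z - lam * w z)"
  shows "AE z in lborel. z \<in> cylQ T L \<longrightarrow> weight (fst z) * w z = - (LBINT s:{fst z<..}. g (s, snd z))"
proof -
  have "AE x in lborel. x \<in> {0<..<L} \<longrightarrow> (\<forall>t\<in>{0<..<T}. exp (- lam * t) * (LBINT r:{t<..}. wt (r, x)) = (LBINT s:{t<..}. g (s, x)))"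
    using AE_lborel2_swapped[OF ae] AE_lborel2_swapped[OF w_time] lborel2_AE_snd[OF L2_on_integrable[OF w_L2(2)]]
  proof eventually_elim
    case (elim x)
    show ?case
    proof (intro impI ballI)
      fix t assume x: "x \<in> {0<..<L}" and t: "t \<in> {0<..<T}"
      show "exp (- lam * t) * (LBINT r:{t<..}. wt (r, x)) = (LBINT s:{t<..}. g (s, x))"
      proof (rule exp_weighted_tail[OF elim(3) t])
        show "wt (s, x) = 0" if "s \<notin> {0<..<T}" for s using that by (intro L2_on_cylQ_zero[OF w_L2(2)]) auto
        show "g (s, x) = 0" if "s \<notin> {0<..<T}" for s using that by (intro L2_on_cylQ_zero[OF g]) auto
        note [measurable] = L2_onD(1)[OF g]
        show "(\<lambda>s. g (s, x)) \<in> borel_measurable borel" by measurable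
        show "AE s in lborel. s \<in> {0<..<T} \<longrightarrow> g (s, x) = exp (- lam * s) * (wt (s, x) + lam * (LBINT r:{s<..}. wt (r, x)))"
          using elim(1,2)
        proof eventually_elim
          case (elim s)
          show ?case
          proof
            assume s: "s \<in> {0<..<T}"
            then have "(s, x) \<in> cylQ T L" using x by (simp add: cylQ_def)
            then have "g (s, x) = weight s * (wt (s, x) - lam * w (s, x))" "w (s, x) = - (LBINT r:{s<..}. wt (r, x))"
              using elim by simp_all
            moreover have "weight s = exp (- lam * s)" using s by (simp add: weight_def)
            ultimately show "g (s, x) = exp (- lam * s) * (wt (s, x) + lam * (LBINT r:{s<..}. wt (r, x)))" by simp
          qed
        qed
      qed
    qed
  qed
  from AE_lborel2_snd[OF this] w_time show ?thesis
  proof eventually_elim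
    case (elim z)
    show ?case
    proof
      assume z: "z \<in> cylQ T L"
      then have "fst z \<in> {0<..<T}" "snd z \<in> {0<..<L}" by (auto simp: cylQ_def)
      moreover from this have "weight (fst z) = exp (- lam * fst z)" by (simp add: weight_def)
      moreover have "w z = - (LBINT s:{fst z<..}. wt (s, snd z))" using elim z by simp
      ultimately show "weight (fst z) * w z = - (LBINT s:{fst z<..}. g (s, snd z))" using elim(1) by simp
    qed
  qed
qed

section \<open>The Lasry-Lions identity and its sign\<close>

abbreviation \<mu> where "\<mu> z \<equiv> M1 z - M2 z"
abbreviation \<mu>x where "\<mu>x z \<equiv> Mx1 z - Mx2 z"

text \<open>The \<open>x\<close>-derivative of \<open>s2 * (M1 - M2)\<close> in expanded form; with
  \<open>control_flux\<close> it makes up the difference of the two fluxes.\<close>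

definition diffusive_flux :: "real \<times> real \<Rightarrow> real" where
  "diffusive_flux z = s2 (snd z) * \<mu>x z + ds2 (snd z) * \<mu> z"

definition control_flux :: "real \<times> real \<Rightarrow> real" where
  "control_flux z = M1 z * q1 z - M2 z * q2 z"

lemma \<mu>_L2: "L2_on (cylQ T L) \<mu>" "L2_on (cylQ T L) \<mu>x"
  by (intro L2_on_diff S1.M S2.M S1.Mx S2.Mx)+

lemma \<mu>_bound: "\<bar>\<mu> z\<bar> \<le> B1 + B2"
  using S1.M_bound[of z] S2.M_bound[of z] by linarith

lemma diffusive_flux_L2: "L2_on (cylQ T L) diffusive_flux"
  unfolding diffusive_flux_def[abs_def]
  by (rule L2_on_add; rule L2_on_mult_bounded[OF \<mu>_L2(2) S1.s2_snd_meas(1) S1.s2_bound]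
    L2_on_mult_bounded[OF \<mu>_L2(1) S1.s2_snd_meas(2) S1.ds2_bound])

lemma control_flux_L2: "L2_on (cylQ T L) control_flux"
  unfolding control_flux_def[abs_def]
  by (rule L2_on_diff; rule L2_on_mult_bounded[OF S1.q L2_onD(1)[OF S1.M] S1.M_bound]
    L2_on_mult_bounded[OF S2.q L2_onD(1)[OF S2.M] S2.M_bound])

lemma weight_fst_measurable: "(\<lambda>z :: real \<times> real. weight (fst z)) \<in> borel_measurable borel"
  by measurable

lemma weighted_L2: "L2_on (cylQ T L) f \<Longrightarrow> L2_on (cylQ T L) (\<lambda>z. weight (fst z) * f z)"
  by (rule L2_on_mult_bounded[OF _ weight_fst_measurable weight_bound])

text \<open>Integration by parts in \<open>x\<close> on each time slice. No boundary term appears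
  because \<open>wx\<close> is 0 at \<open>L\<close>, as its tail form says, and
  \<open>\<mu>\<close> is 0 at the left end, as its primitive form says.\<close>

lemma diffusive_pairing:
  "(\<integral>z. (weight (fst z) * wx z) * diffusive_flux z \<partial>lborel) = - (\<integral>z. (weight (fst z) * wxx z) * (s2 (snd z) * \<mu> z) \<partial>lborel)"
proof -
  note wx' = weighted_L2[OF w_L2(3)] and wxx' = weighted_L2[OF w_L2(4)]
  have s\<mu>: "L2_on (cylQ T L) (\<lambda>z. s2 (snd z) * \<mu> z)" by (rule L2_on_mult_bounded[OF \<mu>_L2(1) S1.s2_snd_meas(1) S1.s2_bound])
  have i1: "integrable lborel (\<lambda>z. (weight (fst z) * wx z) * diffusive_flux z)" by (rule L2_on_pairing[OF wx' diffusive_flux_L2])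
  have i2: "integrable lborel (\<lambda>z. (weight (fst z) * wxx z) * (s2 (snd z) * \<mu> z))" by (rule L2_on_pairing[OF wxx' s\<mu>])
  note [measurable] = L2_onD(1)[OF w_L2(3)] L2_onD(1)[OF w_L2(4)] L2_onD(1)[OF diffusive_flux_L2] L2_onD(1)[OF \<mu>_L2(1)] S1.s2_meas
  have ds2: "integrable lborel ds2" by (rule integrable_bounded_on_interval(1)[OF S1.ds2_meas S1.ds2_bound S1.ds2_zero])
  have "AE t in lborel. (\<integral>x. (weight t * wx (t, x)) * diffusive_flux (t, x) \<partial>lborel)
      = - (\<integral>x. (weight t * wxx (t, x)) * (s2 x * \<mu> (t, x)) \<partial>lborel)"
    using AE_lborel2_iterated[OF wx_prim] AE_lborel2_iterated[OF density_difference_prim]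
      lborel2_AE_fst[OF L2_on_integrable[OF w_L2(4)]] lborel2_AE_fst[OF L2_on_integrable[OF diffusive_flux_L2]]
      lborel2_AE_fst[OF L2_on_integrable[OF \<mu>_L2(2)]]
  proof eventually_elim
    case (elim t)
    show ?case
    proof (cases "t \<in> {0<..<T}")
      case False
      then show ?thesis by (simp add: weight_def)
    next
      case True
      have Qt: "(t, x) \<in> cylQ T L \<longleftrightarrow> x \<in> {0<..<L}" for x using True by (simp add: cylQ_def)
      have zt: "wxx (t, x) = 0" "diffusive_flux (t, x) = 0" "\<mu>x (t, x) = 0" if "x \<notin> {0<..<L}" for x
        using that Qt L2_on_zero[OF w_L2(4), of "(t, x)"] L2_on_zero[OF diffusive_flux_L2, of "(t, x)"]
          L2_on_zero[OF \<mu>_L2(2), of "(t, x)"] by blast+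
      have \<mu>p: "AE x in lborel. x \<in> {0<..<L} \<longrightarrow> \<mu> (t, x) = (LBINT s:{..<x}. \<mu>x (t, s))"
        using elim(2) by eventually_elim (simp add: Qt)
      have "(\<integral>x. (weight t * wx (t, x)) * diffusive_flux (t, x) \<partial>lborel)
        = (\<integral>x. (- weight t) * (diffusive_flux (t, x) * (LBINT y:{x<..}. wxx (t, y))) \<partial>lborel)"
      proof (rule integral_cong_AE)
        show "AE x in lborel. (weight t * wx (t, x)) * diffusive_flux (t, x)
          = (- weight t) * (diffusive_flux (t, x) * (LBINT y:{x<..}. wxx (t, y)))"
          using elim(1)
        proof eventually_elim
          case (elim x)
          then show ?case using zt(2)[of x] Qt[of x] by (cases "x \<in> {0<..<L}") auto
        qed
      qed measurable
      also have "\<dots> = (- weight t) * (\<integral>y. wxx (t, y) * (LBINT x:{..<y}. diffusive_flux (t, x)) \<partial>lborel)"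
        by (simp only: integral_mult_right_zero integral_triangle[OF elim(4) elim(3)])
      also have "(\<integral>y. wxx (t, y) * (LBINT x:{..<y}. diffusive_flux (t, x)) \<partial>lborel)
        = (\<integral>x. wxx (t, x) * (s2 x * \<mu> (t, x)) \<partial>lborel)"
      proof (rule integral_cong_AE)
        show "AE y in lborel. wxx (t, y) * (LBINT x:{..<y}. diffusive_flux (t, x)) = wxx (t, y) * (s2 y * \<mu> (t, y))"
          using \<mu>p
        proof eventually_elim
          case (elim y)
          show ?case
          proof (cases "y \<in> {0<..<L}")
            case True
            have "s2 y * \<mu> (t, y) = (LBINT x:{..<y}. s2 x * \<mu>x (t, x) + ds2 x * \<mu> (t, x))"
              by (rule divergence_primitive[where L=L and ?s20.0=s20])
                (use \<open>integrable lborel (\<lambda>x. \<mu>x (t, x))\<close> zt(3) ds2 S1.ds2_zero S1.s2_meas S1.s2_prim \<mu>p True elim in auto)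
            then show ?thesis by (simp add: diffusive_flux_def)
          qed (simp add: zt(1))
        qed
      qed measurable
      also have "(- weight t) * \<dots> = - (\<integral>x. (weight t * wxx (t, x)) * (s2 x * \<mu> (t, x)) \<partial>lborel)"
        by (simp add: mult.assoc)
      finally show ?thesis .
    qed
  qed
  then have "(\<integral>t. \<integral>x. (weight t * wx (t, x)) * diffusive_flux (t, x) \<partial>lborel \<partial>lborel)
      = (\<integral>t. - (\<integral>x. (weight t * wxx (t, x)) * (s2 x * \<mu> (t, x)) \<partial>lborel) \<partial>lborel)"
    by (intro integral_cong_AE) measurable
  then show ?thesis unfolding lborel2_integral_fst[OF i1] lborel2_integral_fst[OF i2] by simp
qed

definition cross_term :: "real \<times> real \<Rightarrow> real" where
  "cross_term z = weight (fst z) * (kap * \<mu> z * ((q1 z)\<^sup>2 - (q2 z)\<^sup>2) + wx z * control_flux z)"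

text \<open>\<open>cross_pairing\<close> for the weighted \<open>w\<close> equates the two tests of
  the time derivatives. \<open>diffusive_pairing\<close> turns the diffusive flux into exactly the
  second order term of the HJB difference, and only the control terms are left.\<close>

lemma cross_term_integral: "integrable lborel cross_term" "(\<integral>z. cross_term z \<partial>lborel) = 0"
proof -
  define vt where "vt z = weight (fst z) * (wt z - lam * w z)" for z
  define vx where "vx z = weight (fst z) * wx z" for z
  have vt: "L2_on (cylQ T L) vt" unfolding vt_def[abs_def]
    by (rule weighted_L2[OF L2_on_diff[OF w_L2(2) L2_on_cmult[OF w_L2(1)]]])
  have vx: "L2_on (cylQ T L) vx" unfolding vx_def[abs_def] by (rule weighted_L2[OF w_L2(3)])
  define G where "G z = S1.flux z - S2.flux z" for z
  have G: "L2_on (cylQ T L) G" unfolding G_def[abs_def] by (rule L2_on_diff[OF S1.flux_L2 S2.flux_L2])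
  have G_eq: "G z = diffusive_flux z + control_flux z" for z
    by (simp add: G_def S1.flux_def S2.flux_def diffusive_flux_def control_flux_def algebra_simps)
  have c: "(\<integral>z. \<mu> z * vt z \<partial>lborel) = (\<integral>z. vx z * G z \<partial>lborel)"
  proof (rule cross_pairing[where T=T and L=L and B="B1 + B2"])
    show "AE z in lborel. z \<in> {0<..<T} \<times> {0<..<L} \<longrightarrow> (LBINT y:{snd z<..}. \<mu> (fst z, y)) = - (LBINT s:{..<fst z}. G (s, snd z))"
      using density_difference by (simp only: cylQ_def G_def)
    have "AE z in lborel. z \<in> cylQ T L \<longrightarrow> weight (fst z) * w z = - (LBINT s:{fst z<..}. vt (s, snd z))"
      by (rule w_weighted_time[OF vt]) (simp add: vt_def)
    then show "AE z in lborel. z \<in> {0<..<T} \<times> {0<..<L} \<longrightarrow> (LBINT y:{..<snd z}. vx (fst z, y)) = - (LBINT s:{fst z<..}. vt (s, snd z))"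
      using w_prim by eventually_elim (simp add: vx_def cylQ_def)
  qed (use L2_onD[OF \<mu>_L2(1)] L2_onD[OF G] L2_onD[OF vt] L2_onD[OF vx] L2_on_cylQ_zero[OF \<mu>_L2(1)]
    L2_on_cylQ_zero[OF G] L2_on_cylQ_zero[OF vt] L2_on_cylQ_zero[OF vx] \<mu>_bound in blast)+
  have s\<mu>: "L2_on (cylQ T L) (\<lambda>z. s2 (snd z) * \<mu> z)" by (rule L2_on_mult_bounded[OF \<mu>_L2(1) S1.s2_snd_meas(1) S1.s2_bound])
  note wxx' = weighted_L2[OF w_L2(4)]
  have i1: "integrable lborel (\<lambda>z. vx z * diffusive_flux z)" by (rule L2_on_pairing[OF vx diffusive_flux_L2])
  have i2: "integrable lborel (\<lambda>z. vx z * control_flux z)" by (rule L2_on_pairing[OF vx control_flux_L2])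
  have i3: "integrable lborel (\<lambda>z. (weight (fst z) * wxx z) * (s2 (snd z) * \<mu> z))" by (rule L2_on_pairing[OF wxx' s\<mu>])
  have i4: "integrable lborel (\<lambda>z. \<mu> z * vt z)" by (rule L2_on_pairing[OF \<mu>_L2(1) vt])
  \<comment> \<open>The integral of \<open>?Z\<close> vanishes by \<open>c\<close> and
    \<open>diffusive_pairing\<close>; the HJB difference then identifies \<open>?Z\<close> with
    \<open>cross_term\<close> almost everywhere.\<close>
  let ?Z = "\<lambda>z. vx z * control_flux z - \<mu> z * vt z - (weight (fst z) * wxx z) * (s2 (snd z) * \<mu> z)"
  have iZ: "integrable lborel ?Z" using i2 i3 i4 by simp
  have "(\<integral>z. vx z * G z \<partial>lborel) = (\<integral>z. vx z * diffusive_flux z \<partial>lborel) + (\<integral>z. vx z * control_flux z \<partial>lborel)"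
    unfolding G_eq distrib_left by (rule Bochner_Integration.integral_add[OF i1 i2])
  then have Z0: "(\<integral>z. ?Z z \<partial>lborel) = 0"
    using c diffusive_pairing i2 i3 i4 by (simp add: vx_def)
  note [measurable] = L2_onD(1)[OF \<mu>_L2(1)] L2_onD(1)[OF w_L2(3)] L2_onD(1)[OF control_flux_L2] L2_onD(1)[OF S1.q] L2_onD(1)[OF S2.q]
  have m: "cross_term \<in> borel_measurable lborel" unfolding cross_term_def[abs_def] by measurable
  have ae: "AE z in lborel. ?Z z = cross_term z"
    using w_equation
  proof eventually_elim
    case (elim z)
    show ?case
    proof (cases "z \<in> cylQ T L")
      case True
      have "?Z z = weight (fst z) * (wx z * control_flux z - \<mu> z * (wt z + s2 (snd z) * wxx z - lam * w z))"
        by (simp add: vx_def vt_def algebra_simps)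
      also have "wt z + s2 (snd z) * wxx z - lam * w z = - (kap * ((q1 z)\<^sup>2 - (q2 z)\<^sup>2))" using elim True by simp
      finally show ?thesis by (simp add: cross_term_def algebra_simps)
    next
      case False
      have "vx z = 0" "\<mu> z = 0" "wx z = 0"
        using L2_on_zero[OF vx False] L2_on_zero[OF \<mu>_L2(1) False] L2_on_zero[OF w_L2(3) False] by auto
      then show ?thesis by (simp add: cross_term_def)
    qed
  qed
  show "integrable lborel cross_term" by (rule integrable_cong_AE_imp[OF iZ m ae])
  have "(\<integral>z. cross_term z \<partial>lborel) = (\<integral>z. ?Z z \<partial>lborel)"
    by (rule integral_cong_AE[symmetric]) (use iZ m ae in auto)
  then show "(\<integral>z. cross_term z \<partial>lborel) = 0" using Z0 by simp
qed

text \<open>The price difference \<open>p\<close> is constant on a slice and meets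
  \<open>control_flux\<close> only through its integral \<open>a1 - a2\<close>, so antitonicity of
  the price makes this contribution nonpositive. The rest is the convexity estimate, whose
  nonnegative defect \<open>R\<close> must then have integral 0.\<close>

lemma lasry_lions:
  assumes mono: "\<And>t a b. t \<in> {0<..<T} \<Longrightarrow> 0 \<le> a \<Longrightarrow> a \<le> b \<Longrightarrow> P t b \<le> P t a"
  shows "AE z in lborel. (M1 z + M2 z) * (q1 z - q2 z)\<^sup>2 = 0"
proof -
  note [measurable] = L2_onD(1)[OF S1.M] L2_onD(1)[OF S2.M] L2_onD(1)[OF S1.q] L2_onD(1)[OF S2.q] L2_onD(1)[OF control_flux_L2]
  define R where "R z = weight (fst z) * (kap * (M1 z + M2 z) * (q1 z - q2 z)\<^sup>2)" for z
  have Rm[measurable]: "R \<in> borel_measurable borel" unfolding R_def[abs_def] by measurable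
  have MZ: "M1 z = 0" "M2 z = 0" if "z \<notin> cylQ T L" for z using L2_on_zero[OF S1.M that] L2_on_zero[OF S2.M that] by auto
  have iR: "integrable lborel R"
  proof (rule integrable_bounded_on_rectangle[where B="exp (\<bar>lam\<bar> * T) * (kap * (B1 + B2) * (B1 + B2)\<^sup>2)" and a=0 and b=T and c=0 and d=L])
    show "\<bar>R z\<bar> \<le> exp (\<bar>lam\<bar> * T) * (kap * (B1 + B2) * (B1 + B2)\<^sup>2)" for z
    proof -
      have "\<bar>M1 z + M2 z\<bar> \<le> B1 + B2" using S1.M_bound[of z] S2.M_bound[of z] by linarith
      moreover have "\<bar>(q1 z - q2 z)\<^sup>2\<bar> \<le> (B1 + B2)\<^sup>2"
        by (rule abs_square_le) (use S1.q_bound[of z] S2.q_bound[of z] in linarith)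
      ultimately show ?thesis unfolding R_def abs_mult using weight_bound[of "fst z"] S1.kap_pos
        by (intro mult_mono) auto
    qed
    show "R z = 0" if "z \<notin> {0<..<T} \<times> {0<..<L}" for z using MZ[of z] that by (simp add: R_def cylQ_def)
  qed measurable
  have "AE t in lborel. (\<integral>x. cross_term (t, x) \<partial>lborel) \<le> - (\<integral>x. R (t, x) \<partial>lborel)"
    using AE_lborel2_iterated[OF S1.control] AE_lborel2_iterated[OF S2.control] AE_lborel2_iterated[OF S1.density_nonneg]
      AE_lborel2_iterated[OF S2.density_nonneg] lborel2_AE_fst[OF cross_term_integral(1)] lborel2_AE_fst[OF iR]
  proof eventually_elim
    case (elim t)
    show ?case
    proof (cases "t \<in> {0<..<T}")
      case False
      then show ?thesis by (simp add: cross_term_def R_def weight_def)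
    next
      case True
      define a1 a2 where "a1 = (\<integral>x. q1 (t, x) * M1 (t, x) \<partial>lborel)" and "a2 = (\<integral>x. q2 (t, x) * M2 (t, x) \<partial>lborel)"
      have Mt: "M1 (t, x) = 0" "M2 (t, x) = 0" if "x \<notin> {0<..<L}" for x
        using MZ[of "(t, x)"] that by (auto simp: cylQ_def)
      have i: "integrable lborel (\<lambda>x. q1 (t, x) * M1 (t, x))"
      proof (rule integrable_bounded_on_interval(1)[where B="B1 * B1" and c=0 and d=L])
        show "\<bar>q1 (t, x) * M1 (t, x)\<bar> \<le> B1 * B1" for x
          unfolding abs_mult using S1.q_bound[of "(t, x)"] S1.M_bound[of "(t, x)"] by (intro mult_mono) auto
      qed (use Mt in auto)
      have i': "integrable lborel (\<lambda>x. q2 (t, x) * M2 (t, x))"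
      proof (rule integrable_bounded_on_interval(1)[where B="B2 * B2" and c=0 and d=L])
        show "\<bar>q2 (t, x) * M2 (t, x)\<bar> \<le> B2 * B2" for x
          unfolding abs_mult using S2.q_bound[of "(t, x)"] S2.M_bound[of "(t, x)"] by (intro mult_mono) auto
      qed (use Mt in auto)
      \<comment> \<open>\<open>mono\<close> speaks only of nonnegative quantities, so the sign of
        the densities is needed already for the price.\<close>
      have a0: "a1 \<ge> 0" unfolding a1_def by (rule integral_nonneg_AE) (use elim(3) in \<open>eventually_elim, simp add: S1.q_nonneg\<close>)
      have a0': "a2 \<ge> 0" unfolding a2_def by (rule integral_nonneg_AE) (use elim(4) in \<open>eventually_elim, simp add: S2.q_nonneg\<close>)
      define p where "p = P t a1 - P t a2"
      have pa: "p * (a1 - a2) \<le> 0"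
      proof (cases "a1 \<le> a2")
        case c: True
        have "P t a2 \<le> P t a1" by (rule mono[OF True a0 c])
        then show ?thesis using c by (simp add: p_def mult_nonneg_nonpos)
      next
        case c: False
        then have "P t a1 \<le> P t a2" by (intro mono[OF True a0']) simp
        then show ?thesis using c by (simp add: p_def mult_nonpos_nonneg)
      qed
      have iD: "integrable lborel (\<lambda>x. control_flux (t, x))" "(\<integral>x. control_flux (t, x) \<partial>lborel) = a1 - a2"
        using i i' by (simp_all add: control_flux_def a1_def a2_def mult.commute)
      have "(\<integral>x. cross_term (t, x) \<partial>lborel) \<le> (\<integral>x. weight t * p * control_flux (t, x) - R (t, x) \<partial>lborel)"
      proof (rule integral_mono_AE)
        show "integrable lborel (\<lambda>x. cross_term (t, x))" by (rule elim(5))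
        show "integrable lborel (\<lambda>x. weight t * p * control_flux (t, x) - R (t, x))" using iD elim(6) by simp
        show "AE x in lborel. cross_term (t, x) \<le> weight t * p * control_flux (t, x) - R (t, x)"
          using elim(1-4)
        proof eventually_elim
          case (elim x)
          show ?case
          proof (cases "(t, x) \<in> cylQ T L")
            case in_Q: True
            define A1 A2 where "A1 = P t a1 - gam - Ux1 (t, x)" and "A2 = P t a2 - gam - Ux2 (t, x)"
            have q: "q1 (t, x) = max 0 (A1 / (2 * kap))" "q2 (t, x) = max 0 (A2 / (2 * kap))"
              using elim in_Q by (simp_all add: A1_def A2_def a1_def a2_def)
            \<comment> \<open>This splits \<open>wx\<close> into a price part, constant in
              \<open>x\<close>, and the difference of the arguments of the Hamiltonian.\<close>
            have wx: "wx (t, x) = p - (A1 - A2)" by (simp add: A1_def A2_def p_def)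
            have "kap * \<mu> (t, x) * ((q1 (t, x))\<^sup>2 - (q2 (t, x))\<^sup>2) - (A1 - A2) * (q1 (t, x) * M1 (t, x) - q2 (t, x) * M2 (t, x))
              \<le> - (kap * (M1 (t, x) + M2 (t, x)) * (q1 (t, x) - q2 (t, x))\<^sup>2)"
              by (rule lasry_lions_pointwise[OF S1.kap_pos _ _ q]) (use elim in auto)
            then have "kap * \<mu> (t, x) * ((q1 (t, x))\<^sup>2 - (q2 (t, x))\<^sup>2) + wx (t, x) * control_flux (t, x)
              \<le> p * control_flux (t, x) - kap * (M1 (t, x) + M2 (t, x)) * (q1 (t, x) - q2 (t, x))\<^sup>2"
              unfolding wx by (simp add: control_flux_def algebra_simps)
            from mult_left_mono[OF this weight_nonneg[of t]] show ?thesis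
              by (simp add: cross_term_def R_def right_diff_distrib mult.assoc)
          next
            case False
            then have "cross_term (t, x) = 0" "control_flux (t, x) = 0" "R (t, x) = 0"
              using MZ[OF False] by (simp_all add: cross_term_def control_flux_def R_def)
            then show ?thesis by simp
          qed
        qed
      qed
      also have "\<dots> = weight t * (p * (a1 - a2)) - (\<integral>x. R (t, x) \<partial>lborel)" using iD elim(6) by (simp add: mult.assoc)
      also have "\<dots> \<le> - (\<integral>x. R (t, x) \<partial>lborel)"
        using mult_nonneg_nonpos[OF weight_nonneg pa, of t] by simp
      finally show ?thesis .
    qed
  qed
  then have "(\<integral>t. \<integral>x. cross_term (t, x) \<partial>lborel \<partial>lborel) \<le> (\<integral>t. - (\<integral>x. R (t, x) \<partial>lborel) \<partial>lborel)"
    by (intro integral_mono_AE lborel2_integrable_fst[OF cross_term_integral(1)] Bochner_Integration.integrable_minus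
      lborel2_integrable_fst[OF iR])
  then have "(\<integral>z. R z \<partial>lborel) \<le> 0"
    using cross_term_integral(2) lborel2_integral_fst[OF cross_term_integral(1)] lborel2_integral_fst[OF iR] by simp
  moreover have R0: "AE z in lborel. 0 \<le> R z"
    using S1.density_nonneg S2.density_nonneg
    by eventually_elim (use S1.kap_pos weight_nonneg in \<open>auto simp: R_def intro!: mult_nonneg_nonneg\<close>)
  ultimately have "(\<integral>z. R z \<partial>lborel) = 0" using integral_nonneg_AE[OF R0] by simp
  then have "AE z in lborel. R z = 0" using integral_nonneg_eq_0_iff_AE[OF iR R0] by simp
  then show ?thesis
  proof eventually_elim
    case (elim z)
    show ?case
    proof (cases "z \<in> cylQ T L")
      case True
      then have "weight (fst z) > 0" by (intro weight_pos) (auto simp: cylQ_def)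
      then show ?thesis using elim S1.kap_pos by (simp add: R_def)
    qed (simp add: MZ)
  qed
qed

section \<open>Uniqueness of the densities, the prices and the value functions\<close>

lemma swapped: "regular_pair T L lam gam kap P s2 ds2 n0 uT a0 A s20 U2 Ut2 Ux2 Uxx2 M2 Mx2 q2 B2 U1 Ut1 Ux1 Uxx1 M1 Mx1 q1 B1"
  by (rule regular_pair.intro) (rule S2.regular_solution_axioms S1.regular_solution_axioms)+

text \<open>Where \<open>M1 + M2\<close> is 0, both nonnegative densities are 0; elsewhere the
  controls agree. Either way each density times \<open>q1 - q2\<close> vanishes, which is the
  hypothesis of \<open>density_le\<close> in both orders.\<close>

lemma density_unique:
  assumes mono: "\<And>t a b. t \<in> {0<..<T} \<Longrightarrow> 0 \<le> a \<Longrightarrow> a \<le> b \<Longrightarrow> P t b \<le> P t a"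
  shows "AE z in lborel. M1 z = M2 z \<and> M2 z * (q1 z - q2 z) = 0"
proof -
  have ll: "AE z in lborel. (M1 z + M2 z) * (q1 z - q2 z)\<^sup>2 = 0" by (rule lasry_lions) (rule mono)
  have *: "AE z in lborel. M1 z * (q1 z - q2 z) = 0 \<and> M2 z * (q1 z - q2 z) = 0"
    using ll S1.density_nonneg S2.density_nonneg
  proof eventually_elim
    case (elim z)
    then have "M1 z + M2 z = 0 \<or> q1 z - q2 z = 0" by simp
    then show ?case using elim(2,3) by auto
  qed
  have "AE z in lborel. M2 z \<le> M1 z" by (rule density_le) (use * in eventually_elim, simp)
  moreover have "AE z in lborel. M1 z \<le> M2 z"
  proof (rule regular_pair.density_le[OF swapped])
    show "AE z in lborel. M1 z * (q2 z - q1 z) = 0" using * by eventually_elim auto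
  qed
  ultimately show ?thesis using * by eventually_elim auto
qed

text \<open>The hypothesis is a Lipschitz bound of the Hamiltonian in \<open>ux\<close>, available
  once the prices agree. The opposite inequality comes from exchanging the two solutions.\<close>

lemma wx_nonneg:
  assumes C: "AE z in lborel. z \<in> cylQ T L \<longrightarrow> \<bar>(q1 z)\<^sup>2 - (q2 z)\<^sup>2\<bar> \<le> C * \<bar>wx z\<bar>"
  shows "AE z in lborel. 0 \<le> wx z"
proof -
  \<comment> \<open>with \<open>\<beta>\<close> as bounded drift the x-derivative of the HJB difference is a linear backward Fokker-Planck
    equation for \<open>wx\<close>; reversing \<open>t\<close> turns it forward, reversing \<open>x\<close> exchanges the boundary conditions\<close>
  define \<beta> where "\<beta> z = (if \<bar>(q1 z)\<^sup>2 - (q2 z)\<^sup>2\<bar> \<le> C * \<bar>wx z\<bar> \<and> wx z \<noteq> 0 then kap * ((q1 z)\<^sup>2 - (q2 z)\<^sup>2) / wx z else 0)" for z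
  note [measurable] = L2_onD(1)[OF S1.q] L2_onD(1)[OF S2.q] L2_onD(1)[OF w_L2(3)] L2_onD(1)[OF w_L2(4)]
    S1.s2_meas
  have \<beta>m[measurable]: "\<beta> \<in> borel_measurable borel" unfolding \<beta>_def[abs_def] by measurable
  have \<beta>B: "\<bar>\<beta> z\<bar> \<le> kap * \<bar>C\<bar>" for z
  proof (cases "\<bar>(q1 z)\<^sup>2 - (q2 z)\<^sup>2\<bar> \<le> C * \<bar>wx z\<bar> \<and> wx z \<noteq> 0")
    case True
    have "\<bar>(q1 z)\<^sup>2 - (q2 z)\<^sup>2\<bar> \<le> \<bar>C\<bar> * \<bar>wx z\<bar>"
      by (rule order_trans[OF conjunct1[OF True] mult_right_mono[OF abs_ge_self abs_ge_zero]])
    then have "\<bar>(q1 z)\<^sup>2 - (q2 z)\<^sup>2\<bar> / \<bar>wx z\<bar> \<le> \<bar>C\<bar>" using True by (simp add: divide_le_eq)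
    from mult_left_mono[OF this, of kap] show ?thesis
      using True S1.kap_pos by (simp add: \<beta>_def abs_mult)
  next
    case False
    then show ?thesis using S1.kap_pos by (auto simp: \<beta>_def)
  qed
  \<comment> \<open>Where \<open>wx z = 0\<close> the hypothesis forces equal squares, so the
    default value 0 of \<open>\<beta>\<close> is correct there.\<close>
  have \<beta>wx: "AE z in lborel. z \<in> cylQ T L \<longrightarrow> \<beta> z * wx z = kap * ((q1 z)\<^sup>2 - (q2 z)\<^sup>2)"
    using C by eventually_elim (auto simp: \<beta>_def)
  define g where "g z = weight (fst z) * (- (s2 (snd z) * wxx z + \<beta> z * wx z))" for z
  have s2wxx: "L2_on (cylQ T L) (\<lambda>z. s2 (snd z) * wxx z)" by (rule L2_on_mult_bounded[OF w_L2(4) S1.s2_snd_meas(1) S1.s2_bound])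
  have \<beta>wx2: "L2_on (cylQ T L) (\<lambda>z. \<beta> z * wx z)" by (rule L2_on_mult_bounded[OF w_L2(3) \<beta>m \<beta>B])
  have g: "L2_on (cylQ T L) g" unfolding g_def[abs_def]
    using weighted_L2[OF L2_on_cmult[OF L2_on_add[OF s2wxx \<beta>wx2], of "-1"]] by simp
  have g_eq: "AE z in lborel. z \<in> cylQ T L \<longrightarrow> weight (fst z) * w z = - (LBINT s:{fst z<..}. g (s, snd z))"
  proof (rule w_weighted_time[OF g])
    show "AE z in lborel. z \<in> cylQ T L \<longrightarrow> g z = weight (fst z) * (wt z - lam * w z)"
      using w_equation \<beta>wx
    proof eventually_elim
      case (elim z)
      show ?case
      proof
        assume "z \<in> cylQ T L"
        then have "- (s2 (snd z) * wxx z + \<beta> z * wx z) = wt z - lam * w z" using elim by auto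
        then show "g z = weight (fst z) * (wt z - lam * w z)" by (simp only: g_def)
      qed
    qed
  qed
  define v where "v z = weight (fst z) * wx z" for z
  define vx where "vx z = weight (fst z) * wxx z" for z
  have v2: "L2_on (cylQ T L) v" and vx2: "L2_on (cylQ T L) vx" unfolding v_def[abs_def] vx_def[abs_def]
    by (rule weighted_L2[OF w_L2(3)], rule weighted_L2[OF w_L2(4)])
  define \<nu> where "\<nu> z = v (T - fst z, L - snd z)" for z
  define \<nu>x where "\<nu>x z = - vx (T - fst z, L - snd z)" for z
  have \<nu>2: "L2_on (cylQ T L) \<nu>" unfolding \<nu>_def[abs_def] by (rule L2_on_reflect[OF v2])
  have \<nu>x2: "L2_on (cylQ T L) \<nu>x" unfolding \<nu>x_def[abs_def] using L2_on_cmult[OF L2_on_reflect[OF vx2], of "-1"] by simp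
  define F where "F z = s2 (L - snd z) * \<nu>x z + (- \<beta> (T - fst z, L - snd z)) * \<nu> z" for z
  have Fg: "F z = g (T - fst z, L - snd z)" for z
    by (simp add: F_def \<nu>_def \<nu>x_def v_def vx_def g_def algebra_simps)
  have wxB: "\<bar>wx z\<bar> \<le> B1 + B2" for z using S1.Ux_bound[of z] S2.Ux_bound[of z] by linarith
  have vB: "\<bar>v z\<bar> \<le> exp (\<bar>lam\<bar> * T) * (B1 + B2)" for z
    unfolding v_def abs_mult by (intro mult_mono weight_bound wxB) auto
  have Q: "(T - fst z, L - snd z) \<in> cylQ T L \<longleftrightarrow> z \<in> cylQ T L" for z :: "real \<times> real"
    by (auto simp: cylQ_def mem_Times_iff)
  have "AE z in lborel. \<nu> z \<ge> 0"
  proof (rule fokker_planck_nonneg[where T=T and L=L and m=\<nu> and mx=\<nu>x and a="\<lambda>z. s2 (L - snd z)"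
      and c="\<lambda>z. - \<beta> (T - fst z, L - snd z)" and ?m0.0="\<lambda>_. 0" and F=F and B="exp (\<bar>lam\<bar> * T) * (B1 + B2)"
      and A=A and C="kap * \<bar>C\<bar>" and ?a0.0=a0])
    show "\<nu> \<in> borel_measurable borel" "\<nu>x \<in> borel_measurable borel" by (rule L2_onD(1)[OF \<nu>2] L2_onD(1)[OF \<nu>x2])+
    show "(\<lambda>z :: real \<times> real. s2 (L - snd z)) \<in> borel_measurable borel"
      "(\<lambda>z. - \<beta> (T - fst z, L - snd z)) \<in> borel_measurable borel" by measurable
    show "integrable lborel (\<lambda>z. (\<nu>x z)\<^sup>2)" by (rule L2_onD(2)[OF \<nu>x2])
    show "\<nu> z = 0" if "z \<notin> {0<..<T} \<times> {0<..<L}" for z by (rule L2_on_cylQ_zero[OF \<nu>2 that])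
    show "\<nu>x z = 0" if "z \<notin> {0<..<T} \<times> {0<..<L}" for z by (rule L2_on_cylQ_zero[OF \<nu>x2 that])
    show "\<bar>\<nu> z\<bar> \<le> exp (\<bar>lam\<bar> * T) * (B1 + B2)" for z unfolding \<nu>_def by (rule vB)
    show "\<bar>0\<bar> \<le> exp (\<bar>lam\<bar> * T) * (B1 + B2)" using vB[of 0] by linarith
    show "a0 \<le> s2 (L - snd z)" if "z \<in> {0<..<T} \<times> {0<..<L}" for z using that by (intro S1.s2_ge) auto
    show "\<bar>- \<beta> (T - fst z, L - snd z)\<bar> \<le> kap * \<bar>C\<bar>" for z using \<beta>B by simp
    show "F z = s2 (L - snd z) * \<nu>x z + - \<beta> (T - fst z, L - snd z) * \<nu> z" for z by (rule F_def)
    \<comment> \<open>Reflection in \<open>x\<close> moves the condition \<open>wx = 0\<close> from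
      \<open>L\<close> to the left end, where the maximum principle expects it.\<close>
    show "AE z in lborel. z \<in> {0<..<T} \<times> {0<..<L} \<longrightarrow> \<nu> z = (LBINT y:{..<snd z}. \<nu>x (fst z, y))"
      using AE_reflect[OF wx_prim, of T L]
    proof eventually_elim
      case (elim z)
      show ?case
      proof
        assume "z \<in> {0<..<T} \<times> {0<..<L}"
        then have "wx (T - fst z, L - snd z) = - (LBINT y:{L - snd z<..}. wxx (T - fst z, y))"
          using elim Q[of z] by (simp add: cylQ_def)
        also have "(LBINT y:{L - snd z<..}. wxx (T - fst z, y)) = (LBINT y:{..<snd z}. wxx (T - fst z, L - y))"
          using primitive_reflect(1)[of L "L - snd z" "\<lambda>y. wxx (T - fst z, y)"] by simp
        finally have "\<nu> z = weight (T - fst z) * - (LBINT y:{..<snd z}. wxx (T - fst z, L - y))"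
          by (simp add: \<nu>_def v_def)
        also have "\<dots> = (LBINT y:{..<snd z}. (- weight (T - fst z)) * wxx (T - fst z, L - y))"
          by (simp only: set_integral_mult_right)
        finally show "\<nu> z = (LBINT y:{..<snd z}. \<nu>x (fst z, y))" by (simp add: \<nu>x_def vx_def)
      qed
    qed
    \<comment> \<open>The tail of the reflected \<open>wx\<close> is the left primitive of
      \<open>wx\<close>, that is \<open>w\<close>. Its time identity has zero terminal value, which
      the reversal of time turns into zero initial value.\<close>
    show "AE z in lborel. z \<in> {0<..<T} \<times> {0<..<L} \<longrightarrow> (LBINT y:{snd z<..}. \<nu> (fst z, y))
      = (LBINT y:{snd z<..}. 0) - (LBINT s:{..<fst z}. F (s, snd z))"
      using AE_reflect[OF w_prim, of T L] AE_reflect[OF g_eq, of T L]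
    proof eventually_elim
      case (elim z)
      show ?case
      proof
        assume z: "z \<in> {0<..<T} \<times> {0<..<L}"
        have "(LBINT y:{snd z<..}. \<nu> (fst z, y)) = (LBINT y:{snd z<..}. weight (T - fst z) * wx (T - fst z, L - y))"
          by (simp add: \<nu>_def v_def)
        also have "\<dots> = weight (T - fst z) * (LBINT y:{snd z<..}. wx (T - fst z, L - y))" by (simp only: set_integral_mult_right)
        also have "(LBINT y:{snd z<..}. wx (T - fst z, L - y)) = (LBINT y:{..<L - snd z}. wx (T - fst z, y))"
          using primitive_reflect(2)[of L "L - snd z" "\<lambda>y. wx (T - fst z, y)"] by simp
        also have "\<dots> = w (T - fst z, L - snd z)" using elim(1) z Q[of z] by (simp add: cylQ_def)
        also have "weight (T - fst z) * w (T - fst z, L - snd z) = - (LBINT s:{T - fst z<..}. g (s, L - snd z))"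
          using elim(2) z Q[of z] by (simp add: cylQ_def)
        also have "(LBINT s:{T - fst z<..}. g (s, L - snd z)) = (LBINT s:{..<fst z}. F (s, snd z))"
          using primitive_reflect(1)[of T "T - fst z" "\<lambda>s. g (s, L - snd z)"] by (simp add: Fg)
        finally show "(LBINT y:{snd z<..}. \<nu> (fst z, y)) = (LBINT y:{snd z<..}. 0) - (LBINT s:{..<fst z}. F (s, snd z))"
          by simp
      qed
    qed
  qed (use S1.T_pos S1.L_pos S1.a0_pos S1.s2_bound in auto)
  from AE_reflect[OF this, of T L] have "AE z in lborel. v z \<ge> 0" by (simp add: \<nu>_def)
  then show ?thesis
  proof eventually_elim
    case (elim z)
    show ?case
    proof (cases "z \<in> cylQ T L")
      case True
      then have "weight (fst z) > 0" by (intro weight_pos) (auto simp: cylQ_def)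
      then show ?thesis using elim by (simp add: v_def zero_le_mult_iff)
    next
      case False
      then show ?thesis using L2_on_zero[OF w_L2(3) False] by simp
    qed
  qed
qed

theorem regular_unique:
  assumes mono: "\<And>t a b. t \<in> {0<..<T} \<Longrightarrow> 0 \<le> a \<Longrightarrow> a \<le> b \<Longrightarrow> P t b \<le> P t a"
  shows "AE z in lborel. z \<in> cylQ T L \<longrightarrow> U1 z = U2 z \<and> M1 z = M2 z \<and> q1 z = q2 z"
proof -
  have M: "AE z in lborel. M1 z = M2 z \<and> M2 z * (q1 z - q2 z) = 0" by (rule density_unique) (rule mono)
  note [measurable] = L2_onD(1)[OF S1.M] L2_onD(1)[OF S2.M] L2_onD(1)[OF S1.q] L2_onD(1)[OF S2.q]
  \<comment> \<open>Equal total output on almost every slice gives equal prices, although the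
    controls may still differ where the density vanishes.\<close>
  have a: "AE t in lborel. (\<integral>x. q1 (t, x) * M1 (t, x) \<partial>lborel) = (\<integral>x. q2 (t, x) * M2 (t, x) \<partial>lborel)"
    using AE_lborel2_iterated[OF M]
  proof eventually_elim
    case (elim t)
    show ?case
    proof (rule integral_cong_AE)
      show "AE x in lborel. q1 (t, x) * M1 (t, x) = q2 (t, x) * M2 (t, x)" using elim by eventually_elim auto
    qed measurable
  qed
  define K where "K = 2 * kap"
  have K: "K > 0" using S1.kap_pos by (simp add: K_def)
  \<comment> \<open>With a common price the controls differ only through \<open>ux\<close>, and
    clipping at 0 does not increase distances.\<close>
  have qq: "AE z in lborel. z \<in> cylQ T L \<longrightarrow> \<bar>q1 z - q2 z\<bar> \<le> \<bar>wx z\<bar> / K"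
    using S1.control S2.control AE_lborel2_fst[OF a]
  proof eventually_elim
    case (elim z)
    show ?case
    proof
      assume "z \<in> cylQ T L"
      then obtain p where p: "q1 z = max 0 ((p - Ux1 z) / K)" "q2 z = max 0 ((p - Ux2 z) / K)"
        using elim unfolding K_def by metis
      have "\<bar>q1 z - q2 z\<bar> \<le> \<bar>(p - Ux1 z) / K - (p - Ux2 z) / K\<bar>" unfolding p by (auto simp: max_def)
      also have "(p - Ux1 z) / K - (p - Ux2 z) / K = - (wx z / K)" by (simp add: diff_divide_distrib)
      finally show "\<bar>q1 z - q2 z\<bar> \<le> \<bar>wx z\<bar> / K" unfolding abs_minus_cancel abs_divide using K by simp
    qed
  qed
  have qC: "AE z in lborel. z \<in> cylQ T L \<longrightarrow> \<bar>(q1 z)\<^sup>2 - (q2 z)\<^sup>2\<bar> \<le> ((B1 + B2) / K) * \<bar>wx z\<bar>"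
    using qq
  proof eventually_elim
    case (elim z)
    show ?case
    proof
      assume "z \<in> cylQ T L"
      then have 1: "\<bar>q1 z - q2 z\<bar> \<le> \<bar>wx z\<bar> / K" using elim by simp
      have 2: "\<bar>q1 z + q2 z\<bar> \<le> B1 + B2" using S1.q_bound[of z] S2.q_bound[of z] by linarith
      have "\<bar>(q1 z)\<^sup>2 - (q2 z)\<^sup>2\<bar> = \<bar>q1 z + q2 z\<bar> * \<bar>q1 z - q2 z\<bar>"
        by (simp add: abs_mult[symmetric] power2_eq_square algebra_simps)
      also have "\<dots> \<le> (B1 + B2) * (\<bar>wx z\<bar> / K)" using 1 2 by (intro mult_mono) auto
      finally show "\<bar>(q1 z)\<^sup>2 - (q2 z)\<^sup>2\<bar> \<le> ((B1 + B2) / K) * \<bar>wx z\<bar>" by simp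
    qed
  qed
  have "AE z in lborel. 0 \<le> wx z" by (rule wx_nonneg[OF qC])
  moreover have "AE z in lborel. 0 \<le> Ux2 z - Ux1 z"
  proof (rule regular_pair.wx_nonneg[OF swapped])
    show "AE z in lborel. z \<in> cylQ T L \<longrightarrow> \<bar>(q2 z)\<^sup>2 - (q1 z)\<^sup>2\<bar> \<le> ((B1 + B2) / K) * \<bar>Ux2 z - Ux1 z\<bar>"
      using qC by eventually_elim (simp add: abs_minus_commute)
  qed
  ultimately have wx0: "AE z in lborel. wx z = 0" by eventually_elim simp
  \<comment> \<open>Quantified over all \<open>x\<close>, so that one null set of times serves every
    primitive.\<close>
  have "AE z :: real \<times> real in lborel. \<forall>x. (LBINT y:{..<x}. wx (fst z, y)) = 0"
  proof (rule AE_lborel2_fst)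
    note [measurable] = L2_onD(1)[OF S1.U_L2(3)] L2_onD(1)[OF S2.U_L2(3)]
    show "AE t in lborel. \<forall>x. (LBINT y:{..<x}. wx (t, y)) = 0"
      using AE_lborel2_iterated[OF wx0]
    proof eventually_elim
      case (elim t)
      show ?case
      proof
        fix x
        have "(LBINT y:{..<x}. wx (t, y)) = (LBINT y:{..<x}. 0)"
          by (rule set_lebesgue_integral_cong_AE) (use elim in \<open>measurable, eventually_elim, simp\<close>)
        then show "(LBINT y:{..<x}. wx (t, y)) = 0" by simp
      qed
    qed
  qed
  \<comment> \<open>\<open>qq\<close> with \<open>wx = 0\<close> gives equality of the controls also
    where the density vanishes.\<close>
  with w_prim wx0 M qq show ?thesis
  proof eventually_elim
    case (elim z)
    show ?case
    proof
      assume z: "z \<in> cylQ T L"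
      have "w z = 0" using elim z by simp
      moreover have "\<bar>q1 z - q2 z\<bar> \<le> 0" using elim z by simp
      ultimately show "U1 z = U2 z \<and> M1 z = M2 z \<and> q1 z = q2 z" using elim by simp
    qed
  qed
qed

end

text \<open>All choices of representatives are made here, so that later arguments never return to
  Lebesgue classes. Product test functions turn (i) and (ii) into identities almost
  everywhere.\<close>

lemma regular_solution_of_weak:
  assumes sol: "cournot_weak_solution L T lam gam kap r sig P m0 uT u m q"
    and TL: "T > 0" "L > 0" and kap: "kap > 0" and r: "r \<ge> 2" and a0: "a0 > 0"
    and s2: "s2 \<in> borel_measurable borel" "ds2 \<in> borel_measurable borel"
      "\<And>x. \<bar>s2 x\<bar> \<le> A" "\<And>x. \<bar>ds2 x\<bar> \<le> A" "\<And>x. x \<in> {0<..<L} \<Longrightarrow> s2 x = (sig x)\<^sup>2"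
      "\<And>x. x \<in> {0<..<L} \<Longrightarrow> s2 x \<ge> a0"
      "\<And>x. x \<in> {0<..<L} \<Longrightarrow> ds2 x = vector_derivative (\<lambda>y. (sig y)\<^sup>2) (at x within {0..L})"
      "\<And>x. x \<in> {0<..<L} \<Longrightarrow> s2 x = s20 + (LBINT y:{..<x}. ds2 y)"
      "\<And>x. x \<notin> {0<..<L} \<Longrightarrow> ds2 x = 0"
    and n0: "n0 \<in> borel_measurable borel" "\<And>x. \<bar>n0 x\<bar> \<le> B0" "\<And>x. x \<notin> {0<..<L} \<Longrightarrow> n0 x = 0" "\<And>x. n0 x \<ge> 0"
      "\<And>x. x \<in> {0<..<L} \<Longrightarrow> m0 x = n0 x"
  obtains U Ut Ux Uxx M Mx q' B where "regular_solution T L lam gam kap P s2 ds2 n0 uT a0 A s20 U Ut Ux Uxx M Mx q' B"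
    "AE z in lborel. z \<in> cylQ T L \<longrightarrow> u z = U z \<and> m z = M z \<and> q z = q' z"
proof -
  let ?Q = "cylQ T L"
  note S = sol[unfolded cournot_weak_solution_def]
  note Lu = conjunct1[OF S] and S2 = conjunct2[OF S]
  note ex_u = conjunct1[OF S2] and S3 = conjunct2[OF S2]
  note Lm = conjunct1[OF S3] and S4 = conjunct2[OF S3]
  note Lim = conjunct1[OF S4] and S5 = conjunct2[OF S4]
  note ex_m = conjunct1[OF S5] and S6 = conjunct2[OF S5]
  note Liq = conjunct1[OF S6] and qpos = conjunct2[OF S6]
  obtain ut ux uxx where Lut: "Lp_on r ?Q ut" and Lux: "Lp_on r ?Q ux" and Luxx: "Lp_on r ?Q uxx"
    and wt: "weak_dt ?Q u ut" and wx: "weak_dx ?Q u ux" and wxx: "weak_dxx ?Q u uxx"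
    and eq_i: "\<forall>\<phi>. test_fun ?Q \<phi> \<longrightarrow> (LINT z:?Q|lebesgue.
             (ut z + (sig (snd z))\<^sup>2 * uxx z - lam * u z
              + (SUP p\<in>{0..}. - p * ux z + p * price L P q m (fst z) - gam * p - kap * p\<^sup>2)) * \<phi> z) = 0"
    and ex_U: "\<exists>U Ux. continuous_on ({0..T} \<times> {0..L}) U \<and> continuous_on ({0..T} \<times> {0..L}) Ux \<and>
          (AE z in lebesgue. z \<in> ?Q \<longrightarrow> u z = U z) \<and> (AE z in lebesgue. z \<in> ?Q \<longrightarrow> ux z = Ux z) \<and>
          (\<forall>t\<in>{0..T}. U (t, 0) = 0 \<and> Ux (t, L) = 0) \<and> (\<forall>x\<in>{0..L}. U (T, x) = uT x)"
    and eq_iii: "AE z in lebesgue. z \<in> ?Q \<longrightarrow> q z = max 0 ((price L P q m (fst z) - gam - ux z) / (2 * kap))"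
    using ex_u by (elim exE, elim conjE) (rule that; assumption)
  obtain mx where Lmx: "Lp_on 2 ?Q mx" and wmx: "weak_dx ?Q m mx"
    and trace: "AE t in lebesgue. t \<in> {0<..<T} \<longrightarrow> (\<exists>g. continuous_on {0..L} g \<and> g 0 = 0 \<and>
               (AE x in lebesgue. x \<in> {0<..<L} \<longrightarrow> m (t, x) = g x))"
    and eq_ii: "\<forall>\<phi>. test_fun ({..<T} \<times> UNIV) \<phi> \<and> (\<forall>t. \<phi> (t, 0) = 0) \<longrightarrow>
          (LINT z:?Q|lebesgue. m z * pdt \<phi> z) + (LINT x:{0<..<L}|lebesgue. m0 x * \<phi> (0, x))
          = (LINT z:?Q|lebesgue. ((sig (snd z))\<^sup>2 * mx z
                + vector_derivative (\<lambda>y. (sig y)\<^sup>2) (at (snd z) within {0..L}) * m z + m z * q z) * pdx \<phi> z)"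
    using ex_m by (elim exE, elim conjE) (rule that; assumption)
  obtain U0 Ux0 where U0: "continuous_on ({0..T} \<times> {0..L}) U0" "continuous_on ({0..T} \<times> {0..L}) Ux0"
    "AE z in lebesgue. z \<in> ?Q \<longrightarrow> u z = U0 z" "AE z in lebesgue. z \<in> ?Q \<longrightarrow> ux z = Ux0 z"
    "\<forall>t\<in>{0..T}. U0 (t, 0) = 0 \<and> Ux0 (t, L) = 0" "\<forall>x\<in>{0..L}. U0 (T, x) = uT x"
    using ex_U by (elim exE, elim conjE) (rule that; assumption)
  obtain U Ut Ux Uxx where reg: "value_regular T L uT U Ut Ux Uxx"
    and aeU: "AE z in lborel. z \<in> ?Q \<longrightarrow> u z = U z \<and> ut z = Ut z \<and> ux z = Ux z \<and> uxx z = Uxx z"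
    by (rule value_regularity[OF TL r Lu Lut Lux Luxx wt wx wxx U0])
  obtain Bu where Bu: "\<And>z. \<bar>Ux z\<bar> \<le> Bu" using reg unfolding value_regular_def by blast
  have UL: "L2_on ?Q U" "L2_on ?Q Ut" "L2_on ?Q Uxx" using reg unfolding value_regular_def by blast+
  obtain M Bm where M: "M \<in> borel_measurable borel" "\<And>z. \<bar>M z\<bar> \<le> Bm" "\<And>z. z \<notin> ?Q \<Longrightarrow> M z = 0"
    "AE z in lborel. z \<in> ?Q \<longrightarrow> m z = M z" by (rule Linf_representative[OF Lim]) blast
  have LM: "L2_on ?Q M" by (rule L2_on_bounded[OF M(1,2,3)])
  obtain q0 Bq where q0: "q0 \<in> borel_measurable borel" "\<And>z. \<bar>q0 z\<bar> \<le> Bq" "\<And>z. z \<notin> ?Q \<Longrightarrow> q0 z = 0"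
    "AE z in lborel. z \<in> ?Q \<longrightarrow> q z = q0 z" by (rule Linf_representative[OF Liq]) blast
  \<comment> \<open>\<open>q\<close> is nonnegative on the rectangle, so the positive part of
    \<open>q0\<close> still represents it and has the right sign at every point.\<close>
  define q' where "q' z = max 0 (q0 z)" for z
  have q'm: "q' \<in> borel_measurable borel" unfolding q'_def[abs_def] using q0(1) by measurable
  have q'B: "\<bar>q' z\<bar> \<le> Bq" for z using q0(2)[of z] by (auto simp: q'_def)
  have q'0: "q' z = 0" if "z \<notin> ?Q" for z using q0(3)[OF that] by (simp add: q'_def)
  have q'pos: "q' z \<ge> 0" for z by (simp add: q'_def)
  have qL: "L2_on ?Q q'" by (rule L2_on_bounded[OF q'm q'B q'0])
  have aeq: "AE z in lborel. z \<in> ?Q \<longrightarrow> q z = q' z"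
    using q0(4)
  proof eventually_elim
    case (elim z)
    show ?case
    proof
      assume z: "z \<in> ?Q"
      then have "0 \<le> q z" using qpos by blast
      then show "q z = q' z" using elim z by (simp add: q'_def)
    qed
  qed
  obtain Mx where Mx: "L2_on ?Q Mx" "AE z in lborel. z \<in> ?Q \<longrightarrow> mx z = Mx z" by (rule Lp_representative[OF Lmx]) auto
  define B where "B = \<bar>B0\<bar> + \<bar>Bu\<bar> + \<bar>Bm\<bar> + \<bar>Bq\<bar>"
  have bounds: "\<bar>n0 x\<bar> \<le> B" "\<bar>Ux z\<bar> \<le> B" "\<bar>M z\<bar> \<le> B" "\<bar>q' z\<bar> \<le> B" for x z
    using n0(2)[of x] Bu[of z] M(2)[of z] q'B[of z] unfolding B_def by linarith+
  note [measurable] = M(1) q'm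
  \<comment> \<open>The price is defined by Lebesgue integrals over slices of \<open>q\<close> and
    \<open>m\<close>; on almost every slice these equal the integrals of the
    representatives.\<close>
  have price: "AE t in lborel. t \<in> {0<..<T} \<longrightarrow> price L P q m t = P t (\<integral>x. q' (t, x) * M (t, x) \<partial>lborel)"
    using AE_lborel2_iterated[OF M(4)] AE_lborel2_iterated[OF aeq]
  proof eventually_elim
    case (elim t)
    show ?case
    proof
      assume t: "t \<in> {0<..<T}"
      have "(LINT x:{0<..<L}|lebesgue. q (t, x) * m (t, x)) = (\<integral>x. q' (t, x) * M (t, x) \<partial>lborel)"
      proof (rule set_integral_lebesgue_eq_lborel)
        show "(\<lambda>x. q' (t, x) * M (t, x)) \<in> borel_measurable borel" by measurable
        show "AE x in lborel. x \<in> {0<..<L} \<longrightarrow> q (t, x) * m (t, x) = q' (t, x) * M (t, x)"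
          using elim by eventually_elim (use t in \<open>simp add: cylQ_def\<close>)
        show "q' (t, x) * M (t, x) = 0" if "x \<notin> {0<..<L}" for x using M(3)[of "(t, x)"] that by (auto simp: cylQ_def)
      qed
      then show "price L P q m t = P t (\<integral>x. q' (t, x) * M (t, x) \<partial>lborel)" by (simp add: price_def)
    qed
  qed
  have eq_iii': "AE z in lborel. z \<in> ?Q \<longrightarrow> q z = max 0 ((price L P q m (fst z) - gam - ux z) / (2 * kap))"
    using eq_iii by (simp add: AE_completion_iff)
  have control: "AE z in lborel. z \<in> ?Q \<longrightarrow>
      q' z = max 0 ((P (fst z) (\<integral>x. q' (fst z, x) * M (fst z, x) \<partial>lborel) - gam - Ux z) / (2 * kap))"
    using AE_lborel2_fst[OF price] aeq aeU eq_iii'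
  proof eventually_elim
    case (elim z)
    show ?case
    proof
      assume z: "z \<in> ?Q"
      then have "fst z \<in> {0<..<T}" by (auto simp: cylQ_def)
      then have "price L P q m (fst z) = P (fst z) (\<integral>x. q' (fst z, x) * M (fst z, x) \<partial>lborel)" using elim by simp
      then show "q' z = max 0 ((P (fst z) (\<integral>x. q' (fst z, x) * M (fst z, x) \<partial>lborel) - gam - Ux z) / (2 * kap))"
        using elim z by simp
    qed
  qed
  \<comment> \<open>By \<open>quadratic_sup\<close> the supremum is \<open>kap * q^2\<close>. It is
    written as \<open>(kap * q' z) * q' z\<close>, a bounded function times a square integrable
    one.\<close>
  define E where "E z = Ut z + s2 (snd z) * Uxx z - lam * U z + (kap * q' z) * q' z" for z
  have s2m: "(\<lambda>z :: real \<times> real. s2 (snd z)) \<in> borel_measurable borel" "(\<lambda>z :: real \<times> real. ds2 (snd z)) \<in> borel_measurable borel"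
    using s2(1,2) by measurable
  have EL: "L2_on ?Q E" unfolding E_def[abs_def]
  proof (intro L2_on_add L2_on_diff UL(2) L2_on_cmult UL(1))
    show "L2_on ?Q (\<lambda>z. s2 (snd z) * Uxx z)" by (rule L2_on_mult_bounded[OF UL(3) s2m(1) s2(3)])
    show "L2_on ?Q (\<lambda>z. (kap * q' z) * q' z)"
    proof (rule L2_on_mult_bounded[OF qL])
      show "(\<lambda>z. kap * q' z) \<in> borel_measurable borel" by measurable
      show "\<bar>kap * q' z\<bar> \<le> kap * Bq" for z unfolding abs_mult using kap q'B[of z] by simp
    qed
  qed
  have aeE: "AE z in lborel. z \<in> ?Q \<longrightarrow> ut z + (sig (snd z))\<^sup>2 * uxx z - lam * u z
      + (SUP p\<in>{0..}. - p * ux z + p * price L P q m (fst z) - gam * p - kap * p\<^sup>2) = E z"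
    using aeU aeq eq_iii'
  proof eventually_elim
    case (elim z)
    show ?case
    proof
      assume z: "z \<in> ?Q"
      then have "s2 (snd z) = (sig (snd z))\<^sup>2" by (intro s2(5)) (auto simp: cylQ_def)
      moreover have "(SUP p\<in>{0..}. - p * ux z + p * price L P q m (fst z) - gam * p - kap * p\<^sup>2) = kap * (q z)\<^sup>2"
        using quadratic_sup[OF kap, of "ux z" "price L P q m (fst z)" gam] elim z by simp
      ultimately show "ut z + (sig (snd z))\<^sup>2 * uxx z - lam * u z
        + (SUP p\<in>{0..}. - p * ux z + p * price L P q m (fst z) - gam * p - kap * p\<^sup>2) = E z"
        using elim z by (simp only: E_def power2_eq_square mult.assoc)
    qed
  qed
  have "AE z in lborel. z \<in> {0<..<T} \<times> {0<..<L} \<longrightarrow> E z = 0"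
  proof (rule AE_zero_if_bump_integrals_zero[OF L2_on_integrable[OF EL]])
    fix \<theta> \<xi> assume b: "bump_on {0<..<T} \<theta>" "bump_on {0<..<L} \<xi>"
    have "test_fun ?Q (\<lambda>z. \<theta> (fst z) * \<xi> (snd z))" by (rule test_fun_product[OF b]) (simp add: cylQ_def)
    then show "(\<integral>z. E z * (\<theta> (fst z) * \<xi> (snd z)) \<partial>lborel) = 0"
      using eq_i weak_integral_transfer[OF EL aeE bump_product_measurable[OF b]] by simp
  qed
  then have hjb: "AE z in lborel. z \<in> ?Q \<longrightarrow> Ut z + s2 (snd z) * Uxx z - lam * U z + kap * (q' z)\<^sup>2 = 0"
    by (simp only: cylQ_def E_def power2_eq_square mult.assoc)
  define F where "F z = s2 (snd z) * Mx z + ds2 (snd z) * M z + M z * q' z" for z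
  have FL: "L2_on ?Q F" unfolding F_def[abs_def]
    by (intro L2_on_add L2_on_mult_bounded[OF Mx(1) s2m(1) s2(3)] L2_on_mult_bounded[OF LM s2m(2) s2(4)]
      L2_on_mult_bounded[OF qL M(1,2)])
  have aeF: "AE z in lborel. z \<in> ?Q \<longrightarrow> (sig (snd z))\<^sup>2 * mx z
      + vector_derivative (\<lambda>y. (sig y)\<^sup>2) (at (snd z) within {0..L}) * m z + m z * q z = F z"
    using Mx(2) M(4) aeq
  proof eventually_elim
    case (elim z)
    show ?case
    proof
      assume z: "z \<in> ?Q"
      then have "snd z \<in> {0<..<L}" by (auto simp: cylQ_def)
      from s2(5)[OF this] s2(7)[OF this] show "(sig (snd z))\<^sup>2 * mx z
          + vector_derivative (\<lambda>y. (sig y)\<^sup>2) (at (snd z) within {0..L}) * m z + m z * q z = F z"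
        using elim z by (simp only: F_def)
    qed
  qed
  have dens: "AE z in lborel. z \<in> ?Q \<longrightarrow> M z = (LBINT y:{..<snd z}. Mx (fst z, y))"
    "AE z in lborel. z \<in> ?Q \<longrightarrow> (LBINT y:{snd z<..}. M (fst z, y)) = (LBINT y:{snd z<..}. n0 y) - (LBINT s:{..<fst z}. F (s, snd z))"
    by (rule density_regularity[OF TL LM bounds(3) M(4) Mx FL aeF n0(1) bounds(1) _ _ wmx trace eq_ii]; rule n0; assumption)+
  have "regular_solution T L lam gam kap P s2 ds2 n0 uT a0 A s20 U Ut Ux Uxx M Mx q' B"
  proof (rule regular_solution.intro)
    show "AE z in lborel. z \<in> ?Q \<longrightarrow> (LBINT y:{snd z<..}. M (fst z, y)) = (LBINT y:{snd z<..}. n0 y)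
      - (LBINT s:{..<fst z}. s2 (snd z) * Mx (s, snd z) + ds2 (snd z) * M (s, snd z) + M (s, snd z) * q' (s, snd z))"
      using dens(2) by (simp only: F_def fst_conv snd_conv)
  qed (rule TL kap a0 s2 n0 bounds reg LM Mx qL q'pos hjb control dens(1); assumption)+
  moreover have "AE z in lborel. z \<in> ?Q \<longrightarrow> u z = U z \<and> m z = M z \<and> q z = q' z"
    using aeU M(4) aeq by eventually_elim blast
  ultimately show ?thesis by (rule that)
qed

text \<open>At interior points the derivative within the half-line is the two-sided one; continuity
  up to the end point covers \<open>a = 0\<close>.\<close>

lemma price_antimono:
  fixes P :: "real \<Rightarrow> real \<Rightarrow> real"
  assumes C: "Ck2_on 2 ({0..T} \<times> {0..}) (\<lambda>(t, a). P t a)"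
    and dP: "\<forall>t\<in>{0..T}. \<forall>a\<in>{0..}. vector_derivative (P t) (at a within {0..}) \<le> 0"
    and t: "t \<in> {0..T}" and ab: "0 \<le> a" "a \<le> b"
  shows "P t b \<le> P t a"
proof -
  let ?S = "{0..T} \<times> {0 :: real..}"
  obtain D where D: "\<forall>z\<in>?S. D [] z = (\<lambda>(t, a). P t a) z"
    "\<And>ds t x. length ds < 2 \<Longrightarrow> (t, x) \<in> ?S \<Longrightarrow>
       ((\<lambda>y. D ds (t, y)) has_real_derivative D (False # ds) (t, x)) (at x within {y. (t, y) \<in> ?S})"
    using C unfolding Ck2_on_def by blast
  have S: "{y. (t, y) \<in> ?S} = {0..}" using t by auto
  have der: "(P t has_real_derivative D [False] (t, x)) (at x within {0..})" if x: "x \<ge> 0" for x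
  proof -
    have "((\<lambda>y. D [] (t, y)) has_real_derivative D [False] (t, x)) (at x within {0..})"
      using D(2)[of "[]" t x] t x unfolding S by auto
    then show ?thesis
      by (rule has_field_derivative_transform_within[OF _ zero_less_one]) (use D(1) t x in auto)
  qed
  have "P t a \<ge> P t b"
  proof (rule DERIV_nonpos_imp_decreasing_open[OF ab(2)])
    show "\<exists>y. (P t has_real_derivative y) (at x) \<and> y \<le> 0" if x: "a < x" "x < b" for x
    proof -
      have x0: "x > 0" using ab x by linarith
      have at: "at x within {0..} = at x" by (rule at_within_interior) (use x0 in simp)
      have d: "(P t has_real_derivative D [False] (t, x)) (at x)" using der[of x] x0 unfolding at by simp
      then have "vector_derivative (P t) (at x) = D [False] (t, x)"
        by (intro vector_derivative_at) (simp add: has_real_derivative_iff_has_vector_derivative)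
      moreover have "vector_derivative (P t) (at x within {0..}) \<le> 0" using dP t x0 by auto
      ultimately show ?thesis using d unfolding at by auto
    qed
    show "continuous_on {a..b} (P t)"
      by (rule DERIV_continuous_on[of _ _ "\<lambda>x. D [False] (t, x)"], rule DERIV_subset[OF der]) (use ab in auto)
  qed
  then show ?thesis .
qed

theorem mainTheorem5:
  fixes L T lam gam kap r CP sig0 :: real
    and sig m0 uT :: "real \<Rightarrow> real"
    and P Phi :: "real \<Rightarrow> real \<Rightarrow> real"
    and u1 m1 q1 u2 m2 q2 :: "real \<times> real \<Rightarrow> real"
  assumes "L > 0" and "T > 0" and "lam > 0" and "gam > 0" and "kap > 0" and "r > 3"
    and A1: "Ck_on 3 {0..L} m0" "integral {0..L} m0 = 1" "m0 0 = 0" "\<forall>x\<in>{0<..L}. m0 x > 0"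
    and A2: "Ck_on 3 {0..L} uT"
      "\<forall>x\<in>{0..L}. vector_derivative uT (at x within {0..L}) \<ge> 0"
      "uT 0 = 0" "vector_derivative uT (at L within {0..L}) = 0"
    and A3: "Ck2_on 2 ({0..T} \<times> {0..}) (\<lambda>(t, a). P t a)"
      "\<forall>t\<in>{0..T}. \<forall>a\<in>{0..}. vector_derivative (P t) (at a within {0..}) \<le> 0"
      "Ck2_on 3 ({0..T} \<times> {0..}) (\<lambda>(t, a). Phi t a)"
      "\<forall>t\<in>{0..T}. \<forall>a\<in>{0..}. P t a = vector_derivative (Phi t) (at a within {0..})"
      "CP > 0" "\<forall>t\<in>{0..T}. gam < P t 0 \<and> P t 0 \<le> CP + gam"
    and A4: "Ck_on 2 {0..L} sig" "sig0 > 0" "\<forall>x\<in>{0..L}. sig x \<ge> sig0"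
    and sol1: "cournot_weak_solution L T lam gam kap r sig P m0 uT u1 m1 q1"
    and sol2: "cournot_weak_solution L T lam gam kap r sig P m0 uT u2 m2 q2"
  shows "AE z in lebesgue. z \<in> cylQ T L \<longrightarrow> u1 z = u2 z \<and> m1 z = m2 z \<and> q1 z = q2 z"
proof -
  obtain s2 ds2 A where s2: "s2 \<in> borel_measurable borel" "ds2 \<in> borel_measurable borel"
    "\<And>x. \<bar>s2 x\<bar> \<le> A" "\<And>x. \<bar>ds2 x\<bar> \<le> A" "\<And>x. x \<in> {0<..<L} \<Longrightarrow> s2 x = (sig x)\<^sup>2"
    "\<And>x. x \<in> {0<..<L} \<Longrightarrow> s2 x \<ge> sig0\<^sup>2"
    "\<And>x. x \<in> {0<..<L} \<Longrightarrow> ds2 x = vector_derivative (\<lambda>y. (sig y)\<^sup>2) (at x within {0..L})"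
    "\<And>x. x \<in> {0<..<L} \<Longrightarrow> s2 x = (sig 0)\<^sup>2 + (LBINT y:{..<x}. ds2 y)"
    "\<And>x. x \<notin> {0<..<L} \<Longrightarrow> ds2 x = 0"
    using square_coefficient[OF \<open>L > 0\<close> A4] by blast
  have cm0: "continuous_on {0..L} m0"
  proof -
    obtain D where D: "\<forall>x\<in>{0..L}. D 0 x = m0 x" "\<forall>j\<le>3. continuous_on {0..L} (D (j :: nat))"
      using A1(1) unfolding Ck_on_def by blast
    show ?thesis by (rule continuous_on_eq[of _ "D 0"]) (use D in auto)
  qed
  \<comment> \<open>\<open>m0\<close> is unspecified off \<open>[0, L]\<close>; the cut to the open
    interval gives a bounded nonnegative Borel function on the line.\<close>
  define n0 where "n0 x = indicator {0<..<L} x *\<^sub>R m0 x" for x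
  have n0m: "n0 \<in> borel_measurable borel" unfolding n0_def[abs_def]
    by (rule borel_measurable_continuous_on_indicator[OF _ continuous_on_subset[OF cm0]]) auto
  have "bounded (m0 ` {0..L})" by (intro compact_imp_bounded compact_continuous_image cm0 compact_Icc)
  then obtain B0 where B0: "\<And>x. x \<in> {0..L} \<Longrightarrow> \<bar>m0 x\<bar> \<le> B0"
    unfolding bounded_iff real_norm_def by (metis image_eqI)
  have n0B: "\<bar>n0 x\<bar> \<le> \<bar>B0\<bar>" for x
  proof (cases "x \<in> {0<..<L}")
    case True
    then have "\<bar>m0 x\<bar> \<le> B0" by (intro B0) auto
    then show ?thesis using True by (simp add: n0_def)
  qed (simp add: n0_def)
  have n0z: "n0 x = 0" if "x \<notin> {0<..<L}" for x using that by (simp add: n0_def)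
  have n0p: "n0 x \<ge> 0" for x
  proof (cases "x \<in> {0<..<L}")
    case True
    then show ?thesis using A1(4) by (simp add: n0_def less_imp_le)
  qed (simp add: n0_def)
  have n0e: "m0 x = n0 x" if "x \<in> {0<..<L}" for x using that by (simp add: n0_def)
  have r2: "r \<ge> 2" and a0: "sig0\<^sup>2 > 0" using \<open>r > 3\<close> A4(2) by simp_all
  obtain U1 Ut1 Ux1 Uxx1 M1 Mx1 p1 B1
    where S1: "regular_solution T L lam gam kap P s2 ds2 n0 uT (sig0\<^sup>2) A ((sig 0)\<^sup>2) U1 Ut1 Ux1 Uxx1 M1 Mx1 p1 B1"
    and e1: "AE z in lborel. z \<in> cylQ T L \<longrightarrow> u1 z = U1 z \<and> m1 z = M1 z \<and> q1 z = p1 z"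
    by (rule regular_solution_of_weak[OF sol1 \<open>T > 0\<close> \<open>L > 0\<close> \<open>kap > 0\<close> r2 a0 s2 n0m n0B n0z n0p n0e])
  obtain U2 Ut2 Ux2 Uxx2 M2 Mx2 p2 B2
    where S2: "regular_solution T L lam gam kap P s2 ds2 n0 uT (sig0\<^sup>2) A ((sig 0)\<^sup>2) U2 Ut2 Ux2 Uxx2 M2 Mx2 p2 B2"
    and e2: "AE z in lborel. z \<in> cylQ T L \<longrightarrow> u2 z = U2 z \<and> m2 z = M2 z \<and> q2 z = p2 z"
    by (rule regular_solution_of_weak[OF sol2 \<open>T > 0\<close> \<open>L > 0\<close> \<open>kap > 0\<close> r2 a0 s2 n0m n0B n0z n0p n0e])
  have "AE z in lborel. z \<in> cylQ T L \<longrightarrow> U1 z = U2 z \<and> M1 z = M2 z \<and> p1 z = p2 z"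
  proof (rule regular_pair.regular_unique[OF regular_pair.intro[OF S1 S2]])
    show "P t b \<le> P t a" if "t \<in> {0<..<T}" "0 \<le> a" "a \<le> b" for t a b
      by (rule price_antimono[OF A3(1,2)]) (use that in auto)
  qed
  with e1 e2 have "AE z in lborel. z \<in> cylQ T L \<longrightarrow> u1 z = u2 z \<and> m1 z = m2 z \<and> q1 z = q2 z"
    by eventually_elim auto
  then show ?thesis by (simp add: AE_completion_iff)
qed

end
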